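(* Let $N\ge1$ be an odd integer, let $q\in\mathbb{N}$ and let $\chi$ be an even primitive Dirichlet character modulo $q$. Let $\alpha,\beta>0$ with $\alpha\beta^N=\pi^{N+1}$. Then for every nonzero integer $m$, \begin{align*} &\alpha^{-\frac{2Nm}{N+1}}\left\{\sum_{r=1}^{q}\sum_{n=1}^{\infty}\frac{\chi(r)\exp\left(-\frac{r}{q}(2n)^N\alpha\right)}{n^{2Nm+1}\left(1-\exp\left(-(2n)^N\alpha\right)\right)}-\zeta(2Nm+1)L(0,\chi)\right\}\\ &=\frac{(-1)^m\beta^{-\frac{2Nm}{N+1}}2^{2m(N-1)}}{N}\Bigg\{\frac{q}{2\mathcal{G}(\bar\chi)}L(2m+1,\bar\chi)+(-1)^{\frac{N+3}{2}}\mathcal{G}(\chi)\sum_{j=-\frac{N-1}{2}}^{\frac{N-1}{2}}(-1)^j\sum_{n=1}^{\infty}\frac{1}{n^{2m+1}}\frac{\bar\chi(n)}{\exp\left((2n)^{1/N}\beta\exp\left(-\frac{i\pi j}{N}\right)\right)-1}\Bigg\}\\ &\quad+(-1)^{m+\frac{N+3}{2}}2^{2Nm}\sum_{j=1}^{\lfloor m+\frac{N+1}{2N}\rfloor}\frac{(-1)^j}{q^{2j-1}}\frac{B_{2j,\chi}}{(2j)!}\frac{B_{2N(m-j)+N+1}}{(2N(m-j)+N+1)!}\alpha^{\frac{2j}{N+1}}\beta^{N+\frac{2N^2(m-j)}{N+1}}+\mathcal{R}, \end{align*} where $\mathcal{R}=(-1)^{m+\frac{N+3}{2}}2^{2Nm}\frac{B_{2Nm+N+1}}{(2Nm+N+1)!}\beta^{N+\frac{2N^2m}{N+1}}$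 if $q=1$, and $\mathcal{R}=0$ if $q>1$.
   Context: $\zeta(s)$ is the Riemann zeta function, $L(s,\chi)$ the Dirichlet $L$-function (for $q=1$, $\chi$ is trivial and $L(s,\chi)=\zeta(s)$), $\bar\chi$ the conjugate character. $\mathcal{G}(\chi)=\sum_{r=1}^{q}\chi(r)e^{2\pi i r/q}$ is the Gauss sum. $B_k$ are the Bernoulli numbers, and the generalized Bernoulli numbers $B_{n,\chi}$ are defined by $\sum_{k=1}^{q}\chi(k)\frac{te^{kt}}{e^{qt}-1}=\sum_{n=0}^{\infty}B_{n,\chi}\frac{t^n}{n!}$. A character is even if $\chi(-1)=1$. An empty sum is zero.
   Formalization: For q=1 and m<0 the index 2Nm+N+1 in R can be negative, where B_k/k! is undefined; the formal statement takes B_k/k! to be 0 for k<0, so R=0 in those cases. *)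

theory Defs
  imports "HOL-Complex_Analysis.Complex_Analysis"
          "HOL-Computational_Algebra.Formal_Power_Series"
begin

definition dirichlet_char :: "nat \<Rightarrow> (int \<Rightarrow> complex) \<Rightarrow> bool" where
  "dirichlet_char q chi \<longleftrightarrow> q > 0 \<and> chi 1 = 1 \<and>
     (\<forall>a b. chi (a * b) = chi a * chi b) \<and>
     (\<forall>a. chi (a + int q) = chi a) \<and>
     (\<forall>a. chi a \<noteq> 0 \<longleftrightarrow> coprime a (int q))"

definition primitive_dirichlet_char :: "nat \<Rightarrow> (int \<Rightarrow> complex) \<Rightarrow> bool" where
  "primitive_dirichlet_char q chi \<longleftrightarrow> dirichlet_char q chi \<and>
     (\<forall>d. d dvd q \<and> d < q \<longrightarrow>
        (\<exists>a. coprime a (int q) \<and> a mod int d = 1 mod int d \<and> chi a \<noteq> 1))"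

definition even_char :: "(int \<Rightarrow> complex) \<Rightarrow> bool" where
  "even_char chi \<longleftrightarrow> chi (-1) = 1"

(* Dirichlet L-function: the analytic continuation to C - {1} of the Dirichlet series
   sum_{n>=1} chi(n) n^{-s}, which converges for Re s > 1 *)
definition dirichlet_L :: "(int \<Rightarrow> complex) \<Rightarrow> complex \<Rightarrow> complex" where
  "dirichlet_L chi s = (SOME f. f holomorphic_on (- {1}) \<and>
      (\<forall>z. Re z > 1 \<longrightarrow> f z = (\<Sum>n. chi (int (Suc n)) / of_nat (Suc n) powr z))) s"

definition riemann_zeta :: "complex \<Rightarrow> complex" where
  "riemann_zeta = dirichlet_L (\<lambda>_. 1)"

definition gauss_sum :: "nat \<Rightarrow> (int \<Rightarrow> complex) \<Rightarrow> complex" where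
  "gauss_sum q chi = (\<Sum>r=1..q. chi (int r) * exp (2 * pi * \<i> * of_nat r / of_nat q))"

definition bernoulli_num :: "nat \<Rightarrow> complex" where
  "bernoulli_num n = fact n * ((THE B. fps_X = (fps_exp 1 - 1) * B) $ n)"

definition gen_bernoulli :: "nat \<Rightarrow> (int \<Rightarrow> complex) \<Rightarrow> nat \<Rightarrow> complex" where
  "gen_bernoulli q chi n = fact n * ((THE B.
      (\<Sum>k=1..q. fps_const (chi (int k)) * fps_X * fps_exp (of_nat k)) =
      (fps_exp (of_nat q) - 1) * B) $ n)"

(* B_k / k! for an integer index k, with the convention 1/k! = 0 for k < 0 *)
definition bern_over_fact :: "int \<Rightarrow> complex" where
  "bern_over_fact k = (if k < 0 then 0 else bernoulli_num (nat k) / fact (nat k))"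

end

theory Submission
  imports Defs "HOL-Number_Theory.Number_Theory"
begin

text \<open>
  Expand the kernel \<open>\<Sum>\<^sub>r \<chi>(r) e\<^sup>-\<^sup>r\<^sup>x\<^sup>/\<^sup>q / (1 - e\<^sup>-\<^sup>x)\<close> into partial fractions in \<open>x\<close>, with the Gauss sum
  and the values \<open>cnj (\<chi>(k))\<close> as coefficients, put \<open>x = a n\<^sup>N\<close> with \<open>a = 2\<^sup>N \<alpha>\<close>, and exchange the two
  summations. The inner sums \<open>\<Sum>\<^sub>n n\<^sup>N\<^sup>-\<^sup>1 / (n\<^sup>2\<^sup>N + c\<^sup>2\<^sup>N)\<close> have a closed form in terms of
  \<open>1 / (exp (2\<pi>c e\<^sup>-\<^sup>i\<^sup>\<pi>\<^sup>j\<^sup>/\<^sup>N) - 1)\<close>, by splitting into the \<open>N\<close>-th roots of unity.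

  For \<open>m > 0\<close> the factor \<open>n\<^sup>-\<^sup>2\<^sup>N\<^sup>m\<close> is handled by repeated subtraction, which produces the Bernoulli sum.
  For \<open>m < 0\<close> the exchange diverges. Instead the \<open>n\<close>-th term is weighted with \<open>C / (C + n\<^sup>2\<^sup>N)\<close>,
  where \<open>C = i R\<^sup>2\<^sup>N\<close>; the weighted identity holds for all \<open>R > 0\<close>, and comparing the coefficients of
  \<open>R\<^sup>2\<^sup>N\<^sup>m\<close> in the asymptotic expansions of both sides as \<open>R \<longrightarrow> \<infinity>\<close> gives the claim. The values of
  \<open>\<zeta>\<close> and \<open>L\<close> at negative odd integers enter as coefficients of these expansions; they are identified
  with the analytic continuations by a Mellin transform.
\<close>

section \<open>Partial fractions of the exponential and sums over roots of unity\<close>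

text \<open>With x = a n^N and b = 2 pi / a one has x^2 + (2 pi k)^2 = a^2 (n^(2N) + (b k)^2), and
  dividing the kernel by n leaves exactly the numerator n^(N-1) for which the sums over n are
  elementary. Evenness of the character folds the poles at 2 pi i k and -2 pi i k into this
  quadratic form; the pole at 0 survives only for q = 1 and is the source of the residual term.

  For negative m the weights bring in denominators C + n^(2N) and C - (b k)^2, shifts of C by reals
  of both signs; an imaginary C keeps them all of size at least R^(2N). Sums such as the weighted
  harmonic series grow like log R and have no expansion in 1/R. Comparing f(R) with f(2R) removes
  the logarithm and loses only the coefficient of index 0, while the one wanted has index 2N|m| > 0.

  The values of zeta and L enter both ways through one object: the expansion at 0 of an exponential
  series gives its Mellin transform at nonpositive integers and, by a Laplace integral, the
  behaviour at infinity of the sums over 1 / (k + y).\<close>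

lemma Digamma_reflection:
  fixes z :: complex
  assumes "z \<notin> \<int>"
  shows "Digamma (1 - z) - Digamma z = of_real pi * cot (of_real pi * z)"
proof -
  have z: "z \<notin> \<int>\<^sub>\<le>\<^sub>0" "1 - z \<notin> \<int>\<^sub>\<le>\<^sub>0"
    using assms nonpos_Ints_subset_Ints by (auto dest: Ints_diff[OF Ints_1])
  have s: "sin (of_real pi * z) \<noteq> 0"
    using assms by (auto simp: sin_eq_0 mult_ac)
  \<comment> \<open>Both sides of the reflection formula of the Gamma function are differentiated,
    and uniqueness of the derivative compares the results.\<close>
  have "((\<lambda>z. Gamma z * Gamma (1 - z)) has_field_derivative
          (Gamma z * Gamma (1 - z) * (Digamma z - Digamma (1 - z)))) (at z)"
    using z by (auto intro!: derivative_eq_intros simp: algebra_simps)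
  also have "(\<lambda>z::complex. Gamma z * Gamma (1 - z)) = (\<lambda>z. of_real pi / sin (of_real pi * z))"
    by (simp add: Gamma_reflection_complex)
  finally have 1: "((\<lambda>z. of_real pi / sin (of_real pi * z)) has_field_derivative
          (of_real pi / sin (of_real pi * z) * (Digamma z - Digamma (1 - z)))) (at z)"
    by (simp add: Gamma_reflection_complex)
  have 2: "((\<lambda>z. of_real pi / sin (of_real pi * z)) has_field_derivative
          (- of_real pi * (of_real pi * cos (of_real pi * z)) / (sin (of_real pi * z))^2)) (at z)"
    using s by (auto intro!: derivative_eq_intros simp: power2_eq_square)
  have alg: "b - a = P * (C / S)"
    if "P / S * (a - b) = - P * (P * C) / S\<^sup>2" "S \<noteq> 0" "P \<noteq> 0" for P S C a b :: complex
  proof -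
    have "a - b = (P / S * (a - b)) * S / P" using that(2,3) by simp
    also have "\<dots> = - (P * (C / S))"
      unfolding that(1) using that(2,3) by (simp add: field_simps power2_eq_square)
    finally show ?thesis by (simp add: algebra_simps)
  qed
  show ?thesis
    unfolding cot_def by (rule alg[OF DERIV_unique[OF 1 2] s]) simp
qed

text \<open>In the variable z = w / (2 pi i) this is the expansion of pi cot (pi z), obtained as the
  difference of the Digamma series at 1 - z and 1 + z. The summand 1/2 is the shift between 1 / (exp
  w - 1) and coth (w/2) / 2, and 1/w is the pole at the origin, kept out of the series.\<close>

lemma exp_minus_1_partial_fractions:
  fixes w :: complex
  assumes "exp w \<noteq> 1"
  shows "(\<lambda>k. 2 * w / (w\<^sup>2 + 4 * of_real (pi\<^sup>2) * (of_nat (Suc k))\<^sup>2))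
           sums (1 / (exp w - 1) + 1 / 2 - 1 / w)"
proof -
  define z where "z = w / (2 * of_real pi * \<i>)"
  have w: "w = 2 * of_real pi * \<i> * z" by (simp add: z_def)
  have nz: "z \<notin> \<int>"
    using assms unfolding w by (auto elim!: Ints_cases simp: exp_eq_1 mult_ac)
  have z0: "z \<noteq> 0" "1 + z \<noteq> 0" "1 - z \<noteq> 0" using nz
    by (auto simp: add_eq_0_iff)
  have nn: "1 + z + of_nat k \<noteq> 0" "1 - z + of_nat k \<noteq> 0" for k
  proof -
    have "- (1 + of_nat k :: complex) \<in> \<int>" "(1 + of_nat k :: complex) \<in> \<int>" by auto
    then show "1 + z + of_nat k \<noteq> 0" "1 - z + of_nat k \<noteq> 0" using nz
      by (metis add.assoc add.commute add_eq_0_iff, metis add.assoc add.commute diff_add_eq eq_iff_diff_eq_0)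
  qed
  have "(\<lambda>k. (inverse (of_nat (Suc k)) - inverse ((1 - z) + of_nat k))
           - (inverse (of_nat (Suc k)) - inverse ((1 + z) + of_nat k)))
        sums ((Digamma (1 - z) + euler_mascheroni) - (Digamma (1 + z) + euler_mascheroni))"
    using z0 by (intro sums_diff)
      (auto simp: Digamma_def simp del: of_nat_Suc intro!: summable_sums summable_Digamma)
  also have "(Digamma (1 - z) + euler_mascheroni) - (Digamma (1 + z) + euler_mascheroni)
           = of_real pi * cot (of_real pi * z) - 1 / z"
    using Digamma_reflection[OF nz] Digamma_plus1[of z] z0 by (simp add: add.commute)
  finally have "(\<lambda>k. (inverse (of_nat (Suc k)) - inverse ((1 - z) + of_nat k))
           - (inverse (of_nat (Suc k)) - inverse ((1 + z) + of_nat k)))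
        sums (of_real pi * cot (of_real pi * z) - 1 / z)" .
  from sums_mult[OF this, of "1 / (2 * of_real pi * \<i>)"]
  have "(\<lambda>k. 1 / (2 * of_real pi * \<i>) * ((inverse (of_nat (Suc k)) - inverse ((1 - z) + of_nat k))
           - (inverse (of_nat (Suc k)) - inverse ((1 + z) + of_nat k))))
        sums (1 / (2 * of_real pi * \<i>) * (of_real pi * cot (of_real pi * z) - 1 / z))" .
  also have "(\<lambda>k. 1 / (2 * of_real pi * \<i>) * ((inverse (of_nat (Suc k)) - inverse ((1 - z) + of_nat k))
           - (inverse (of_nat (Suc k)) - inverse ((1 + z) + of_nat k))))
      = (\<lambda>k. 2 * w / (w\<^sup>2 + 4 * of_real (pi\<^sup>2) * (of_nat (Suc k))\<^sup>2))"
  proof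
    fix k
    have "2 * w / (w\<^sup>2 + 4 * of_real (pi\<^sup>2) * (of_nat (Suc k))\<^sup>2)
        = \<i> * z / (of_real pi * ((1 + z + of_nat k) * (1 - z + of_nat k)))"
    proof -
      have "w\<^sup>2 + 4 * of_real (pi\<^sup>2) * (of_nat (Suc k))\<^sup>2
          = 4 * of_real (pi\<^sup>2) * ((1 + z + of_nat k) * (1 - z + of_nat k))"
        unfolding w by (simp add: algebra_simps power2_eq_square)
      moreover have "2 * (2 * of_real pi * \<i> * z) / (4 * of_real (pi\<^sup>2) * D)
          = \<i> * z / (of_real pi * D)" for D
        by (cases "D = 0") (simp_all add: field_simps power2_eq_square)
      ultimately show ?thesis unfolding w by (simp only:)
    qed
    also have "\<dots> = 1 / (2 * of_real pi * \<i>) * ((inverse (of_nat (Suc k)) - inverse ((1 - z) + of_nat k))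
           - (inverse (of_nat (Suc k)) - inverse ((1 + z) + of_nat k)))"
      using nn[of k] by (simp add: divide_simps del: of_nat_Suc) (simp add: algebra_simps)
    finally show "1 / (2 * of_real pi * \<i>) * ((inverse (of_nat (Suc k)) - inverse ((1 - z) + of_nat k))
           - (inverse (of_nat (Suc k)) - inverse ((1 + z) + of_nat k)))
        = 2 * w / (w\<^sup>2 + 4 * of_real (pi\<^sup>2) * (of_nat (Suc k))\<^sup>2)" ..
  qed
  also have "1 / (2 * of_real pi * \<i>) * (of_real pi * cot (of_real pi * z) - 1 / z)
      = 1 / (exp w - 1) + 1 / 2 - 1 / w"
  proof -
    have e: "exp w = exp (\<i> * (of_real pi * z)) * exp (\<i> * (of_real pi * z))"
      unfolding w by (simp add: exp_add [symmetric] algebra_simps)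
    define E where "E = exp (\<i> * (of_real pi * z))"
    have E: "E \<noteq> 0" "E * E \<noteq> 1" using assms e by (auto simp: E_def)
    then have E': "E \<noteq> inverse E" by (metis right_inverse)
    have c: "cot (of_real pi * z) = \<i> * (E * E + 1) / (E * E - 1)"
      unfolding cot_def sin_exp_eq cos_exp_eq exp_minus E_def[symmetric]
      using E E' by (simp add: divide_simps)
    have *: "1 / (2 * of_real pi * \<i>) * (of_real pi * (\<i> * t)) = t / 2" for t :: complex
      by (simp add: field_simps)
    have "1 / (2 * of_real pi * \<i>) * (of_real pi * cot (of_real pi * z) - 1 / z)
       = 1 / (2 * of_real pi * \<i>) * (of_real pi * (\<i> * ((E * E + 1) / (E * E - 1)))) - 1 / w"
      unfolding c w by (simp add: right_diff_distrib)
    also have "\<dots> = (E * E + 1) / (E * E - 1) / 2 - 1 / w" unfolding * ..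
    also have "(E * E + 1) / (E * E - 1) / 2 = 1 / (exp w - 1) + 1 / 2"
      unfolding e E_def[symmetric] using E by (simp add: divide_simps)
    finally show ?thesis .
  qed
  finally show ?thesis .
qed

text \<open>The range of j in the theorem is a complete residue system for the odd modulus 2p + 1.
  Shifting by p gives a geometric series whose ratio is a root of unity.\<close>

lemma sum_exp_symmetric_interval:
  fixes l :: int and p :: nat
  shows "(\<Sum>j\<in>{- int p..int p}. exp (2 * of_real pi * \<i> * of_int (j * l) / of_nat (2 * p + 1)))
       = (if int (2 * p + 1) dvd l then of_nat (2 * p + 1) else 0 :: complex)"
proof -
  define N where "N = 2 * p + 1"
  have N0: "N > 0" by (simp add: N_def)
  define f where "f = (\<lambda>j::int. exp (2 * of_real pi * \<i> * of_int (j * l) / of_nat N) :: complex)"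
  have f_pow: "f (int i - int p) = f (- int p) * (f 1) ^ i" for i
    unfolding f_def exp_of_nat_mult[symmetric] exp_add[symmetric]
    by (rule arg_cong[of _ _ exp]) (simp add: diff_divide_distrib algebra_simps)
  have "(\<Sum>j\<in>{- int p..int p}. f j) = (\<Sum>i<N. f (int i - int p))"
    by (rule sum.reindex_bij_witness[of _ "\<lambda>i. int i - int p" "\<lambda>j. nat (j + int p)"])
      (auto simp: N_def)
  also have "\<dots> = f (- int p) * (\<Sum>i<N. (f 1) ^ i)"
    by (simp add: f_pow sum_distrib_left)
  also have "\<dots> = (if int N dvd l then of_nat N else 0)"
  proof (cases "int N dvd l")
    case True
    then obtain t where t: "l = int N * t" by blast
    have "2 * of_real pi * \<i> * of_int (j * l) / of_nat N = 2 * of_real pi * \<i> * of_int (j * t)" for j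
      using N0 by (simp add: t field_simps)
    then have "f j = 1" for j unfolding f_def by (simp only: exp_eq_1) (auto intro: exI[of _ "j * t"])
    then show ?thesis using True by simp
  next
    case False
    have "f 1 \<noteq> 1"
    proof
      assume "f 1 = 1"
      then obtain t :: int where "2 * pi * of_int l / real N = of_int (2 * t) * pi"
        unfolding f_def exp_eq_1 by auto
      then have "of_int l = (of_int (t * int N) :: real)" using N0 by (simp add: field_simps)
      then have "l = t * int N" by (simp only: of_int_eq_iff)
      then show False using False by simp
    qed
    moreover have "(f 1) ^ N = 1"
    proof -
      have "(f 1) ^ N = exp (2 * of_real pi * \<i> * of_int l)"
        unfolding f_def exp_of_nat_mult[symmetric] using N0 by simp
      then show ?thesis by (simp add: exp_eq_1)
    qed
    ultimately show ?thesis using False by (simp add: geometric_sum)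
  qed
  finally show ?thesis unfolding f_def N_def .
qed

text \<open>As N is odd, X + C e divides X^N + C^N for every N-th root of unity e, with a quotient
  that is a polynomial in e. Summing over all e against a character of the cyclic group of order N
  selects one power of e. The case i = p produces n^(2p) / (n^(2N) + c^(2N)), the case i = 0 the
  weighted harmonic series.\<close>

lemma partial_fractions_roots_of_unity:
  fixes X C :: complex and p i :: nat
  defines "N \<equiv> 2 * p + 1"
  assumes "X ^ N + C ^ N \<noteq> 0" "i < N"
  shows "(\<Sum>j\<in>{- int p..int p}. exp (2 * of_real pi * \<i> * of_int (j * int i) / of_nat N) /
            (X + C * exp (- (2 * of_real pi * \<i> * of_int j / of_nat N))))
       = of_nat N * X ^ (N - 1 - i) * (- C) ^ i / (X ^ N + C ^ N)"
proof -
  have N0: "N > 0" by (simp add: N_def)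
  define e where "e = (\<lambda>j::int. exp (- (2 * of_real pi * \<i> * of_int j / of_nat N)) :: complex)"
  have eN: "e j ^ N = 1" for j
  proof -
    have "e j ^ N = exp (2 * of_real pi * \<i> * of_int (-j))"
      unfolding e_def exp_of_nat_mult[symmetric] using N0 by simp
    also have "\<dots> = 1" by (simp only: exp_eq_1) (auto intro!: exI[of _ "-j"])
    finally show ?thesis .
  qed
  have ep: "e j ^ k = exp (2 * of_real pi * \<i> * of_int (j * (- int k)) / of_nat N)" for j k
    unfolding e_def exp_of_nat_mult[symmetric] by (simp add: field_simps)
  have oddN: "odd N" by (simp add: N_def)
  have key: "(X + C * e j) * (\<Sum>k<N. X ^ (N - 1 - k) * (- C) ^ k * e j ^ k) = X ^ N + C ^ N" for j
  proof -
    have "X ^ N - (- C * e j) ^ N = (X - (- C * e j)) * (\<Sum>k<N. (- C * e j) ^ (N - Suc k) * X ^ k)"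
      by (rule power_diff_sumr2)
    also have "(\<Sum>k<N. (- C * e j) ^ (N - Suc k) * X ^ k)
             = (\<Sum>k<N. X ^ (N - 1 - k) * (- C) ^ k * e j ^ k)"
      by (rule sum.reindex_bij_witness[of _ "\<lambda>k. N - Suc k" "\<lambda>k. N - Suc k"])
        (auto simp: power_mult_distrib[symmetric])
    also have "(- C * e j) ^ N = - (C ^ N)"
      by (simp only: power_mult_distrib eN) (simp add: oddN)
    finally show ?thesis by simp
  qed
  have inv: "1 / (X + C * e j) = (\<Sum>k<N. X ^ (N - 1 - k) * (- C) ^ k * e j ^ k) / (X ^ N + C ^ N)" for j
  proof -
    have "X + C * e j \<noteq> 0" using key[of j] assms(2) by (metis mult_zero_left)
    then show ?thesis using key[of j] assms(2) by (metis (no_types, lifting) mult.commute mult.right_neutral frac_eq_eq)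
  qed
  have "(\<Sum>j\<in>{- int p..int p}. exp (2 * of_real pi * \<i> * of_int (j * int i) / of_nat N) / (X + C * e j))
      = (\<Sum>j\<in>{- int p..int p}. exp (2 * of_real pi * \<i> * of_int (j * int i) / of_nat N) * (1 / (X + C * e j)))"
    by simp
  also have "\<dots> = (\<Sum>j\<in>{- int p..int p}. \<Sum>k<N. X ^ (N - 1 - k) * (- C) ^ k / (X ^ N + C ^ N) *
            exp (2 * of_real pi * \<i> * of_int (j * (int i - int k)) / of_nat N))"
    unfolding inv sum_divide_distrib sum_distrib_left ep
  proof (intro sum.cong refl)
    fix j k
    have "exp (2 * of_real pi * \<i> * of_int (j * int i) / of_nat N) *
        exp (2 * of_real pi * \<i> * of_int (j * (- int k)) / of_nat N)
      = (exp (2 * of_real pi * \<i> * of_int (j * (int i - int k)) / of_nat N) :: complex)"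
      unfolding exp_add[symmetric]
      by (rule arg_cong[of _ _ exp]) (simp add: diff_divide_distrib algebra_simps)
    moreover have "E1 * (u * E2 / d) = u / d * (E1 * E2)" for E1 E2 u d :: complex by simp
    ultimately show "exp (2 * of_real pi * \<i> * of_int (j * int i) / of_nat N) *
         (X ^ (N - 1 - k) * (- C) ^ k * exp (2 * of_real pi * \<i> * of_int (j * (- int k)) / of_nat N) / (X ^ N + C ^ N))
      = X ^ (N - 1 - k) * (- C) ^ k / (X ^ N + C ^ N) *
            exp (2 * of_real pi * \<i> * of_int (j * (int i - int k)) / of_nat N)"
      by (simp only:)
  qed
  also have "\<dots> = (\<Sum>k<N. X ^ (N - 1 - k) * (- C) ^ k / (X ^ N + C ^ N) *
         (\<Sum>j\<in>{- int p..int p}. exp (2 * of_real pi * \<i> * of_int (j * (int i - int k)) / of_nat N)))"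
    by (subst sum.swap) (simp add: sum_distrib_left)
  also have "\<dots> = (\<Sum>k<N. if k = i then of_nat N * X ^ (N - 1 - i) * (- C) ^ i / (X ^ N + C ^ N) else 0)"
  proof (intro sum.cong refl)
    fix k assume k: "k \<in> {..<N}"
    have d: "int N dvd int i - int k \<longleftrightarrow> k = i"
    proof
      assume d: "int N dvd int i - int k"
      show "k = i"
      proof (rule ccontr)
        assume "k \<noteq> i"
        then have "int N \<le> \<bar>int i - int k\<bar>"
          using d by (intro zdvd_imp_le) auto
        then show False using k \<open>i < N\<close> by auto
      qed
    qed auto
    show "X ^ (N - 1 - k) * (- C) ^ k / (X ^ N + C ^ N) *
         (\<Sum>j\<in>{- int p..int p}. exp (2 * of_real pi * \<i> * of_int (j * (int i - int k)) / of_nat N))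
       = (if k = i then of_nat N * X ^ (N - 1 - i) * (- C) ^ i / (X ^ N + C ^ N) else 0)"
      unfolding N_def sum_exp_symmetric_interval using d unfolding N_def by simp
  qed
  also have "\<dots> = of_nat N * X ^ (N - 1 - i) * (- C) ^ i / (X ^ N + C ^ N)"
    using \<open>i < N\<close> by simp
  finally show ?thesis unfolding e_def .
qed

section \<open>The directions exp (-i pi j / N) and their alternating sums\<close>

lemma minus_one_powi_eq_exp: "(-1) powi j = exp (of_real pi * \<i> * of_int j)"
proof (cases "even j")
  case True
  then obtain k where k: "j = 2 * k" by blast
  have "exp (of_real pi * \<i> * of_int j) = 1"
    unfolding k by (simp only: exp_eq_1) (auto intro!: exI[of _ k])
  moreover have "(-1 :: complex) powi j = 1"
    unfolding k power_int_mult by simp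
  ultimately show ?thesis by simp
next
  case False
  then obtain k where k: "j = 2 * k + 1" by (elim oddE)
  have "exp (of_real pi * \<i> * of_int j) = exp (of_real pi * \<i> * of_int (2 * k)) * exp (of_real pi * \<i>)"
    unfolding k by (simp add: exp_add[symmetric] algebra_simps)
  also have "exp (of_real pi * \<i> * of_int (2 * k)) = 1"
    by (simp only: exp_eq_1) (auto intro!: exI[of _ k])
  finally have "exp (of_real pi * \<i> * of_int j) = -1" by (simp add: mult.commute)
  moreover have "(-1 :: complex) powi j = -1"
    unfolding k by (simp add: power_int_add power_int_mult)
  ultimately show ?thesis by simp
qed

text \<open>The square root of an N-th root of unity that lies in the right half plane when |j| <=
  p, so that the exponentials in these directions decay.\<close>

definition root_dir :: "nat \<Rightarrow> int \<Rightarrow> complex" where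
  "root_dir N j = exp (- \<i> * of_real (pi * of_int j / real N))"

lemma root_dir_square: "N > 0 \<Longrightarrow> (root_dir N j)\<^sup>2 = exp (- (2 * of_real pi * \<i> * of_int j / of_nat N))"
  unfolding root_dir_def exp_double[symmetric] by (rule arg_cong[of _ _ exp]) simp

lemma root_dir_power_N: "N > 0 \<Longrightarrow> root_dir N j ^ N = (-1) powi j"
proof -
  assume "N > 0"
  have "root_dir N j ^ N = exp (of_real pi * \<i> * of_int (- j))"
    unfolding root_dir_def exp_of_nat_mult[symmetric] using \<open>N > 0\<close>
    by (intro arg_cong[of _ _ exp]) simp
  also have "\<dots> = (-1) powi (- j)" by (rule minus_one_powi_eq_exp[symmetric])
  also have "\<dots> = (-1) powi j" by (simp add: power_int_minus power_int_inverse[symmetric])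
  finally show ?thesis .
qed

text \<open>Since N - 1 = 2p, the exponent pi i j - pi i j / N equals 2 pi i j p / N. The
  alternating sign and the half-integral direction thus combine into the character that selects i =
  p in \<open>partial_fractions_roots_of_unity\<close>.\<close>

lemma minus_one_powi_root_dir:
  "(-1) powi j * root_dir (2 * p + 1) j
     = exp (2 * of_real pi * \<i> * of_int (j * int p) / of_nat (2 * p + 1))"
proof -
  define N where "N = 2 * p + 1"
  have "of_real pi * \<i> * of_int j + - \<i> * of_real (pi * of_int j / real N)
      = 2 * of_real pi * \<i> * of_int (j * int p) / of_nat N"
  proof -
    have N: "of_nat N = 2 * of_nat p + (1 :: complex)" "of_nat N \<noteq> (0 :: complex)"
      unfolding N_def by (simp, metis Suc_eq_plus1 of_nat_neq_0)
    have "2 * of_real pi * \<i> * of_int (j * int p) / of_nat N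
        = of_real pi * \<i> * of_int j * (of_nat N - 1) / of_nat N" by (simp add: N(1) mult_ac)
    also have "\<dots> = of_real pi * \<i> * of_int j + - \<i> * of_real (pi * of_int j / real N)"
      using N(2) by (simp add: field_simps)
    finally show ?thesis ..
  qed
  then show ?thesis
    unfolding minus_one_powi_eq_exp root_dir_def exp_add[symmetric] N_def by (rule arg_cong)
qed

text \<open>Dividing by the square of the direction raises the frequency from p to p + 1, which is
  divisible by 2p + 1 only for p = 0. All distinctions between N = 1 and N > 1 in the formulas below
  originate here.\<close>

lemma sum_minus_one_powi_div_root_dir:
  "(\<Sum>j\<in>{- int p..int p}. (-1) powi j / root_dir (2 * p + 1) j) = (if p = 0 then 1 else 0)"
proof -
  define N where "N = 2 * p + 1"
  have N0: "N > 0" by (simp add: N_def)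
  have eq: "(-1) powi j / root_dir N j = exp (2 * of_real pi * \<i> * of_int (j * int (p + 1)) / of_nat N)" for j
  proof -
    have "(-1) powi j / root_dir N j = ((-1) powi j * root_dir N j) / (root_dir N j)\<^sup>2"
      by (simp add: power2_eq_square)
    also have "\<dots> = exp (2 * of_real pi * \<i> * of_int (j * int p) / of_nat N
        - (- (2 * of_real pi * \<i> * of_int j / of_nat N)))"
      unfolding root_dir_square[OF N0] exp_diff
      using minus_one_powi_root_dir[of j p, folded N_def] by (simp only:)
    also have "2 * of_real pi * \<i> * of_int (j * int p) / of_nat N
        - (- (2 * of_real pi * \<i> * of_int j / of_nat N))
      = 2 * of_real pi * \<i> * of_int (j * int (p + 1)) / (of_nat N :: complex)"
      by (simp add: add_divide_distrib algebra_simps)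
    finally show ?thesis .
  qed
  have "int N dvd int (p + 1) \<longleftrightarrow> p = 0"
    using zdvd_imp_le[of "int N" "int (p + 1)"] by (auto simp: N_def)
  then show ?thesis
    using eq sum_exp_symmetric_interval[where p = p and l = "int (p + 1)"] unfolding N_def by simp
qed

lemma sum_minus_one_powi: "(\<Sum>j\<in>{- int p..int p}. (-1) powi j) = (-1 :: complex) ^ p"
proof (induction p)
  case (Suc p)
  have s: "{- int (Suc p)..int (Suc p)} = insert (- int (Suc p)) (insert (int (Suc p)) {- int p..int p})"
    by auto
  have "(\<Sum>j\<in>{- int (Suc p)..int (Suc p)}. (-1) powi j)
      = (-1 :: complex) powi (- int (Suc p)) + ((-1) powi int (Suc p) + (-1) ^ p)"
    unfolding s using Suc by simp
  also have "(-1 :: complex) powi (- int (Suc p)) = (-1) powi int (Suc p)"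
    by (simp only: power_int_minus power_int_inverse[symmetric]) simp
  also have "(-1 :: complex) powi int (Suc p) = (-1) ^ Suc p" by (rule power_int_of_nat)
  finally show ?case by simp
qed simp

text \<open>Partial fractions in n^2 reduce the series to sums of w / (n^2 + c^2 w^2) over the
  directions w, and each of these is \<open>exp_minus_1_partial_fractions\<close> at 2 pi c w. Its
  constants 1/2 and its poles at 0 are collected over j and give the two elementary terms of the
  result. The parameter c is complex because it is taken at real nodes as well as on an oblique
  ray.\<close>

theorem sum_power_over_binomial:
  fixes c :: complex and p :: nat
  defines "N \<equiv> 2 * p + 1"
  assumes c: "c \<noteq> 0" and ne: "\<And>n. of_nat (Suc n) ^ (2 * N) + c ^ (2 * N) \<noteq> 0"
    and ne1: "\<And>j. j \<in> {- int p..int p} \<Longrightarrow> exp (2 * of_real pi * c * root_dir N j) \<noteq> 1"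
  shows "(\<lambda>n. of_nat (Suc n) ^ (2 * p) / (of_nat (Suc n) ^ (2 * N) + c ^ (2 * N))) sums
           (of_real pi / (2 * of_nat N * c ^ N)
             + of_real pi / (of_nat N * c ^ N) * (-1) ^ p *
               (\<Sum>j\<in>{- int p..int p}. (-1) powi j / (exp (2 * of_real pi * c * root_dir N j) - 1))
             - (if p = 0 then 1 / (2 * c\<^sup>2) else 0))"
proof -
  have N0: "N > 0" by (simp add: N_def)
  have W: "(\<lambda>n. root_dir N j / ((of_nat (Suc n))\<^sup>2 + c\<^sup>2 * (root_dir N j)\<^sup>2)) sums
      (of_real pi / c * (1 / (exp (2 * of_real pi * c * root_dir N j) - 1) + 1 / 2
          - 1 / (2 * of_real pi * c * root_dir N j)))"
    if "j \<in> {- int p..int p}" for j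
  proof -
    define w where "w = root_dir N j"
    have *: "of_real pi / c * (2 * (2 * of_real pi * c * w) /
        ((2 * of_real pi * c * w)\<^sup>2 + 4 * of_real (pi\<^sup>2) * (of_nat (Suc n))\<^sup>2))
      = w / ((of_nat (Suc n))\<^sup>2 + c\<^sup>2 * w\<^sup>2)" for n
    proof -
      have "(2 * of_real pi * c * w)\<^sup>2 + 4 * of_real (pi\<^sup>2) * (of_nat (Suc n))\<^sup>2
          = 4 * of_real (pi\<^sup>2) * ((of_nat (Suc n))\<^sup>2 + c\<^sup>2 * w\<^sup>2)"
        by (simp add: algebra_simps power2_eq_square)
      moreover have "of_real pi / c * (2 * (2 * of_real pi * c * w) / (4 * of_real (pi\<^sup>2) * D)) = w / D" for D
        using c by (cases "D = 0") (simp_all add: field_simps power2_eq_square)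
      ultimately show ?thesis by (simp only:)
    qed
    show ?thesis
      using sums_mult[OF exp_minus_1_partial_fractions[OF ne1[OF that]], of "of_real pi / c"]
      unfolding w_def[symmetric] * .
  qed
  \<comment> \<open>The inverse of the factor N (-c^2)^p that the partial fractions leave in front
    of n^(2p).\<close>
  define K where "K = (-1) ^ p / (of_nat N * c ^ (2 * p))"
  have "(\<lambda>n. K * (\<Sum>j\<in>{- int p..int p}. (-1) powi j *
          (root_dir N j / ((of_nat (Suc n))\<^sup>2 + c\<^sup>2 * (root_dir N j)\<^sup>2))))
      sums (K * (\<Sum>j\<in>{- int p..int p}. (-1) powi j * (of_real pi / c *
        (1 / (exp (2 * of_real pi * c * root_dir N j) - 1) + 1 / 2
          - 1 / (2 * of_real pi * c * root_dir N j)))))"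
    by (intro sums_mult sums_sum W)
  also have "(\<lambda>n. K * (\<Sum>j\<in>{- int p..int p}. (-1) powi j *
          (root_dir N j / ((of_nat (Suc n))\<^sup>2 + c\<^sup>2 * (root_dir N j)\<^sup>2))))
     = (\<lambda>n. of_nat (Suc n) ^ (2 * p) / (of_nat (Suc n) ^ (2 * N) + c ^ (2 * N)))"
  proof
    fix n
    define X where "X = (of_nat (Suc n) :: complex)\<^sup>2"
    define C where "C = c\<^sup>2"
    have XC: "X ^ N + C ^ N \<noteq> 0"
      using ne[of n] unfolding X_def C_def power_mult[symmetric] .
    have "K * (\<Sum>j\<in>{- int p..int p}. (-1) powi j * (root_dir N j / (X + C * (root_dir N j)\<^sup>2)))
        = K * (\<Sum>j\<in>{- int p..int p}. exp (2 * of_real pi * \<i> * of_int (j * int p) / of_nat N) /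
            (X + C * exp (- (2 * of_real pi * \<i> * of_int j / of_nat N))))"
      using minus_one_powi_root_dir[of _ p, symmetric] root_dir_square[OF N0] unfolding N_def by simp
    also have "\<dots> = K * (of_nat N * X ^ (N - 1 - p) * (- C) ^ p / (X ^ N + C ^ N))"
      unfolding N_def by (subst partial_fractions_roots_of_unity) (use XC in \<open>auto simp: N_def\<close>)
    also have "\<dots> = X ^ p / (X ^ N + C ^ N)"
    proof -
      have "K * (of_nat N * X ^ (N - 1 - p) * (- C) ^ p) = X ^ p"
      proof -
        have "N - 1 - p = p" "of_nat N \<noteq> (0 :: complex)" using N0 by (simp add: N_def, simp)
        moreover have "(-1 :: complex) ^ p * (-1) ^ p = 1" by (simp flip: power_mult_distrib)
        ultimately show ?thesis
          unfolding K_def C_def power_mult power_minus[of "c\<^sup>2"] using c by (simp add: field_simps)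
      qed
      then show ?thesis by (metis times_divide_eq_right)
    qed
    finally show "K * (\<Sum>j\<in>{- int p..int p}. (-1) powi j *
          (root_dir N j / ((of_nat (Suc n))\<^sup>2 + c\<^sup>2 * (root_dir N j)\<^sup>2)))
       = of_nat (Suc n) ^ (2 * p) / (of_nat (Suc n) ^ (2 * N) + c ^ (2 * N))"
      unfolding X_def C_def power_mult[symmetric] .
  qed
  also have "K * (\<Sum>j\<in>{- int p..int p}. (-1) powi j * (of_real pi / c *
        (1 / (exp (2 * of_real pi * c * root_dir N j) - 1) + 1 / 2
          - 1 / (2 * of_real pi * c * root_dir N j))))
     = K * of_real pi / c * ((\<Sum>j\<in>{- int p..int p}. (-1) powi j / (exp (2 * of_real pi * c * root_dir N j) - 1))
        + (\<Sum>j\<in>{- int p..int p}. (-1) powi j) / 2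
        - 1 / (2 * of_real pi * c) * (\<Sum>j\<in>{- int p..int p}. (-1) powi j / root_dir N j))"
  proof -
    have "(\<Sum>j\<in>{- int p..int p}. (-1) powi j * (of_real pi / c *
        (1 / (exp (2 * of_real pi * c * root_dir N j) - 1) + 1 / 2
          - 1 / (2 * of_real pi * c * root_dir N j))))
       = (\<Sum>j\<in>{- int p..int p}. of_real pi / c * ((-1) powi j / (exp (2 * of_real pi * c * root_dir N j) - 1)
          + (-1) powi j / 2 - 1 / (2 * of_real pi * c) * ((-1) powi j / root_dir N j)))"
      using c by (intro sum.cong refl) (simp add: ring_distribs mult_ac)
    also have "\<dots> = of_real pi / c * ((\<Sum>j\<in>{- int p..int p}. (-1) powi j / (exp (2 * of_real pi * c * root_dir N j) - 1))
        + (\<Sum>j\<in>{- int p..int p}. (-1) powi j) / 2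
        - 1 / (2 * of_real pi * c) * (\<Sum>j\<in>{- int p..int p}. (-1) powi j / root_dir N j))"
      by (simp only: sum_distrib_left[symmetric] sum.distrib sum_subtractf sum_divide_distrib[symmetric])
    finally show ?thesis by (metis (no_types, lifting) mult.assoc times_divide_eq_right)
  qed
  also have "\<dots> = of_real pi / (2 * of_nat N * c ^ N)
             + of_real pi / (of_nat N * c ^ N) * (-1) ^ p *
               (\<Sum>j\<in>{- int p..int p}. (-1) powi j / (exp (2 * of_real pi * c * root_dir N j) - 1))
             - (if p = 0 then 1 / (2 * c\<^sup>2) else 0)"
  proof -
    have K: "K * of_real pi / c = of_real pi / (of_nat N * c ^ N) * (-1) ^ p"
      unfolding K_def N_def by (simp add: field_simps)
    have m1: "(-1 :: complex) ^ p * (-1) ^ p = 1" by (simp flip: power_mult_distrib)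
    have alg: "Q / n / cc * s * (S + s / 2 - u) = Q / (2 * n * cc) + Q / (n * cc) * s * S - Q / n / cc * s * u"
      if "s * s = 1" for Q n cc s S u :: complex
    proof -
      have "Q / n / cc * s * (S + s / 2 - u) = Q / n / cc * (s * s) / 2 + Q / n / cc * s * S - Q / n / cc * s * u"
        by (simp add: ring_distribs)
      then show ?thesis using that by simp
    qed
    have "of_real pi / of_nat N / c ^ N * (-1) ^ p *
          (1 / (2 * of_real pi * c) * (if p = 0 then 1 else 0)) = (if p = 0 then 1 / (2 * c\<^sup>2) else 0)"
      by (simp add: N_def power2_eq_square)
    then show ?thesis
      unfolding K sum_minus_one_powi N_def sum_minus_one_powi_div_root_dir
      unfolding N_def[symmetric] divide_divide_eq_left[symmetric]
      by (subst alg[OF m1]) simp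
  qed
  finally show ?thesis .
qed

section \<open>Dirichlet characters, Gauss sums and the character kernel\<close>

lemma periodic_int_shift:
  fixes f :: "int \<Rightarrow> 'a"
  assumes per: "\<And>a. f (a + int q) = f a"
  shows "f (a + k * int q) = f a"
proof (induction k rule: int_induct[where k = 0])
  case (step1 i)
  have "f (a + (i + 1) * int q) = f ((a + i * int q) + int q)" by (simp add: algebra_simps)
  then show ?case using step1 by (simp only: per)
next
  case (step2 i)
  have "f (a + (i - 1) * int q) = f ((a + (i - 1) * int q) + int q)" by (simp only: per)
  also have "\<dots> = f (a + i * int q)" by (simp add: algebra_simps)
  finally show ?case using step2 by simp
qed simp

lemma periodic_int_mod:
  fixes f :: "int \<Rightarrow> 'a"
  assumes per: "\<And>a. f (a + int q) = f a"
  shows "f (a mod int q) = f a"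
  using periodic_int_shift[of f q "a mod int q" "a div int q", OF per] by simp

lemma sum_period_eq:
  fixes f :: "int \<Rightarrow> 'a :: comm_monoid_add"
  assumes "q > 0" and per: "\<And>a. f (a + int q) = f a"
  shows "(\<Sum>r=1..q. f (int r)) = (\<Sum>x\<in>{0..<int q}. f x)"
proof (rule sum.reindex_bij_witness[of _ "\<lambda>x. if x = 0 then q else nat x" "\<lambda>r. int r mod int q"])
  fix r assume r: "r \<in> {1..q}"
  \<comment> \<open>The residue 0 is represented by r = q.\<close>
  show "(if int r mod int q = 0 then q else nat (int r mod int q)) = r"
    using r by (cases "r = q") auto
  show "f (int r mod int q) = f (int r)" using periodic_int_mod[of f, OF per] .
  show "int r mod int q \<in> {0..<int q}" using r \<open>q > 0\<close> by auto
qed (use assms in auto)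

lemma sum_period_mult:
  fixes f :: "int \<Rightarrow> 'a :: comm_monoid_add"
  assumes "q > 0" and per: "\<And>a. f (a + int q) = f a" and cop: "coprime n (int q)"
  shows "(\<Sum>r=1..q. f (n * int r)) = (\<Sum>r=1..q. f (int r))"
proof -
  have per': "f (n * (a + int q)) = f (n * a)" for a
    using periodic_int_shift[of f q "n * a" n, OF per] by (simp add: algebra_simps)
  have "(\<Sum>r=1..q. f (n * int r)) = (\<Sum>x\<in>{0..<int q}. f (n * x))"
    by (rule sum_period_eq[of q "\<lambda>x. f (n * x)", OF assms(1) per'])
  also have "\<dots> = (\<Sum>x\<in>{0..<int q}. f ((n * x) mod int q))"
    using periodic_int_mod[of f, OF per] by simp
  also have "\<dots> = (\<Sum>y\<in>(\<lambda>x. (n * x) mod int q) ` {0..<int q}. f y)"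
  proof (subst sum.reindex)
    show "inj_on (\<lambda>x. n * x mod int q) {0..<int q}"
    proof (rule inj_onI)
      fix x y assume xy: "x \<in> {0..<int q}" "y \<in> {0..<int q}" and "n * x mod int q = n * y mod int q"
      then have "[n * x = n * y] (mod int q)" by (simp add: cong_def)
      then have "[x = y] (mod int q)" using cop by (simp add: cong_mult_lcancel)
      then show "x = y" using xy by (simp add: cong_def)
    qed
  qed simp
  also have "(\<lambda>x. (n * x) mod int q) ` {0..<int q} = {0..<int q}"
  proof (rule card_subset_eq)
    show "(\<lambda>x. n * x mod int q) ` {0..<int q} \<subseteq> {0..<int q}" using \<open>q > 0\<close> by auto
    show "card ((\<lambda>x. n * x mod int q) ` {0..<int q}) = card {0..<int q}"
    proof (rule card_image, rule inj_onI)
      fix x y assume xy: "x \<in> {0..<int q}" "y \<in> {0..<int q}" and "n * x mod int q = n * y mod int q"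
      then have "[n * x = n * y] (mod int q)" by (simp add: cong_def)
      then have "[x = y] (mod int q)" using cop by (simp add: cong_mult_lcancel)
      then show "x = y" using xy by (simp add: cong_def)
    qed
  qed simp
  also have "(\<Sum>y\<in>{0..<int q}. f y) = (\<Sum>r=1..q. f (int r))"
    by (rule sum_period_eq[of q f, OF assms(1) per, symmetric])
  finally show ?thesis .
qed

locale dirichlet_character =
  fixes q :: nat and chi :: "int \<Rightarrow> complex"
  assumes char: "dirichlet_char q chi"
begin

lemma modulus_pos: "q > 0"
  and chi_1: "chi 1 = 1"
  and chi_mult: "chi (a * b) = chi a * chi b"
  and chi_periodic: "chi (a + int q) = chi a"
  and chi_nonzero_iff: "chi a \<noteq> 0 \<longleftrightarrow> coprime a (int q)"
  using char unfolding dirichlet_char_def by blast+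

lemma chi_power: "chi (a ^ n) = chi a ^ n"
  by (induction n) (simp_all add: chi_mult chi_1)

lemma chi_mod: "chi (a mod int q) = chi a"
  by (rule periodic_int_mod) (rule chi_periodic)

lemma chi_cong: "a mod int q = b mod int q \<Longrightarrow> chi a = chi b"
  by (metis chi_mod)

text \<open>By Euler's theorem the value is a root of unity.\<close>

lemma norm_chi_unit:
  assumes "coprime a (int q)"
  shows "norm (chi a) = 1"
proof -
  define b where "b = nat (a mod int q)"
  have b: "int b = a mod int q" using modulus_pos by (simp add: b_def)
  have "coprime (int b) (int q)" using assms unfolding b by (simp add: coprime_mod_left_iff modulus_pos)
  then have "coprime b q" by simp
  then have "[b ^ totient q = 1] (mod q)" by (rule euler_theorem)
  then have "[int b ^ totient q = 1] (mod int q)" by (metis cong_int_iff of_nat_1 of_nat_power)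
  then have "chi (int b ^ totient q) = chi 1" unfolding cong_def by (rule chi_cong)
  then have "chi (int b) ^ totient q = 1" by (simp add: chi_power chi_1)
  then have "norm (chi (int b)) ^ totient q = 1" by (metis norm_one norm_power)
  moreover have "totient q > 0" using modulus_pos by simp
  ultimately have "norm (chi (int b)) = 1"
    by (metis norm_ge_zero power_eq_1_iff less_imp_neq abs_norm_cancel power_eq_imp_eq_base power_one zero_le_one)
  then show ?thesis unfolding b chi_mod .
qed

lemma norm_chi_le_1: "norm (chi a) \<le> 1"
  using norm_chi_unit[of a] chi_nonzero_iff[of a] by fastforce

lemma cnj_chi_mult_chi: "coprime a (int q) \<Longrightarrow> cnj (chi a) * chi a = 1"
  using norm_chi_unit[of a] by (metis complex_norm_square mult.commute of_real_1 power_one)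

lemma dirichlet_char_cnj: "dirichlet_char q (\<lambda>n. cnj (chi n))"
  using char unfolding dirichlet_char_def by simp

lemma chi_0: "chi 0 = (if q = 1 then 1 else 0)"
proof (cases "q = 1")
  case True
  then show ?thesis using chi_periodic[of 0] by (simp add: chi_1)
next
  case False
  then show ?thesis using chi_nonzero_iff[of 0] by auto
qed

end

locale primitive_character = dirichlet_character +
  assumes primitive: "primitive_dirichlet_char q chi"
begin

lemma primitive_cnj: "primitive_dirichlet_char q (\<lambda>n. cnj (chi n))"
  using primitive unfolding primitive_dirichlet_char_def dirichlet_char_def by simp

text \<open>For n prime to q, replace r by n r. Otherwise let d = q / gcd (n, q), a proper divisor
  of q; primitivity yields a unit a that is 1 modulo d with chi a different from 1. Replacing r by a
  r leaves every n r unchanged modulo q but multiplies the sum by chi a, so the sum vanishes, as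
  does chi n.\<close>

theorem gauss_sum_separable:
  "(\<Sum>r=1..q. chi (int r) * exp (2 * of_real pi * \<i> * of_int (n * int r) / of_nat q))
     = cnj (chi n) * gauss_sum q chi"
proof -
  define e where "e = (\<lambda>x::int. exp (2 * of_real pi * \<i> * of_int x / of_nat q) :: complex)"
  have e_cong: "e x = e y" if "int q dvd x - y" for x y
  proof -
    obtain k where "x - y = int q * k" using \<open>int q dvd x - y\<close> by blast
    then have x: "x = y + int q * k" by simp
    have "2 * of_real pi * \<i> * of_int x / of_nat q
        = 2 * of_real pi * \<i> * of_int y / of_nat q + 2 * of_real pi * \<i> * (of_int k :: complex)"
      using modulus_pos unfolding x by (simp add: field_simps)
    moreover have "exp (2 * of_real pi * \<i> * of_int k) = (1 :: complex)" by (simp add: exp_eq_1)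
    ultimately show ?thesis unfolding e_def by (simp add: exp_add)
  qed
  have per: "chi (a + int q) * e (n * (a + int q)) = chi a * e (n * a)" for a n
  proof -
    have "e (n * (a + int q)) = e (n * a)" by (rule e_cong) (simp add: algebra_simps)
    then show ?thesis by (simp add: chi_periodic)
  qed
  have per1: "chi (a + int q) * e (a + int q) = chi a * e a" for a
    using per[of a 1] by simp
  have G: "gauss_sum q chi = (\<Sum>r=1..q. chi (int r) * e (int r))"
    unfolding gauss_sum_def e_def by simp
  show ?thesis
  proof (cases "coprime n (int q)")
    case True
    have "(\<Sum>r=1..q. chi (int r) * e (n * int r)) = (\<Sum>r=1..q. cnj (chi n) * (chi (n * int r) * e (n * int r)))"
      using cnj_chi_mult_chi[OF True] by (simp add: chi_mult mult.assoc[symmetric])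
    also have "\<dots> = cnj (chi n) * (\<Sum>r=1..q. chi (n * int r) * e (n * int r))"
      by (simp add: sum_distrib_left)
    also have "(\<Sum>r=1..q. chi (n * int r) * e (n * int r)) = gauss_sum q chi"
      unfolding G by (rule sum_period_mult[of q "\<lambda>x. chi x * e x", OF modulus_pos per1 True])
    finally show ?thesis unfolding e_def .
  next
    case False
    define g where "g = nat (gcd n (int q))"
    have g: "int g = gcd n (int q)" by (simp add: g_def)
    have "g dvd q" by (metis g gcd_dvd2 int_dvd_int_iff)
    then obtain d where d: "q = g * d" by blast
    have "g \<noteq> 1" using False g by (auto simp: coprime_iff_gcd_eq_1)
    moreover have "g > 0" "d > 0" using modulus_pos d by (auto intro: gr0I)
    ultimately have "d < q" "d dvd q" using d by auto
    then obtain a where a: "coprime a (int q)" "a mod int d = 1 mod int d" "chi a \<noteq> 1"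
      using primitive unfolding primitive_dirichlet_char_def by blast
    define S where "S = (\<Sum>r=1..q. chi (int r) * e (n * int r))"
    have "S = (\<Sum>r=1..q. chi (a * int r) * e (n * (a * int r)))"
      unfolding S_def by (rule sum_period_mult[of q "\<lambda>x. chi x * e (n * x)", OF modulus_pos per a(1), symmetric])
    also have "\<dots> = (\<Sum>r=1..q. chi a * (chi (int r) * e (n * int r)))"
    proof (intro sum.cong refl)
      fix r
      have "int d dvd a - 1" using a(2) by (simp add: mod_eq_dvd_iff)
      moreover have "int g dvd n" by (simp add: g)
      ultimately have "int g * int d dvd n * (a - 1)" by (rule mult_dvd_mono[rotated])
      then have "int q dvd n * (a - 1) * int r" unfolding d by simp
      then have "e (n * (a * int r)) = e (n * int r)" by (intro e_cong) (simp add: algebra_simps)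
      then show "chi (a * int r) * e (n * (a * int r)) = chi a * (chi (int r) * e (n * int r))"
        by (simp add: chi_mult)
    qed
    also have "\<dots> = chi a * S" unfolding S_def by (simp add: sum_distrib_left)
    finally have "S = 0" using a(3) by auto
    moreover have "chi n = 0" using False chi_nonzero_iff by blast
    ultimately show ?thesis unfolding S_def e_def by simp
  qed
qed

text \<open>Separability moves the conjugate values into the exponential of the other sum;
  orthogonality of additive characters then leaves only r congruent to -1.\<close>

theorem gauss_sum_mult_cnj: "gauss_sum q chi * gauss_sum q (\<lambda>n. cnj (chi n)) = of_nat q * chi (-1)"
proof -
  define e where "e = (\<lambda>x::int. exp (2 * of_real pi * \<i> * of_int x / of_nat q) :: complex)"
  have e_add: "e (x + y) = e x * e y" for x y
    unfolding e_def exp_add[symmetric] by (rule arg_cong[of _ _ exp]) (simp add: add_divide_distrib algebra_simps)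
  have e_sum: "(\<Sum>n=1..q. e (int n * m)) = (if int q dvd m then of_nat q else 0)" for m
  proof (cases "int q dvd m")
    case True
    then obtain k where "m = int q * k" by blast
    then have "e (int n * m) = 1" for n
    proof -
      have "2 * of_real pi * \<i> * of_int (int n * m) / of_nat q = 2 * of_real pi * \<i> * (of_int (int n * k) :: complex)"
        using modulus_pos \<open>m = int q * k\<close> by simp
      then show ?thesis unfolding e_def by (simp only: exp_eq_1) (auto intro!: exI[of _ "int n * k"])
    qed
    then show ?thesis using True by simp
  next
    case False
    have ne: "e m \<noteq> 1"
    proof
      assume "e m = 1"
      then obtain t :: int where "2 * pi * of_int m / real q = of_int (2 * t) * pi"
        unfolding e_def exp_eq_1 by auto
      then have "of_int m = (of_int (t * int q) :: real)" using modulus_pos by (simp add: field_simps)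
      then have "m = t * int q" by (simp only: of_int_eq_iff)
      then show False using False by simp
    qed
    have pow: "e (int n * m) = e m ^ n" for n
      unfolding e_def exp_of_nat_mult[symmetric] by (simp add: mult_ac)
    have "e m ^ q = 1"
    proof -
      have "e m ^ q = exp (2 * of_real pi * \<i> * of_int m)"
        unfolding e_def exp_of_nat_mult[symmetric] using modulus_pos by simp
      then show ?thesis by (simp add: exp_eq_1)
    qed
    then have "(\<Sum>n=1..q. e (int n * m)) = e m * (\<Sum>n<q. e m ^ n)"
      unfolding pow using modulus_pos
      by (simp add: sum_distrib_left power_Suc[symmetric] sum.atLeast1_atMost_eq del: power_Suc)
    also have "\<dots> = 0" using ne \<open>e m ^ q = 1\<close> by (simp add: geometric_sum)
    finally show ?thesis using False by simp
  qed
  have "gauss_sum q chi * gauss_sum q (\<lambda>n. cnj (chi n))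
      = (\<Sum>n=1..q. e (int n) * (cnj (chi (int n)) * gauss_sum q chi))"
    unfolding gauss_sum_def[of q "\<lambda>n. cnj (chi n)"] sum_distrib_left e_def
    by (intro sum.cong refl) (simp add: mult_ac)
  also have "\<dots> = (\<Sum>n=1..q. e (int n) * (\<Sum>r=1..q. chi (int r) * e (int n * int r)))"
    unfolding gauss_sum_separable[symmetric] e_def ..
  also have "\<dots> = (\<Sum>r=1..q. chi (int r) * (\<Sum>n=1..q. e (int n * (int r + 1))))"
    unfolding sum_distrib_left by (subst sum.swap) (simp add: e_add algebra_simps)
  \<comment> \<open>The representative of -1 in 1..q is q - 1, except for q = 1, where the only
    residue is r = 1.\<close>
  also have "\<dots> = (\<Sum>r=1..q. if r = (if q = 1 then 1 else q - 1) then of_nat q * chi (-1) else 0)"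
  proof (intro sum.cong refl)
    fix r assume r: "r \<in> {1..q}"
    have "int q dvd int r + 1 \<longleftrightarrow> q dvd r + 1" by (metis int_dvd_int_iff of_nat_Suc Suc_eq_plus1 add.commute)
    also have "\<dots> \<longleftrightarrow> r = (if q = 1 then 1 else q - 1)"
    proof
      assume "q dvd r + 1"
      then obtain k where k: "r + 1 = q * k" by blast
      show "r = (if q = 1 then 1 else q - 1)"
      proof (cases "q = 1")
        case False
        have "k < 2"
        proof (rule ccontr)
          assume "\<not> k < 2"
          then have "q * 2 \<le> r + 1" unfolding k by simp
          then show False using r False by auto
        qed
        then have "k = 1" using k by (cases k) auto
        then show ?thesis using k False by simp
      qed (use r in auto)
    qed (use r in \<open>auto split: if_splits\<close>)
    finally have d: "int q dvd int r + 1 \<longleftrightarrow> r = (if q = 1 then 1 else q - 1)" .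
    have "chi (int r) = chi (-1)" if "int q dvd int r + 1"
      using that by (intro chi_cong) (metis diff_minus_eq_add mod_eq_dvd_iff)
    then show "chi (int r) * (\<Sum>n=1..q. e (int n * (int r + 1)))
        = (if r = (if q = 1 then 1 else q - 1) then of_nat q * chi (-1) else 0)"
      unfolding e_sum using d by (simp add: mult.commute)
  qed
  also have "\<dots> = of_nat q * chi (-1)" using modulus_pos by auto
  finally show ?thesis .
qed

lemma sum_chi: "(\<Sum>r=1..q. chi (int r)) = (if q = 1 then 1 else 0)"
proof (cases "q = 1")
  case False
  then show ?thesis using gauss_sum_separable[of 0] chi_0 by simp
qed (simp add: chi_1)

end


section \<open>Partial fractions of the character kernel\<close>

lemma tendsto_inverse_linear_nat:
  fixes x a :: complex
  assumes "a \<noteq> 0"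
  shows "(\<lambda>n. 1 / (x + a * of_nat n)) \<longlonglongrightarrow> 0"
  using assms
  by (intro tendsto_divide_0[OF tendsto_const] tendsto_add_filterlim_at_infinity[OF tendsto_const]
      tendsto_mult_filterlim_at_infinity[OF tendsto_const] tendsto_of_nat)

text \<open>Pairing l with -l gives the quadratic terms of
  \<open>exp_minus_1_partial_fractions\<close>. The bilateral form converges only as a limit of
  symmetric partial sums, but it is the one in which poles of different residue classes can be
  merged.\<close>

lemma exp_minus_1_symmetric_sum:
  fixes w :: complex
  assumes "exp w \<noteq> 1"
  shows "(\<lambda>K. \<Sum>l\<in>{- int K..int K}. 1 / (w + 2 * of_real pi * \<i> * of_int l))
           \<longlonglongrightarrow> 1 / (exp w - 1) + 1 / 2"
proof -
  have nz: "w + 2 * of_real pi * \<i> * of_int l \<noteq> 0" for l :: int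
  proof
    assume "w + 2 * of_real pi * \<i> * of_int l = 0"
    then have "w = of_int (2 * (- l)) * of_real pi * \<i>" by (simp add: add_eq_0_iff mult_ac)
    then have "exp w = 1" unfolding exp_eq_1 by (auto intro!: exI[of _ "- l"])
    then show False using assms by simp
  qed
  have eq: "(\<Sum>l\<in>{- int K..int K}. 1 / (w + 2 * of_real pi * \<i> * of_int l))
      = 1 / w + (\<Sum>k<K. 2 * w / (w\<^sup>2 + 4 * of_real (pi\<^sup>2) * (of_nat (Suc k))\<^sup>2))" for K
  proof (induction K)
    case (Suc K)
    have s: "{- int (Suc K)..int (Suc K)} = insert (- int (Suc K)) (insert (int (Suc K)) {- int K..int K})"
      by auto
    define z where "z = 2 * of_real pi * \<i> * (of_nat (Suc K) :: complex)"
    have "w + z \<noteq> 0" "w - z \<noteq> 0" using nz[of "int (Suc K)"] nz[of "- int (Suc K)"] by (auto simp: z_def simp del: of_nat_Suc)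
    then have "1 / (w - z) + 1 / (w + z) = 2 * w / ((w + z) * (w - z))"
      by (simp add: divide_simps)
    also have "(w + z) * (w - z) = w\<^sup>2 - z\<^sup>2" by (simp add: algebra_simps power2_eq_square)
    also have "w\<^sup>2 - z\<^sup>2 = w\<^sup>2 + 4 * of_real (pi\<^sup>2) * (of_nat (Suc K))\<^sup>2"
      by (simp add: z_def power_mult_distrib)
    finally have "1 / (w + 2 * of_real pi * \<i> * of_int (- int (Suc K))) + 1 / (w + 2 * of_real pi * \<i> * of_int (int (Suc K)))
        = 2 * w / (w\<^sup>2 + 4 * of_real (pi\<^sup>2) * (of_nat (Suc K))\<^sup>2)"
      by (simp add: z_def del: of_nat_Suc)
    then show ?case unfolding s using Suc.IH by (simp add: algebra_simps)
  qed simp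
  have "(\<lambda>K. 1 / w + (\<Sum>k<K. 2 * w / (w\<^sup>2 + 4 * of_real (pi\<^sup>2) * (of_nat (Suc k))\<^sup>2)))
      \<longlonglongrightarrow> 1 / w + (1 / (exp w - 1) + 1 / 2 - 1 / w)"
    using exp_minus_1_partial_fractions[OF assms] unfolding sums_def by (intro tendsto_add tendsto_const)
  then show ?thesis unfolding eq by simp
qed

text \<open>Writing k = r + q l sorts the poles by residue class. The interval covered is not
  symmetric: against -qK..qK it misses the left end point and has q further points on the
  right.\<close>

lemma sum_residue_blocks:
  fixes f :: "int \<Rightarrow> 'a :: comm_monoid_add"
  shows "(\<Sum>l\<in>{- int K..int K}. \<Sum>r=1..q. f (int r + int q * l))
       = (\<Sum>k\<in>{1 - int q * int K..int q + int q * int K}. f k)"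
proof (induction K)
  case 0
  show ?case
    by simp (rule sum.reindex_bij_witness[of _ nat int], auto)
next
  case (Suc K)
  have s: "{- int (Suc K)..int (Suc K)} = insert (- int (Suc K)) (insert (int (Suc K)) {- int K..int K})"
    by auto
  have block: "(\<Sum>r=1..q. f (int r + int q * l)) = (\<Sum>k\<in>{int q * l + 1..int q * l + int q}. f k)" for l
    by (rule sum.reindex_bij_witness[of _ "\<lambda>k. nat (k - int q * l)" "\<lambda>r. int r + int q * l"]) auto
  have u: "{1 - int q * int (Suc K)..int q + int q * int (Suc K)} =
      {int q * (- int (Suc K)) + 1..int q * (- int (Suc K)) + int q} \<union>
      ({int q * int (Suc K) + 1..int q * int (Suc K) + int q} \<union>
       {1 - int q * int K..int q + int q * int K})"
  proof -
    define a where "a = int q * int K"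
    have "a \<ge> 0" "int q \<ge> 0" by (simp_all add: a_def)
    moreover have "int q * int (Suc K) = a + int q" "int q * (- int (Suc K)) = - a - int q"
      by (simp_all add: a_def algebra_simps)
    ultimately show ?thesis unfolding a_def[symmetric] by auto
  qed
  have d: "{int q * (- int (Suc K)) + 1..int q * (- int (Suc K)) + int q} \<inter>
      ({int q * int (Suc K) + 1..int q * int (Suc K) + int q} \<union>
       {1 - int q * int K..int q + int q * int K}) = {}"
    "{int q * int (Suc K) + 1..int q * int (Suc K) + int q} \<inter>
       {1 - int q * int K..int q + int q * int K} = {}"
  proof -
    define a where "a = int q * int K"
    have "a \<ge> 0" "int q \<ge> 0" by (simp_all add: a_def)
    moreover have "int q * int (Suc K) = a + int q" "int q * (- int (Suc K)) = - a - int q"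
      by (simp_all add: a_def algebra_simps)
    ultimately show "{int q * (- int (Suc K)) + 1..int q * (- int (Suc K)) + int q} \<inter>
      ({int q * int (Suc K) + 1..int q * int (Suc K) + int q} \<union>
       {1 - int q * int K..int q + int q * int K}) = {}"
    "{int q * int (Suc K) + 1..int q * int (Suc K) + int q} \<inter>
       {1 - int q * int K..int q + int q * int K} = {}" unfolding a_def[symmetric] by auto
  qed
  have "(\<Sum>l\<in>{- int (Suc K)..int (Suc K)}. \<Sum>r=1..q. f (int r + int q * l))
     = (\<Sum>r=1..q. f (int r + int q * (- int (Suc K)))) + ((\<Sum>r=1..q. f (int r + int q * int (Suc K)))
       + (\<Sum>k\<in>{1 - int q * int K..int q + int q * int K}. f k))"
    unfolding s Suc.IH[symmetric] by simp
  also have "\<dots> = (\<Sum>k\<in>{1 - int q * int (Suc K)..int q + int q * int (Suc K)}. f k)"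
    unfolding u block by (subst sum.union_disjoint; use d in simp)+
  finally show ?case .
qed

lemma summable_bounded_over_quadratic:
  fixes f :: "nat \<Rightarrow> complex" and z :: complex
  assumes "\<And>k. norm (f k) \<le> B"
  shows "summable (\<lambda>k. f k / (z + 4 * of_real (pi\<^sup>2) * (of_nat (Suc k))\<^sup>2))"
proof (rule summable_comparison_test_ev)
  have B: "B \<ge> 0" using assms[of 0] norm_ge_zero order_trans by blast
  show "\<forall>\<^sub>F k in sequentially. norm (f k / (z + 4 * of_real (pi\<^sup>2) * (of_nat (Suc k))\<^sup>2))
        \<le> B * inverse (real (Suc k) ^ 2)"
  \<comment> \<open>From this index on |z| is at most the square of \<open>Suc k\<close>; as 4 pi^2
    >= 2, the denominator keeps at least one such square.\<close>
  proof (rule eventually_sequentiallyI[of "nat \<lceil>norm z\<rceil>"])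
    fix k assume k: "k \<ge> nat \<lceil>norm z\<rceil>"
    then have "norm z \<le> real (Suc k)" by linarith
    also have "\<dots> \<le> (real (Suc k))\<^sup>2" by (simp add: power2_eq_square)
    finally have z: "norm z \<le> (real (Suc k))\<^sup>2" .
    have "4 * pi\<^sup>2 \<ge> 2"
    proof -
      have "pi\<^sup>2 \<ge> 1\<^sup>2" using pi_ge_two by (intro power_mono) auto
      then show ?thesis by simp
    qed
    then have "4 * pi\<^sup>2 * (real (Suc k))\<^sup>2 \<ge> 2 * (real (Suc k))\<^sup>2" by (intro mult_right_mono) auto
    moreover have "norm (4 * of_real (pi\<^sup>2) * (of_nat (Suc k))\<^sup>2 :: complex) = 4 * pi\<^sup>2 * (real (Suc k))\<^sup>2"
      by (simp add: norm_mult norm_power del: of_nat_Suc)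
    ultimately have *: "norm (z + 4 * of_real (pi\<^sup>2) * (of_nat (Suc k))\<^sup>2) \<ge> (real (Suc k))\<^sup>2"
      using z norm_diff_ineq[of "4 * of_real (pi\<^sup>2) * (of_nat (Suc k))\<^sup>2" z]
      unfolding add.commute[of z] by linarith
    have "norm (f k / (z + 4 * of_real (pi\<^sup>2) * (of_nat (Suc k))\<^sup>2))
        \<le> B / (real (Suc k))\<^sup>2"
      unfolding norm_divide using assms * B by (intro frac_le) auto
    then show "norm (f k / (z + 4 * of_real (pi\<^sup>2) * (of_nat (Suc k))\<^sup>2)) \<le> B * inverse (real (Suc k) ^ 2)"
      by (simp only: divide_inverse)
  qed
  show "summable (\<lambda>k. B * inverse (real (Suc k) ^ 2))"
    by (intro summable_mult inverse_power_summable[THEN summable_Suc_iff[THEN iffD2]]) simp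
qed

locale even_primitive_character = primitive_character +
  assumes even: "even_char chi"
begin

lemma chi_minus: "chi (- a) = chi a"
  using chi_mult[of "-1" a] even by (simp add: even_char_def)

text \<open>The residue of \<open>char_kernel\<close> at 0, which is the sum of chi over one
  period.\<close>

definition pole_coeff :: complex where "pole_coeff = (if q = 1 then 1 else 0)"

text \<open>For x > 0 this is the sum of chi n exp (-n x / q) over all n >= 1, see
  \<open>exp_series_chi\<close>; the closed form makes sense for complex x and shows the
  poles.\<close>

definition char_kernel :: "complex \<Rightarrow> complex" where
  "char_kernel x = (\<Sum>r=1..q. chi (int r) * exp (- (of_nat r / of_nat q * x))) / (1 - exp (- x))"

lemma gauss_sum_mult: "gauss_sum q chi * gauss_sum q (\<lambda>n. cnj (chi n)) = of_nat q"
  using gauss_sum_mult_cnj even by (simp add: even_char_def)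

lemma pole_coeff_mult: "pole_coeff * of_nat q = pole_coeff" "pole_coeff * gauss_sum q chi = pole_coeff"
proof -
  have "gauss_sum 1 chi = 1" if "q = 1"
    using that chi_periodic[of 0] chi_0 by (simp add: gauss_sum_def exp_eq_1)
  then show "pole_coeff * of_nat q = pole_coeff" "pole_coeff * gauss_sum q chi = pole_coeff"
    by (auto simp: pole_coeff_def)
qed

text \<open>Each \<open>1 / (e\<^sup>w - 1)\<close> with \<open>w = (x + 2\<pi>ir) / q\<close> is a finite geometric sum over
  powers of \<open>e\<^sup>-\<^sup>w\<close>; twisting by the conjugate character turns it into a Gauss sum.\<close>
lemma twisted_sum_exp_minus_1:
  assumes "exp x \<noteq> 1"
  shows "(\<Sum>r=1..q. cnj (chi (int r)) / (exp ((x + 2 * of_real pi * \<i> * of_nat r) / of_nat q) - 1))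
       = gauss_sum q (\<lambda>n. cnj (chi n)) * char_kernel x"
proof -
  interpret cnj_char: primitive_character q "\<lambda>n. cnj (chi n)"
    using dirichlet_char_cnj primitive_cnj by unfold_locales
  have ex: "1 - exp (- x) \<noteq> 0" using assms by (auto simp: exp_minus)
  have q0: "of_nat q \<noteq> (0 :: complex)" using modulus_pos by simp
  have geo: "1 / (exp ((x + 2 * of_real pi * \<i> * of_nat r) / of_nat q) - 1)
      = (\<Sum>p=1..q. exp (- (of_nat p / of_nat q * x)) *
           exp (2 * of_real pi * \<i> * of_int (- int p * int r) / of_nat q)) / (1 - exp (- x))" for r
  proof -
    define u where "u = exp (- ((x + 2 * of_real pi * \<i> * of_nat r) / of_nat q))"
    have up: "exp (- (of_nat p / of_nat q * x)) * exp (2 * of_real pi * \<i> * of_int (- int p * int r) / of_nat q) = u ^ p" for p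
      unfolding u_def exp_of_nat_mult[symmetric] exp_add[symmetric]
      using q0 by (intro arg_cong[of _ _ exp]) (simp add: field_simps)
    have "u ^ q = exp (- x - 2 * of_real pi * \<i> * of_int (int r))"
      unfolding u_def exp_of_nat_mult[symmetric] using q0 by simp
    also have "\<dots> = exp (- x) / exp (2 * of_real pi * \<i> * of_int (int r))" by (rule exp_diff)
    also have "exp (2 * of_real pi * \<i> * of_int (int r)) = (1 :: complex)"
      by (simp only: exp_eq_1) (auto intro!: exI[of _ "int r"])
    finally have uq: "u ^ q = exp (- x)" by simp
    then have u1: "u \<noteq> 1" using ex by auto
    have u0: "u \<noteq> 0" by (simp add: u_def)
    have "(\<Sum>p=1..q. u ^ p) = u * (\<Sum>p<q. u ^ p)"
      by (simp add: sum_distrib_left power_Suc[symmetric] sum.atLeast1_atMost_eq del: power_Suc)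
    also have "\<dots> = u * ((1 - exp (- x)) / (1 - u))"
      using u1 by (simp add: geometric_sum uq divide_simps) (simp add: algebra_simps)
    finally have "(\<Sum>p=1..q. u ^ p) / (1 - exp (- x)) = u / (1 - u)" using ex by simp
    also have "\<dots> = 1 / (1 / u - 1)" using u0 u1 by (simp add: divide_simps)
    also have "1 / u = exp ((x + 2 * of_real pi * \<i> * of_nat r) / of_nat q)"
      unfolding u_def exp_minus by (simp only: inverse_eq_divide[symmetric] inverse_inverse_eq)
    finally show ?thesis unfolding up by simp
  qed
  have "(\<Sum>r=1..q. cnj (chi (int r)) / (exp ((x + 2 * of_real pi * \<i> * of_nat r) / of_nat q) - 1))
      = (\<Sum>r=1..q. cnj (chi (int r)) * (1 / (exp ((x + 2 * of_real pi * \<i> * of_nat r) / of_nat q) - 1)))"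
    by simp
  also have "\<dots> = (\<Sum>p=1..q. exp (- (of_nat p / of_nat q * x)) *
     (\<Sum>r=1..q. cnj (chi (int r)) * exp (2 * of_real pi * \<i> * of_int (- int p * int r) / of_nat q))) / (1 - exp (- x))"
    unfolding geo sum_divide_distrib sum_distrib_left by (subst sum.swap) (simp add: mult_ac)
  also have "\<dots> = (\<Sum>p=1..q. exp (- (of_nat p / of_nat q * x)) *
     (chi (int p) * gauss_sum q (\<lambda>n. cnj (chi n)))) / (1 - exp (- x))"
    unfolding cnj_char.gauss_sum_separable by (simp add: chi_minus)
  also have "\<dots> = gauss_sum q (\<lambda>n. cnj (chi n)) * char_kernel x"
    unfolding char_kernel_def by (simp add: sum_distrib_left mult_ac)
  finally show ?thesis .
qed

text \<open>The symmetric expansion at (x + 2 pi i r) / q, twisted by the conjugate character and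
  summed over r, runs over all poles x + 2 pi i k. Evenness folds k and -k together, and k = 0
  leaves \<open>pole_coeff / x\<close>.\<close>

theorem char_kernel_partial_fractions:
  assumes "exp x \<noteq> 1"
  shows "(\<lambda>k. gauss_sum q chi * cnj (chi (int (Suc k))) * (2 * x / (x\<^sup>2 + 4 * of_real (pi\<^sup>2) * (of_nat (Suc k))\<^sup>2)))
           sums (char_kernel x + pole_coeff / 2 - pole_coeff / x)"
proof -
  interpret cnj_char: primitive_character q "\<lambda>n. cnj (chi n)"
    using dirichlet_char_cnj primitive_cnj by unfold_locales
  have q0: "of_nat q \<noteq> (0 :: complex)" using modulus_pos by simp
  have nz: "x + 2 * of_real pi * \<i> * of_int k \<noteq> 0" for k :: int
  proof
    assume "x + 2 * of_real pi * \<i> * of_int k = 0"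
    then have "x = of_int (2 * (- k)) * of_real pi * \<i>" by (simp add: add_eq_0_iff mult_ac)
    then have "exp x = 1" unfolding exp_eq_1 by (auto intro!: exI[of _ "- k"])
    then show False using assms by simp
  qed
  define f where "f = (\<lambda>k::int. cnj (chi k) / (x + 2 * of_real pi * \<i> * of_int k))"
  define g where "g = (\<lambda>k. cnj (chi (int (Suc k))) * (2 * x / (x\<^sup>2 + 4 * of_real (pi\<^sup>2) * (of_nat (Suc k))\<^sup>2)))"
  have sym: "(\<Sum>k\<in>{- int n..int n}. f k) = pole_coeff / x + (\<Sum>k<n. g k)" for n
  proof (induction n)
    case 0
    show ?case by (simp add: f_def chi_0 pole_coeff_def)
  next
    case (Suc n)
    have s: "{- int (Suc n)..int (Suc n)} = insert (- int (Suc n)) (insert (int (Suc n)) {- int n..int n})"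
      by auto
    define z where "z = 2 * of_real pi * \<i> * (of_nat (Suc n) :: complex)"
    have "x + z \<noteq> 0" "x - z \<noteq> 0" using nz[of "int (Suc n)"] nz[of "- int (Suc n)"] by (auto simp: z_def simp del: of_nat_Suc)
    then have "t / (x - z) + t / (x + z) = t * (2 * x / ((x + z) * (x - z)))" for t
      by (simp add: divide_simps) (simp add: algebra_simps)
    moreover have "(x + z) * (x - z) = x\<^sup>2 - z\<^sup>2" by (simp add: algebra_simps power2_eq_square)
    moreover have "x\<^sup>2 - z\<^sup>2 = x\<^sup>2 + 4 * of_real (pi\<^sup>2) * (of_nat (Suc n))\<^sup>2"
      by (simp add: z_def power_mult_distrib)
    ultimately have "t / (x - z) + t / (x + z) = t * (2 * x / (x\<^sup>2 + 4 * of_real (pi\<^sup>2) * (of_nat (Suc n))\<^sup>2))" for t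
      by (simp only:)
    then have "f (- int (Suc n)) + f (int (Suc n)) = g n"
      unfolding f_def g_def chi_minus by (simp add: z_def del: of_nat_Suc)
    then show ?case unfolding s using Suc.IH by (simp add: algebra_simps)
  qed
  have summ: "summable g"
  proof -
    have "summable (\<lambda>k. 2 * x * (cnj (chi (int (Suc k))) / (x\<^sup>2 + 4 * of_real (pi\<^sup>2) * (of_nat (Suc k))\<^sup>2)))"
      using norm_chi_le_1 by (intro summable_mult summable_bounded_over_quadratic[of _ 1]) simp
    then show ?thesis unfolding g_def by (simp add: mult_ac)
  qed
  have qK: "filterlim (\<lambda>K. q * K) at_top sequentially"
    using modulus_pos by (intro filterlim_subseq) (auto simp: strict_mono_def)
  have f0: "(\<lambda>K. f (int (q * K) + int r)) \<longlonglongrightarrow> 0" for r :: nat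
  proof (rule Lim_null_comparison[OF always_eventually])
    show "\<forall>K. norm (f (int (q * K) + int r)) \<le> norm (1 / (x + 2 * of_real pi * \<i> * of_nat (q * K + r)))"
      using cnj_char.norm_chi_le_1 unfolding f_def
      by (auto simp: norm_divide intro!: divide_right_mono)
    have "filterlim (\<lambda>K. q * K + r) at_top sequentially"
      using modulus_pos by (intro filterlim_subseq) (auto simp: strict_mono_def)
    from filterlim_compose[OF tendsto_inverse_linear_nat[of "2 * of_real pi * \<i>" x] this]
    show "(\<lambda>K. norm (1 / (x + 2 * of_real pi * \<i> * of_nat (q * K + r)))) \<longlonglongrightarrow> 0"
      by (intro tendsto_norm_zero) simp
  qed
  have f0': "(\<lambda>K. f (- int (q * K))) \<longlonglongrightarrow> 0"
  proof (rule Lim_null_comparison[OF always_eventually])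
    show "\<forall>K. norm (f (- int (q * K))) \<le> norm (1 / (x + (- 2 * of_real pi * \<i>) * of_nat (q * K)))"
      using cnj_char.norm_chi_le_1 unfolding f_def
      by (auto simp: norm_divide intro!: divide_right_mono)
    from filterlim_compose[OF tendsto_inverse_linear_nat[of "- 2 * of_real pi * \<i>" x] qK]
    show "(\<lambda>K. norm (1 / (x + (- 2 * of_real pi * \<i>) * of_nat (q * K)))) \<longlonglongrightarrow> 0"
      by (intro tendsto_norm_zero) simp
  qed
  \<comment> \<open>The block interval differs from a symmetric one by q + 1 boundary terms, each of
    which tends to 0.\<close>
  have split: "(\<Sum>k\<in>{1 - int q * int K..int q + int q * int K}. f k)
      = (pole_coeff / x + (\<Sum>k<q * K. g k)) + (\<Sum>r=1..q. f (int (q * K) + int r)) - f (- int (q * K))" for K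
  proof -
    define a where "a = int (q * K)"
    have a: "a \<ge> 0" "int q * int K = a" by (simp_all add: a_def)
    have 1: "{- a..a + int q} = insert (- a) {1 - a..int q + a}" using a(1) by auto
    have 2: "{- a..a + int q} = {- a..a} \<union> {a + 1..a + int q}" using a(1) by auto
    have "f (- a) + (\<Sum>k\<in>{1 - a..int q + a}. f k) = (\<Sum>k\<in>{- a..a + int q}. f k)"
      unfolding 1 by simp
    also have "\<dots> = (\<Sum>k\<in>{- a..a}. f k) + (\<Sum>k\<in>{a + 1..a + int q}. f k)"
      unfolding 2 by (rule sum.union_disjoint) auto
    also have "(\<Sum>k\<in>{a + 1..a + int q}. f k) = (\<Sum>r=1..q. f (a + int r))"
      by (rule sum.reindex_bij_witness[of _ "\<lambda>r. a + int r" "\<lambda>k. nat (k - a)"]) auto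
    finally show ?thesis unfolding a(2) using sym[of "q * K"] unfolding a_def[symmetric]
      by (simp add: algebra_simps)
  qed
  have lim1: "(\<lambda>K. \<Sum>k\<in>{1 - int q * int K..int q + int q * int K}. f k)
      \<longlonglongrightarrow> (pole_coeff / x + suminf g) + (\<Sum>r=1..q. 0) - 0"
    unfolding split
    by (intro tendsto_add tendsto_diff tendsto_const tendsto_sum f0 f0'
        filterlim_compose[OF summable_LIMSEQ[OF summ] qK])
  have ew: "exp ((x + 2 * of_real pi * \<i> * of_nat r) / of_nat q) \<noteq> 1" for r
  proof
    assume "exp ((x + 2 * of_real pi * \<i> * of_nat r) / of_nat q) = 1"
    then have "exp ((x + 2 * of_real pi * \<i> * of_nat r) / of_nat q) ^ q = 1" by simp
    then have "exp (x + 2 * of_real pi * \<i> * of_int (int r)) = 1"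
      unfolding exp_of_nat_mult[symmetric] using q0 by simp
    moreover have "exp (2 * of_real pi * \<i> * of_int (int r)) = (1 :: complex)"
      by (simp only: exp_eq_1) (auto intro!: exI[of _ "int r"])
    ultimately show False using assms by (simp add: exp_add)
  qed
  have "(\<lambda>K. (\<Sum>r=1..q. cnj (chi (int r)) * (\<Sum>l\<in>{- int K..int K}. 1 / ((x + 2 * of_real pi * \<i> * of_nat r) / of_nat q + 2 * of_real pi * \<i> * of_int l))))
      \<longlonglongrightarrow> (\<Sum>r=1..q. cnj (chi (int r)) * (1 / (exp ((x + 2 * of_real pi * \<i> * of_nat r) / of_nat q) - 1) + 1 / 2))"
    by (intro tendsto_sum tendsto_mult tendsto_const exp_minus_1_symmetric_sum ew)
  also have "(\<lambda>K. (\<Sum>r=1..q. cnj (chi (int r)) * (\<Sum>l\<in>{- int K..int K}. 1 / ((x + 2 * of_real pi * \<i> * of_nat r) / of_nat q + 2 * of_real pi * \<i> * of_int l))))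
      = (\<lambda>K. of_nat q * (\<Sum>k\<in>{1 - int q * int K..int q + int q * int K}. f k))"
  proof
    fix K
    have "cnj (chi (int r)) * (1 / ((x + 2 * of_real pi * \<i> * of_nat r) / of_nat q + 2 * of_real pi * \<i> * of_int l))
        = of_nat q * f (int r + int q * l)" for r l
    proof -
      have "chi (int r + int q * l) = chi (int r)"
        using periodic_int_shift[of chi q "int r" l, OF chi_periodic] by (simp add: mult.commute)
      moreover have "(x + 2 * of_real pi * \<i> * of_nat r) / of_nat q + 2 * of_real pi * \<i> * of_int l
          = (x + 2 * of_real pi * \<i> * of_int (int r + int q * l)) / of_nat q"
        using q0 by (simp add: field_simps)
      ultimately show ?thesis unfolding f_def by simp
    qed
    then show "(\<Sum>r=1..q. cnj (chi (int r)) * (\<Sum>l\<in>{- int K..int K}. 1 / ((x + 2 * of_real pi * \<i> * of_nat r) / of_nat q + 2 * of_real pi * \<i> * of_int l)))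
      = of_nat q * (\<Sum>k\<in>{1 - int q * int K..int q + int q * int K}. f k)"
      unfolding sum_residue_blocks[symmetric] sum_distrib_left by (subst sum.swap) simp
  qed
  also have "(\<Sum>r=1..q. cnj (chi (int r)) * (1 / (exp ((x + 2 * of_real pi * \<i> * of_nat r) / of_nat q) - 1) + 1 / 2))
      = gauss_sum q (\<lambda>n. cnj (chi n)) * char_kernel x + pole_coeff / 2"
  proof -
    have "(\<Sum>r=1..q. cnj (chi (int r)) * (1 / (exp ((x + 2 * of_real pi * \<i> * of_nat r) / of_nat q) - 1) + 1 / 2))
      = (\<Sum>r=1..q. cnj (chi (int r)) / (exp ((x + 2 * of_real pi * \<i> * of_nat r) / of_nat q) - 1))
        + (\<Sum>r=1..q. cnj (chi (int r))) / 2"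
      by (simp add: ring_distribs sum.distrib sum_divide_distrib)
    then show ?thesis unfolding twisted_sum_exp_minus_1[OF assms] cnj_char.sum_chi pole_coeff_def .
  qed
  finally have lim2: "(\<lambda>K. of_nat q * (\<Sum>k\<in>{1 - int q * int K..int q + int q * int K}. f k))
      \<longlonglongrightarrow> gauss_sum q (\<lambda>n. cnj (chi n)) * char_kernel x + pole_coeff / 2" .
  from tendsto_mult[OF tendsto_const[of "of_nat q"] lim1] lim2
  have eq: "of_nat q * (pole_coeff / x + suminf g) = gauss_sum q (\<lambda>n. cnj (chi n)) * char_kernel x + pole_coeff / 2"
    using LIMSEQ_unique by fastforce
  \<comment> \<open>Multiplying by the Gauss sum of chi isolates the kernel, since the product of
    the two Gauss sums is q.\<close>
  have "of_nat q * (gauss_sum q chi * suminf g)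
      = gauss_sum q chi * (of_nat q * (pole_coeff / x + suminf g)) - of_nat q * (pole_coeff * gauss_sum q chi) / x"
    by (simp add: algebra_simps)
  also have "\<dots> = (gauss_sum q chi * gauss_sum q (\<lambda>n. cnj (chi n))) * char_kernel x
        + (pole_coeff * gauss_sum q chi) / 2 - of_nat q * (pole_coeff * gauss_sum q chi) / x"
    unfolding eq by (simp add: algebra_simps)
  also have "\<dots> = of_nat q * char_kernel x + (pole_coeff * of_nat q) / 2 - of_nat q * pole_coeff / x"
    unfolding gauss_sum_mult pole_coeff_mult ..
  also have "\<dots> = of_nat q * (char_kernel x + pole_coeff / 2 - pole_coeff / x)"
    by (simp add: algebra_simps)
  finally have "gauss_sum q chi * suminf g = char_kernel x + pole_coeff / 2 - pole_coeff / x"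
    using q0 by simp
  with sums_mult[OF summable_sums[OF summ], of "gauss_sum q chi"] show ?thesis
    unfolding g_def by (simp add: mult.assoc)
qed

end

section \<open>Generalized Bernoulli numbers\<close>

lemma sums_swap:
  fixes f :: "nat \<Rightarrow> nat \<Rightarrow> complex"
  assumes 1: "\<And>i. summable (\<lambda>j. norm (f i j))" and 2: "summable (\<lambda>i. \<Sum>j. norm (f i j))"
  shows "summable (\<lambda>i. \<Sum>j. f i j)" "summable (\<lambda>i. norm (f i j))"
    and "(\<lambda>j. \<Sum>i. f i j) sums (\<Sum>i. \<Sum>j. f i j)"
proof -
  define F where "F = (\<lambda>(i, j). f i j)"
  have h: "((\<lambda>j. norm (f i j)) has_sum (\<Sum>j. norm (f i j))) UNIV" for i
    by (intro sums_nonneg_imp_has_sum summable_sums 1) simp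
  have "(\<lambda>x. norm (F x)) summable_on (UNIV \<times> UNIV)"
    unfolding Infinite_Sum.abs_summable_on_Sigma_iff
  proof (intro conjI ballI)
    show "(\<lambda>j. norm (F (i, j))) summable_on UNIV" for i
      using h[of i] by (auto simp: F_def summable_on_def)
    have "(\<Sum>\<^sub>\<infinity>j. norm (F (i, j))) = (\<Sum>j. norm (f i j))" for i
      using infsumI[OF h] by (simp add: F_def)
    moreover have "norm (\<Sum>j. norm (f i j)) = (\<Sum>j. norm (f i j))" for i
      using suminf_nonneg[OF 1[of i]] by simp
    ultimately show "(\<lambda>i. norm (\<Sum>\<^sub>\<infinity>j. norm (F (i, j)))) summable_on UNIV"
      using 2 by (simp add: norm_summable_imp_summable_on)
  qed
  then have "F summable_on (UNIV \<times> UNIV)" by (rule Infinite_Sum.abs_summable_summable)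
  then obtain S where S: "(F has_sum S) (UNIV \<times> UNIV)" by (auto simp: summable_on_def)
  have row: "((\<lambda>i. \<Sum>j. f i j) has_sum S) UNIV"
    by (rule has_sum_SigmaD[OF S])
      (auto simp: F_def intro!: norm_summable_imp_has_sum 1 summable_sums summable_norm_cancel[OF 1])
  from has_sum_imp_sums[OF row] show "summable (\<lambda>i. \<Sum>j. f i j)" by (rule sums_summable)
  from has_sum_imp_sums[OF row] have Seq: "S = (\<Sum>i. \<Sum>j. f i j)" by (rule sums_unique)
  have col: "summable (\<lambda>i. norm (f i j))" for j
  proof (rule summable_comparison_test'[OF 2])
    show "norm (norm (f i j)) \<le> (\<Sum>j. norm (f i j))" for i
      using sum_le_suminf[OF 1[of i], of "{j}"] by simp
  qed
  then show "summable (\<lambda>i. norm (f i j))" .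
  have "((\<lambda>j. \<Sum>i. f i j) has_sum S) UNIV"
    by (rule has_sum_SigmaD[OF S[THEN has_sum_swap[THEN iffD1]]])
      (auto simp: F_def intro!: norm_summable_imp_has_sum col summable_sums summable_norm_cancel[OF col])
  then show "(\<lambda>j. \<Sum>i. f i j) sums (\<Sum>i. \<Sum>j. f i j)"
    unfolding Seq by (rule has_sum_imp_sums)
qed

lemma sums_swap_product_bound:
  fixes f :: "nat \<Rightarrow> nat \<Rightarrow> complex"
  assumes b: "\<And>i j. norm (f i j) \<le> u i * v j" and u: "summable u" "\<And>i. u i \<ge> 0" and v: "summable v"
  shows "summable (\<lambda>i. \<Sum>j. f i j)" "summable (\<lambda>j. norm (f i j))" "summable (\<lambda>i. norm (f i j))"
    and "(\<lambda>j. \<Sum>i. f i j) sums (\<Sum>i. \<Sum>j. f i j)"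
proof -
  have 1: "summable (\<lambda>j. norm (f i j))" for i
    by (rule summable_comparison_test'[OF summable_mult[OF v, of "u i"]]) (use b in auto)
  have 2: "summable (\<lambda>i. \<Sum>j. norm (f i j))"
  proof (rule summable_comparison_test'[OF summable_mult2[OF u(1), of "suminf v"]])
    fix i
    have "(\<Sum>j. norm (f i j)) \<le> (\<Sum>j. u i * v j)"
      by (intro suminf_le b 1 summable_mult v)
    also have "\<dots> = u i * suminf v" by (rule suminf_mult[OF v])
    finally show "norm (\<Sum>j. norm (f i j)) \<le> u i * suminf v"
      using suminf_nonneg[OF 1[of i]] by simp
  qed
  show "summable (\<lambda>i. \<Sum>j. f i j)" "summable (\<lambda>j. norm (f i j))" "summable (\<lambda>i. norm (f i j))"
    "(\<lambda>j. \<Sum>i. f i j) sums (\<Sum>i. \<Sum>j. f i j)"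
    using 1 sums_swap[of f, OF 1 2] by auto
qed

lemma summable_inverse_power_Suc: "k \<ge> 2 \<Longrightarrow> summable (\<lambda>n. 1 / real (Suc n) ^ k)"
  using inverse_power_summable[of k, where 'a = real, THEN summable_Suc_iff[THEN iffD2]]
  by (simp add: inverse_eq_divide del: of_nat_Suc)

lemma exp_neq_1_small: "x \<noteq> 0 \<Longrightarrow> norm x < 2 * pi \<Longrightarrow> exp x \<noteq> (1 :: complex)"
proof
  assume x: "x \<noteq> 0" "norm x < 2 * pi" "exp x = 1"
  then obtain n :: int where n: "Re x = 0" "Im x = of_int (2 * n) * pi" unfolding exp_eq_1 by auto
  then have "norm x = \<bar>of_int n\<bar> * (2 * pi)" by (simp add: cmod_def abs_mult)
  moreover have "n \<noteq> 0" using n x by (auto simp: complex_eq_iff)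
  then have "\<bar>of_int n :: real\<bar> \<ge> 1" by linarith
  ultimately show False using x(2) by (simp add: mult_le_cancel_right1)
qed

context even_primitive_character
begin

definition cnj_L_series :: "nat \<Rightarrow> complex" where
  "cnj_L_series n = (\<Sum>k. cnj (chi (int (Suc k))) / of_nat (Suc k) ^ n)"

lemma summable_norm_L_series: "n \<ge> 2 \<Longrightarrow> summable (\<lambda>k. norm (chi (int (Suc k)) / of_nat (Suc k) ^ n))"
  by (rule summable_comparison_test'[OF summable_inverse_power_Suc[of n]])
    (use norm_chi_le_1 in \<open>auto simp: norm_divide norm_power simp del: of_nat_Suc intro!: divide_right_mono\<close>)

text \<open>Laurent coefficients of \<open>char_kernel\<close> at 0 apart from the pole, read off by
  expanding each partial fraction as a geometric series in x^2. Only odd powers arise, and for q = 1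
  the constant -1/2.\<close>

definition kernel_coeff :: "nat \<Rightarrow> complex" where
  "kernel_coeff n = (if n = 0 then - pole_coeff / 2 else if odd n
     then 2 * gauss_sum q chi * (-1) ^ (n div 2) * cnj_L_series (n + 1) / (2 * of_real pi) ^ (n + 1)
     else 0)"

theorem char_kernel_power_series:
  assumes x: "x \<noteq> 0" "norm x < 2 * pi"
  shows "(\<lambda>n. kernel_coeff n * x ^ n) sums (char_kernel x - pole_coeff / x)"
proof -
  define G where "G = gauss_sum q chi"
  define f where "f = (\<lambda>k i. G * cnj (chi (int (Suc k))) * (2 * x * (-1) ^ i * x ^ (2 * i) /
      (2 * of_real pi * of_nat (Suc k)) ^ (2 * i + 2)))"
  define \<rho> where "\<rho> = (norm x / (2 * pi))\<^sup>2"
  have \<rho>: "0 \<le> \<rho>" "\<rho> < 1" using x by (auto simp: \<rho>_def abs_square_less_1)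
  have bound: "norm (f k i) \<le> (1 / real (Suc k) ^ 2) * ((2 * norm G * norm x / (4 * pi\<^sup>2)) * \<rho> ^ i)" for k i
  proof -
    have "norm (f k i) = norm (chi (int (Suc k))) * (norm G * (2 * norm x * norm x ^ (2 * i)) /
        ((2 * pi) ^ (2 * i + 2) * real (Suc k) ^ (2 * i + 2)))"
      by (simp add: f_def norm_mult norm_divide norm_power power_mult_distrib del: of_nat_Suc)
    also have "\<dots> \<le> 1 * (norm G * (2 * norm x * norm x ^ (2 * i)) /
        ((2 * pi) ^ (2 * i + 2) * real (Suc k) ^ (2 * i + 2)))"
      by (intro mult_right_mono norm_chi_le_1) auto
    \<comment> \<open>Lowering the exponent of k to 2 separates k from i and gives a bound of
      product form.\<close>
    also have "\<dots> \<le> norm G * (2 * norm x * norm x ^ (2 * i)) /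
        ((2 * pi) ^ (2 * i + 2) * real (Suc k) ^ 2)"
      unfolding mult_1 by (intro divide_left_mono mult_left_mono power_increasing mult_pos_pos) auto
    also have "\<dots> = (1 / real (Suc k) ^ 2) * ((2 * norm G * norm x / (4 * pi\<^sup>2)) * \<rho> ^ i)"
    proof -
      have "\<rho> ^ i = norm x ^ (2 * i) / (2 * pi) ^ (2 * i)" by (simp add: \<rho>_def power_divide power_mult)
      moreover have "(2 * pi) ^ (2 * i + 2) = (2 * pi) ^ (2 * i) * (4 * pi\<^sup>2)"
        by (simp add: power_add power2_eq_square)
      moreover have "g * (2 * X * A) / (P * D * E) = 1 / E * (2 * g * X / D * (A / P))" for g X A P D E :: real
        by (simp add: mult_ac)
      ultimately show ?thesis by (simp only:)
    qed
    finally show ?thesis .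
  qed
  have row: "(\<lambda>i. f k i) sums (G * cnj (chi (int (Suc k))) * (2 * x / (x\<^sup>2 + 4 * of_real (pi\<^sup>2) * (of_nat (Suc k))\<^sup>2)))" for k
  proof -
    define z where "z = 2 * of_real pi * (of_nat (Suc k) :: complex)"
    have z0: "z \<noteq> 0" by (simp add: z_def del: of_nat_Suc)
    have "norm x < 2 * pi * 1" using x by simp
    also have "\<dots> \<le> 2 * pi * real (Suc k)" by (intro mult_left_mono) auto
    finally have "norm x < norm z" by (simp add: z_def norm_mult del: of_nat_Suc)
    then have *: "norm (- ((x / z)\<^sup>2)) < 1"
      using z0 by (simp add: norm_power norm_divide abs_square_less_1)
    have "(\<lambda>i. G * cnj (chi (int (Suc k))) * (2 * x / z\<^sup>2 * (- ((x / z)\<^sup>2)) ^ i))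
        sums (G * cnj (chi (int (Suc k))) * (2 * x / z\<^sup>2 * (1 / (1 - - ((x / z)\<^sup>2)))))"
      by (intro sums_mult geometric_sums *)
    also have "(\<lambda>i. G * cnj (chi (int (Suc k))) * (2 * x / z\<^sup>2 * (- ((x / z)\<^sup>2)) ^ i)) = f k"
    proof
      fix i
      have "(- ((x / z)\<^sup>2)) ^ i = (-1) ^ i * x ^ (2 * i) / z ^ (2 * i)"
        by (subst power_minus) (simp add: power_divide power_mult)
      then have "2 * x / z\<^sup>2 * (- ((x / z)\<^sup>2)) ^ i = 2 * x * (-1) ^ i * x ^ (2 * i) / z ^ (2 * i + 2)"
        by (simp add: power_add mult_ac power2_eq_square)
      then show "G * cnj (chi (int (Suc k))) * (2 * x / z\<^sup>2 * (- ((x / z)\<^sup>2)) ^ i) = f k i"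
        unfolding f_def z_def[symmetric] by (simp only:)
    qed
    also have "2 * x / z\<^sup>2 * (1 / (1 - - ((x / z)\<^sup>2))) = 2 * x / (x\<^sup>2 + z\<^sup>2)"
      using z0 by (simp add: field_simps power2_eq_square)
    also have "z\<^sup>2 = 4 * of_real (pi\<^sup>2) * (of_nat (Suc k))\<^sup>2"
      by (simp add: z_def power_mult_distrib)
    finally show ?thesis .
  qed
  have "(\<lambda>i. \<Sum>k. f k i) sums (\<Sum>k. \<Sum>i. f k i)"
    using \<rho> by (intro sums_swap_product_bound(4)[OF bound] summable_inverse_power_Suc summable_mult
        summable_geometric) auto
  also have "(\<Sum>k. \<Sum>i. f k i) = char_kernel x + pole_coeff / 2 - pole_coeff / x"
    using char_kernel_partial_fractions[OF exp_neq_1_small[OF x]] sums_unique[OF row]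
    by (simp add: G_def sums_iff)
  also have "(\<lambda>i. \<Sum>k. f k i) = (\<lambda>i. kernel_coeff (2 * i + 1) * x ^ (2 * i + 1))"
  proof
    fix i
    have "f k i = 2 * G * (-1) ^ i * x ^ (2 * i + 1) / (2 * of_real pi) ^ (2 * i + 2) *
        (cnj (chi (int (Suc k))) / of_nat (Suc k) ^ (2 * i + 2))" for k
      by (simp add: f_def power_mult_distrib mult_ac del: of_nat_Suc)
    then have "(\<Sum>k. f k i) = 2 * G * (-1) ^ i * x ^ (2 * i + 1) / (2 * of_real pi) ^ (2 * i + 2) * cnj_L_series (2 * i + 2)"
      unfolding cnj_L_series_def using summable_norm_L_series[of "2 * i + 2"]
      by (simp only:) (rule suminf_mult, rule summable_norm_cancel, simp add: norm_divide)
    then show "(\<Sum>k. f k i) = kernel_coeff (2 * i + 1) * x ^ (2 * i + 1)"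
      by (simp add: kernel_coeff_def G_def mult_ac)
  qed
  finally have "(\<lambda>i. kernel_coeff (2 * i + 1) * x ^ (2 * i + 1)) sums (char_kernel x + pole_coeff / 2 - pole_coeff / x)" .
  also have "(\<lambda>i. kernel_coeff (2 * i + 1) * x ^ (2 * i + 1))
      = (\<lambda>i. (\<lambda>n. if odd n then kernel_coeff n * x ^ n else 0) (2 * i + 1))" by simp
  also have "\<dots> sums (char_kernel x + pole_coeff / 2 - pole_coeff / x) \<longleftrightarrow>
      (\<lambda>n. if odd n then kernel_coeff n * x ^ n else 0) sums (char_kernel x + pole_coeff / 2 - pole_coeff / x)"
    by (rule sums_mono_reindex) (auto simp: strict_mono_def elim!: oddE)
  finally have odd: "(\<lambda>n. if odd n then kernel_coeff n * x ^ n else 0) sums (char_kernel x + pole_coeff / 2 - pole_coeff / x)" .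
  have "(\<lambda>n. (if n = 0 then - pole_coeff / 2 else 0) + (if odd n then kernel_coeff n * x ^ n else 0))
      sums (- pole_coeff / 2 + (char_kernel x + pole_coeff / 2 - pole_coeff / x))"
    by (intro sums_add odd sums_single)
  also have "(\<lambda>n. (if n = 0 then - pole_coeff / 2 else 0) + (if odd n then kernel_coeff n * x ^ n else 0))
      = (\<lambda>n. kernel_coeff n * x ^ n)"
    by (auto simp: kernel_coeff_def)
  finally show ?thesis by simp
qed

text \<open>The generating function of the generalized Bernoulli numbers is -t times the kernel at x
  = -q t. The factor t turns the pole into the constant coefficient, and comparing analytic
  functions near 0 gives the formal identity.\<close>

lemma gen_bernoulli_fps:
  "(\<Sum>k=1..q. fps_const (chi (int k)) * fps_X * fps_exp (of_nat k)) =
     (fps_exp (of_nat q) - 1) *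
       Abs_fps (\<lambda>n. if n = 0 then pole_coeff else - kernel_coeff (n - 1) * (- of_nat q) ^ (n - 1))"
  (is "_ = _ * ?P")
proof -
  define P where "P = (\<lambda>t. if t = 0 then pole_coeff else - t * char_kernel (- of_nat q * t))"
  have q0: "real q > 0" "of_nat q \<noteq> (0 :: complex)" using modulus_pos by auto
  have ev: "eventually (\<lambda>t::complex. norm t < 2 * pi / q) (nhds 0)"
    using q0 eventually_nhds_metric[of "\<lambda>t::complex. norm t < 2 * pi / q" 0] by (auto intro!: exI[of _ "2 * pi / q"])
  have P: "P has_fps_expansion ?P"
  proof (rule has_fps_expansionI, rule eventually_mono[OF ev])
    fix t :: complex assume t: "norm t < 2 * pi / q"
    show "(\<lambda>n. fps_nth ?P n * t ^ n) sums P t"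
    proof (cases "t = 0")
      case True
      then show ?thesis using powser_sums_zero[of "fps_nth ?P"] by (simp add: P_def)
    next
      case False
      define x where "x = - of_nat q * t"
      have x: "x \<noteq> 0" "norm x < 2 * pi" using False t q0 by (auto simp: x_def norm_mult field_simps)
      have "(\<lambda>n. - t * (kernel_coeff n * x ^ n)) sums (- t * (char_kernel x - pole_coeff / x))"
        by (intro sums_mult char_kernel_power_series x)
      also have "(\<lambda>n. - t * (kernel_coeff n * x ^ n)) = (\<lambda>n. fps_nth ?P (Suc n) * t ^ Suc n)"
        unfolding x_def power_mult_distrib by (simp add: mult_ac)
      finally have "(\<lambda>n. fps_nth ?P n * t ^ n) sums (- t * (char_kernel x - pole_coeff / x) + fps_nth ?P 0 * t ^ 0)"
        by (rule sums_Suc)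
      also have "- t * (char_kernel x - pole_coeff / x) + fps_nth ?P 0 * t ^ 0 = P t"
      proof -
        have "t * pole_coeff / x = - pole_coeff"
          using False q0 pole_coeff_mult(1) by (auto simp: x_def field_simps pole_coeff_def split: if_splits)
        then show ?thesis using False unfolding P_def x_def[symmetric] by (simp add: right_diff_distrib)
      qed
      finally show ?thesis .
    qed
  qed
  have "(\<lambda>t. (exp (of_nat q * t) - 1) * P t) has_fps_expansion (fps_exp (of_nat q) - 1) * ?P"
    by (intro fps_expansion_intros P)
  moreover have expansion: "(\<lambda>t. \<Sum>k=1..q. chi (int k) * t * exp (of_nat k * t)) has_fps_expansion
     (\<Sum>k=1..q. fps_const (chi (int k)) * fps_X * fps_exp (of_nat k))"
    by (intro fps_expansion_intros)
  moreover have eq: "eventually (\<lambda>t. (exp (of_nat q * t) - 1) * P t = (\<Sum>k=1..q. chi (int k) * t * exp (of_nat k * t))) (nhds 0)"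
  proof (rule eventually_mono[OF ev])
    fix t :: complex assume t: "norm t < 2 * pi / q"
    show "(exp (of_nat q * t) - 1) * P t = (\<Sum>k=1..q. chi (int k) * t * exp (of_nat k * t))"
    proof (cases "t = 0")
      case False
      have "of_nat q * t \<noteq> 0" "norm (of_nat q * t) < 2 * pi" using False t q0 by (auto simp: norm_mult field_simps)
      from exp_neq_1_small[OF this] have e: "1 - exp (of_nat q * t) \<noteq> 0" by simp
      have "(exp (of_nat q * t) - 1) * P t
          = t * (\<Sum>r=1..q. chi (int r) * exp (- (of_nat r / of_nat q * (- of_nat q * t))))"
        using False e by (simp add: P_def char_kernel_def divide_simps) (simp add: algebra_simps)
      also have "\<dots> = (\<Sum>k=1..q. chi (int k) * t * exp (of_nat k * t))"
        using q0 by (simp add: sum_distrib_left mult_ac)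
      finally show ?thesis .
    qed simp
  qed
  ultimately show ?thesis
    using has_fps_expansion_cong[OF eq refl] fps_expansion_unique_complex[OF expansion] by simp
qed

lemma fps_exp_minus_1_nonzero: "c \<noteq> 0 \<Longrightarrow> fps_exp c - 1 \<noteq> (0 :: complex fps)"
proof
  assume "c \<noteq> 0" "fps_exp c - 1 = (0 :: complex fps)"
  then have "fps_nth (fps_exp c - 1) 1 = 0" by simp
  then show False using \<open>c \<noteq> 0\<close> by simp
qed

lemma gen_bernoulli_kernel_coeff:
  "gen_bernoulli q chi n = fact n *
     (if n = 0 then pole_coeff else - kernel_coeff (n - 1) * (- of_nat q) ^ (n - 1))"
proof -
  have "(THE B. (\<Sum>k=1..q. fps_const (chi (int k)) * fps_X * fps_exp (of_nat k)) =
      (fps_exp (of_nat q) - 1) * B) =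
      Abs_fps (\<lambda>n. if n = 0 then pole_coeff else - kernel_coeff (n - 1) * (- of_nat q) ^ (n - 1))"
    by (rule the_equality) (use gen_bernoulli_fps fps_exp_minus_1_nonzero[of "of_nat q"] modulus_pos in auto)
  then show ?thesis unfolding gen_bernoulli_def by simp
qed

corollary gen_bernoulli_even:
  assumes "i > 0"
  shows "gen_bernoulli q chi (2 * i) / fact (2 * i) =
    of_nat q ^ (2 * i - 1) * 2 * gauss_sum q chi * (-1) ^ (i - 1) * cnj_L_series (2 * i) / (2 * of_real pi) ^ (2 * i)"
proof -
  have o: "odd (2 * i - 1)" "(2 * i - 1) div 2 = i - 1" "2 * i - 1 + 1 = 2 * i" "2 * i - 1 \<noteq> 0" using assms by auto
  have "gen_bernoulli q chi (2 * i) / fact (2 * i) = - kernel_coeff (2 * i - 1) * (- of_nat q) ^ (2 * i - 1)"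
    unfolding gen_bernoulli_kernel_coeff using assms by simp
  also have "\<dots> = kernel_coeff (2 * i - 1) * of_nat q ^ (2 * i - 1)"
    using o(1) by (simp add: power_minus_odd)
  finally show ?thesis unfolding kernel_coeff_def using o by (simp add: mult_ac)
qed

end

text \<open>With the constant 1 as a primitive character modulo 1, zeta and the ordinary Bernoulli
  numbers become instances of the results on characters.\<close>

lemma primitive_character_1: "even_primitive_character (Suc 0) (\<lambda>_. 1)"
proof -
  have c: "dirichlet_char (Suc 0) (\<lambda>_. 1)" unfolding dirichlet_char_def by simp
  then have "primitive_dirichlet_char (Suc 0) (\<lambda>_. 1)"
    unfolding primitive_dirichlet_char_def by (metis dvd_0_left_iff less_Suc0 nat.distinct(1))
  with c show ?thesis by unfold_locales (simp_all add: even_char_def)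
qed

interpretation trivial: even_primitive_character "Suc 0" "\<lambda>_. 1"
  by (rule primitive_character_1)

text \<open>The generating functions t / (e^t - 1) and t e^t / (e^t - 1) differ by t, so only the
  index 1 is affected.\<close>

lemma bernoulli_num_eq_gen_bernoulli:
  assumes "n \<noteq> 1"
  shows "bernoulli_num n = gen_bernoulli (Suc 0) (\<lambda>_. 1) n"
proof -
  define B1 where "B1 = Abs_fps (\<lambda>n. if n = 0 then trivial.pole_coeff else - trivial.kernel_coeff (n - 1) * (- of_nat (Suc 0)) ^ (n - 1))"
  have B1: "fps_X * fps_exp 1 = (fps_exp 1 - 1) * B1"
    using trivial.gen_bernoulli_fps by (simp add: B1_def)
  have nz: "fps_exp 1 - 1 \<noteq> (0 :: complex fps)" by (rule trivial.fps_exp_minus_1_nonzero) simp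
  have eq: "fps_X = (fps_exp 1 - 1) * (B1 - fps_X)"
    unfolding right_diff_distrib B1[symmetric] by (simp add: algebra_simps)
  then have the: "(THE B. fps_X = (fps_exp 1 - 1) * B) = B1 - fps_X"
  proof (rule the_equality)
    fix B :: "complex fps" assume B: "fps_X = (fps_exp 1 - 1) * B"
    have "(fps_exp 1 - 1) * B = (fps_exp 1 - 1) * (B1 - fps_X)"
      by (rule trans[OF B[symmetric] eq])
    then show "B = B1 - fps_X" using nz by (simp only: mult_cancel_left) simp
  qed
  have "bernoulli_num n = fact n * fps_nth B1 n"
  proof -
    have X: "fps_nth fps_X n = (0 :: complex)" using assms by (simp only: fps_X_nth if_False)
    show ?thesis by (simp only: bernoulli_num_def the fps_sub_nth X diff_zero)
  qed
  then show ?thesis unfolding trivial.gen_bernoulli_kernel_coeff B1_def by simp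
qed

lemma bernoulli_num_0: "bernoulli_num 0 = 1"
  using bernoulli_num_eq_gen_bernoulli[of 0] trivial.gen_bernoulli_kernel_coeff[of 0]
  by (simp add: trivial.pole_coeff_def)

corollary bernoulli_num_even:
  assumes "i > 0"
  shows "bernoulli_num (2 * i) / fact (2 * i) =
    2 * (-1) ^ (i - 1) * (\<Sum>k. 1 / of_nat (Suc k) ^ (2 * i)) / (2 * of_real pi) ^ (2 * i)"
proof -
  have "gauss_sum (Suc 0) (\<lambda>_. 1) = 1" using trivial.pole_coeff_mult(2) by (simp add: trivial.pole_coeff_def)
  then show ?thesis
    using trivial.gen_bernoulli_even[OF assms] bernoulli_num_eq_gen_bernoulli[of "2 * i"]
    by (simp add: trivial.cnj_L_series_def)
qed

section \<open>Special values of Dirichlet series\<close>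

lemma Gamma_lborel:
  assumes "Re s > 0"
  shows "set_integrable lborel {0<..} (\<lambda>t. of_real t powr (s - 1) / of_real (exp t))"
    and "(LINT t:{0<..}|lborel. of_real t powr (s - 1) / of_real (exp t)) = Gamma s"
proof -
  have m: "(\<lambda>t. indicator {0<..} t *\<^sub>R (complex_of_real t powr (s - 1) / of_real (exp t))) \<in> borel_measurable lborel"
    by measurable
  show i: "set_integrable lborel {0<..} (\<lambda>t. of_real t powr (s - 1) / of_real (exp t))"
    using absolutely_integrable_Gamma_integral'[OF assms] integrable_completion[OF m]
    unfolding set_integrable_def by blast
  show "(LINT t:{0<..}|lborel. of_real t powr (s - 1) / of_real (exp t)) = Gamma s"
    using set_borel_integral_eq_integral(2)[OF i] integral_unique[OF Gamma_integral_complex'[OF assms]] by simp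
qed

lemma Mellin_exp:
  assumes "Re s > 0" "a > (0 :: real)"
  shows "set_integrable lborel {0<..} (\<lambda>t. of_real t powr (s - 1) * of_real (exp (- (a * t))))"
    and "(LINT t:{0<..}|lborel. of_real t powr (s - 1) * of_real (exp (- (a * t)))) = Gamma s / of_real a powr s"
proof -
  define h where "h = (\<lambda>t. indicator {0<..} t *\<^sub>R (complex_of_real t powr (s - 1) / of_real (exp t)))"
  have h: "integrable lborel h" "integral\<^sup>L lborel h = Gamma s"
    using Gamma_lborel[OF assms(1)] unfolding h_def set_integrable_def set_lebesgue_integral_def by auto
  have ha: "h (0 + a * t) = of_real a powr (s - 1) *
      (indicator {0<..} t *\<^sub>R (of_real t powr (s - 1) * of_real (exp (- (a * t)))))" for t
  proof (cases "t > 0")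
    case True
    have "complex_of_real (a * t) powr (s - 1) = of_real a powr (s - 1) * of_real t powr (s - 1)"
      using True assms by (simp add: powr_times_real)
    then show ?thesis using True assms by (simp add: h_def exp_minus divide_inverse)
  next
    case False
    then show ?thesis using assms by (simp add: h_def zero_less_mult_iff)
  qed
  have a0: "of_real a powr (s - 1) \<noteq> (0 :: complex)" using assms by simp
  have "integrable lborel (\<lambda>t. h (0 + a * t))"
    using h(1) assms by (intro lborel_integrable_real_affine) auto
  then have "integrable lborel (\<lambda>t. inverse (of_real a powr (s - 1)) * h (0 + a * t))"
    by (rule integrable_mult_right)
  moreover have "inverse (of_real a powr (s - 1)) * h (0 + a * t) =
      indicator {0<..} t *\<^sub>R (of_real t powr (s - 1) * of_real (exp (- (a * t))))" for t
    unfolding ha mult.assoc[symmetric] using a0 by simp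
  ultimately show "set_integrable lborel {0<..} (\<lambda>t. of_real t powr (s - 1) * of_real (exp (- (a * t))))"
    unfolding set_integrable_def by simp
  have "Gamma s = a *\<^sub>R integral\<^sup>L lborel (\<lambda>t. h (0 + a * t))"
    using lborel_integral_real_affine[of a h 0] h(2) assms by simp
  also have "\<dots> = of_real a * of_real a powr (s - 1) *
       (LINT t:{0<..}|lborel. of_real t powr (s - 1) * of_real (exp (- (a * t))))"
    unfolding ha set_lebesgue_integral_def by (simp add: scaleR_conv_of_real)
  also have "of_real a * of_real a powr (s - 1) = of_real a powr s"
    using assms by (simp add: powr_diff)
  finally show "(LINT t:{0<..}|lborel. of_real t powr (s - 1) * of_real (exp (- (a * t)))) = Gamma s / of_real a powr s"
    using assms by simp
qed

definition exp_series :: "(nat \<Rightarrow> complex) \<Rightarrow> real \<Rightarrow> complex" where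
  "exp_series f t = (\<Sum>k. f k * of_real (exp (- (real (Suc k) * t))))"

lemma borel_measurable_exp_series [measurable]: "exp_series f \<in> borel_measurable borel"
  unfolding exp_series_def by measurable

lemma summable_exp_series:
  fixes f :: "nat \<Rightarrow> complex"
  assumes "\<And>k. norm (f k) \<le> 1" "t > 0"
  shows "summable (\<lambda>k. norm (f k * of_real (exp (- (real (Suc k) * t)))))"
proof (rule summable_comparison_test')
  show "summable (\<lambda>k. exp (- t) ^ Suc k)"
    using assms(2) by (intro summable_Suc_iff[THEN iffD2] summable_geometric) auto
  fix k
  have "exp (- (real (Suc k) * t)) = exp (- t) ^ Suc k"
    by (simp only: exp_of_nat_mult[symmetric]) simp
  moreover have "norm (norm (f k * of_real (exp (- (real (Suc k) * t))))) \<le> exp (- (real (Suc k) * t))"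
    using assms(1)[of k] by (simp add: norm_mult mult_left_le_one_le del: of_nat_Suc)
  ultimately show "norm (norm (f k * of_real (exp (- (real (Suc k) * t))))) \<le> exp (- t) ^ Suc k"
    by (simp only:)
qed

lemma Mellin_exp_series:
  fixes f :: "nat \<Rightarrow> complex"
  assumes f: "\<And>k. norm (f k) \<le> 1" and s: "Re s > 1"
  shows "set_integrable lborel {0<..} (\<lambda>t. of_real t powr (s - 1) * exp_series f t)"
    and "(\<lambda>k. Gamma s * (f k / of_nat (Suc k) powr s)) sums
           (LINT t:{0<..}|lborel. of_real t powr (s - 1) * exp_series f t)"
proof -
  define \<sigma> where "\<sigma> = Re s"
  define H where "H = (\<lambda>s k t. indicator {0<..} t *\<^sub>R (complex_of_real t powr (s - 1) * of_real (exp (- (real (Suc k) * t)))))"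
  have H: "integrable lborel (H s k)" "integral\<^sup>L lborel (H s k) = Gamma s / of_nat (Suc k) powr s"
    if "Re s > 0" for s k
    using Mellin_exp[OF that, of "real (Suc k)"]
    unfolding H_def set_integrable_def set_lebesgue_integral_def by simp_all
  define F where "F = (\<lambda>k t. f k * H s k t)"
  have 1: "integrable lborel (F k)" for k
    unfolding F_def using H(1)[of s k] s by simp
  \<comment> \<open>In absolute value the integrand is the one at the real exponent \<sigma>, so the
    integrals of the norms are again Gamma values and are summable because \<sigma> > 1.\<close>
  have nF: "norm (F k t) = norm (f k) * Re (H (of_real \<sigma>) k t)" for k t
  proof (cases "t > 0")
    case True
    have "norm (complex_of_real t powr (s - 1)) = t powr (\<sigma> - 1)"
      using True by (simp add: norm_powr_real_powr \<sigma>_def)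
    moreover have "complex_of_real t powr (of_real \<sigma> - 1) = of_real (t powr (\<sigma> - 1))"
      using True by (simp add: powr_of_real[symmetric])
    ultimately show ?thesis using True by (simp add: F_def H_def norm_mult del: of_nat_Suc)
  qed (simp add: F_def H_def)
  have 2: "AE t in lborel. summable (\<lambda>k. norm (F k t))"
  proof (intro AE_I2)
    fix t :: real
    show "summable (\<lambda>k. norm (F k t))"
    proof (cases "t > 0")
      case True
      have "summable (\<lambda>k. norm (complex_of_real t powr (s - 1)) * norm (f k * of_real (exp (- (real (Suc k) * t)))))"
        by (intro summable_mult summable_exp_series f True)
      then show ?thesis using True by (simp add: F_def H_def norm_mult mult_ac del: of_nat_Suc)
    qed (simp add: F_def H_def)
  qed
  have 3: "summable (\<lambda>k. \<integral>t. norm (F k t) \<partial>lborel)"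
  proof (rule summable_comparison_test')
    have "summable (\<lambda>k. real (Suc k) powr (- \<sigma>))"
      using s by (subst summable_Suc_iff[of "\<lambda>k. real k powr (- \<sigma>)"]) (simp add: summable_real_powr_iff \<sigma>_def)
    then show "summable (\<lambda>k. Gamma \<sigma> * real (Suc k) powr (- \<sigma>))" by (rule summable_mult)
    fix k
    have \<sigma>0: "\<sigma> > 0" using s by (simp add: \<sigma>_def)
    have "(\<integral>t. norm (F k t) \<partial>lborel) = norm (f k) * Re (Gamma (of_real \<sigma>) / of_nat (Suc k) powr of_real \<sigma>)"
      unfolding nF using H[of "of_real \<sigma>" k] \<sigma>0 by simp
    also have "Gamma (of_real \<sigma>) / of_nat (Suc k) powr of_real \<sigma> = complex_of_real (Gamma \<sigma> * real (Suc k) powr (- \<sigma>))"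
      by (simp add: Gamma_complex_of_real powr_of_real[symmetric] powr_minus divide_inverse del: of_nat_Suc)
    also have "norm (f k) * Re (complex_of_real (Gamma \<sigma> * real (Suc k) powr (- \<sigma>))) \<le> 1 * (Gamma \<sigma> * real (Suc k) powr (- \<sigma>))"
      using f[of k] Gamma_real_pos[OF \<sigma>0] by (simp add: mult_left_le_one_le del: of_nat_Suc)
    finally show "norm (\<integral>t. norm (F k t) \<partial>lborel) \<le> Gamma \<sigma> * real (Suc k) powr (- \<sigma>)"
      by simp
  qed
  have S: "(\<Sum>k. F k t) = indicator {0<..} t *\<^sub>R (of_real t powr (s - 1) * exp_series f t)" for t
  proof (cases "t > 0")
    case True
    then show ?thesis
      using suminf_mult[OF summable_norm_cancel[OF summable_exp_series[of f, OF f True]], of "complex_of_real t powr (s - 1)"]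
      by (simp add: F_def H_def exp_series_def mult_ac del: of_nat_Suc)
  qed (simp add: F_def H_def)
  show "set_integrable lborel {0<..} (\<lambda>t. of_real t powr (s - 1) * exp_series f t)"
    using integrable_suminf[OF 1 2 3] unfolding S set_integrable_def .
  have "integral\<^sup>L lborel (F k) = Gamma s * (f k / of_nat (Suc k) powr s)" for k
    unfolding F_def using H[of s k] s by simp
  then show "(\<lambda>k. Gamma s * (f k / of_nat (Suc k) powr s)) sums
           (LINT t:{0<..}|lborel. of_real t powr (s - 1) * exp_series f t)"
    using sums_integral[OF 1 2 3] unfolding S set_lebesgue_integral_def by simp
qed

lemma integral_powr_from_0_complex:
  assumes "Re z > 0" "c > (0 :: real)"
  shows "set_integrable lborel {0<..c} (\<lambda>t. complex_of_real t powr (z - 1))"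
    and "(LINT t:{0<..c}|lborel. complex_of_real t powr (z - 1)) = of_real c powr z / z"
proof -
  have z0: "z \<noteq> 0" using assms by auto
  have hi: "((\<lambda>t. complex_of_real t powr (z - 1)) has_integral
            (of_real c powr z / z - of_real 0 powr z / z)) {0..c}"
    using assms z0
    by (intro fundamental_theorem_of_calculus_interior)
       (auto intro!: continuous_intros derivative_eq_intros has_vector_derivative_real_field)
  have "(\<lambda>t. norm (complex_of_real t powr (z - 1))) integrable_on {0..c}"
  proof (rule integrable_eq)
    show "(\<lambda>t. t powr (Re z - 1)) integrable_on {0..c}"
      using assms by (intro integrable_on_powr_from_0) auto
  qed (auto simp: norm_powr_real_powr)
  with hi have "(\<lambda>t. complex_of_real t powr (z - 1)) absolutely_integrable_on {0..c}"
    by (intro absolutely_integrable_onI) auto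
  moreover have m: "(\<lambda>t. indicator {0..c} t *\<^sub>R (complex_of_real t powr (z - 1))) \<in> borel_measurable lborel"
    by measurable
  ultimately have i: "set_integrable lborel {0..c} (\<lambda>t. complex_of_real t powr (z - 1))"
    using integrable_completion[OF m] unfolding set_integrable_def by blast
  have eq: "indicator {0<..c} t *\<^sub>R (complex_of_real t powr (z - 1)) = indicator {0..c} t *\<^sub>R (complex_of_real t powr (z - 1))" for t
    by (cases "t = 0") (auto simp: indicator_def)
  show "set_integrable lborel {0<..c} (\<lambda>t. complex_of_real t powr (z - 1))"
    using i unfolding set_integrable_def eq .
  show "(LINT t:{0<..c}|lborel. complex_of_real t powr (z - 1)) = of_real c powr z / z"
    using set_borel_integral_eq_integral(2)[OF i] integral_unique[OF hi]
    unfolding set_lebesgue_integral_def eq by simp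
qed

text \<open>Each power of t integrates to a simple fraction in s. The polar part \<delta> / t is
  integrated separately, which is possible because Re s > 1.\<close>

lemma Mellin_power_series:
  assumes c: "c > 0" and s: "Re s > 1"
    and a: "summable (\<lambda>n. norm (a n) * c ^ n)"
    and A: "\<And>t. 0 < t \<Longrightarrow> t \<le> c \<Longrightarrow> (\<lambda>n. a n * of_real t ^ n) sums (A t - \<delta> / of_real t)"
  shows "(\<lambda>n. a n * (of_real c powr (s + of_nat n) / (s + of_nat n))) sums
           ((LINT t:{0<..c}|lborel. of_real t powr (s - 1) * A t) - \<delta> * of_real c powr (s - 1) / (s - 1))"
proof -
  define \<sigma> where "\<sigma> = Re s"
  have \<sigma>: "\<sigma> > 1" using s by (simp add: \<sigma>_def)
  define H where "H = (\<lambda>z t. indicator {0<..c} t *\<^sub>R (complex_of_real t powr (z - 1)))"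
  have H: "integrable lborel (H z)" "integral\<^sup>L lborel (H z) = of_real c powr z / z" if "Re z > 0" for z
    using integral_powr_from_0_complex[OF that c]
    unfolding H_def set_integrable_def set_lebesgue_integral_def by simp_all
  define F where "F = (\<lambda>n t. a n * H (s + of_nat n) t)"
  have 1: "integrable lborel (F n)" for n
    unfolding F_def using H(1)[of "s + of_nat n"] s by simp
  have nF: "norm (F n t) = norm (a n) * Re (H (of_real (\<sigma> + real n)) t)" for n t
  proof (cases "0 < t \<and> t \<le> c")
    case True
    have "norm (complex_of_real t powr (s + of_nat n - 1)) = t powr (\<sigma> + real n - 1)"
      using True by (simp add: norm_powr_real_powr \<sigma>_def)
    moreover have "complex_of_real t powr (of_real (\<sigma> + real n) - 1) = of_real (t powr (\<sigma> + real n - 1))"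
      using True by (simp add: powr_of_real[symmetric])
    ultimately show ?thesis using True by (simp add: F_def H_def norm_mult)
  qed (auto simp: F_def H_def indicator_def)
  have Ft: "F n t = of_real t powr (s - 1) * (a n * of_real t ^ n)" if "0 < t" "t \<le> c" for n t
  proof -
    have "complex_of_real t powr (s + of_nat n - 1) = of_real t powr (s - 1) * of_real t ^ n"
      using that by (simp add: powr_add powr_diff powr_nat')
    then show ?thesis using that by (simp add: F_def H_def mult_ac)
  qed
  have 2: "AE t in lborel. summable (\<lambda>n. norm (F n t))"
  proof (intro AE_I2)
    fix t :: real
    show "summable (\<lambda>n. norm (F n t))"
    proof (cases "0 < t \<and> t \<le> c")
      case True
      have "summable (\<lambda>n. norm (a n) * t ^ n)"
        by (rule summable_comparison_test'[OF a]) (use True c in \<open>auto intro!: mult_left_mono power_mono\<close>)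
      then have "summable (\<lambda>n. norm (complex_of_real t powr (s - 1)) * (norm (a n) * t ^ n))"
        by (rule summable_mult)
      then show ?thesis using True by (simp add: Ft norm_mult norm_power)
    qed (auto simp: F_def H_def indicator_def)
  qed
  have 3: "summable (\<lambda>n. \<integral>t. norm (F n t) \<partial>lborel)"
  proof (rule summable_comparison_test')
    show "summable (\<lambda>n. c powr \<sigma> * (norm (a n) * c ^ n))" by (intro summable_mult a)
    fix n
    have "(\<integral>t. norm (F n t) \<partial>lborel) = norm (a n) * Re (of_real c powr (of_real (\<sigma> + real n)) / of_real (\<sigma> + real n))"
      unfolding nF using H[of "of_real (\<sigma> + real n)"] \<sigma> by simp
    also have "of_real c powr (of_real (\<sigma> + real n)) / of_real (\<sigma> + real n) = complex_of_real (c powr (\<sigma> + real n) / (\<sigma> + real n))"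
      using c by (simp add: powr_of_real[symmetric])
    also have "norm (a n) * Re (complex_of_real (c powr (\<sigma> + real n) / (\<sigma> + real n))) \<le> norm (a n) * (c powr (\<sigma> + real n))"
    proof (intro mult_left_mono)
      have "c powr (\<sigma> + real n) / (\<sigma> + real n) \<le> c powr (\<sigma> + real n) / 1"
        using \<sigma> by (intro frac_le) auto
      then show "Re (complex_of_real (c powr (\<sigma> + real n) / (\<sigma> + real n))) \<le> c powr (\<sigma> + real n)"
        by (simp only: Re_complex_of_real div_by_1)
    qed simp
    also have "\<dots> = c powr \<sigma> * (norm (a n) * c ^ n)"
      using c by (simp add: powr_add powr_realpow mult_ac)
    finally show "norm (\<integral>t. norm (F n t) \<partial>lborel) \<le> c powr \<sigma> * (norm (a n) * c ^ n)" by simp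
  qed
  have S: "(\<Sum>n. F n t) = indicator {0<..c} t *\<^sub>R (of_real t powr (s - 1) * A t) - \<delta> * H (s - 1) t" for t
  proof (cases "0 < t \<and> t \<le> c")
    case True
    have "(\<lambda>n. F n t) sums (of_real t powr (s - 1) * (A t - \<delta> / of_real t))"
      unfolding Ft[OF True[THEN conjunct1] True[THEN conjunct2]]
      using True by (intro sums_mult A) auto
    moreover have "complex_of_real t powr (s - 1 - 1) = of_real t powr (s - 1) / of_real t"
      using True by (simp add: powr_diff power2_eq_square)
    ultimately show ?thesis using True by (simp add: H_def sums_iff right_diff_distrib)
  qed (auto simp: F_def H_def indicator_def)
  have hs: "integrable lborel (H (s - 1))" "integral\<^sup>L lborel (H (s - 1)) = of_real c powr (s - 1) / (s - 1)"
    using H[of "s - 1"] s by simp_all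
  have i: "integrable lborel (\<lambda>t. \<Sum>n. F n t)" by (rule integrable_suminf[OF 1 2 3])
  have "integrable lborel (\<lambda>t. (\<Sum>n. F n t) + \<delta> * H (s - 1) t)"
    using i hs by simp
  then have iA: "integrable lborel (\<lambda>t. indicator {0<..c} t *\<^sub>R (of_real t powr (s - 1) * A t))"
    unfolding S by simp
  have "(\<integral>t. (\<Sum>n. F n t) \<partial>lborel) = (LINT t:{0<..c}|lborel. of_real t powr (s - 1) * A t) - \<delta> * of_real c powr (s - 1) / (s - 1)"
    unfolding S set_lebesgue_integral_def using iA hs by simp
  moreover have "integral\<^sup>L lborel (F n) = a n * (of_real c powr (s + of_nat n) / (s + of_nat n))" for n
    unfolding F_def using H[of "s + of_nat n"] s by simp
  ultimately show ?thesis using sums_integral[OF 1 2 3] by simp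
qed

text \<open>Expanding t^s = exp (s ln t) and integrating term by term exhibits the function as an
  everywhere convergent power series in s.\<close>

lemma Mellin_upper_entire:
  fixes f :: "nat \<Rightarrow> complex"
  assumes f: "\<And>k. norm (f k) \<le> 1" and c: "c > (0 :: real)"
  shows "(\<lambda>s. LINT t:{c<..}|lborel. of_real t powr (s - 1) * exp_series f t) holomorphic_on UNIV"
proof -
  define u where "u = (\<lambda>j. LINT t:{c<..}|lborel. of_real (ln t ^ j / fact j / t) * exp_series f t)"
  have "(\<lambda>j. u j * s ^ j) sums (LINT t:{c<..}|lborel. of_real t powr (s - 1) * exp_series f t)" for s
  proof -
    define S where "S = norm s"
    \<comment> \<open>Chosen so that exp (S |ln t|) <= C t^(S+2) for all t > c: the 1 serves t >= 1
      and the quotient serves c < t < 1. The exponent S + 2 has real part above 1, where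
      \<open>Mellin_exp_series\<close> supplies the integrable majorant.\<close>
    define C where "C = max 1 (c powr (- S) / c powr (S + 2))"
    define D where "D = (\<lambda>t. C * norm (indicator {0<..} t *\<^sub>R (complex_of_real t powr (of_real (S + 2) - 1) * exp_series f t)))"
    have iD: "integrable lborel D"
      unfolding D_def using Mellin_exp_series(1)[of f, OF f, of "of_real (S + 2)"]
      by (intro integrable_mult_right integrable_norm) (auto simp: set_integrable_def S_def add_pos_nonneg)
    define F where "F = (\<lambda>j t. indicator {c<..} t *\<^sub>R (of_real (ln t ^ j / fact j / t) * exp_series f t) * s ^ j)"
    have [measurable]: "F j \<in> borel_measurable lborel" for j
      unfolding F_def by measurable
    have expo: "exp (S * \<bar>ln t\<bar>) \<le> C * t powr (S + 2)" if "t > c" for t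
    proof (cases "t \<ge> 1")
      case True
      have "exp (S * \<bar>ln t\<bar>) = t powr S" using True by (simp add: powr_def)
      also have "\<dots> \<le> t powr (S + 2)" using True by (intro powr_mono) auto
      also have "\<dots> \<le> C * t powr (S + 2)" by (simp add: C_def mult_le_cancel_right1)
      finally show ?thesis .
    next
      case False
      have "exp (S * \<bar>ln t\<bar>) = t powr (- S)" using False that c by (simp add: powr_def abs_if)
      also have "\<dots> \<le> c powr (- S)" using that c by (intro powr_mono2') (auto simp: S_def)
      also have "\<dots> = (c powr (- S) / c powr (S + 2)) * c powr (S + 2)" using c by simp
      also have "\<dots> \<le> C * t powr (S + 2)"
        using that c by (intro mult_mono powr_mono2) (auto simp: C_def S_def)
      finally show ?thesis .
    qed
    have nF: "norm (F j t) = indicator {c<..} t * ((S * \<bar>ln t\<bar>) ^ j / fact j) * (norm (exp_series f t) / \<bar>t\<bar>)" for j t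
      by (simp add: F_def norm_mult norm_divide norm_power S_def power_mult_distrib power_abs indicator_def)
    have snF: "(\<lambda>j. norm (F j t)) sums (indicator {c<..} t * exp (S * \<bar>ln t\<bar>) * (norm (exp_series f t) / \<bar>t\<bar>))" for t
      unfolding nF using exp_converges[of "S * \<bar>ln t\<bar>"]
      by (intro sums_mult2 sums_mult) (simp add: scaleR_conv_of_real divide_inverse mult.commute)
    have le: "indicator {c<..} t * exp (S * \<bar>ln t\<bar>) * (norm (exp_series f t) / \<bar>t\<bar>) \<le> D t" for t
    proof (cases "t > c")
      case True
      have t: "t > 0" using True c by simp
      have e: "t powr (S + 2) / t = t powr (S + 2 - 1)" using t powr_diff[of t "S + 2" 1] by simp
      have "norm (complex_of_real t powr (of_real (S + 2) - 1)) = t powr (S + 2 - 1)"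
        using t by (simp add: norm_powr_real_powr)
      then have "D t = C * (t powr (S + 2 - 1) * norm (exp_series f t))"
        using t by (simp add: D_def norm_mult)
      also have "\<dots> = C * t powr (S + 2) * (norm (exp_series f t) / t)"
        unfolding e[symmetric] by simp
      finally have "D t = C * t powr (S + 2) * (norm (exp_series f t) / t)" .
      moreover have "exp (S * \<bar>ln t\<bar>) * (norm (exp_series f t) / t) \<le> C * t powr (S + 2) * (norm (exp_series f t) / t)"
        using expo[OF True] t by (intro mult_right_mono) auto
      ultimately show ?thesis using True t by simp
    qed (auto simp: D_def C_def)
    have bound: "(\<Sum>j<n. norm (F j t)) \<le> D t" for n t
      using sum_le_suminf[OF sums_summable[OF snF], of "{..<n}" t] sums_unique[OF snF[of t]] le[of t] by simp
    have 1: "integrable lborel (F j)" for j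
    proof (rule Bochner_Integration.integrable_bound[OF iD])
      have "norm (F j t) \<le> norm (D t)" for t
        using member_le_sum[of j "{..<Suc j}" "\<lambda>j. norm (F j t)"] bound[of t "Suc j"] by simp
      then show "AE t in lborel. norm (F j t) \<le> norm (D t)" by simp
    qed simp
    have 2: "AE t in lborel. summable (\<lambda>j. norm (F j t))"
      using sums_summable[OF snF] by simp
    have 3: "summable (\<lambda>j. \<integral>t. norm (F j t) \<partial>lborel)"
    proof (rule summableI_nonneg_bounded)
      show "(\<Sum>j<n. \<integral>t. norm (F j t) \<partial>lborel) \<le> integral\<^sup>L lborel D" for n
      proof -
        have "(\<Sum>j<n. \<integral>t. norm (F j t) \<partial>lborel) = (\<integral>t. (\<Sum>j<n. norm (F j t)) \<partial>lborel)"
          using 1 by (subst Bochner_Integration.integral_sum) auto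
        also have "\<dots> \<le> integral\<^sup>L lborel D"
          using 1 iD bound by (intro integral_mono) auto
        finally show ?thesis .
      qed
    qed simp
    have Fsum: "(\<Sum>j. F j t) = indicator {c<..} t *\<^sub>R (of_real t powr (s - 1) * exp_series f t)" for t
    proof (cases "t > c")
      case True
      have t: "t > 0" using True c by simp
      have "(\<lambda>j. (s * of_real (ln t)) ^ j /\<^sub>R fact j * (exp_series f t / of_real t)) sums
          (exp (s * of_real (ln t)) * (exp_series f t / of_real t))"
        by (intro sums_mult2 exp_converges)
      also have "(\<lambda>j. (s * of_real (ln t)) ^ j /\<^sub>R fact j * (exp_series f t / of_real t)) = (\<lambda>j. F j t)"
        using True by (simp add: F_def power_mult_distrib scaleR_conv_of_real divide_inverse mult_ac)
      also have "exp (s * of_real (ln t)) * (exp_series f t / of_real t) = of_real t powr (s - 1) * exp_series f t"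
        using t by (simp add: powr_def left_diff_distrib exp_diff Ln_of_real exp_of_real)
      finally show ?thesis using True by (simp add: sums_iff)
    qed (simp add: F_def)
    have "integral\<^sup>L lborel (F j) = u j * s ^ j" for j
      unfolding F_def u_def set_lebesgue_integral_def by (rule integral_mult_left_zero)
    then show ?thesis
      using sums_integral[OF 1 2 3] unfolding Fsum set_lebesgue_integral_def by simp
  qed
  then have "(\<lambda>s. LINT t:{c<..}|lborel. of_real t powr (s - 1) * exp_series f t) holomorphic_on ball 0 r" for r
    by (intro power_series_holomorphic[of 0 r u]) simp
  then have "(\<lambda>s. LINT t:{c<..}|lborel. of_real t powr (s - 1) * exp_series f t) holomorphic_on (\<Union>r. ball 0 r)"
    by (intro holomorphic_on_UN_open) auto
  moreover have "(\<Union>r. ball 0 r) = (UNIV :: complex set)"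
    by (auto intro: gt_ex)
  ultimately show ?thesis by simp
qed

text \<open>Expresses \<open>rGamma s / (s + n)\<close> by an entire function: the zero of
  \<open>rGamma\<close> at -n absorbs the pole of the Mellin integral there.\<close>

lemma rGamma_over_shift:
  fixes s :: complex
  shows "(s + of_nat n) * (pochhammer s n * rGamma (s + of_nat n + 1)) = rGamma s"
  using pochhammer_rGamma[of s "Suc n"] by (simp add: pochhammer_Suc algebra_simps)

lemma holomorphic_lower_part:
  assumes c: "c > (0 :: real)" and a: "summable (\<lambda>n. norm (a n) * c ^ n)"
  shows "(\<lambda>s. \<Sum>n. a n * of_real c powr (s + of_nat n) * (pochhammer s n * rGamma (s + of_nat n + 1))) holomorphic_on UNIV"
    (is "?g holomorphic_on UNIV")
proof (rule holomorphic_uniform_sequence[of _ "\<lambda>N s. \<Sum>n<N. a n * of_real c powr (s + of_nat n) * (pochhammer s n * rGamma (s + of_nat n + 1))"])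
  show "(\<lambda>s. \<Sum>n<N. a n * of_real c powr (s + of_nat n) * (pochhammer s n * rGamma (s + of_nat n + 1))) holomorphic_on UNIV" for N
    using c by (auto intro!: holomorphic_intros simp: pochhammer_prod)
  fix x :: complex
  define B where "B = norm x + 1"
  have "compact ((\<lambda>s. (of_real c powr s) * rGamma s) ` cball x 1)"
    using c by (intro compact_continuous_image continuous_intros) auto
  from compact_imp_bounded[OF this]
  obtain K where K: "\<And>s. s \<in> cball x 1 \<Longrightarrow> norm ((of_real c powr s) * rGamma s) \<le> K"
    unfolding bounded_iff by blast
  have "uniform_limit (cball x 1) (\<lambda>N s. \<Sum>n<N. a n * of_real c powr (s + of_nat n) * (pochhammer s n * rGamma (s + of_nat n + 1))) ?g sequentially"
  proof (rule Weierstrass_m_test_ev)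
    show "summable (\<lambda>n. K * (norm (a n) * c ^ n))" by (intro summable_mult a)
    show "\<forall>\<^sub>F n in sequentially. \<forall>s\<in>cball x 1. norm (a n * of_real c powr (s + of_nat n) * (pochhammer s n * rGamma (s + of_nat n + 1))) \<le> K * (norm (a n) * c ^ n)"
    \<comment> \<open>On the closed disc |s| <= B, so from this index on |s + n| >= 1 and the
      denominator may be dropped.\<close>
    proof (rule eventually_sequentiallyI[of "nat \<lceil>B + 1\<rceil>"], intro ballI)
      fix n s assume n: "nat \<lceil>B + 1\<rceil> \<le> n" and s: "s \<in> cball x 1"
      have "norm s \<le> B" using s norm_triangle_ineq[of x "s - x"] by (simp add: B_def dist_norm norm_minus_commute)
      moreover have "real n \<ge> B + 1" using n by linarith
      ultimately have sn: "norm (s + of_nat n) \<ge> 1"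
        using norm_diff_ineq[of "of_nat n" s] by (simp add: add.commute)
      then have sn0: "s + of_nat n \<noteq> 0" by auto
      have "a n * of_real c powr (s + of_nat n) * (pochhammer s n * rGamma (s + of_nat n + 1))
          = (of_real c powr s * rGamma s) * (a n * of_real c ^ n) / (s + of_nat n)"
        unfolding rGamma_over_shift[of s n, symmetric] using c sn0 by (simp add: powr_add powr_nat')
      also have "norm \<dots> = norm (of_real c powr s * rGamma s) * (norm (a n) * c ^ n) / norm (s + of_nat n)"
        using c by (simp add: norm_mult norm_divide norm_power)
      also have "\<dots> \<le> K * (norm (a n) * c ^ n) / 1"
        using sn c K[OF s] order_trans[OF norm_ge_zero K[OF s]] by (intro frac_le mult_right_mono mult_nonneg_nonneg) auto
      finally show "norm (a n * of_real c powr (s + of_nat n) * (pochhammer s n * rGamma (s + of_nat n + 1))) \<le> K * (norm (a n) * c ^ n)"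
        by simp
    qed
  qed
  then show "\<exists>d>0. cball x d \<subseteq> UNIV \<and> uniform_limit (cball x d) (\<lambda>N s. \<Sum>n<N. a n * of_real c powr (s + of_nat n) * (pochhammer s n * rGamma (s + of_nat n + 1))) ?g sequentially"
    by (intro exI[of _ 1]) auto
qed auto

text \<open>\<open>\<Gamma>(s) L(s)\<close> is the Mellin transform of the exponential series.
  The part of the integral above \<open>c\<close> is entire, the part below \<open>c\<close> is computed from the expansion at
  \<open>0\<close>, and the poles of \<open>\<Gamma>\<close> at the nonpositive integers are what produces the special values.\<close>
theorem dirichlet_series_continuation:
  fixes f a :: "nat \<Rightarrow> complex"
  assumes f: "\<And>k. norm (f k) \<le> 1" and c: "c > 0"
    and a: "summable (\<lambda>n. norm (a n) * c ^ n)"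
    and A: "\<And>t. 0 < t \<Longrightarrow> t \<le> c \<Longrightarrow> (\<lambda>n. a n * of_real t ^ n) sums (exp_series f t - \<delta> / of_real t)"
  obtains g where "g holomorphic_on - {1}"
    and "\<And>z. Re z > 1 \<Longrightarrow> g z = (\<Sum>n. f n / of_nat (Suc n) powr z)"
    and "\<And>n. g (- of_nat n) = (-1) ^ n * fact n * a n"
proof
  define U where "U = (\<lambda>s. LINT t:{c<..}|lborel. of_real t powr (s - 1) * exp_series f t)"
  define V where "V = (\<lambda>s. \<Sum>n. a n * of_real c powr (s + of_nat n) * (pochhammer s n * rGamma (s + of_nat n + 1)))"
  \<comment> \<open>The three summands are the integral above c, the polar part, and the power
    series below c, all multiplied by 1 / \<Gamma>(s); in \<open>V\<close> this factor has already
    been merged with the denominators s + n.\<close>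
  define g where "g = (\<lambda>s. rGamma s * U s + \<delta> * rGamma s * of_real c powr (s - 1) / (s - 1) + V s)"
  have U: "U holomorphic_on S" and V: "V holomorphic_on S" for S
    using Mellin_upper_entire[of f, OF f c] holomorphic_lower_part[OF c a]
    unfolding U_def V_def by (auto intro: holomorphic_on_subset)
  show "g holomorphic_on - {1}"
    unfolding g_def using c by (auto intro!: holomorphic_intros U V)
  show "g z = (\<Sum>n. f n / of_nat (Suc n) powr z)" if z: "Re z > 1" for z
  proof -
    have zn: "z + of_nat n \<noteq> 0" for n
    proof
      assume "z + of_nat n = 0"
      then have "Re (z + of_nat n) = 0" by simp
      then show False using z by simp
    qed
    have z1: "z \<notin> \<int>\<^sub>\<le>\<^sub>0"
      using z by (auto elim!: nonpos_Ints_cases)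
    have G: "rGamma z * Gamma z = 1" using z1 by (simp add: Gamma_eq_zero_iff rGamma_inverse_Gamma)
    have i: "set_integrable lborel {0<..} (\<lambda>t. of_real t powr (z - 1) * exp_series f t)"
      using Mellin_exp_series(1)[of f, OF f z] .
    have "(LINT t:{0<..}|lborel. of_real t powr (z - 1) * exp_series f t)
        = (LINT t:{0<..c} \<union> {c<..}|lborel. of_real t powr (z - 1) * exp_series f t)"
      using c by (simp add: ivl_disj_un)
    also have "\<dots> = (LINT t:{0<..c}|lborel. of_real t powr (z - 1) * exp_series f t) + U z"
      unfolding U_def using c by (intro set_integral_Un) (auto intro!: set_integrable_subset[OF i])
    finally have split: "(LINT t:{0<..}|lborel. of_real t powr (z - 1) * exp_series f t)
        = (LINT t:{0<..c}|lborel. of_real t powr (z - 1) * exp_series f t) + U z" .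
    have "(\<lambda>n. rGamma z * (a n * (of_real c powr (z + of_nat n) / (z + of_nat n)))) sums
         (rGamma z * ((LINT t:{0<..c}|lborel. of_real t powr (z - 1) * exp_series f t) - \<delta> * of_real c powr (z - 1) / (z - 1)))"
      by (intro sums_mult Mellin_power_series c z a A)
    also have "(\<lambda>n. rGamma z * (a n * (of_real c powr (z + of_nat n) / (z + of_nat n))))
        = (\<lambda>n. a n * of_real c powr (z + of_nat n) * (pochhammer z n * rGamma (z + of_nat n + 1)))"
    proof
      fix n
      show "rGamma z * (a n * (of_real c powr (z + of_nat n) / (z + of_nat n)))
        = a n * of_real c powr (z + of_nat n) * (pochhammer z n * rGamma (z + of_nat n + 1))"
        unfolding rGamma_over_shift[of z n, symmetric] using zn[of n] by simp
    qed
    finally have "V z = rGamma z * ((LINT t:{0<..c}|lborel. of_real t powr (z - 1) * exp_series f t) - \<delta> * of_real c powr (z - 1) / (z - 1))"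
      unfolding V_def by (simp add: sums_iff)
    then have "g z = rGamma z * (LINT t:{0<..}|lborel. of_real t powr (z - 1) * exp_series f t)"
      unfolding g_def split by (simp add: algebra_simps)
    moreover have "(\<lambda>k. rGamma z * (Gamma z * (f k / of_nat (Suc k) powr z))) sums
         (rGamma z * (LINT t:{0<..}|lborel. of_real t powr (z - 1) * exp_series f t))"
      by (intro sums_mult Mellin_exp_series(2) f z)
    ultimately show ?thesis using G by (simp add: sums_iff mult.assoc[symmetric])
  qed
  \<comment> \<open>At s = -m the factor \<open>rGamma s\<close> removes the first two summands. In
    \<open>V\<close> the terms with n < m vanish through \<open>rGamma\<close> and those with n > m
    through the Pochhammer symbol, which leaves n = m.\<close>
  show "g (- of_nat m) = (-1) ^ m * fact m * a m" for m
  proof -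
    have "rGamma (- of_nat m) = (0 :: complex)" by (simp add: rGamma_eq_zero_iff)
    moreover have "a n * of_real c powr (- of_nat m + of_nat n) * (pochhammer (- of_nat m) n * rGamma (- of_nat m + of_nat n + 1))
        = (if n = m then (-1) ^ m * fact m * a m else 0)" for n
    proof -
      consider "n < m" | "n = m" | "n > m" by linarith
      then show ?thesis
      proof cases
        case 1
        then have "- of_nat m + of_nat n + 1 = - (of_nat (m - n - 1) :: complex)"
          by (simp add: of_nat_diff)
        then have "rGamma (- of_nat m + of_nat n + 1) = (0 :: complex)"
          by (simp only:) (simp add: rGamma_eq_zero_iff)
        then show ?thesis using 1 by simp
      next
        case 2
        then show ?thesis using c by (simp add: pochhammer_same mult_ac)
      next
        case 3
        then have "pochhammer (- of_nat m) n = (0 :: complex)" by (simp add: pochhammer_of_nat_eq_0_iff)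
        then show ?thesis using 3 by simp
      qed
    qed
    then have "V (- of_nat m) = (-1) ^ m * fact m * a m"
      unfolding V_def by (simp add: sums_unique[OF sums_single, symmetric])
    ultimately show ?thesis unfolding g_def by simp
  qed
qed

text \<open>The half plane Re z > 1 determines the continuation on the connected set without the
  point 1; at 1 itself the choice operator leaves the value open.\<close>

lemma dirichlet_L_unique:
  assumes "g holomorphic_on - {1}" "\<And>z. Re z > 1 \<Longrightarrow> g z = (\<Sum>n. chi (int (Suc n)) / of_nat (Suc n) powr z)"
    and "s \<noteq> 1"
  shows "dirichlet_L chi s = g s"
proof -
  define P where "P = (\<lambda>f. f holomorphic_on (- {1}) \<and>
      (\<forall>z. Re z > 1 \<longrightarrow> f z = (\<Sum>n. chi (int (Suc n)) / of_nat (Suc n) powr z)))"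
  have "P g" using assms by (simp add: P_def)
  then have P: "P (SOME f. P f)" by (rule someI[of P])
  have "(SOME f. P f) s = g s"
  proof (rule analytic_continuation_open[of "{z. Re z > 1}" "- {1}" "SOME f. P f" g])
    show "open {z. Re z > 1}" by (rule open_halfspace_Re_gt)
    show "{z. Re z > 1} \<noteq> {}" by (auto intro!: exI[of _ "2 :: complex"])
    show "connected (- {1 :: complex})" by (rule connected_punctured_universe) simp
  qed (use P assms in \<open>auto simp: P_def\<close>)
  then show ?thesis unfolding dirichlet_L_def P_def .
qed

text \<open>Two terms of the exponential series suffice. Inverted, the bound gives decay of 1 / (e^t
  - 1) faster than any power, uniformly in t > 0, on which the later summability estimates
  rest.\<close>

lemma power_over_fact_le_exp_minus_1:
  assumes "t \<ge> (0 :: real)" "m > 0"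
  shows "t ^ m / fact m \<le> exp t - 1"
proof -
  have "(\<Sum>i\<in>{0, m}. t ^ i /\<^sub>R fact i) \<le> exp t"
    unfolding exp_def using assms by (intro sum_le_suminf summable_exp_generic) auto
  then show ?thesis using assms by (simp add: divide_inverse mult.commute)
qed

lemma norm_exp_series_le:
  fixes f :: "nat \<Rightarrow> complex"
  assumes f: "\<And>k. norm (f k) \<le> 1" and t: "t > 0" and m: "m > 0"
  shows "norm (exp_series f t) \<le> fact m / t ^ m"
proof -
  have s: "summable (\<lambda>k. norm (f k * complex_of_real (exp (- (real (Suc k) * t)))))"
    by (rule summable_exp_series[OF f t])
  have e: "exp (- (real k * t)) = exp (- t) ^ k" for k
    unfolding exp_of_nat_mult[symmetric] by simp
  have g: "(\<lambda>k. exp (- t) * exp (- t) ^ k) sums (exp (- t) * (1 / (1 - exp (- t))))"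
    using t by (intro sums_mult geometric_sums) simp
  have "norm (exp_series f t) \<le> (\<Sum>k. norm (f k * complex_of_real (exp (- (real (Suc k) * t)))))"
    unfolding exp_series_def by (rule summable_norm[OF s])
  also have "\<dots> \<le> (\<Sum>k. exp (- t) * exp (- t) ^ k)"
  proof (rule suminf_le[OF _ s sums_summable[OF g]])
    fix k
    show "norm (f k * complex_of_real (exp (- (real (Suc k) * t)))) \<le> exp (- t) * exp (- t) ^ k"
      unfolding e using f[of k] by (simp add: norm_mult mult_left_le_one_le norm_power)
  qed
  also have "\<dots> = 1 / (exp t - 1)"
  proof -
    have "exp t \<noteq> 1" using t by simp
    then have "exp (- t) * (1 / (1 - exp (- t))) = 1 / (exp t - 1)"
      by (simp add: exp_minus divide_simps)
    then show ?thesis using sums_unique[OF g] by simp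
  qed
  also have "\<dots> \<le> 1 / (t ^ m / fact m)"
    using power_over_fact_le_exp_minus_1[of t m] t m by (intro divide_left_mono) auto
  finally show ?thesis by simp
qed

section \<open>Values of zeta and L at integers\<close>

context even_primitive_character
begin

text \<open>Periodicity makes the blocks of length q a geometric series in exp (-q t).\<close>

lemma exp_series_chi:
  assumes t: "t > 0"
  shows "exp_series (\<lambda>k. chi (int (Suc k))) t = char_kernel (of_real (real q * t))"
proof -
  define y where "y = complex_of_real (exp (- t))"
  have q0: "real q > 0" "of_nat q \<noteq> (0 :: complex)" using modulus_pos by simp_all
  have y: "complex_of_real (exp (- (real k * t))) = y ^ k" for k
    unfolding y_def of_real_power[symmetric] exp_of_nat_mult[symmetric] by simp
  define f where "f = (\<lambda>k. chi (int (Suc k)) * y ^ Suc k)"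
  have "summable (\<lambda>k. norm (f k))"
    using summable_exp_series[of "\<lambda>k. chi (int (Suc k))", OF norm_chi_le_1 t] unfolding y f_def .
  then have "f sums suminf f" by (rule summable_sums[OF summable_norm_cancel])
  from sums_group[OF this modulus_pos]
  have 1: "(\<lambda>n. sum f {n * q..<n * q + q}) sums suminf f" .
  have "sum f {n * q..<n * q + q} = (y ^ q) ^ n * (\<Sum>r=1..q. chi (int r) * y ^ r)" for n
  proof -
    have "sum f {n * q..<n * q + q} = (\<Sum>r=1..q. f (n * q + r - 1))"
      by (rule sum.reindex_bij_witness[of _ "\<lambda>r. n * q + r - 1" "\<lambda>k. k + 1 - n * q"]) auto
    also have "\<dots> = (\<Sum>r=1..q. (y ^ q) ^ n * (chi (int r) * y ^ r))"
    proof (intro sum.cong refl)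
      fix r assume r: "r \<in> {1..q}"
      then have "Suc (n * q + r - 1) = n * q + r" by simp
      moreover have "chi (int (n * q + r)) = chi (int r)"
        using periodic_int_shift[of chi q "int r" "int n", OF chi_periodic] by (simp add: add.commute)
      ultimately show "f (n * q + r - 1) = (y ^ q) ^ n * (chi (int r) * y ^ r)"
        unfolding f_def by (simp add: power_add power_mult[symmetric] mult_ac)
    qed
    finally show ?thesis by (simp add: sum_distrib_left)
  qed
  moreover have "norm (y ^ q) < 1"
    using t q0 modulus_pos by (simp add: y_def norm_power power_less_one_iff)
  then have "(\<lambda>n. (y ^ q) ^ n * (\<Sum>r=1..q. chi (int r) * y ^ r)) sums (1 / (1 - y ^ q) * (\<Sum>r=1..q. chi (int r) * y ^ r))"
    by (intro sums_mult2 geometric_sums)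
  ultimately have "suminf f = 1 / (1 - y ^ q) * (\<Sum>r=1..q. chi (int r) * y ^ r)"
    using 1 sums_unique2 by simp
  moreover have "exp_series (\<lambda>k. chi (int (Suc k))) t = suminf f"
    unfolding exp_series_def y f_def ..
  moreover have "exp (- (of_nat r / of_nat q * of_real (real q * t))) = y ^ r" for r
    unfolding y[symmetric] exp_of_real[symmetric] using q0 by (intro arg_cong[of _ _ exp]) simp
  moreover have "exp (- complex_of_real (real q * t)) = y ^ q"
    unfolding y[symmetric] exp_of_real[symmetric] by simp
  ultimately show ?thesis unfolding char_kernel_def by (simp only: times_divide_eq_left mult_1)
qed

lemma summable_kernel_coeff:
  assumes "0 \<le> x" "x < 2 * pi"
  shows "summable (\<lambda>n. norm (kernel_coeff n) * x ^ n)"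
proof -
  obtain y where y: "x < y" "y < 2 * pi" using assms dense by blast
  have "summable (\<lambda>n. kernel_coeff n * of_real y ^ n)"
    by (rule sums_summable[OF char_kernel_power_series]) (use y assms in auto)
  then have "summable (\<lambda>n. norm (kernel_coeff n * of_real x ^ n))"
    by (rule powser_insidea) (use y assms in auto)
  then show ?thesis using assms by (simp add: norm_mult norm_power)
qed

definition exp_coeff :: "nat \<Rightarrow> complex" where "exp_coeff n = kernel_coeff n * of_nat q ^ n"

text \<open>The cut pi / q lies inside |t| < 2 pi / q, where \<open>char_kernel_power_series\<close>
  applies at x = q t.\<close>

lemma summable_exp_coeff: "summable (\<lambda>n. norm (exp_coeff n) * (pi / real q) ^ n)"
  using summable_kernel_coeff[of pi] modulus_pos
  by (simp add: exp_coeff_def norm_mult norm_power power_divide)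

lemma exp_series_chi_expansion:
  assumes "0 < t" "t \<le> pi / real q"
  shows "(\<lambda>n. exp_coeff n * of_real t ^ n) sums (exp_series (\<lambda>k. chi (int (Suc k))) t - pole_coeff / of_real t)"
proof -
  have q0: "real q > 0" using modulus_pos by simp
  have "real q * t \<le> pi" using assms q0 by (simp add: field_simps)
  moreover have "pi < 2 * pi" by simp
  ultimately have "real q * t < 2 * pi" by linarith
  then have "(\<lambda>n. kernel_coeff n * of_real (real q * t) ^ n) sums
      (char_kernel (of_real (real q * t)) - pole_coeff / of_real (real q * t))"
    using assms q0 by (intro char_kernel_power_series) (auto simp: norm_mult)
  moreover have "pole_coeff / of_real (real q * t) = pole_coeff / of_real t"
    by (simp add: pole_coeff_def)
  moreover have "kernel_coeff n * of_real (real q * t) ^ n = exp_coeff n * of_real t ^ n" for n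
    by (simp add: exp_coeff_def power_mult_distrib mult_ac)
  ultimately show ?thesis
    unfolding exp_series_chi[OF assms(1)] by (simp only:)
qed

theorem dirichlet_L_values:
  shows "\<And>z. Re z > 1 \<Longrightarrow> dirichlet_L chi z = (\<Sum>n. chi (int (Suc n)) / of_nat (Suc n) powr z)"
    and "\<And>n. dirichlet_L chi (- of_nat n) = (-1) ^ n * fact n * exp_coeff n"
proof -
  obtain g where g: "g holomorphic_on - {1}"
      "\<And>z. Re z > 1 \<Longrightarrow> g z = (\<Sum>n. chi (int (Suc n)) / of_nat (Suc n) powr z)"
      "\<And>n. g (- of_nat n) = (-1) ^ n * fact n * exp_coeff n"
    using modulus_pos
    by (auto intro: dirichlet_series_continuation[of "\<lambda>k. chi (int (Suc k))",
        OF norm_chi_le_1 _ summable_exp_coeff exp_series_chi_expansion])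
  have eq: "dirichlet_L chi s = g s" if "s \<noteq> 1" for s
    using dirichlet_L_unique[OF g(1,2) that] .
  show "dirichlet_L chi z = (\<Sum>n. chi (int (Suc n)) / of_nat (Suc n) powr z)" if "Re z > 1" for z
  proof -
    have "z \<noteq> 1" using that by auto
    then show ?thesis using eq g(2)[OF that] by simp
  qed
  show "dirichlet_L chi (- of_nat n) = (-1) ^ n * fact n * exp_coeff n" for n
  proof -
    have "- of_nat n \<noteq> (1 :: complex)"
    proof
      assume "- of_nat n = (1 :: complex)"
      then have "of_nat (Suc n) = (0 :: complex)" by (simp add: add_eq_0_iff2)
      then show False by (simp only: of_nat_eq_0_iff)
    qed
    then show ?thesis using eq g(3) by simp
  qed
qed

lemma dirichlet_L_0: "dirichlet_L chi 0 = - pole_coeff / 2"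
  using dirichlet_L_values(2)[of 0] by (simp add: exp_coeff_def kernel_coeff_def)

lemma dirichlet_L_nat:
  assumes "n \<ge> 2"
  shows "dirichlet_L chi (of_nat n) = (\<Sum>k. chi (int (Suc k)) / of_nat (Suc k) ^ n)"
proof -
  have "of_nat (Suc k) powr of_nat n = (of_nat (Suc k) :: complex) ^ n" for k
    using powr_nat'[of "of_nat (Suc k)" n] by (simp del: of_nat_Suc)
  then show ?thesis using dirichlet_L_values(1)[of "of_nat n"] assms by (simp del: of_nat_Suc)
qed

lemma even_primitive_cnj: "even_primitive_character q (\<lambda>n. cnj (chi n))"
  using dirichlet_char_cnj primitive_cnj even by unfold_locales (auto simp: even_char_def)

lemma norm_char_kernel_le:
  assumes x: "x > 0" and m: "m > 0"
  shows "norm (char_kernel (of_real x)) \<le> fact m * real q ^ m / x ^ m"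
proof -
  define t where "t = x / real q"
  have q0: "real q > 0" using modulus_pos by simp
  have t: "t > 0" "real q * t = x" using x q0 by (simp_all add: t_def)
  have "norm (char_kernel (of_real x)) = norm (exp_series (\<lambda>k. chi (int (Suc k))) t)"
    using exp_series_chi[OF t(1)] t(2) by simp
  also have "\<dots> \<le> fact m / t ^ m"
    by (rule norm_exp_series_le[OF norm_chi_le_1 t(1) m])
  also have "\<dots> = fact m * real q ^ m / x ^ m" by (simp add: t_def power_divide)
  finally show ?thesis .
qed

end

lemma riemann_zeta_nat: "n \<ge> 2 \<Longrightarrow> riemann_zeta (of_nat n) = (\<Sum>k. 1 / of_nat (Suc k) ^ n)"
  unfolding riemann_zeta_def by (rule trivial.dirichlet_L_nat)

lemma riemann_zeta_nonpos: "riemann_zeta (- of_nat n) = (-1) ^ n * fact n * trivial.exp_coeff n"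
  unfolding riemann_zeta_def by (rule trivial.dirichlet_L_values(2))

section \<open>The identity for positive m\<close>

lemma norm_inverse_exp_minus_1_le:
  fixes w :: complex
  assumes "Re w > 0" "m > 0"
  shows "exp w \<noteq> 1" "norm (1 / (exp w - 1)) \<le> fact m / Re w ^ m"
proof -
  define t where "t = Re w"
  have t: "t > 0" using assms by (simp add: t_def)
  have e: "t ^ m / fact m \<le> exp t - 1" using t assms by (intro power_over_fact_le_exp_minus_1) auto
  have "exp t - 1 \<le> norm (exp w - 1)"
    using norm_triangle_ineq2[of "exp w" 1] by (simp add: t_def norm_exp_eq_Re)
  with e have le: "t ^ m / fact m \<le> norm (exp w - 1)" by simp
  have pos: "t ^ m / fact m > 0" using t by simp
  show "exp w \<noteq> 1" using le pos by auto
  have "norm (1 / (exp w - 1)) \<le> 1 / (t ^ m / fact m)"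
    unfolding norm_divide norm_one using le pos less_le_trans[OF pos le] by (intro divide_left_mono mult_pos_pos) auto
  then show "norm (1 / (exp w - 1)) \<le> fact m / Re w ^ m" by (simp add: t_def)
qed

definition dir_sum :: "nat \<Rightarrow> complex \<Rightarrow> complex" where
  "dir_sum p c = (\<Sum>j\<in>{- int p..int p}. (-1) powi j / (exp (2 * of_real pi * c * root_dir (2 * p + 1) j) - 1))"

text \<open>Only positivity of the real parts in all directions is used, so the bound serves both
  \<kappa> = 1, for the real nodes, and \<kappa> = \<open>generic_dir p\<close>, for the ray along
  which R tends to infinity.\<close>

lemma dir_sum_bound:
  assumes dir: "\<And>j. j \<in> {- int p..int p} \<Longrightarrow> Re (\<kappa> * root_dir (2 * p + 1) j) > 0" and m: "m > 0"
  shows "\<exists>C\<ge>0. (\<forall>R>0. norm (dir_sum p (\<kappa> * of_real R)) \<le> C / R ^ m) \<and>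
    (\<forall>R>0. \<forall>j\<in>{- int p..int p}.
        norm (1 / (exp (2 * of_real pi * (\<kappa> * of_real R) * root_dir (2 * p + 1) j) - 1)) \<le> C / R ^ m)"
proof (intro exI conjI allI impI ballI)
  define D where "D = (\<lambda>j. fact m / (2 * pi * Re (\<kappa> * root_dir (2 * p + 1) j)) ^ m)"
  have D: "D j \<ge> 0" if "j \<in> {- int p..int p}" for j
    using dir[OF that] unfolding D_def by (intro divide_nonneg_nonneg zero_le_power) auto
  have t: "norm (1 / (exp (2 * of_real pi * (\<kappa> * of_real R) * root_dir (2 * p + 1) j) - 1)) \<le> D j / R ^ m"
    if "j \<in> {- int p..int p}" "R > 0" for j R
  proof -
    have Re: "Re (2 * of_real pi * (\<kappa> * of_real R) * root_dir (2 * p + 1) j) = 2 * pi * Re (\<kappa> * root_dir (2 * p + 1) j) * R"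
      by (simp add: algebra_simps)
    have "norm (1 / (exp (2 * of_real pi * (\<kappa> * of_real R) * root_dir (2 * p + 1) j) - 1))
        \<le> fact m / (2 * pi * Re (\<kappa> * root_dir (2 * p + 1) j) * R) ^ m"
      using norm_inverse_exp_minus_1_le(2)[of "2 * of_real pi * (\<kappa> * of_real R) * root_dir (2 * p + 1) j", OF _ m]
        dir[OF that(1)] that(2) unfolding Re by simp
    then show ?thesis by (simp add: D_def power_mult_distrib)
  qed
  show "sum D {- int p..int p} \<ge> 0" using D by (rule sum_nonneg)
  show "norm (1 / (exp (2 * of_real pi * (\<kappa> * of_real R) * root_dir (2 * p + 1) j) - 1)) \<le> sum D {- int p..int p} / R ^ m"
    if "R > 0" "j \<in> {- int p..int p}" for R j
  proof -
    have "D j \<le> sum D {- int p..int p}" using that D by (intro member_le_sum) auto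
    then have "D j / R ^ m \<le> sum D {- int p..int p} / R ^ m" using that by (intro divide_right_mono) auto
    then show ?thesis using t[OF that(2,1)] by linarith
  qed
  show "norm (dir_sum p (\<kappa> * of_real R)) \<le> sum D {- int p..int p} / R ^ m" if "R > 0" for R
    unfolding dir_sum_def sum_divide_distrib
  proof (rule sum_norm_le)
    fix j assume j: "j \<in> {- int p..int p}"
    have "norm ((-1 :: complex) powi j) = 1" by (simp add: norm_power_int)
    then show "norm ((-1) powi j / (exp (2 * of_real pi * (\<kappa> * of_real R) * root_dir (2 * p + 1) j) - 1)) \<le> D j / R ^ m"
      using t[OF j that] by (simp add: norm_divide)
  qed
qed

lemma Re_root_dir: "Re (root_dir N j) = cos (pi * of_int j / real N)"
  unfolding root_dir_def by (simp add: exp_eq_polar cis.ctr Re_exp)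

lemma Re_root_dir_pos: "j \<in> {- int p..int p} \<Longrightarrow> Re (root_dir (2 * p + 1) j) > 0"
proof -
  assume j: "j \<in> {- int p..int p}"
  define x where "x = of_int j / real (2 * p + 1)"
  have "\<bar>of_int j :: real\<bar> \<le> real p" using j by auto
  then have "\<bar>x\<bar> \<le> real p / real (2 * p + 1)"
    unfolding x_def abs_divide abs_of_nat by (rule divide_right_mono) simp
  also have "\<dots> < 1 / 2" by (simp add: divide_simps)
  finally have "pi * \<bar>x\<bar> < pi * (1 / 2)" by (intro mult_strict_left_mono) auto
  then have "\<bar>pi * x\<bar> < pi / 2" by (simp add: abs_mult)
  moreover have "pi * of_int j / real (2 * p + 1) = pi * x" by (simp add: x_def)
  ultimately show ?thesis unfolding Re_root_dir by (simp only: abs_less_iff) (intro cos_gt_zero_pi, auto)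
qed

text \<open>The exponent may have either sign; decay of order |e| + 2 leaves an inverse square in
  both cases.\<close>

lemma summable_over_powi:
  fixes f :: "nat \<Rightarrow> complex"
  assumes "\<And>k. norm (f k) \<le> C / real (Suc k) ^ (nat \<bar>e\<bar> + 2)"
  shows "summable (\<lambda>k. norm (f k / of_nat (Suc k) powi e))"
proof (rule summable_comparison_test'[OF summable_mult[OF summable_inverse_power_Suc[of 2]]])
  fix k
  have le: "1 / real (Suc k) powi e \<le> real (Suc k) ^ nat \<bar>e\<bar>"
  proof (cases "e \<ge> 0")
    case True
    have "1 / real (Suc k) powi e \<le> 1 / 1"
      using True by (intro divide_left_mono) (auto simp: one_le_power_int power_int_def)
    also have "\<dots> \<le> real (Suc k) ^ nat \<bar>e\<bar>" by simp
    finally show ?thesis .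
  next
    case False
    then show ?thesis by (simp add: power_int_def inverse_eq_divide power_one_over del: of_nat_Suc)
  qed
  have "norm (f k / of_nat (Suc k) powi e) = norm (f k) * (1 / real (Suc k) powi e)"
    by (simp add: norm_divide norm_power_int del: of_nat_Suc)
  also have "\<dots> \<le> C / real (Suc k) ^ (nat \<bar>e\<bar> + 2) * real (Suc k) ^ nat \<bar>e\<bar>"
    by (intro mult_mono assms le order_trans[OF norm_ge_zero assms]) simp
  also have "\<dots> = C * (1 / real (Suc k) ^ 2)"
    by (simp add: power_add power2_eq_square del: of_nat_Suc)
  finally show "norm (norm (f k / of_nat (Suc k) powi e)) \<le> C * (1 / real (Suc k) ^ 2)" by simp
qed simp

locale kernel_setup = even_primitive_character +
  fixes p :: nat and a :: real
  assumes a: "a > 0"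
begin

definition N :: nat where "N = 2 * p + 1"

text \<open>Scales the poles of the kernel: for x = a n^N, the sum x^2 + (2 pi k)^2 is a^2 times
  n^(2N) + (b k)^2.\<close>

definition b :: real where "b = 2 * pi / a"

text \<open>The positive c with c^N = b (k + 1), at which \<open>sum_power_over_binomial\<close> is
  evaluated. For a = 2^N \<alpha> it is (2 (k + 1))^(1/N) \<beta> / (2 pi), the argument occurring
  in the theorem.\<close>

definition node :: "nat \<Rightarrow> real" where "node k = (b * real (Suc k)) powr (1 / real N)"

lemma N_pos: "N > 0" and b_pos: "b > 0"
  using a by (simp_all add: N_def b_def)

lemma node_pos: "node k > 0"
  unfolding node_def using b_pos by simp

lemma node_power: "node k ^ N = b * real (Suc k)"
  unfolding node_def using b_pos N_pos by (simp add: powr_realpow[symmetric] powr_powr del: of_nat_Suc)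

lemma node_power2: "node k ^ (2 * N) = (b * real (Suc k))\<^sup>2"
  using node_power[of k] by (metis mult.commute power_mult)

lemma dir_sum_node_bound:
  "\<exists>C\<ge>0. (\<forall>k. norm (dir_sum p (of_real (node k))) \<le> C / real (Suc k) ^ m) \<and>
    (\<forall>k. \<forall>j\<in>{- int p..int p}.
        norm (1 / (exp (2 * of_real pi * of_real (node k) * root_dir N j) - 1)) \<le> C / real (Suc k) ^ m)"
proof -
  obtain C where C: "C \<ge> 0" "\<And>R. R > 0 \<Longrightarrow> norm (dir_sum p (1 * of_real R)) \<le> C / R ^ (N * Suc m)"
    "\<And>R j. R > 0 \<Longrightarrow> j \<in> {- int p..int p} \<Longrightarrow>
        norm (1 / (exp (2 * of_real pi * (1 * of_real R) * root_dir (2 * p + 1) j) - 1)) \<le> C / R ^ (N * Suc m)"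
    using dir_sum_bound[of p 1 "N * Suc m"] Re_root_dir_pos N_pos by auto
  have le: "C / node k ^ (N * Suc m) \<le> (C / b ^ Suc m) / real (Suc k) ^ m" for k
  proof -
    have "C / node k ^ (N * Suc m) = (C / b ^ Suc m) / real (Suc k) ^ Suc m"
      unfolding power_mult node_power power_mult_distrib by simp
    also have "\<dots> \<le> (C / b ^ Suc m) / real (Suc k) ^ m"
      using C(1) b_pos by (intro divide_left_mono) (auto simp: mult_le_cancel_right1)
    finally show ?thesis .
  qed
  show ?thesis
  proof (intro exI[of _ "C / b ^ Suc m"] conjI allI ballI)
    show "0 \<le> C / b ^ Suc m" using C(1) b_pos by simp
    show "norm (dir_sum p (of_real (node k))) \<le> (C / b ^ Suc m) / real (Suc k) ^ m" for k
      using C(2)[OF node_pos[of k]] le[of k] by simp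
    show "norm (1 / (exp (2 * of_real pi * of_real (node k) * root_dir N j) - 1)) \<le> (C / b ^ Suc m) / real (Suc k) ^ m"
      if "j \<in> {- int p..int p}" for k j
      using C(3)[OF node_pos[of k] that] le[of k] by (simp add: N_def)
  qed
qed

definition psi :: "nat \<Rightarrow> complex" where
  "psi k = of_real pi / (2 * of_nat N * of_real (b * real (Suc k)))
     + of_real pi / (of_nat N * of_real (b * real (Suc k))) * (-1) ^ p * dir_sum p (of_real (node k))
     - (if p = 0 then 1 / (2 * (of_real (b * real (Suc k)))\<^sup>2) else 0)"

lemma psi_sums:
  "(\<lambda>n. of_nat (Suc n) ^ (2 * p) / (of_nat (Suc n) ^ (2 * N) + (of_real (b * real (Suc k)))\<^sup>2)) sums psi k"
proof -
  define c where "c = complex_of_real (node k)"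
  have c0: "c \<noteq> 0" using node_pos[of k] by (simp add: c_def)
  have cN: "c ^ N = of_real (b * real (Suc k))" unfolding c_def of_real_power[symmetric] node_power ..
  have c2N: "c ^ (2 * N) = (of_real (b * real (Suc k)))\<^sup>2"
    unfolding c_def of_real_power[symmetric] node_power2 ..
  have c2: "c\<^sup>2 = (of_real (b * real (Suc k)))\<^sup>2" if "p = 0"
  proof -
    have "N = 1" unfolding N_def using that by simp
    then show ?thesis using cN by (simp only: power_one_right)
  qed
  have "of_nat (Suc n) ^ (2 * N) + c ^ (2 * N) \<noteq> 0" for n
  proof -
    have "real (Suc n) ^ (2 * N) + (b * real (Suc k))\<^sup>2 > 0" by (intro add_pos_nonneg) auto
    then have "complex_of_real (real (Suc n) ^ (2 * N) + (b * real (Suc k))\<^sup>2) \<noteq> 0"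
      by (simp only: of_real_eq_0_iff)
    then show ?thesis unfolding c2N by simp
  qed
  moreover have "exp (2 * of_real pi * c * root_dir (2 * p + 1) j) \<noteq> 1" if "j \<in> {- int p..int p}" for j
    using Re_root_dir_pos[OF that] node_pos[of k]
    by (intro norm_inverse_exp_minus_1_le(1)[of _ 1]) (auto simp: c_def)
  ultimately show ?thesis
    using sum_power_over_binomial[of c p, OF c0] unfolding N_def[symmetric] psi_def dir_sum_def c2N cN c_def[symmetric]
    using c2 by (cases "p = 0") auto
qed

text \<open>The partial fractions of the kernel at x = a n^N have numerator proportional to n^N; the
  division by n makes it n^(2p), the power covered by \<open>psi_sums\<close>.\<close>

lemma kernel_expansion:
  "(\<lambda>k. 2 * gauss_sum q chi / of_real a * (cnj (chi (int (Suc k))) *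
        (of_nat (Suc n) ^ (2 * p) / (of_nat (Suc n) ^ (2 * N) + (of_real (b * real (Suc k)))\<^sup>2)))) sums
     (char_kernel (of_real (a * real (Suc n) ^ N)) / of_nat (Suc n) + pole_coeff / (2 * of_nat (Suc n))
        - pole_coeff / (of_real a * of_nat (Suc n) ^ (N + 1)))"
proof -
  define X where "X = (of_nat (Suc n) :: complex)"
  define x where "x = complex_of_real (a * real (Suc n) ^ N)"
  have x: "x = of_real a * X ^ N" by (simp add: x_def X_def)
  have X0: "X \<noteq> 0" by (simp add: X_def del: of_nat_Suc)
  have a0: "complex_of_real a \<noteq> 0" using a by simp
  have "a * real (Suc n) ^ N > 0" using a by simp
  then have "exp x \<noteq> 1" unfolding x_def by (simp only: exp_of_real of_real_eq_1_iff exp_eq_one_iff)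
  from sums_mult2[OF char_kernel_partial_fractions[OF this], of "1 / X"]
  have "(\<lambda>k. gauss_sum q chi * cnj (chi (int (Suc k))) * (2 * x / (x\<^sup>2 + 4 * of_real (pi\<^sup>2) * (of_nat (Suc k))\<^sup>2)) * (1 / X))
      sums ((char_kernel x + pole_coeff / 2 - pole_coeff / x) * (1 / X))" .
  also have "(\<lambda>k. gauss_sum q chi * cnj (chi (int (Suc k))) * (2 * x / (x\<^sup>2 + 4 * of_real (pi\<^sup>2) * (of_nat (Suc k))\<^sup>2)) * (1 / X))
     = (\<lambda>k. 2 * gauss_sum q chi / of_real a * (cnj (chi (int (Suc k))) *
        (X ^ (2 * p) / (X ^ (2 * N) + (of_real (b * real (Suc k)))\<^sup>2))))"
  proof
    fix k
    define B where "B = complex_of_real (b * real (Suc k))"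
    have aB: "2 * of_real pi * of_nat (Suc k) = of_real a * B"
      using a by (simp add: B_def b_def)
    have "4 * of_real (pi\<^sup>2) * (of_nat (Suc k))\<^sup>2 = (2 * of_real pi * (of_nat (Suc k) :: complex))\<^sup>2"
      by (simp add: power_mult_distrib)
    also have "\<dots> = (of_real a)\<^sup>2 * B\<^sup>2" unfolding aB by (simp add: power_mult_distrib)
    finally have "x\<^sup>2 + 4 * of_real (pi\<^sup>2) * (of_nat (Suc k))\<^sup>2 = (of_real a)\<^sup>2 * (X ^ (2 * N) + B\<^sup>2)"
      unfolding x by (simp add: power_mult_distrib power_mult[symmetric] mult.commute distrib_left)
    then have "2 * x / (x\<^sup>2 + 4 * of_real (pi\<^sup>2) * (of_nat (Suc k))\<^sup>2) * (1 / X)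
        = 2 * (of_real a * X ^ N) / ((of_real a)\<^sup>2 * (X ^ (2 * N) + B\<^sup>2)) * (1 / X)"
      by (simp only: x)
    also have "\<dots> = 2 / of_real a * (X ^ (2 * p) / (X ^ (2 * N) + B\<^sup>2))"
    proof -
      have "X ^ N = X ^ (2 * p) * X" by (simp add: N_def)
      moreover have "2 * (A * (Y * X)) / (A\<^sup>2 * D) * (1 / X) = 2 / A * (Y / D)" if "A \<noteq> 0" for A Y D
        using that X0 by (simp add: power2_eq_square)
      ultimately show ?thesis using a0 by (simp only:)
    qed
    finally show "gauss_sum q chi * cnj (chi (int (Suc k))) * (2 * x / (x\<^sup>2 + 4 * of_real (pi\<^sup>2) * (of_nat (Suc k))\<^sup>2)) * (1 / X)
      = 2 * gauss_sum q chi / of_real a * (cnj (chi (int (Suc k))) * (X ^ (2 * p) / (X ^ (2 * N) + (of_real (b * real (Suc k)))\<^sup>2)))"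
      unfolding B_def[symmetric] by (simp only: mult.assoc) (simp add: mult_ac)
  qed
  also have "(char_kernel x + pole_coeff / 2 - pole_coeff / x) * (1 / X)
      = char_kernel x / X + pole_coeff / (2 * X) - pole_coeff / (of_real a * X ^ (N + 1))"
    unfolding x using X0 a0 by (simp add: add_divide_distrib diff_divide_distrib mult_ac)
  finally show ?thesis unfolding X_def x_def .
qed

definition zeta_sum :: "nat \<Rightarrow> complex" where "zeta_sum n = (\<Sum>k. 1 / of_nat (Suc k) ^ n)"

lemma zeta_sum_sums: "n \<ge> 2 \<Longrightarrow> (\<lambda>k. 1 / of_nat (Suc k) ^ n) sums zeta_sum n"
  unfolding zeta_sum_def
  by (intro summable_sums, rule summable_norm_cancel)
    (use summable_inverse_power_Suc[of n] in \<open>simp add: norm_divide norm_power del: of_nat_Suc\<close>)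

lemma cnj_L_series_sums: "n \<ge> 2 \<Longrightarrow> (\<lambda>k. cnj (chi (int (Suc k))) / of_nat (Suc k) ^ n) sums cnj_L_series n"
  unfolding cnj_L_series_def
  by (intro summable_sums, rule summable_norm_cancel)
    (use summable_norm_L_series[of n] in \<open>simp add: norm_divide del: of_nat_Suc\<close>)

text \<open>Induction with 1 / (V (V + B^2)) = (1/V - 1/(V + B^2)) / B^2 for V = n^(2N). Every step
  splits off one zeta value, and these are the summands that later become products of Bernoulli
  numbers.\<close>

lemma psi_power_sums:
  "(\<lambda>n. of_nat (Suc n) ^ (2 * p) / (of_nat (Suc n) ^ (2 * N * m) * (of_nat (Suc n) ^ (2 * N) + (of_real (b * real (Suc k)))\<^sup>2))) sums
     ((-1) ^ m / (of_real (b * real (Suc k))) ^ (2 * m) * psi k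
       + (\<Sum>j=1..m. (-1) ^ (j - 1) / (of_real (b * real (Suc k))) ^ (2 * j) * zeta_sum (2 * N * (m - j) + N + 1)))"
proof (induction m)
  case 0
  show ?case using psi_sums[of k] by simp
next
  case (Suc m)
  define B where "B = complex_of_real (b * real (Suc k))"
  have B0: "B \<noteq> 0" using b_pos by (simp add: B_def del: of_nat_Suc)
  have "(\<lambda>n. 1 / B\<^sup>2 * (1 / of_nat (Suc n) ^ (2 * N * m + N + 1) -
        of_nat (Suc n) ^ (2 * p) / (of_nat (Suc n) ^ (2 * N * m) * (of_nat (Suc n) ^ (2 * N) + B\<^sup>2)))) sums
      (1 / B\<^sup>2 * (zeta_sum (2 * N * m + N + 1) - ((-1) ^ m / B ^ (2 * m) * psi k
       + (\<Sum>j=1..m. (-1) ^ (j - 1) / B ^ (2 * j) * zeta_sum (2 * N * (m - j) + N + 1)))))"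
    using Suc unfolding B_def[symmetric]
    by (intro sums_mult sums_diff zeta_sum_sums) (auto simp: N_def)
  also have "(\<lambda>n. 1 / B\<^sup>2 * (1 / of_nat (Suc n) ^ (2 * N * m + N + 1) -
        of_nat (Suc n) ^ (2 * p) / (of_nat (Suc n) ^ (2 * N * m) * (of_nat (Suc n) ^ (2 * N) + B\<^sup>2))))
    = (\<lambda>n. of_nat (Suc n) ^ (2 * p) / (of_nat (Suc n) ^ (2 * N * Suc m) * (of_nat (Suc n) ^ (2 * N) + B\<^sup>2)))"
  proof
    fix n
    define X where "X = (of_nat (Suc n) :: complex)"
    have X0: "X \<noteq> 0" by (simp add: X_def del: of_nat_Suc)
    have "real (Suc n) ^ (2 * N) + (b * real (Suc k))\<^sup>2 > 0" by (intro add_pos_nonneg) auto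
    then have "complex_of_real (real (Suc n) ^ (2 * N) + (b * real (Suc k))\<^sup>2) \<noteq> 0"
      by (simp only: of_real_eq_0_iff)
    then have D0: "X ^ (2 * N) + B\<^sup>2 \<noteq> 0" unfolding X_def B_def by simp
    \<comment> \<open>The zeta exponent N + 1 is 2N - 2p, what remains of V = n^(2N) after
      cancelling the numerator.\<close>
    have e: "X ^ (2 * N * m + N + 1) * X ^ (2 * p) = X ^ (2 * N * m) * X ^ (2 * N)"
      unfolding power_add[symmetric] by (rule arg_cong[of _ _ "\<lambda>e. X ^ e"]) (simp add: N_def)
    have "1 / X ^ (2 * N * m + N + 1) = X ^ (2 * p) / (X ^ (2 * N * m) * X ^ (2 * N))"
      unfolding e[symmetric] using X0 by simp
    moreover have "1 / B\<^sup>2 * (Y / (U * V) - Y / (U * (V + B\<^sup>2))) = Y / (U * V * (V + B\<^sup>2))"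
      if "U \<noteq> 0" "V \<noteq> 0" "V + B\<^sup>2 \<noteq> 0" for U V Y
      using that B0 by (simp add: divide_simps) (simp add: algebra_simps)
    ultimately have "1 / B\<^sup>2 * (1 / X ^ (2 * N * m + N + 1) - X ^ (2 * p) / (X ^ (2 * N * m) * (X ^ (2 * N) + B\<^sup>2)))
        = X ^ (2 * p) / (X ^ (2 * N * m) * X ^ (2 * N) * (X ^ (2 * N) + B\<^sup>2))"
      using X0 D0 by simp
    also have "X ^ (2 * N * m) * X ^ (2 * N) = X ^ (2 * N * Suc m)" by (simp add: power_add mult_ac)
    finally show "1 / B\<^sup>2 * (1 / of_nat (Suc n) ^ (2 * N * m + N + 1) -
        of_nat (Suc n) ^ (2 * p) / (of_nat (Suc n) ^ (2 * N * m) * (of_nat (Suc n) ^ (2 * N) + B\<^sup>2)))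
       = of_nat (Suc n) ^ (2 * p) / (of_nat (Suc n) ^ (2 * N * Suc m) * (of_nat (Suc n) ^ (2 * N) + B\<^sup>2))"
      unfolding X_def .
  qed
  also have "1 / B\<^sup>2 * (zeta_sum (2 * N * m + N + 1) - ((-1) ^ m / B ^ (2 * m) * psi k
       + (\<Sum>j=1..m. (-1) ^ (j - 1) / B ^ (2 * j) * zeta_sum (2 * N * (m - j) + N + 1))))
     = (-1) ^ Suc m / B ^ (2 * Suc m) * psi k
       + (\<Sum>j=1..Suc m. (-1) ^ (j - 1) / B ^ (2 * j) * zeta_sum (2 * N * (Suc m - j) + N + 1))"
  proof -
    have "(\<Sum>j=1..Suc m. (-1) ^ (j - 1) / B ^ (2 * j) * zeta_sum (2 * N * (Suc m - j) + N + 1))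
        = 1 / B\<^sup>2 * zeta_sum (2 * N * m + N + 1)
          + (\<Sum>j=Suc 1..Suc m. (-1) ^ (j - 1) / B ^ (2 * j) * zeta_sum (2 * N * (Suc m - j) + N + 1))"
      by (subst sum.atLeast_Suc_atMost) simp_all
    also have "(\<Sum>j=Suc 1..Suc m. (-1) ^ (j - 1) / B ^ (2 * j) * zeta_sum (2 * N * (Suc m - j) + N + 1))
        = (\<Sum>j=1..m. (-1) ^ j / B ^ (2 * Suc j) * zeta_sum (2 * N * (m - j) + N + 1))"
      by (subst sum.shift_bounds_cl_Suc_ivl) simp
    also have "\<dots> = (\<Sum>j=1..m. - (1 / B\<^sup>2) * ((-1) ^ (j - 1) / B ^ (2 * j) * zeta_sum (2 * N * (m - j) + N + 1)))"
    proof (intro sum.cong refl)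
      fix j assume j: "j \<in> {1..m}"
      then have "(-1 :: complex) ^ j = - ((-1) ^ (j - 1))" by (cases j) auto
      then show "(-1) ^ j / B ^ (2 * Suc j) * zeta_sum (2 * N * (m - j) + N + 1)
         = - (1 / B\<^sup>2) * ((-1) ^ (j - 1) / B ^ (2 * j) * zeta_sum (2 * N * (m - j) + N + 1))"
        by (simp add: power2_eq_square)
    qed
    also have "\<dots> = - (1 / B\<^sup>2) * (\<Sum>j=1..m. (-1) ^ (j - 1) / B ^ (2 * j) * zeta_sum (2 * N * (m - j) + N + 1))"
      by (rule sum_distrib_left[symmetric])
    finally have s: "(\<Sum>j=1..Suc m. (-1) ^ (j - 1) / B ^ (2 * j) * zeta_sum (2 * N * (Suc m - j) + N + 1))
        = 1 / B\<^sup>2 * zeta_sum (2 * N * m + N + 1)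
          + - (1 / B\<^sup>2) * (\<Sum>j=1..m. (-1) ^ (j - 1) / B ^ (2 * j) * zeta_sum (2 * N * (m - j) + N + 1))" .
    show ?thesis unfolding s by (simp add: ring_distribs power2_eq_square)
  qed
  finally show ?case unfolding B_def .
qed

text \<open>The double sum over j and n in the theorem with the finite sum inside; the exponent is
  an integer so that both signs of m are covered.\<close>

definition dir_series :: "int \<Rightarrow> complex" where
  "dir_series e = (\<Sum>k. cnj (chi (int (Suc k))) / of_nat (Suc k) powi e * dir_sum p (of_real (node k)))"

lemma summable_norm_dir_series:
  "summable (\<lambda>k. norm (cnj (chi (int (Suc k))) / of_nat (Suc k) powi e * dir_sum p (of_real (node k))))"
proof -
  obtain C where C: "\<And>k. norm (dir_sum p (of_real (node k))) \<le> C / real (Suc k) ^ (nat \<bar>e\<bar> + 2)"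
    using dir_sum_node_bound[of "nat \<bar>e\<bar> + 2"] by blast
  have "norm (cnj (chi (int (Suc k))) * dir_sum p (of_real (node k))) \<le> C / real (Suc k) ^ (nat \<bar>e\<bar> + 2)" for k
    unfolding norm_mult complex_mod_cnj
    by (rule order_trans[OF mult_left_le_one_le[OF _ _ norm_chi_le_1] C]) auto
  from summable_over_powi[of "\<lambda>k. cnj (chi (int (Suc k))) * dir_sum p (of_real (node k))", OF this]
  show ?thesis by (simp only: times_divide_eq_left)
qed

lemma dir_series_sums:
  "(\<lambda>k. cnj (chi (int (Suc k))) / of_nat (Suc k) powi e * dir_sum p (of_real (node k))) sums dir_series e"
  unfolding dir_series_def by (rule summable_sums[OF summable_norm_cancel[OF summable_norm_dir_series]])

text \<open>\<open>kernel_expansion\<close> divided by n^(2Nm) is summed over n in both orders. Rows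
  give the kernel series with its two pole corrections, columns are evaluated by
  \<open>psi_power_sums\<close>.\<close>

theorem core_identity_pos:
  assumes m: "m > 0"
  shows "(\<lambda>n. char_kernel (of_real (a * real (Suc n) ^ N)) / of_nat (Suc n) ^ (2 * N * m + 1)) sums
    (- pole_coeff / 2 * zeta_sum (2 * N * m + 1) + pole_coeff / of_real a * zeta_sum (2 * N * m + N + 1)
      + 2 * gauss_sum q chi / of_real a *
       ((-1) ^ m / of_real b ^ (2 * m + 1) * (of_real pi / of_nat N) *
          (cnj_L_series (2 * m + 1) / 2 + (-1) ^ p * dir_series (2 * int m + 1))
        - (if p = 0 then (-1) ^ m / (2 * of_real b ^ (2 * m + 2)) * cnj_L_series (2 * m + 2) else 0)
        + (\<Sum>j=1..m. (-1) ^ (j - 1) / of_real b ^ (2 * j) * cnj_L_series (2 * j) * zeta_sum (2 * N * (m - j) + N + 1))))"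
proof -
  define K where "K = 2 * gauss_sum q chi / of_real a"
  define T where "T = (\<lambda>n k. of_nat (Suc n) ^ (2 * p) / (of_nat (Suc n) ^ (2 * N * m) *
      (of_nat (Suc n) ^ (2 * N) + (complex_of_real (b * real (Suc k)))\<^sup>2)))"
  define f where "f = (\<lambda>n k. cnj (chi (int (Suc k))) * T n k)"
  have bound: "norm (f n k) \<le> (1 / real (Suc n) ^ 2) * ((1 / b\<^sup>2) * (1 / real (Suc k) ^ 2))" for n k
  proof -
    define x where "x = real (Suc n)"
    have x: "x \<ge> 1" by (simp add: x_def)
    have "T n k = of_real (x ^ (2 * p) / (x ^ (2 * N * m) * (x ^ (2 * N) + (b * real (Suc k))\<^sup>2)))"
      unfolding T_def x_def by simp
    then have "norm (T n k) = \<bar>x ^ (2 * p) / (x ^ (2 * N * m) * (x ^ (2 * N) + (b * real (Suc k))\<^sup>2))\<bar>"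
      by (simp only: norm_of_real)
    also have "\<dots> = x ^ (2 * p) / (x ^ (2 * N * m) * (x ^ (2 * N) + (b * real (Suc k))\<^sup>2))"
      using x by (intro abs_of_nonneg divide_nonneg_nonneg mult_nonneg_nonneg add_nonneg_nonneg) auto
    \<comment> \<open>Here m > 0 enters: 2Nm >= 2p + 2 pays for the numerator and leaves 1/n^2,
      while dropping n^(2N) in the other factor leaves 1/k^2.\<close>
    also have "\<dots> \<le> x ^ (2 * p) / (x ^ (2 * p + 2) * (b * real (Suc k))\<^sup>2)"
    proof (intro divide_left_mono mult_mono)
      have "2 * p + 2 \<le> 2 * N * 1" by (simp add: N_def)
      also have "\<dots> \<le> 2 * N * m" using m by (intro mult_le_mono) auto
      finally show "x ^ (2 * p + 2) \<le> x ^ (2 * N * m)" using x by (intro power_increasing)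
      show "0 < x ^ (2 * N * m) * (x ^ (2 * N) + (b * real (Suc k))\<^sup>2) * (x ^ (2 * p + 2) * (b * real (Suc k))\<^sup>2)"
        using x b_pos by (intro mult_pos_pos add_pos_pos) auto
    qed (use x in auto)
    also have "\<dots> = (1 / x ^ 2) * ((1 / b\<^sup>2) * (1 / real (Suc k) ^ 2))"
      using x by (simp add: power_add power_mult_distrib power2_eq_square del: of_nat_Suc)
    finally have "norm (T n k) \<le> (1 / x ^ 2) * ((1 / b\<^sup>2) * (1 / real (Suc k) ^ 2))" .
    moreover have "norm (f n k) \<le> norm (T n k)"
      unfolding f_def norm_mult using norm_chi_le_1[of "int (Suc k)"] by (simp add: mult_left_le_one_le)
    ultimately show ?thesis unfolding x_def by simp
  qed
  note swap = sums_swap_product_bound[OF bound summable_inverse_power_Suc[OF order_refl] _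
     summable_mult[OF summable_inverse_power_Suc[OF order_refl]]]
  have sw: "(\<lambda>k. \<Sum>n. f n k) sums (\<Sum>n. \<Sum>k. f n k)" and sm: "summable (\<lambda>n. \<Sum>k. f n k)"
    by (rule swap; simp)+
  have col: "(\<Sum>n. f n k) = cnj (chi (int (Suc k))) * ((-1) ^ m / (of_real (b * real (Suc k))) ^ (2 * m) * psi k
       + (\<Sum>j=1..m. (-1) ^ (j - 1) / (of_real (b * real (Suc k))) ^ (2 * j) * zeta_sum (2 * N * (m - j) + N + 1)))" for k
    using sums_unique[OF sums_mult[OF psi_power_sums[of m k], of "cnj (chi (int (Suc k)))"]]
    unfolding f_def T_def by simp
  have row: "K * (\<Sum>k. f n k) = char_kernel (of_real (a * real (Suc n) ^ N)) / of_nat (Suc n) ^ (2 * N * m + 1)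
      + pole_coeff / 2 * (1 / of_nat (Suc n) ^ (2 * N * m + 1))
      - pole_coeff / of_real a * (1 / of_nat (Suc n) ^ (2 * N * m + N + 1))" for n
  proof -
    define X where "X = (of_nat (Suc n) :: complex)"
    have "(\<lambda>k. 1 / X ^ (2 * N * m) * (K * (cnj (chi (int (Suc k))) *
        (X ^ (2 * p) / (X ^ (2 * N) + (of_real (b * real (Suc k)))\<^sup>2))))) sums
       (1 / X ^ (2 * N * m) * (char_kernel (of_real (a * real (Suc n) ^ N)) / X + pole_coeff / (2 * X)
        - pole_coeff / (of_real a * X ^ (N + 1))))"
      unfolding K_def X_def by (intro sums_mult kernel_expansion)
    also have "(\<lambda>k. 1 / X ^ (2 * N * m) * (K * (cnj (chi (int (Suc k))) *
        (X ^ (2 * p) / (X ^ (2 * N) + (of_real (b * real (Suc k)))\<^sup>2))))) = (\<lambda>k. K * f n k)"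
      unfolding f_def T_def X_def[symmetric] by simp
    finally have "(\<lambda>k. K * f n k) sums
       (1 / X ^ (2 * N * m) * (char_kernel (of_real (a * real (Suc n) ^ N)) / X + pole_coeff / (2 * X)
        - pole_coeff / (of_real a * X ^ (N + 1))))" .
    moreover have "(\<lambda>k. K * f n k) sums (K * (\<Sum>k. f n k))"
      by (intro sums_mult summable_sums, rule summable_norm_cancel, rule swap(2)) simp_all
    ultimately have "K * (\<Sum>k. f n k) = 1 / X ^ (2 * N * m) * (char_kernel (of_real (a * real (Suc n) ^ N)) / X + pole_coeff / (2 * X)
        - pole_coeff / (of_real a * X ^ (N + 1)))" by (rule sums_unique2[symmetric])
    then show ?thesis unfolding X_def[symmetric] by (simp add: ring_distribs power_add mult_ac)
  qed
  have dsum: "(\<lambda>k. \<Sum>n. f n k) sums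
       ((-1) ^ m / of_real b ^ (2 * m + 1) * (of_real pi / of_nat N) *
          (cnj_L_series (2 * m + 1) / 2 + (-1) ^ p * dir_series (2 * int m + 1))
        - (if p = 0 then (-1) ^ m / (2 * of_real b ^ (2 * m + 2)) * cnj_L_series (2 * m + 2) else 0)
        + (\<Sum>j=1..m. (-1) ^ (j - 1) / of_real b ^ (2 * j) * zeta_sum (2 * N * (m - j) + N + 1) * cnj_L_series (2 * j)))"
  proof -
    have "(\<lambda>k. (-1) ^ m / of_real b ^ (2 * m + 1) * (of_real pi / of_nat N) *
          (cnj (chi (int (Suc k))) / of_nat (Suc k) ^ (2 * m + 1) / 2
            + (-1) ^ p * (cnj (chi (int (Suc k))) / of_nat (Suc k) powi (2 * int m + 1) * dir_sum p (of_real (node k))))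
        - (if p = 0 then (-1) ^ m / (2 * of_real b ^ (2 * m + 2)) else 0) * (cnj (chi (int (Suc k))) / of_nat (Suc k) ^ (2 * m + 2))
        + (\<Sum>j=1..m. (-1) ^ (j - 1) / of_real b ^ (2 * j) * zeta_sum (2 * N * (m - j) + N + 1) *
            (cnj (chi (int (Suc k))) / of_nat (Suc k) ^ (2 * j)))) sums
       ((-1) ^ m / of_real b ^ (2 * m + 1) * (of_real pi / of_nat N) *
          (cnj_L_series (2 * m + 1) / 2 + (-1) ^ p * dir_series (2 * int m + 1))
        - (if p = 0 then (-1) ^ m / (2 * of_real b ^ (2 * m + 2)) else 0) * cnj_L_series (2 * m + 2)
        + (\<Sum>j=1..m. (-1) ^ (j - 1) / of_real b ^ (2 * j) * zeta_sum (2 * N * (m - j) + N + 1) * cnj_L_series (2 * j)))"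
      using m by (intro sums_add sums_diff sums_mult sums_divide sums_sum cnj_L_series_sums dir_series_sums) auto
    also have "(\<lambda>k. (-1) ^ m / of_real b ^ (2 * m + 1) * (of_real pi / of_nat N) *
          (cnj (chi (int (Suc k))) / of_nat (Suc k) ^ (2 * m + 1) / 2
            + (-1) ^ p * (cnj (chi (int (Suc k))) / of_nat (Suc k) powi (2 * int m + 1) * dir_sum p (of_real (node k))))
        - (if p = 0 then (-1) ^ m / (2 * of_real b ^ (2 * m + 2)) else 0) * (cnj (chi (int (Suc k))) / of_nat (Suc k) ^ (2 * m + 2))
        + (\<Sum>j=1..m. (-1) ^ (j - 1) / of_real b ^ (2 * j) * zeta_sum (2 * N * (m - j) + N + 1) *
            (cnj (chi (int (Suc k))) / of_nat (Suc k) ^ (2 * j)))) = (\<lambda>k. \<Sum>n. f n k)"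
    proof
      fix k
      define X where "X = (of_nat (Suc k) :: complex)"
      define \<beta> where "\<beta> = complex_of_real b"
      have nz: "X \<noteq> 0" "\<beta> \<noteq> 0" "of_nat N \<noteq> (0 :: complex)"
        using b_pos N_pos by (simp_all add: X_def \<beta>_def del: of_nat_Suc)
      have bk: "complex_of_real (b * real (Suc k)) = \<beta> * X" by (simp add: X_def \<beta>_def)
      have pw: "X powi (2 * int m + 1) = X ^ (2 * m + 1)"
      proof -
        have "2 * int m + 1 = int (2 * m + 1)" by simp
        then show ?thesis by (simp only: power_int_of_nat)
      qed
      have 1: "(-1) ^ m / (\<beta> * X) ^ (2 * m) * psi k = (-1) ^ m / \<beta> ^ (2 * m + 1) * (of_real pi / of_nat N) *
          (1 / X ^ (2 * m + 1) / 2 + (-1) ^ p * (1 / X ^ (2 * m + 1) * dir_sum p (of_real (node k))))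
        - (if p = 0 then (-1) ^ m / (2 * \<beta> ^ (2 * m + 2)) else 0) * (1 / X ^ (2 * m + 2))"
        unfolding psi_def bk using nz by (simp add: power_mult_distrib power2_eq_square field_simps)
      have "(\<Sum>n. f n k) = cnj (chi (int (Suc k))) * ((-1) ^ m / (\<beta> * X) ^ (2 * m) * psi k)
         + (\<Sum>j=1..m. cnj (chi (int (Suc k))) * ((-1) ^ (j - 1) / (\<beta> * X) ^ (2 * j) * zeta_sum (2 * N * (m - j) + N + 1)))"
        unfolding col bk by (simp add: distrib_left sum_distrib_left)
      also have "(\<Sum>j=1..m. cnj (chi (int (Suc k))) * ((-1) ^ (j - 1) / (\<beta> * X) ^ (2 * j) * zeta_sum (2 * N * (m - j) + N + 1)))
          = (\<Sum>j=1..m. (-1) ^ (j - 1) / \<beta> ^ (2 * j) * zeta_sum (2 * N * (m - j) + N + 1) * (cnj (chi (int (Suc k))) / X ^ (2 * j)))"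
        by (intro sum.cong refl) (simp add: power_mult_distrib mult_ac)
      also have "cnj (chi (int (Suc k))) * ((-1) ^ m / (\<beta> * X) ^ (2 * m) * psi k) =
          (-1) ^ m / \<beta> ^ (2 * m + 1) * (of_real pi / of_nat N) *
          (cnj (chi (int (Suc k))) / X ^ (2 * m + 1) / 2
            + (-1) ^ p * (cnj (chi (int (Suc k))) / X ^ (2 * m + 1) * dir_sum p (of_real (node k))))
        - (if p = 0 then (-1) ^ m / (2 * \<beta> ^ (2 * m + 2)) else 0) * (cnj (chi (int (Suc k))) / X ^ (2 * m + 2))"
        unfolding 1 by (simp add: ring_distribs mult_ac)
      finally show "(-1) ^ m / of_real b ^ (2 * m + 1) * (of_real pi / of_nat N) *
          (cnj (chi (int (Suc k))) / of_nat (Suc k) ^ (2 * m + 1) / 2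
            + (-1) ^ p * (cnj (chi (int (Suc k))) / of_nat (Suc k) powi (2 * int m + 1) * dir_sum p (of_real (node k))))
        - (if p = 0 then (-1) ^ m / (2 * of_real b ^ (2 * m + 2)) else 0) * (cnj (chi (int (Suc k))) / of_nat (Suc k) ^ (2 * m + 2))
        + (\<Sum>j=1..m. (-1) ^ (j - 1) / of_real b ^ (2 * j) * zeta_sum (2 * N * (m - j) + N + 1) *
            (cnj (chi (int (Suc k))) / of_nat (Suc k) ^ (2 * j))) = (\<Sum>n. f n k)"
        unfolding X_def[symmetric] \<beta>_def[symmetric] pw by (rule sym)
    qed
    finally show ?thesis unfolding if_distrib[of "\<lambda>x. x * cnj_L_series (2 * m + 2)"] mult_zero_left .
  qed
  have "(\<lambda>n. K * (\<Sum>k. f n k) - pole_coeff / 2 * (1 / of_nat (Suc n) ^ (2 * N * m + 1))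
      + pole_coeff / of_real a * (1 / of_nat (Suc n) ^ (2 * N * m + N + 1))) sums
      (K * (\<Sum>n. \<Sum>k. f n k) - pole_coeff / 2 * zeta_sum (2 * N * m + 1) + pole_coeff / of_real a * zeta_sum (2 * N * m + N + 1))"
    using m N_pos by (intro sums_add sums_diff sums_mult zeta_sum_sums summable_sums sm) (auto intro!: Suc_leI)
  also have "(\<lambda>n. K * (\<Sum>k. f n k) - pole_coeff / 2 * (1 / of_nat (Suc n) ^ (2 * N * m + 1))
      + pole_coeff / of_real a * (1 / of_nat (Suc n) ^ (2 * N * m + N + 1)))
     = (\<lambda>n. char_kernel (of_real (a * real (Suc n) ^ N)) / of_nat (Suc n) ^ (2 * N * m + 1))"
    unfolding row by simp
  finally show ?thesis
    unfolding sums_unique2[OF sw dsum] K_def by (simp add: mult_ac algebra_simps)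
qed

end

section \<open>Asymptotic expansions\<close>

definition asym_expansion :: "(real \<Rightarrow> complex) \<Rightarrow> (nat \<Rightarrow> complex) \<Rightarrow> bool" where
  "asym_expansion f u \<longleftrightarrow> (\<forall>n. \<exists>K. \<forall>\<^sub>F R in at_top. norm (f R - (\<Sum>i<n. u i / of_real R ^ i)) \<le> K / R ^ n)"

text \<open>An estimate of higher order implies those of lower order. Expansions in powers of R^s
  are naturally truncated only at multiples of s.\<close>

lemma asymI_cofinal:
  assumes "\<And>n. \<exists>m\<ge>n. \<exists>K. \<forall>\<^sub>F R in at_top. norm (f R - (\<Sum>i<m. u i / of_real R ^ i)) \<le> K / R ^ m"
  shows "asym_expansion f u"
  unfolding asym_expansion_def
proof
  fix n
  obtain m K where m: "m \<ge> n" and K: "\<forall>\<^sub>F R in at_top. norm (f R - (\<Sum>i<m. u i / of_real R ^ i)) \<le> K / R ^ m"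
    using assms by blast
  have "\<forall>\<^sub>F R in at_top. norm (f R - (\<Sum>i<n. u i / of_real R ^ i)) \<le> (\<bar>K\<bar> + (\<Sum>i=n..<m. norm (u i))) / R ^ n"
    using K eventually_ge_at_top[of 1]
  proof eventually_elim
    case (elim R)
    have dec: "c / R ^ i \<le> c / R ^ n" if "i \<ge> n" "c \<ge> 0" for i c
      using that elim by (intro divide_left_mono power_increasing mult_pos_pos) auto
    have "(\<Sum>i<m. u i / of_real R ^ i) = (\<Sum>i<n. u i / of_real R ^ i) + (\<Sum>i=n..<m. u i / of_real R ^ i)"
      using m by (metis atLeast0LessThan le0 sum.atLeastLessThan_concat)
    then have "f R - (\<Sum>i<n. u i / of_real R ^ i) = (f R - (\<Sum>i<m. u i / of_real R ^ i)) + (\<Sum>i=n..<m. u i / of_real R ^ i)"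
      by simp
    also have "norm \<dots> \<le> K / R ^ m + (\<Sum>i=n..<m. norm (u i) / R ^ n)"
    proof (rule norm_triangle_le[OF add_mono])
      show "norm (\<Sum>i=n..<m. u i / of_real R ^ i) \<le> (\<Sum>i=n..<m. norm (u i) / R ^ n)"
        by (rule sum_norm_le) (use elim dec in \<open>auto simp: norm_divide norm_power\<close>)
    qed (use elim in auto)
    also have "K / R ^ m \<le> \<bar>K\<bar> / R ^ m" using elim by (intro divide_right_mono) auto
    also have "\<dots> \<le> \<bar>K\<bar> / R ^ n" using dec m by auto
    finally show ?case by (simp add: add_divide_distrib sum_divide_distrib)
  qed
  then show "\<exists>K. \<forall>\<^sub>F R in at_top. norm (f R - (\<Sum>i<n. u i / of_real R ^ i)) \<le> K / R ^ n" by blast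
qed

lemma asym_cong_ev:
  assumes "\<forall>\<^sub>F R in at_top. f R = g R" "asym_expansion f u"
  shows "asym_expansion g u"
  unfolding asym_expansion_def
proof
  fix n
  obtain K where "\<forall>\<^sub>F R in at_top. norm (f R - (\<Sum>i<n. u i / of_real R ^ i)) \<le> K / R ^ n"
    using assms(2) unfolding asym_expansion_def by blast
  then have "\<forall>\<^sub>F R in at_top. norm (g R - (\<Sum>i<n. u i / of_real R ^ i)) \<le> K / R ^ n"
    using assms(1) by eventually_elim simp
  then show "\<exists>K. \<forall>\<^sub>F R in at_top. norm (g R - (\<Sum>i<n. u i / of_real R ^ i)) \<le> K / R ^ n" by blast
qed

lemma asym_add:
  assumes "asym_expansion f u" "asym_expansion g v"
  shows "asym_expansion (\<lambda>R. f R + g R) (\<lambda>i. u i + v i)"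
  unfolding asym_expansion_def
proof
  fix n
  obtain K L where "\<forall>\<^sub>F R in at_top. norm (f R - (\<Sum>i<n. u i / of_real R ^ i)) \<le> K / R ^ n"
      "\<forall>\<^sub>F R in at_top. norm (g R - (\<Sum>i<n. v i / of_real R ^ i)) \<le> L / R ^ n"
    using assms unfolding asym_expansion_def by blast
  then have "\<forall>\<^sub>F R in at_top. norm (f R + g R - (\<Sum>i<n. (u i + v i) / of_real R ^ i)) \<le> (K + L) / R ^ n"
  proof eventually_elim
    case (elim R)
    have "f R + g R - (\<Sum>i<n. (u i + v i) / of_real R ^ i)
        = (f R - (\<Sum>i<n. u i / of_real R ^ i)) + (g R - (\<Sum>i<n. v i / of_real R ^ i))"
      by (simp add: add_divide_distrib sum.distrib)
    also have "norm \<dots> \<le> K / R ^ n + L / R ^ n" using elim by (intro norm_triangle_le add_mono)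
    finally show ?case by (simp add: add_divide_distrib)
  qed
  then show "\<exists>K. \<forall>\<^sub>F R in at_top. norm (f R + g R - (\<Sum>i<n. (u i + v i) / of_real R ^ i)) \<le> K / R ^ n" by blast
qed

lemma asym_cmult:
  assumes "asym_expansion f u"
  shows "asym_expansion (\<lambda>R. c * f R) (\<lambda>i. c * u i)"
  unfolding asym_expansion_def
proof
  fix n
  obtain K where "\<forall>\<^sub>F R in at_top. norm (f R - (\<Sum>i<n. u i / of_real R ^ i)) \<le> K / R ^ n"
    using assms unfolding asym_expansion_def by blast
  then have "\<forall>\<^sub>F R in at_top. norm (c * f R - (\<Sum>i<n. c * u i / of_real R ^ i)) \<le> (norm c * K) / R ^ n"
  proof eventually_elim
    case (elim R)
    have "c * f R - (\<Sum>i<n. c * u i / of_real R ^ i) = c * (f R - (\<Sum>i<n. u i / of_real R ^ i))"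
      by (simp add: right_diff_distrib sum_distrib_left)
    also have "norm \<dots> \<le> norm c * (K / R ^ n)" unfolding norm_mult using elim by (intro mult_left_mono) auto
    finally show ?case by simp
  qed
  then show "\<exists>K. \<forall>\<^sub>F R in at_top. norm (c * f R - (\<Sum>i<n. c * u i / of_real R ^ i)) \<le> K / R ^ n" by blast
qed

lemma asym_diff: "asym_expansion f u \<Longrightarrow> asym_expansion g v \<Longrightarrow> asym_expansion (\<lambda>R. f R - g R) (\<lambda>i. u i - v i)"
  using asym_add[OF _ asym_cmult[of g v "-1"], of f u] by simp

lemma asym_monomial: "asym_expansion (\<lambda>R. c / of_real R ^ k) (\<lambda>i. if i = k then c else 0)"
proof (rule asymI_cofinal)
  fix n
  have "norm (c / of_real R ^ k - (\<Sum>i<n + Suc k. (if i = k then c else 0) / of_real R ^ i)) \<le> 0 / R ^ (n + Suc k)" for R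
  proof -
    have "(\<Sum>i<n + Suc k. (if i = k then c else 0) / of_real R ^ i) = (\<Sum>i<n + Suc k. if i = k then c / of_real R ^ i else 0)"
      by (intro sum.cong) auto
    then show ?thesis by simp
  qed
  then show "\<exists>m\<ge>n. \<exists>K. \<forall>\<^sub>F R in at_top. norm (c / of_real R ^ k - (\<Sum>i<m. (if i = k then c else 0) / of_real R ^ i)) \<le> K / R ^ m"
    by (intro exI[of _ "n + Suc k"] conjI exI[of _ 0] always_eventually allI) auto
qed

lemma asym_negligible:
  assumes "\<And>n. \<exists>K. \<forall>\<^sub>F R in at_top. norm (f R) \<le> K / R ^ n"
  shows "asym_expansion f (\<lambda>_. 0)"
  using assms unfolding asym_expansion_def by simp

lemma asym_scale:
  assumes "asym_expansion f u" "s > 0"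
  shows "asym_expansion (\<lambda>R. f (s * R)) (\<lambda>i. u i / of_real s ^ i)"
  unfolding asym_expansion_def
proof
  fix n
  obtain K where "\<forall>\<^sub>F R in at_top. norm (f R - (\<Sum>i<n. u i / of_real R ^ i)) \<le> K / R ^ n"
    using assms unfolding asym_expansion_def by blast
  moreover have "filterlim (\<lambda>R. s * R) at_top at_top"
    using assms(2) by (intro filterlim_tendsto_pos_mult_at_top[OF tendsto_const] filterlim_ident)
  ultimately have "\<forall>\<^sub>F R in at_top. norm (f (s * R) - (\<Sum>i<n. u i / of_real (s * R) ^ i)) \<le> K / (s * R) ^ n"
    by (rule eventually_compose_filterlim)
  then have "\<forall>\<^sub>F R in at_top. norm (f (s * R) - (\<Sum>i<n. u i / of_real s ^ i / of_real R ^ i)) \<le> (K / s ^ n) / R ^ n"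
    by eventually_elim (simp add: power_mult_distrib)
  then show "\<exists>K. \<forall>\<^sub>F R in at_top. norm (f (s * R) - (\<Sum>i<n. u i / of_real s ^ i / of_real R ^ i)) \<le> K / R ^ n" by blast
qed

lemma sum_multiples:
  fixes g :: "nat \<Rightarrow> 'a :: comm_monoid_add"
  assumes "s > 0"
  shows "(\<Sum>i<s * n. if s dvd i then g i else 0) = (\<Sum>j<n. g (s * j))"
proof -
  have "(\<Sum>i<s * n. if s dvd i then g i else 0) = (\<Sum>i\<in>{i. i < s * n \<and> s dvd i}. g i)"
    by (subst sum.inter_filter[symmetric]) (auto intro!: sum.cong)
  also have "\<dots> = (\<Sum>j<n. g (s * j))"
    by (rule sum.reindex_bij_witness[of _ "\<lambda>j. s * j" "\<lambda>i. i div s"]) (use assms in auto)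
  finally show ?thesis .
qed

lemma asym_power_subst:
  assumes "asym_expansion f u" "s > 0"
  shows "asym_expansion (\<lambda>R. f (R ^ s)) (\<lambda>i. if s dvd i then u (i div s) else 0)"
proof (rule asymI_cofinal)
  fix n
  obtain K where "\<forall>\<^sub>F R in at_top. norm (f R - (\<Sum>i<n. u i / of_real R ^ i)) \<le> K / R ^ n"
    using assms unfolding asym_expansion_def by blast
  moreover have "filterlim (\<lambda>R::real. R ^ s) at_top at_top"
    using assms(2) by (intro filterlim_pow_at_top filterlim_ident)
  ultimately have "\<forall>\<^sub>F R in at_top. norm (f (R ^ s) - (\<Sum>i<n. u i / of_real (R ^ s) ^ i)) \<le> K / (R ^ s) ^ n"
    by (rule eventually_compose_filterlim)
  moreover have "(\<Sum>i<s * n. (if s dvd i then u (i div s) else 0) / of_real R ^ i) = (\<Sum>i<n. u i / of_real (R ^ s) ^ i)" for R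
  proof -
    have "(\<Sum>i<s * n. (if s dvd i then u (i div s) else 0) / of_real R ^ i)
        = (\<Sum>i<s * n. if s dvd i then u (i div s) / of_real R ^ i else 0)"
      by (intro sum.cong) auto
    also have "\<dots> = (\<Sum>j<n. u (s * j div s) / of_real R ^ (s * j))" by (rule sum_multiples[OF assms(2)])
    finally show ?thesis using assms(2) by (simp add: power_mult)
  qed
  ultimately have "\<forall>\<^sub>F R in at_top. norm (f (R ^ s) - (\<Sum>i<s * n. (if s dvd i then u (i div s) else 0) / of_real R ^ i)) \<le> K / R ^ (s * n)"
    by (simp add: power_mult)
  moreover have "s * n \<ge> n" using assms(2) by simp
  ultimately show "\<exists>m\<ge>n. \<exists>K. \<forall>\<^sub>F R in at_top. norm (f (R ^ s) - (\<Sum>i<m. (if s dvd i then u (i div s) else 0) / of_real R ^ i)) \<le> K / R ^ m"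
    by blast
qed

lemma asym_zero_unique:
  assumes "asym_expansion (\<lambda>_. 0) w"
  shows "w i = 0"
proof (induction i rule: less_induct)
  case (less n)
  obtain K where "\<forall>\<^sub>F R in at_top. norm (0 - (\<Sum>i<Suc n. w i / complex_of_real R ^ i)) \<le> K / R ^ Suc n"
    using assms unfolding asym_expansion_def by blast
  then have ev: "\<forall>\<^sub>F R in at_top. norm (w n) \<le> K / R"
    using eventually_gt_at_top[of 0]
  proof eventually_elim
    case (elim R)
    have "(\<Sum>i<Suc n. w i / complex_of_real R ^ i) = w n / of_real R ^ n" using less by simp
    then have "norm (w n) / R ^ n \<le> K / R ^ Suc n" using elim by (simp add: norm_divide norm_power)
    then show ?case using elim by (simp add: field_simps)
  qed
  have "((\<lambda>R. K / R) \<longlongrightarrow> 0) at_top"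
    by (intro tendsto_divide_0[OF tendsto_const] filterlim_at_top_imp_at_infinity filterlim_ident)
  from tendsto_le[OF _ this tendsto_const ev] show ?case by simp
qed

text \<open>Asymptotic expansions up to a multiple of the logarithm and a constant: the difference between
  \<open>R\<close> and \<open>2R\<close> turns a logarithm into a constant.\<close>
definition log_asym :: "(real \<Rightarrow> complex) \<Rightarrow> (nat \<Rightarrow> complex) \<Rightarrow> bool" where
  "log_asym f u \<longleftrightarrow> (\<exists>d. asym_expansion (\<lambda>R. f R - f (2 * R) - d) (\<lambda>i. (1 - 1 / 2 ^ i) * u i))"

lemma asym_imp_log_asym: "asym_expansion f u \<Longrightarrow> log_asym f u"
  unfolding log_asym_def using asym_diff[OF _ asym_scale[of f u 2], of f u]
  by (intro exI[of _ 0]) (simp add: left_diff_distrib)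

lemma log_asym_const: "log_asym (\<lambda>_. c) (\<lambda>_. 0)"
  unfolding log_asym_def using asym_monomial[of 0 0] by (intro exI[of _ 0]) simp

lemma log_asym_add:
  assumes "log_asym f u" "log_asym g v"
  shows "log_asym (\<lambda>R. f R + g R) (\<lambda>i. u i + v i)"
proof -
  obtain d e where "asym_expansion (\<lambda>R. f R - f (2 * R) - d) (\<lambda>i. (1 - 1 / 2 ^ i) * u i)"
      "asym_expansion (\<lambda>R. g R - g (2 * R) - e) (\<lambda>i. (1 - 1 / 2 ^ i) * v i)"
    using assms unfolding log_asym_def by blast
  from asym_add[OF this] show ?thesis
    unfolding log_asym_def by (intro exI[of _ "d + e"]) (simp add: algebra_simps add_divide_distrib)
qed

lemma log_asym_cmult:
  assumes "log_asym f u"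
  shows "log_asym (\<lambda>R. c * f R) (\<lambda>i. c * u i)"
proof -
  obtain d where "asym_expansion (\<lambda>R. f R - f (2 * R) - d) (\<lambda>i. (1 - 1 / 2 ^ i) * u i)"
    using assms unfolding log_asym_def by blast
  from asym_cmult[OF this, of c] show ?thesis
    unfolding log_asym_def by (intro exI[of _ "c * d"]) (simp add: algebra_simps)
qed

lemma log_asym_diff: "log_asym f u \<Longrightarrow> log_asym g v \<Longrightarrow> log_asym (\<lambda>R. f R - g R) (\<lambda>i. u i - v i)"
  using log_asym_add[OF _ log_asym_cmult[of g v "-1"], of f u] by simp

lemma log_asym_sum:
  assumes "finite S" "\<And>j. j \<in> S \<Longrightarrow> log_asym (f j) (u j)"
  shows "log_asym (\<lambda>R. \<Sum>j\<in>S. f j R) (\<lambda>i. \<Sum>j\<in>S. u j i)"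
  using assms by (induction S rule: finite_induct) (auto intro: log_asym_const log_asym_add)

lemma log_asym_cong_ev:
  assumes "\<forall>\<^sub>F R in at_top. f R = g R" "log_asym f u"
  shows "log_asym g u"
proof -
  obtain d where d: "asym_expansion (\<lambda>R. f R - f (2 * R) - d) (\<lambda>i. (1 - 1 / 2 ^ i) * u i)"
    using assms unfolding log_asym_def by blast
  have "filterlim (\<lambda>R::real. 2 * R) at_top at_top"
    by (intro filterlim_tendsto_pos_mult_at_top[OF tendsto_const] filterlim_ident) simp
  from eventually_compose_filterlim[OF assms(1) this] assms(1)
  have "\<forall>\<^sub>F R in at_top. f R - f (2 * R) - d = g R - g (2 * R) - d"
    by eventually_elim simp
  from asym_cong_ev[OF this d] show ?thesis unfolding log_asym_def by blast
qed

text \<open>The factor 1 - 2^(-i) is nonzero exactly for i > 0, so all coefficients except the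
  constant one are recovered.\<close>

lemma log_asym_unique:
  assumes "log_asym f u" "log_asym f v" "i > 0"
  shows "u i = v i"
proof -
  obtain d e where d: "asym_expansion (\<lambda>R. f R - f (2 * R) - d) (\<lambda>i. (1 - 1 / 2 ^ i) * u i)"
     and e: "asym_expansion (\<lambda>R. f R - f (2 * R) - e) (\<lambda>i. (1 - 1 / 2 ^ i) * v i)"
    using assms unfolding log_asym_def by blast
  \<comment> \<open>The two constants need not agree a priori; their difference is carried as a
    monomial of degree 0, which does not touch index i.\<close>
  have "asym_expansion (\<lambda>R. (f R - f (2 * R) - d) - (f R - f (2 * R) - e) + (d - e) / of_real R ^ 0)
     (\<lambda>i. (1 - 1 / 2 ^ i) * u i - (1 - 1 / 2 ^ i) * v i + (if i = 0 then d - e else 0))"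
    by (intro asym_add asym_diff d e asym_monomial)
  then have "asym_expansion (\<lambda>R. 0) (\<lambda>i. (1 - 1 / 2 ^ i) * u i - (1 - 1 / 2 ^ i) * v i + (if i = 0 then d - e else 0))"
    by simp
  from asym_zero_unique[OF this, of i] assms(3)
  have "(1 - 1 / 2 ^ i) * u i = (1 - 1 / 2 ^ i) * v i" by simp
  moreover have "(1 - 1 / 2 ^ i) \<noteq> (0 :: complex)"
  proof -
    have "(2 :: complex) ^ i \<noteq> 1"
    proof
      assume "(2 :: complex) ^ i = 1"
      then have "norm ((2 :: complex) ^ i) = 1" by simp
      then have "(2 :: real) ^ i = 1" by (simp add: norm_power)
      then show False using assms(3) one_less_power[of "2 :: real" i] by simp
    qed
    then show ?thesis by (simp add: divide_simps)
  qed
  ultimately show ?thesis by simp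
qed

section \<open>Laplace integrals with complex parameter\<close>

lemma Laplace_power_integrable:
  fixes z :: complex
  assumes z: "Re z > 0"
  shows "set_integrable lborel {0<..} (\<lambda>t. of_real t ^ n * exp (- (z * of_real t)))"
    and "(LINT t:{0<..}|lborel. t ^ n * exp (- (Re z * t))) = fact n / Re z ^ Suc n"
    and "set_integrable lborel {0<..} (\<lambda>t. t ^ n * exp (- (Re z * t)))"
proof -
  define H where "H = (\<lambda>t. complex_of_real t powr (of_nat (Suc n) - 1) * of_real (exp (- (Re z * t))))"
  have H: "set_integrable lborel {0<..} H" "(LINT t:{0<..}|lborel. H t) = Gamma (of_nat (Suc n)) / of_real (Re z) powr of_nat (Suc n)"
    unfolding H_def using Mellin_exp[of "of_nat (Suc n)" "Re z"] z by auto
  have Ht: "H t = of_real (t ^ n * exp (- (Re z * t)))" if "t > 0" for t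
    using that powr_nat'[of "complex_of_real t" n] by (simp add: H_def)
  have ind: "indicator {0<..} t *\<^sub>R H t = of_real (indicator {0<..} t *\<^sub>R (t ^ n * exp (- (Re z * t))))" for t
    using Ht[of t] by (auto simp: indicator_def)
  have i: "integrable lborel (\<lambda>t. complex_of_real (indicator {0<..} t *\<^sub>R (t ^ n * exp (- (Re z * t)))))"
    using H(1) unfolding set_integrable_def ind .
  from integrable_Re[OF this] show r: "set_integrable lborel {0<..} (\<lambda>t. t ^ n * exp (- (Re z * t)))"
    unfolding set_integrable_def by simp
  have "complex_of_real (LINT t:{0<..}|lborel. t ^ n * exp (- (Re z * t))) = (LINT t:{0<..}|lborel. H t)"
    unfolding set_lebesgue_integral_def ind by (rule integral_complex_of_real[symmetric])
  also have "\<dots> = complex_of_real (fact n / Re z ^ Suc n)"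
    unfolding H(2) using z powr_nat'[of "complex_of_real (Re z)" "Suc n"] Gamma_fact[of n, where 'a = complex]
    by (simp add: add.commute)
  finally show "(LINT t:{0<..}|lborel. t ^ n * exp (- (Re z * t))) = fact n / Re z ^ Suc n"
    by (simp only: of_real_eq_iff)
  have m: "(\<lambda>t. exp (- (z * complex_of_real t))) \<in> borel_measurable borel"
    by (intro borel_measurable_continuous_onI continuous_intros)
  show "set_integrable lborel {0<..} (\<lambda>t. of_real t ^ n * exp (- (z * of_real t)))"
    unfolding set_integrable_def
  proof (rule Bochner_Integration.integrable_bound[OF r[unfolded set_integrable_def]])
    show "(\<lambda>t. indicator {0<..} t *\<^sub>R (complex_of_real t ^ n * exp (- (z * complex_of_real t)))) \<in> borel_measurable lborel"
      using m by measurable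
    show "AE t in lborel. norm (indicator {0<..} t *\<^sub>R (complex_of_real t ^ n * exp (- (z * complex_of_real t))))
        \<le> norm (indicator {0<..} t *\<^sub>R (t ^ n * exp (- (Re z * t))))"
      by (intro AE_I2) (auto simp: indicator_def norm_mult norm_power norm_exp_eq_Re abs_mult power_abs)
  qed
qed

lemma tendsto_power_exp_at_top:
  fixes z :: complex
  assumes z: "Re z > 0"
  shows "((\<lambda>t. complex_of_real t ^ n * exp (- (z * of_real t))) \<longlongrightarrow> 0) at_top"
proof (rule Lim_null_comparison)
  show "\<forall>\<^sub>F t in at_top. norm (complex_of_real t ^ n * exp (- (z * of_real t))) \<le> fact (Suc n) / Re z ^ Suc n / t"
    using eventually_gt_at_top[of 0]
  proof eventually_elim
    case (elim t)
    have "(Re z * t) ^ Suc n / fact (Suc n) \<le> exp (Re z * t)"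
      using power_over_fact_le_exp_minus_1[of "Re z * t" "Suc n"] z elim by simp
    then have "t ^ n * exp (- (Re z * t)) \<le> t ^ n * (1 / ((Re z * t) ^ Suc n / fact (Suc n)))"
      unfolding exp_minus inverse_eq_divide using z elim by (intro mult_left_mono divide_left_mono) auto
    also have "\<dots> = fact (Suc n) / Re z ^ Suc n / t"
      using elim by (simp add: power_mult_distrib field_simps del: fact_Suc)
    finally show ?case using elim by (simp add: norm_mult norm_power norm_exp_eq_Re del: fact_Suc)
  qed
  show "((\<lambda>t. fact (Suc n) / Re z ^ Suc n / t) \<longlongrightarrow> 0) at_top"
    by (intro tendsto_divide_0[OF tendsto_const] filterlim_at_top_imp_at_infinity filterlim_ident)
qed

text \<open>For complex z the variable cannot be rescaled within the reals; the recursion comes from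
  integration by parts, via antiderivatives that vanish at infinity.\<close>

lemma Laplace_power:
  fixes z :: complex
  assumes z: "Re z > 0"
  shows "(LINT t:{0<..}|lborel. of_real t ^ n * exp (- (z * of_real t))) = fact n / z ^ Suc n"
proof (induction n)
  have z0: "z \<noteq> 0" using z by auto
  have ein: "einterval 0 \<infinity> = {0<..}" by (auto simp: einterval_def)
  have FTC: "(LINT t:{0<..}|lborel. f t) = - A"
    if "\<And>t. (F has_vector_derivative f t) (at t)" "\<And>t. isCont f t" "set_integrable lborel {0<..} f"
      "(F \<longlongrightarrow> A) (at_right 0)" "(F \<longlongrightarrow> 0) at_top" for F f :: "real \<Rightarrow> complex" and A
  proof -
    have "(LBINT t=0..\<infinity>. f t) = 0 - A"
      by (rule interval_integral_FTC_integrable[where F = F])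
        (use that in \<open>auto simp: ein ereal_tendsto_simps zero_ereal_def\<close>)
    then show ?thesis by (simp add: interval_lebesgue_integral_def ein)
  qed
  {
    case 0
    have "(LINT t:{0<..}|lborel. exp (- (z * of_real t))) = - (- 1 / z)"
    proof (rule FTC)
      show "((\<lambda>t. - exp (- (z * of_real t)) / z) has_vector_derivative exp (- (z * of_real t))) (at t)" for t
        using z0 by (auto intro!: derivative_eq_intros has_vector_derivative_real_field)
      show "isCont (\<lambda>t. exp (- (z * complex_of_real t))) t" for t by (intro continuous_intros)
      show "set_integrable lborel {0<..} (\<lambda>t. exp (- (z * complex_of_real t)))"
        using Laplace_power_integrable(1)[OF z, of 0] by simp
      have "((\<lambda>t. - exp (- (z * of_real t)) / z) \<longlongrightarrow> - exp (- (z * of_real 0)) / z) (at_right 0)"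
        by (intro tendsto_intros z0)
      then show "((\<lambda>t. - exp (- (z * of_real t)) / z) \<longlongrightarrow> - 1 / z) (at_right 0)" by simp
      have "((\<lambda>t. - (complex_of_real t ^ 0 * exp (- (z * of_real t))) / z) \<longlongrightarrow> - 0 / z) at_top"
        by (intro tendsto_intros tendsto_power_exp_at_top z z0)
      then show "((\<lambda>t. - exp (- (z * of_real t)) / z) \<longlongrightarrow> 0) at_top" by simp
    qed
    then show ?case by simp
  next
    case (Suc n)
    \<comment> \<open>The derivative of -t^(n+1) exp (-z t) / z, whose boundary values are both 0;
      so its integral vanishes and links n + 1 with n.\<close>
    define f where "f = (\<lambda>t. of_real t ^ Suc n * exp (- (z * of_real t)) - of_nat (Suc n) / z * (of_real t ^ n * exp (- (z * of_real t))))"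
    have int: "set_integrable lborel {0<..} (\<lambda>t. of_real t ^ m * exp (- (z * of_real t)))" for m
      by (rule Laplace_power_integrable(1)[OF z])
    have "(LINT t:{0<..}|lborel. f t) = - 0"
    proof (rule FTC)
      show "((\<lambda>t. - (of_real t ^ Suc n * exp (- (z * of_real t))) / z) has_vector_derivative f t) (at t)" for t
      proof -
        have "((\<lambda>w. - (w ^ Suc n * exp (- (z * w))) / z) has_field_derivative f t) (at (complex_of_real t))"
          unfolding f_def
          by (rule derivative_eq_intros refl z0)+ (use z0 in \<open>simp add: field_simps\<close>)
        then show ?thesis by (rule has_vector_derivative_real_field)
      qed
      show "isCont f t" for t unfolding f_def by (intro continuous_intros z0)
      show "set_integrable lborel {0<..} f"
        unfolding f_def by (intro set_integral_diff set_integrable_mult_right int)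
      have "((\<lambda>t. - (of_real t ^ Suc n * exp (- (z * of_real t))) / z) \<longlongrightarrow> - (of_real 0 ^ Suc n * exp (- (z * of_real 0))) / z) (at_right 0)"
        by (intro tendsto_intros z0)
      then show "((\<lambda>t. - (of_real t ^ Suc n * exp (- (z * of_real t))) / z) \<longlongrightarrow> 0) (at_right 0)" by simp
      have "((\<lambda>t. - (complex_of_real t ^ Suc n * exp (- (z * of_real t))) / z) \<longlongrightarrow> - 0 / z) at_top"
        by (intro tendsto_intros tendsto_power_exp_at_top z z0)
      then show "((\<lambda>t. - (of_real t ^ Suc n * exp (- (z * of_real t))) / z) \<longlongrightarrow> 0) at_top" by simp
    qed
    moreover have "(LINT t:{0<..}|lborel. f t) = (LINT t:{0<..}|lborel. of_real t ^ Suc n * exp (- (z * of_real t)))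
        - of_nat (Suc n) / z * (LINT t:{0<..}|lborel. of_real t ^ n * exp (- (z * of_real t)))"
      unfolding f_def by (subst set_integral_diff(2)) (auto intro!: set_integrable_mult_right int simp del: power_Suc of_nat_Suc)
    ultimately show ?case unfolding Suc by (simp add: mult_ac)
  }
qed

lemma set_integral_sum_fun:
  fixes f :: "_ \<Rightarrow> _ \<Rightarrow> _ :: {banach, second_countable_topology}"
  assumes "\<And>i. i \<in> I \<Longrightarrow> set_integrable M A (f i)"
  shows "set_integrable M A (\<lambda>x. \<Sum>i\<in>I. f i x)"
    and "(LINT x:A|M. (\<Sum>i\<in>I. f i x)) = (\<Sum>i\<in>I. LINT x:A|M. f i x)"
  using assms unfolding set_integrable_def set_lebesgue_integral_def scaleR_sum_right
  by (auto intro!: Bochner_Integration.integral_sum)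

section \<open>Expansion at infinity of the shifted sums J\<close>

locale exp_expansion =
  fixes f a :: "nat \<Rightarrow> complex" and \<delta> :: complex and c :: real
  assumes f: "\<And>k. norm (f k) \<le> 1" and c: "c > 0"
    and a: "summable (\<lambda>n. norm (a n) * c ^ n)"
    and expansion: "\<And>t. 0 < t \<Longrightarrow> t \<le> c \<Longrightarrow> (\<lambda>n. a n * of_real t ^ n) sums (exp_series f t - \<delta> / of_real t)"
begin

text \<open>Valid for all t > 0, not only near 0: up to c it is the tail of a convergent series, and
  beyond c every single term is dominated by a multiple of t^n because t > c.\<close>

lemma remainder_bound:
  "\<exists>C\<ge>0. \<forall>t>0. norm (exp_series f t - \<delta> / of_real t - (\<Sum>i<n. a i * of_real t ^ i)) \<le> C * t ^ n"
proof -
  define C1 where "C1 = (\<Sum>i. norm (a (i + n)) * c ^ i)"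
  define C2 where "C2 = (1 + norm \<delta>) / c ^ Suc n + (\<Sum>i<n. norm (a i) / c ^ (n - i))"
  have s1: "summable (\<lambda>i. norm (a (i + n)) * c ^ i)"
  proof -
    have "summable (\<lambda>i. (norm (a (i + n)) * c ^ (i + n)) * (1 / c ^ n))"
      using a by (intro summable_mult2) (subst summable_iff_shift)
    then show ?thesis using c by (simp add: power_add)
  qed
  have C1: "C1 \<ge> 0" unfolding C1_def using c by (intro suminf_nonneg s1) auto
  have C2: "C2 \<ge> 0" unfolding C2_def using c by (intro add_nonneg_nonneg sum_nonneg divide_nonneg_nonneg) auto
  have "norm (exp_series f t - \<delta> / of_real t - (\<Sum>i<n. a i * of_real t ^ i)) \<le> (C1 + C2) * t ^ n" if t: "t > 0" for t
  proof (cases "t \<le> c")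
    case True
    have sm: "(\<lambda>i. a (i + n) * of_real t ^ (i + n)) sums (exp_series f t - \<delta> / of_real t - (\<Sum>i<n. a i * of_real t ^ i))"
      using sums_split_initial_segment[OF expansion[OF t True], of n] .
    have ns: "summable (\<lambda>i. t ^ n * (norm (a (i + n)) * c ^ i))" by (intro summable_mult s1)
    have le: "norm (a (i + n) * of_real t ^ (i + n)) \<le> t ^ n * (norm (a (i + n)) * c ^ i)" for i
    proof -
      have "t ^ i \<le> c ^ i" using t True by (intro power_mono) auto
      then have "norm (a (i + n)) * t ^ n * t ^ i \<le> norm (a (i + n)) * t ^ n * c ^ i"
        using t by (intro mult_left_mono) auto
      then show ?thesis using t by (simp add: norm_mult norm_power power_add mult_ac)
    qed
    have "norm (exp_series f t - \<delta> / of_real t - (\<Sum>i<n. a i * of_real t ^ i)) \<le> (\<Sum>i. t ^ n * (norm (a (i + n)) * c ^ i))"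
      unfolding sums_unique[OF sm] by (rule norm_suminf_le[OF le ns])
    also have "\<dots> = t ^ n * C1" unfolding C1_def by (rule suminf_mult[OF s1])
    also have "\<dots> \<le> (C1 + C2) * t ^ n" using C2 t by (simp add: algebra_simps)
    finally show ?thesis .
  next
    case False
    have tc: "t > c" using False by simp
    have "norm (exp_series f t) \<le> 1 / t" using norm_exp_series_le[of f t 1, OF f t] by simp
    then have "norm (exp_series f t - \<delta> / of_real t) \<le> (1 + norm \<delta>) / t"
      using t by (intro order_trans[OF norm_triangle_ineq4]) (simp add: norm_divide add_divide_distrib)
    also have "\<dots> \<le> (1 + norm \<delta>) / c ^ Suc n * t ^ n"
    proof -
      have "c * c ^ n \<le> t * t ^ n" using tc c by (intro mult_mono power_mono) auto
      then have "1 / t \<le> t ^ n / c ^ Suc n" using t c by (simp add: field_simps)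
      then have "(1 + norm \<delta>) * (1 / t) \<le> (1 + norm \<delta>) * (t ^ n / c ^ Suc n)" by (intro mult_left_mono) auto
      then show ?thesis by simp
    qed
    finally have 1: "norm (exp_series f t - \<delta> / of_real t) \<le> (1 + norm \<delta>) / c ^ Suc n * t ^ n" .
    have 2: "norm (\<Sum>i<n. a i * of_real t ^ i) \<le> (\<Sum>i<n. norm (a i) / c ^ (n - i)) * t ^ n"
      unfolding sum_distrib_right
    proof (rule sum_norm_le)
      fix i assume "i \<in> {..<n}"
      then have i: "i < n" by simp
      have "t ^ i * c ^ (n - i) \<le> t ^ i * t ^ (n - i)" using tc c by (intro mult_left_mono power_mono) auto
      also have "\<dots> = t ^ n" using i by (simp add: power_add[symmetric])
      finally have "t ^ i \<le> t ^ n / c ^ (n - i)" using c by (simp add: field_simps)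
      then have "norm (a i) * t ^ i \<le> norm (a i) * (t ^ n / c ^ (n - i))" by (intro mult_left_mono) auto
      then show "norm (a i * of_real t ^ i) \<le> norm (a i) / c ^ (n - i) * t ^ n"
        using t by (simp add: norm_mult norm_power)
    qed
    have "norm (exp_series f t - \<delta> / of_real t - (\<Sum>i<n. a i * of_real t ^ i)) \<le> C2 * t ^ n"
      using order_trans[OF norm_triangle_ineq4 add_mono[OF 1 2]] by (simp add: C2_def distrib_right)
    also have "\<dots> \<le> (C1 + C2) * t ^ n" using C1 t by (simp add: algebra_simps)
    finally show ?thesis .
  qed
  then show ?thesis using C1 C2 by (intro exI[of _ "C1 + C2"]) auto
qed

text \<open>A twisted Digamma function: for f = 1 it is Digamma (1 + y) plus the Euler-Mascheroni
  constant. Subtracting the value at y = 0 secures convergence.\<close>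

definition J :: "complex \<Rightarrow> complex" where
  "J y = (\<Sum>k. f k * (1 / of_nat (Suc k) - 1 / (of_nat (Suc k) + y)))"

lemma summable_J:
  assumes "Re y \<ge> 0"
  shows "summable (\<lambda>k. f k * (1 / of_nat (Suc k) - 1 / (of_nat (Suc k) + y)))"
proof (rule summable_comparison_test'[OF summable_mult[OF summable_inverse_power_Suc[of 2]]])
  fix k
  define K where "K = (of_nat (Suc k) :: complex)"
  have "real (Suc k) \<le> Re (K + y)" using assms by (simp add: K_def)
  also have "\<dots> \<le> norm (K + y)" by (rule complex_Re_le_cmod)
  finally have Ky: "real (Suc k) \<le> norm (K + y)" .
  have K: "norm K = real (Suc k)" "K \<noteq> 0" unfolding K_def by (simp_all del: of_nat_Suc)
  have "K + y \<noteq> 0" using Ky by auto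
  then have "1 / K - 1 / (K + y) = y / (K * (K + y))" using K by (simp add: divide_simps)
  then have "norm (f k * (1 / K - 1 / (K + y))) = norm (f k) * (norm y / (real (Suc k) * norm (K + y)))"
    by (simp add: norm_mult norm_divide K)
  also have "\<dots> \<le> 1 * (norm y / (real (Suc k) * real (Suc k)))"
    using Ky f[of k] by (intro mult_mono divide_left_mono mult_pos_pos) (auto simp del: of_nat_Suc intro: less_le_trans)
  finally show "norm (f k * (1 / of_nat (Suc k) - 1 / (of_nat (Suc k) + y))) \<le> norm y * (1 / real (Suc k) ^ 2)"
    by (simp add: K_def power2_eq_square del: of_nat_Suc)
qed simp

text \<open>The Laplace kernel of \<open>J y - J (\<mu> * y)\<close>. Unlike a single exponential it
  vanishes at t = 0, which makes the polar part \<delta> / t integrable.\<close>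

definition exp_diff_kernel :: "real \<Rightarrow> complex \<Rightarrow> real \<Rightarrow> complex" where
  "exp_diff_kernel \<mu> y t = exp (- (of_real \<mu> * y * of_real t)) - exp (- (y * of_real t))"

lemma exp_diff_kernel_bound:
  assumes \<mu>: "\<mu> > 1" and y: "Re y > 0"
  shows "\<exists>K\<ge>0. \<forall>t>0. norm (exp_diff_kernel \<mu> y t) \<le> K * t * exp (- (Re y * t))"
proof -
  define B where "B = (\<mu> - 1) * norm y"
  \<comment> \<open>The entry B exp B comes from the Taylor estimate for t <= 1; for t > 1 the
    trivial bound 2 is at most 2t.\<close>
  define K where "K = max 2 (B * exp B)"
  have B: "B \<ge> 0" using \<mu> by (simp add: B_def)
  have "norm (exp_diff_kernel \<mu> y t) \<le> K * t * exp (- (Re y * t))" if t: "t > 0" for t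
  proof -
    define w where "w = - (of_real (\<mu> - 1) * y * of_real t)"
    have "exp_diff_kernel \<mu> y t = exp (- (y * of_real t)) * (exp w - 1)"
      unfolding exp_diff_kernel_def w_def right_diff_distrib exp_add[symmetric] by (simp add: algebra_simps)
    then have e: "norm (exp_diff_kernel \<mu> y t) = exp (- (Re y * t)) * norm (exp w - 1)"
      by (simp add: norm_mult norm_exp_eq_Re)
    have "norm (exp w - 1) \<le> K * t"
    proof (cases "t \<le> 1")
      case True
      have nw: "norm w = B * t"
        unfolding w_def B_def norm_minus_cancel norm_mult norm_of_real using \<mu> t by simp
      have "norm (exp w - (\<Sum>k\<le>0. w ^ k / fact k)) \<le> exp \<bar>Re w\<bar> * norm w ^ Suc 0 / fact 0"
        by (rule Taylor_exp)
      then have "norm (exp w - 1) \<le> exp \<bar>Re w\<bar> * norm w" by simp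
      also have "\<dots> \<le> exp B * (B * t)"
        unfolding nw using abs_Re_le_cmod[of w] nw B t True mult_left_le[of t B]
        by (intro mult_right_mono) auto
      also have "\<dots> \<le> K * t" using t by (simp add: K_def mult_ac)
      finally show ?thesis .
    next
      case False
      have "Re w \<le> 0" using \<mu> y t by (simp add: w_def mult_nonneg_nonneg)
      then have "norm (exp w) \<le> 1" by (simp add: norm_exp_eq_Re)
      then have "norm (exp w - 1) \<le> 2" using norm_triangle_ineq4[of "exp w" 1] by (simp only: norm_one)
      also have "\<dots> \<le> 2 * t" using False by simp
      also have "\<dots> \<le> K * t" using t by (simp add: K_def)
      finally show ?thesis .
    qed
    then have "exp (- (Re y * t)) * norm (exp w - 1) \<le> exp (- (Re y * t)) * (K * t)" by (intro mult_left_mono) auto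
    then show ?thesis unfolding e by (simp add: mult_ac)
  qed
  then show ?thesis by (intro exI[of _ K]) (auto simp: K_def)
qed

lemma J_diff_integral:
  assumes \<mu>: "\<mu> > 1" and y: "Re y > 0"
  shows "set_integrable lborel {0<..} (\<lambda>t. exp_series f t * exp_diff_kernel \<mu> y t)"
    and "J y - J (of_real \<mu> * y) = (LINT t:{0<..}|lborel. exp_series f t * exp_diff_kernel \<mu> y t)"
proof -
  obtain K where K: "K \<ge> 0" "\<And>t. t > 0 \<Longrightarrow> norm (exp_diff_kernel \<mu> y t) \<le> K * t * exp (- (Re y * t))"
    using exp_diff_kernel_bound[OF assms] by blast
  have \<mu>y: "Re (of_real \<mu> * y) > 0" using \<mu> y by simp
  define F where "F = (\<lambda>k t. indicator {0<..} t *\<^sub>R (f k * of_real (exp (- (real (Suc k) * t))) * exp_diff_kernel \<mu> y t))"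
  define H where "H = (\<lambda>z t. indicator {0<..} t *\<^sub>R (exp (- (z * complex_of_real t))))"
  have H: "integrable lborel (H z)" "integral\<^sup>L lborel (H z) = 1 / z" if "Re z > 0" for z
    using Laplace_power_integrable(1)[OF that, of 0] Laplace_power[OF that, of 0]
    unfolding H_def set_integrable_def set_lebesgue_integral_def by simp_all
  have FH: "F k t = f k * (H (of_nat (Suc k) + of_real \<mu> * y) t - H (of_nat (Suc k) + y) t)" for k t
  proof -
    have e: "complex_of_real (exp (- (real (Suc k) * t))) * exp (- (z * of_real t)) = exp (- ((of_nat (Suc k) + z) * of_real t))" for z
      unfolding exp_of_real[symmetric] exp_add[symmetric]
      by (rule arg_cong[of _ _ exp]) (simp add: algebra_simps)
    show ?thesis
      unfolding F_def H_def exp_diff_kernel_def e[symmetric] by (simp add: scaleR_diff_right algebra_simps)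
  qed
  have Rk: "Re (of_nat (Suc k) + of_real \<mu> * y) > 0" "Re (of_nat (Suc k) + y) > 0" for k
    using y \<mu>y by (simp_all add: add_pos_pos)
  have 1: "integrable lborel (F k)" for k
    unfolding FH using H(1)[OF Rk(1)[of k]] H(1)[OF Rk(2)[of k]] by simp
  have I: "integral\<^sup>L lborel (F k) = f k * (1 / (of_nat (Suc k) + of_real \<mu> * y) - 1 / (of_nat (Suc k) + y))" for k
    unfolding FH using H[OF Rk(1)[of k]] H[OF Rk(2)[of k]] by simp
  have 2: "AE t in lborel. summable (\<lambda>k. norm (F k t))"
  proof (intro AE_I2)
    fix t :: real
    show "summable (\<lambda>k. norm (F k t))"
    proof (cases "t > 0")
      case True
      have "summable (\<lambda>k. norm (f k * complex_of_real (exp (- (real (Suc k) * t)))) * norm (exp_diff_kernel \<mu> y t))"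
        by (intro summable_mult2 summable_exp_series f True)
      then show ?thesis using True by (simp add: F_def norm_mult del: of_nat_Suc)
    qed (simp add: F_def)
  qed
  \<comment> \<open>The zero of the kernel at t = 0 supplies a factor t, and the integral of t exp
    (-(k+1) t) is 1 / (k+1)^2.\<close>
  have 3: "summable (\<lambda>k. \<integral>t. norm (F k t) \<partial>lborel)"
  proof (rule summable_comparison_test'[OF summable_mult[OF summable_inverse_power_Suc[of 2]]])
    fix k
    have rk: "Re (of_nat (Suc k)) > 0" by simp
    define G where "G = (\<lambda>t::real. indicator {0<..} t *\<^sub>R (t ^ 1 * exp (- (real (Suc k) * t))))"
    have G: "integrable lborel G" "integral\<^sup>L lborel G = 1 / real (Suc k) ^ 2"
      using Laplace_power_integrable(2,3)[OF rk, of 1]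
      unfolding G_def set_integrable_def set_lebesgue_integral_def
      by (simp_all add: numeral_2_eq_2 del: of_nat_Suc)
    have "(\<integral>t. norm (F k t) \<partial>lborel) \<le> (\<integral>t. K * G t \<partial>lborel)"
    proof (rule integral_mono)
      fix t :: real
      show "norm (F k t) \<le> K * G t"
      proof (cases "t > 0")
        case True
        have "norm (exp_diff_kernel \<mu> y t) \<le> K * t * exp (- (Re y * t))" using K(2)[OF True] .
        also have "\<dots> \<le> K * t * 1" using y True K(1) by (intro mult_left_mono) auto
        finally have e: "norm (exp_diff_kernel \<mu> y t) \<le> K * t" by simp
        have "norm (F k t) = norm (f k) * exp (- (real (Suc k) * t)) * norm (exp_diff_kernel \<mu> y t)"
          using True by (simp add: F_def norm_mult del: of_nat_Suc)
        also have "\<dots> \<le> 1 * exp (- (real (Suc k) * t)) * (K * t)"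
          using f[of k] e by (intro mult_mono) auto
        finally show ?thesis using True by (simp add: G_def mult_ac del: of_nat_Suc)
      qed (simp add: F_def G_def)
    qed (use 1 G in auto)
    then show "norm (\<integral>t. norm (F k t) \<partial>lborel) \<le> K * (1 / real (Suc k) ^ 2)" using G by simp
  qed simp
  have S: "(\<Sum>k. F k t) = indicator {0<..} t *\<^sub>R (exp_series f t * exp_diff_kernel \<mu> y t)" for t
  proof (cases "t > 0")
    case True
    then show ?thesis
      using suminf_mult2[OF summable_norm_cancel[OF summable_exp_series[of f, OF f True]], of "exp_diff_kernel \<mu> y t"]
      by (simp add: F_def exp_series_def del: of_nat_Suc)
  qed (simp add: F_def)
  show "set_integrable lborel {0<..} (\<lambda>t. exp_series f t * exp_diff_kernel \<mu> y t)"
    using integrable_suminf[OF 1 2 3] unfolding S set_integrable_def .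
  have "J y - J (of_real \<mu> * y) = (\<Sum>k. f k * (1 / of_nat (Suc k) - 1 / (of_nat (Suc k) + y))
      - f k * (1 / of_nat (Suc k) - 1 / (of_nat (Suc k) + of_real \<mu> * y)))"
    unfolding J_def using y \<mu>y by (intro suminf_diff summable_J) auto
  also have "\<dots> = (\<Sum>k. integral\<^sup>L lborel (F k))"
    unfolding I by (rule suminf_cong) (simp add: algebra_simps)
  also have "\<dots> = (LINT t:{0<..}|lborel. exp_series f t * exp_diff_kernel \<mu> y t)"
    using integral_suminf[OF 1 2 3] unfolding S set_lebesgue_integral_def by simp
  finally show "J y - J (of_real \<mu> * y) = (LINT t:{0<..}|lborel. exp_series f t * exp_diff_kernel \<mu> y t)" .
qed

text \<open>The measure dt/t is invariant under scaling. Hence the polar part contributes a constant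
  independent of R, the trace of the logarithm that \<open>log_asym\<close> permits.\<close>

lemma Frullani_scale_invariant:
  assumes "R > 0"
  shows "(LINT t:{0<..}|lborel. exp_diff_kernel \<mu> (y * of_real R) t / of_real t) = (LINT t:{0<..}|lborel. exp_diff_kernel \<mu> y t / of_real t)"
proof -
  define g where "g = (\<lambda>t. indicator {0<..} t *\<^sub>R (exp_diff_kernel \<mu> y t / of_real t))"
  have "R *\<^sub>R g (0 + R * t) = indicator {0<..} t *\<^sub>R (exp_diff_kernel \<mu> (y * of_real R) t / of_real t)" for t
    using assms by (auto simp: g_def exp_diff_kernel_def indicator_def zero_less_mult_iff scaleR_conv_of_real mult_ac)
  then have "(LINT t:{0<..}|lborel. exp_diff_kernel \<mu> (y * of_real R) t / of_real t) = R *\<^sub>R (\<integral>t. g (0 + R * t) \<partial>lborel)"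
    unfolding set_lebesgue_integral_def by (subst integral_scaleR_right[symmetric]) simp
  also have "\<dots> = integral\<^sup>L lborel g"
    using lborel_integral_real_affine[of R g 0] assms by simp
  finally show ?thesis unfolding g_def set_lebesgue_integral_def .
qed

text \<open>Watson's lemma: the expansion of the exponential series at 0 is integrated term by term.
  The power t^i gives i! times a difference of inverse powers of order i + 1, the remainder O(t^n)
  gives O(R^(-n-1)), and the polar part gives the constant d.\<close>

theorem J_diff_expansion:
  assumes \<mu>: "\<mu> > 1" and y: "Re y > 0"
  shows "\<exists>d. asym_expansion (\<lambda>R. J (y * of_real R) - J (of_real \<mu> * (y * of_real R)) - d)
    (\<lambda>i. (1 - 1 / of_real \<mu> ^ i) * (if i = 0 then 0 else - fact (i - 1) * a (i - 1) / y ^ i))"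
proof (rule exI[of _ "\<delta> * (LINT t:{0<..}|lborel. exp_diff_kernel \<mu> y t / of_real t)"], rule asymI_cofinal)
  fix n
  define u where "u = (\<lambda>i. (1 - 1 / of_real \<mu> ^ i) * (if i = 0 then 0 else - fact (i - 1) * a (i - 1) / y ^ i))"
  define W where "W = (LINT t:{0<..}|lborel. exp_diff_kernel \<mu> y t / of_real t)"
  obtain C where C: "C \<ge> 0" "\<And>t. t > 0 \<Longrightarrow> norm (exp_series f t - \<delta> / of_real t - (\<Sum>i<n. a i * of_real t ^ i)) \<le> C * t ^ n"
    using remainder_bound[of n] by blast
  define r where "r = (\<lambda>t. exp_series f t - \<delta> / of_real t - (\<Sum>i<n. a i * of_real t ^ i))"
  have "norm (J (y * of_real R) - J (of_real \<mu> * (y * of_real R)) - \<delta> * W - (\<Sum>i<Suc n. u i / of_real R ^ i))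
      \<le> (2 * C * fact n / Re y ^ Suc n) / R ^ Suc n" if R: "R > 0" for R
  proof -
    define z where "z = y * of_real R"
    have z: "Re z > 0" "z \<noteq> 0" using y R by (auto simp: z_def)
    have \<mu>z: "Re (of_real \<mu> * z) > 0" using \<mu> z by simp
    obtain K where K: "K \<ge> 0" "\<And>t. t > 0 \<Longrightarrow> norm (exp_diff_kernel \<mu> z t) \<le> K * t * exp (- (Re z * t))"
      using exp_diff_kernel_bound[OF \<mu> z(1)] by blast
    have [measurable]: "(\<lambda>t. exp_diff_kernel \<mu> z t) \<in> borel_measurable borel"
      unfolding exp_diff_kernel_def by (intro borel_measurable_continuous_onI continuous_intros)
    have i1: "set_integrable lborel {0<..} (\<lambda>t. exp_diff_kernel \<mu> z t / of_real t)"
      unfolding set_integrable_def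
    proof (rule Bochner_Integration.integrable_bound)
      show "integrable lborel (\<lambda>t. K * (indicator {0<..} t *\<^sub>R (t ^ 0 * exp (- (Re z * t)))))"
        using Laplace_power_integrable(3)[OF z(1), of 0] unfolding set_integrable_def by (rule integrable_mult_right)
      show "AE t in lborel. norm (indicator {0<..} t *\<^sub>R (exp_diff_kernel \<mu> z t / of_real t))
          \<le> norm (K * (indicator {0<..} t *\<^sub>R (t ^ 0 * exp (- (Re z * t)))))"
        using K by (intro AE_I2) (auto simp: indicator_def norm_divide divide_le_eq mult_ac abs_mult)
    qed measurable
    have i2: "set_integrable lborel {0<..} (\<lambda>t. of_real t ^ i * exp_diff_kernel \<mu> z t)"
      and v2: "(LINT t:{0<..}|lborel. of_real t ^ i * exp_diff_kernel \<mu> z t) = fact i / (of_real \<mu> * z) ^ Suc i - fact i / z ^ Suc i" for i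
    proof -
      have *: "of_real t ^ i * exp_diff_kernel \<mu> z t = of_real t ^ i * exp (- (of_real \<mu> * z * of_real t)) - of_real t ^ i * exp (- (z * of_real t))" for t
        by (simp add: exp_diff_kernel_def right_diff_distrib)
      show "set_integrable lborel {0<..} (\<lambda>t. of_real t ^ i * exp_diff_kernel \<mu> z t)"
        unfolding * by (intro set_integral_diff Laplace_power_integrable(1) z \<mu>z)
      show "(LINT t:{0<..}|lborel. of_real t ^ i * exp_diff_kernel \<mu> z t) = fact i / (of_real \<mu> * z) ^ Suc i - fact i / z ^ Suc i"
        unfolding * using Laplace_power_integrable(1)[OF z(1), of i] Laplace_power_integrable(1)[OF \<mu>z, of i]
        by (subst set_integral_diff(2)) (simp_all only: Laplace_power[OF z(1)] Laplace_power[OF \<mu>z])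
    qed
    have i3: "set_integrable lborel {0<..} (\<lambda>t. \<delta> * (exp_diff_kernel \<mu> z t / of_real t) + (\<Sum>i<n. a i * (of_real t ^ i * exp_diff_kernel \<mu> z t)))"
      by (intro set_integral_add set_integrable_mult_right i1 set_integral_sum_fun(1) i2)
    have v3: "(LINT t:{0<..}|lborel. \<delta> * (exp_diff_kernel \<mu> z t / of_real t) + (\<Sum>i<n. a i * (of_real t ^ i * exp_diff_kernel \<mu> z t)))
       = \<delta> * W + (\<Sum>i<n. a i * (fact i / (of_real \<mu> * z) ^ Suc i - fact i / z ^ Suc i))"
    proof -
      have "(LINT t:{0<..}|lborel. \<delta> * (exp_diff_kernel \<mu> z t / of_real t) + (\<Sum>i<n. a i * (of_real t ^ i * exp_diff_kernel \<mu> z t)))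
        = (LINT t:{0<..}|lborel. \<delta> * (exp_diff_kernel \<mu> z t / of_real t)) + (LINT t:{0<..}|lborel. (\<Sum>i<n. a i * (of_real t ^ i * exp_diff_kernel \<mu> z t)))"
        by (intro set_integral_add(2) set_integrable_mult_right i1 set_integral_sum_fun(1) i2)
      also have "(LINT t:{0<..}|lborel. \<delta> * (exp_diff_kernel \<mu> z t / of_real t)) = \<delta> * W"
        unfolding W_def z_def set_integral_mult_right Frullani_scale_invariant[OF R, of \<mu> y] ..
      also have "(LINT t:{0<..}|lborel. (\<Sum>i<n. a i * (of_real t ^ i * exp_diff_kernel \<mu> z t)))
          = (\<Sum>i<n. LINT t:{0<..}|lborel. a i * (of_real t ^ i * exp_diff_kernel \<mu> z t))"
        by (intro set_integral_sum_fun(2) set_integrable_mult_right i2)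
      finally show ?thesis by (simp only: set_integral_mult_right v2)
    qed
    have r: "r t * exp_diff_kernel \<mu> z t = exp_series f t * exp_diff_kernel \<mu> z t
        - (\<delta> * (exp_diff_kernel \<mu> z t / of_real t) + (\<Sum>i<n. a i * (of_real t ^ i * exp_diff_kernel \<mu> z t)))" for t
      unfolding r_def left_diff_distrib sum_distrib_right by (simp add: mult.assoc)
    have ir: "set_integrable lborel {0<..} (\<lambda>t. r t * exp_diff_kernel \<mu> z t)"
      unfolding r by (intro set_integral_diff J_diff_integral(1) \<mu> z i3)
    have "(LINT t:{0<..}|lborel. r t * exp_diff_kernel \<mu> z t) = (J z - J (of_real \<mu> * z))
        - (\<delta> * W + (\<Sum>i<n. a i * (fact i / (of_real \<mu> * z) ^ Suc i - fact i / z ^ Suc i)))"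
      unfolding r J_diff_integral(2)[OF \<mu> z(1)] v3[symmetric]
      by (intro set_integral_diff(2) J_diff_integral(1) \<mu> z i3)
    also have "(\<Sum>i<n. a i * (fact i / (of_real \<mu> * z) ^ Suc i - fact i / z ^ Suc i)) = (\<Sum>i<Suc n. u i / of_real R ^ i)"
    proof -
      have "u 0 = 0" by (simp add: u_def)
      moreover have "a i * (fact i / (of_real \<mu> * z) ^ Suc i - fact i / z ^ Suc i) = u (Suc i) / of_real R ^ Suc i" for i
        using \<mu> R by (simp add: u_def z_def power_mult_distrib algebra_simps diff_divide_distrib)
      ultimately show ?thesis by (subst sum.lessThan_Suc_shift) (simp del: power_Suc)
    qed
    finally have "J z - J (of_real \<mu> * z) - \<delta> * W - (\<Sum>i<Suc n. u i / of_real R ^ i) = (LINT t:{0<..}|lborel. r t * exp_diff_kernel \<mu> z t)"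
      by (simp add: algebra_simps)
    also have "norm \<dots> \<le> (LINT t:{0<..}|lborel. norm (r t * exp_diff_kernel \<mu> z t))"
      by (rule set_integral_norm_bound[OF ir])
    also have "\<dots> \<le> (LINT t:{0<..}|lborel. 2 * C * (t ^ n * exp (- (Re z * t))))"
    proof (rule set_integral_mono)
      fix t :: real assume "t \<in> {0<..}"
      then have t: "t > 0" by simp
      have "Re z * t \<le> \<mu> * (Re z * t)" using mult_right_mono[of 1 \<mu> "Re z * t"] mult_pos_pos[OF z(1) t] \<mu> by simp
      then have "norm (exp (- (of_real \<mu> * z * of_real t))) \<le> exp (- (Re z * t))"
        by (simp add: norm_exp_eq_Re mult.assoc)
      then have "norm (exp_diff_kernel \<mu> z t) \<le> 2 * exp (- (Re z * t))"
        unfolding exp_diff_kernel_def by (intro order_trans[OF norm_triangle_ineq4]) (simp add: norm_exp_eq_Re)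
      then have "norm (r t) * norm (exp_diff_kernel \<mu> z t) \<le> (C * t ^ n) * (2 * exp (- (Re z * t)))"
        using C t unfolding r_def by (intro mult_mono) auto
      then show "norm (r t * exp_diff_kernel \<mu> z t) \<le> 2 * C * (t ^ n * exp (- (Re z * t)))"
        by (simp add: norm_mult mult_ac)
    qed (auto intro!: set_integrable_norm ir set_integrable_mult_right Laplace_power_integrable(3) z)
    also have "\<dots> = 2 * C * (fact n / Re z ^ Suc n)"
      by (simp only: set_integral_mult_right Laplace_power_integrable(2)[OF z(1)])
    also have "\<dots> = (2 * C * fact n / Re y ^ Suc n) / R ^ Suc n"
      by (simp add: z_def power_mult_distrib)
    finally show ?thesis unfolding z_def .
  qed
  then have "\<forall>\<^sub>F R in at_top. norm (J (y * of_real R) - J (of_real \<mu> * (y * of_real R)) - \<delta> * W - (\<Sum>i<Suc n. u i / of_real R ^ i))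
      \<le> (2 * C * fact n / Re y ^ Suc n) / R ^ Suc n"
    using eventually_gt_at_top[of 0] by (rule eventually_mono[rotated])
  then show "\<exists>m\<ge>n. \<exists>K. \<forall>\<^sub>F R in at_top. norm (J (y * of_real R) - J (of_real \<mu> * (y * of_real R))
      - \<delta> * (LINT t:{0<..}|lborel. exp_diff_kernel \<mu> y t / of_real t)
      - (\<Sum>i<m. (1 - 1 / of_real \<mu> ^ i) * (if i = 0 then 0 else - fact (i - 1) * a (i - 1) / y ^ i) / of_real R ^ i)) \<le> K / R ^ m"
    unfolding u_def W_def using le_SucI[OF order_refl, of n] by blast
qed

corollary log_asym_J:
  assumes y: "Re y > 0" and s: "s > 0"
  shows "log_asym (\<lambda>R. J (y * of_real R ^ s))
    (\<lambda>i. if i > 0 \<and> s dvd i then - fact (i div s - 1) * a (i div s - 1) / y ^ (i div s) else 0)"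
proof -
  \<comment> \<open>Doubling R multiplies R^s by 2^s, so this ratio produces the difference between
    R and 2R.\<close>
  define \<mu> where "\<mu> = (2 :: real) ^ s"
  have \<mu>: "\<mu> > 1" using s by (simp add: \<mu>_def)
  obtain d where d: "asym_expansion (\<lambda>R. J (y * of_real R) - J (of_real \<mu> * (y * of_real R)) - d)
    (\<lambda>i. (1 - 1 / of_real \<mu> ^ i) * (if i = 0 then 0 else - fact (i - 1) * a (i - 1) / y ^ i))"
    using J_diff_expansion[OF \<mu> y] by blast
  from asym_power_subst[OF d s]
  have "asym_expansion (\<lambda>R. J (y * of_real (R ^ s)) - J (of_real \<mu> * (y * of_real (R ^ s))) - d)
    (\<lambda>i. if s dvd i then (1 - 1 / of_real \<mu> ^ (i div s)) * (if i div s = 0 then 0 else - fact (i div s - 1) * a (i div s - 1) / y ^ (i div s)) else 0)" .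
  moreover have "(if s dvd i then (1 - 1 / of_real \<mu> ^ (i div s)) * (if i div s = 0 then 0 else - fact (i div s - 1) * a (i div s - 1) / y ^ (i div s)) else 0)
     = (1 - 1 / 2 ^ i) * (if i > 0 \<and> s dvd i then - fact (i div s - 1) * a (i div s - 1) / y ^ (i div s) else 0)" for i
  proof (cases "s dvd i")
    case True
    then obtain j where j: "i = s * j" by blast
    then show ?thesis using s by (auto simp: \<mu>_def power_mult)
  qed simp
  moreover have "J (of_real \<mu> * (y * of_real (R ^ s))) = J (y * of_real (2 * R) ^ s)" for R
    by (rule arg_cong[of _ _ J]) (simp add: \<mu>_def power_mult_distrib mult_ac)
  ultimately show ?thesis unfolding log_asym_def by (intro exI[of _ d]) simp
qed

end

context even_primitive_character
begin

lemma exp_expansion_chi: "exp_expansion (\<lambda>k. chi (int (Suc k))) exp_coeff pole_coeff (pi / real q)"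
  using norm_chi_le_1 modulus_pos summable_exp_coeff exp_series_chi_expansion by unfold_locales auto

end

interpretation trivial_exp: exp_expansion "\<lambda>_. 1" trivial.exp_coeff trivial.pole_coeff pi
  using trivial.exp_expansion_chi by simp

text \<open>A 2N-th root of i: for c = \<open>generic_dir p\<close> times R one has c^(2N) = i
  R^(2N), the parameter C of the weights.\<close>

definition generic_dir :: "nat \<Rightarrow> complex" where
  "generic_dir p = exp (\<i> * of_real (pi / (4 * real (2 * p + 1))))"

lemma norm_generic_dir: "norm (generic_dir p) = 1"
  by (simp add: generic_dir_def)

lemma generic_dir_power: "generic_dir p ^ (2 * (2 * p + 1)) = \<i>"
proof -
  define D where "D = real (2 * p + 1)"
  have D: "D > 0" by (simp add: D_def)
  have "generic_dir p ^ (2 * (2 * p + 1)) = exp (of_nat (2 * (2 * p + 1)) * (\<i> * of_real (pi / (4 * D))))"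
    unfolding generic_dir_def exp_of_nat_mult D_def ..
  also have "of_nat (2 * (2 * p + 1)) = complex_of_real (2 * D)" by (simp add: D_def)
  also have "complex_of_real (2 * D) * (\<i> * of_real (pi / (4 * D))) = \<i> * of_real (2 * D * (pi / (4 * D)))"
    by (simp add: mult_ac)
  also have "2 * D * (pi / (4 * D)) = pi / 2" using D by (simp add: field_simps)
  finally have "generic_dir p ^ (2 * (2 * p + 1)) = exp (\<i> * of_real (pi / 2))" .
  then show ?thesis by (simp add: exp_eq_polar)
qed

text \<open>The argument is pi (1 - 4j) / (4N). Its size stays below pi/2 because |1 - 4j| <= 4p + 1
  < 2N, and it is nonzero because 1 - 4j is odd. The first fact gives exponential decay, the second
  allows the choice of half plane in \<open>root_sign\<close>.\<close>

lemma generic_dir_root_dir: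
  fixes p :: nat
  assumes j: "j \<in> {- int p..int p}"
  shows "Re (generic_dir p * root_dir (2 * p + 1) j) > 0" "Im (generic_dir p * root_dir (2 * p + 1) j) \<noteq> 0"
proof -
  define t where "t = pi * ((1 - 4 * of_int j) / (4 * real (2 * p + 1)))"
  have "generic_dir p * root_dir (2 * p + 1) j = exp (\<i> * of_real t)"
  proof -
    define D where "D = real (2 * p + 1)"
    have D: "D > 0" by (simp add: D_def)
    have "pi / (4 * D) - pi * of_int j / D = t" unfolding t_def D_def[symmetric] using D by (simp add: field_simps)
    then have "\<i> * of_real (pi / (4 * D)) + - \<i> * of_real (pi * of_int j / D) = \<i> * complex_of_real t"
      by (metis minus_mult_left diff_conv_add_uminus of_real_diff right_diff_distrib)
    then show ?thesis unfolding generic_dir_def root_dir_def exp_add[symmetric] D_def by (rule arg_cong)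
  qed
  then have e: "generic_dir p * root_dir (2 * p + 1) j = cis t" by (simp add: cis_conv_exp)
  have "\<bar>1 - 4 * of_int j :: real\<bar> \<le> 4 * real p + 1" using j by (auto simp: abs_le_iff)
  then have "\<bar>(1 - 4 * of_int j) / (4 * real (2 * p + 1))\<bar> \<le> (4 * real p + 1) / (4 * real (2 * p + 1))"
    unfolding abs_divide by (simp add: divide_right_mono)
  also have "\<dots> < 1 / 2" by (simp add: divide_simps)
  finally have "pi * \<bar>(1 - 4 * of_int j) / (4 * real (2 * p + 1))\<bar> < pi * (1 / 2)"
    by (intro mult_strict_left_mono) auto
  then have t: "\<bar>t\<bar> < pi / 2" unfolding t_def abs_mult by simp
  then show "Re (generic_dir p * root_dir (2 * p + 1) j) > 0"
    unfolding e by (simp add: abs_less_iff) (intro cos_gt_zero_pi, auto)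
  have "1 - 4 * j \<noteq> 0" by presburger
  then have "(1 - 4 * of_int j :: real) \<noteq> 0" by linarith
  then have t0: "t \<noteq> 0" by (simp add: t_def)
  have "sin t \<noteq> 0"
  proof (cases "t > 0")
    case True
    then show ?thesis using sin_gt_zero[of t] t by auto
  next
    case False
    then show ?thesis using sin_gt_zero[of "- t"] t t0 by auto
  qed
  then show "Im (generic_dir p * root_dir (2 * p + 1) j) \<noteq> 0" unfolding e by simp
qed

lemma norm_imaginary_add_real:
  fixes S X :: real
  shows "\<bar>S\<bar> \<le> norm (\<i> * of_real S + of_real X)" "\<bar>X\<bar> \<le> norm (\<i> * of_real S + of_real X)"
  using abs_Im_le_cmod[of "\<i> * of_real S + of_real X"] abs_Re_le_cmod[of "\<i> * of_real S + of_real X"] by simp_all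

text \<open>Weighting with \<open>C / (C + X\<^sub>n)\<close> for \<open>C = i R\<^sup>2\<^sup>N\<close> and expanding in powers of \<open>1 / C\<close> recovers
  all moments of the weights \<open>w\<close>; as \<open>C\<close> is imaginary, no denominator is small.\<close>
lemma weighted_sum_expansion:
  fixes w :: "nat \<Rightarrow> complex" and X :: "nat \<Rightarrow> real"
  assumes s: "s > 0" and w: "\<And>j. summable (\<lambda>n. norm (w n) * \<bar>X n\<bar> ^ j)"
  shows "asym_expansion (\<lambda>R. \<Sum>n. w n * (\<i> * of_real R ^ s / (\<i> * of_real R ^ s + of_real (X n))))
    (\<lambda>i. if s dvd i then (\<Sum>n. w n * of_real (- X n) ^ (i div s)) / \<i> ^ (i div s) else 0)"
proof (rule asymI_cofinal)
  fix m
  define M where "M = (\<lambda>j. \<Sum>n. w n * of_real (- X n) ^ j)"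
  have Msums: "(\<lambda>n. w n * of_real (- X n) ^ j) sums M j" for j
    unfolding M_def by (rule summable_sums, rule summable_norm_cancel)
      (use w[of j] in \<open>simp add: norm_mult norm_power\<close>)
  define K where "K = (\<Sum>n. norm (w n) * \<bar>X n\<bar> ^ m)"
  have "norm ((\<Sum>n. w n * (\<i> * of_real R ^ s / (\<i> * of_real R ^ s + of_real (X n)))) -
      (\<Sum>i<s * m. (if s dvd i then M (i div s) / \<i> ^ (i div s) else 0) / of_real R ^ i)) \<le> K / R ^ (s * m)" if R: "R > 0" for R
  proof -
    define C where "C = \<i> * of_real (R ^ s)"
    have C0: "C \<noteq> 0" and nC: "norm C = R ^ s" using R by (simp_all add: C_def norm_mult norm_power)
    have CX: "C + of_real (X n) \<noteq> 0" "norm (C / (C + of_real (X n))) \<le> 1" for n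
    proof -
      have "R ^ s \<le> norm (C + of_real (X n))"
        using norm_imaginary_add_real(1)[of "R ^ s" "X n"] R by (simp add: C_def)
      moreover have "R ^ s > 0" using R by simp
      ultimately show "C + of_real (X n) \<noteq> 0" "norm (C / (C + of_real (X n))) \<le> 1"
        unfolding norm_divide nC by (auto simp: divide_le_eq)
    qed
    \<comment> \<open>A finite geometric sum with exact remainder, valid also when |x| exceeds |C|.
      The remainder contains the original quotient, which is bounded by 1 at the points in
      question.\<close>
    have geo: "C / (C + x) = (\<Sum>j<m. (- x) ^ j / C ^ j) + (- x) ^ m / C ^ m * (C / (C + x))" if "C + x \<noteq> 0" for x
    proof -
      have r: "1 - - x / C \<noteq> 0" "C / (C + x) = 1 / (1 - - x / C)" using C0 that by (auto simp: field_simps)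
      have "(\<Sum>j<m. (- x) ^ j / C ^ j) = (\<Sum>j<m. (- x / C) ^ j)" by (simp only: power_divide)
      also have "\<dots> = (1 - (- x / C) ^ m) / (1 - - x / C)"
      proof -
        have "- x / C \<noteq> 1" using r(1) by (metis diff_self)
        then show ?thesis using sum_gp_strict[of "- x / C" m] by (simp only: if_False)
      qed
      finally have "(\<Sum>j<m. (- x) ^ j / C ^ j) = (1 - (- x / C) ^ m) * (C / (C + x))" unfolding r(2) by simp
      moreover have "(- x) ^ m / C ^ m = (- x / C) ^ m" by (simp only: power_divide)
      moreover have "G = (1 - T) * G + T * G" for G T :: complex by (simp add: algebra_simps)
      ultimately show ?thesis by (simp only:)
    qed
    have sr: "summable (\<lambda>n. norm (w n * (of_real (- X n) ^ m / C ^ m * (C / (C + of_real (X n))))))"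
    proof (rule summable_comparison_test'[OF summable_mult[OF w[of m]]])
      fix n
      have "norm (w n * (of_real (- X n) ^ m / C ^ m * (C / (C + of_real (X n))))) =
          (norm (w n) * \<bar>X n\<bar> ^ m) / (R ^ s) ^ m * norm (C / (C + of_real (X n)))"
        by (simp add: norm_mult norm_divide norm_power nC)
      also have "\<dots> \<le> (norm (w n) * \<bar>X n\<bar> ^ m) / (R ^ s) ^ m * 1"
        using CX(2)[of n] R by (intro mult_left_mono) auto
      finally show "norm (norm (w n * (of_real (- X n) ^ m / C ^ m * (C / (C + of_real (X n)))))) \<le> 1 / R ^ (s * m) * (norm (w n) * \<bar>X n\<bar> ^ m)"
        by (simp add: power_mult)
    qed
    have "(\<lambda>n. (\<Sum>j<m. (w n * of_real (- X n) ^ j) / C ^ j) + w n * (of_real (- X n) ^ m / C ^ m * (C / (C + of_real (X n)))))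
        sums ((\<Sum>j<m. M j / C ^ j) + (\<Sum>n. w n * (of_real (- X n) ^ m / C ^ m * (C / (C + of_real (X n))))))"
      by (intro sums_add sums_sum sums_divide Msums summable_sums summable_norm_cancel[OF sr])
    also have "(\<lambda>n. (\<Sum>j<m. (w n * of_real (- X n) ^ j) / C ^ j) + w n * (of_real (- X n) ^ m / C ^ m * (C / (C + of_real (X n)))))
       = (\<lambda>n. w n * (C / (C + of_real (X n))))"
      by (subst (2) geo[OF CX(1)]) (simp add: distrib_left sum_distrib_left)
    finally have eq: "(\<Sum>n. w n * (C / (C + of_real (X n)))) = (\<Sum>j<m. M j / C ^ j) + (\<Sum>n. w n * (of_real (- X n) ^ m / C ^ m * (C / (C + of_real (X n)))))"
      by (simp add: sums_iff)
    have coeff: "(\<Sum>i<s * m. (if s dvd i then M (i div s) / \<i> ^ (i div s) else 0) / of_real R ^ i) = (\<Sum>j<m. M j / C ^ j)"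
    proof -
      have "(\<Sum>i<s * m. (if s dvd i then M (i div s) / \<i> ^ (i div s) else 0) / of_real R ^ i)
         = (\<Sum>i<s * m. if s dvd i then M (i div s) / \<i> ^ (i div s) / of_real R ^ i else 0)"
        by (intro sum.cong) auto
      also have "\<dots> = (\<Sum>j<m. M (s * j div s) / \<i> ^ (s * j div s) / of_real R ^ (s * j))"
        by (rule sum_multiples[OF s])
      finally show ?thesis using s by (simp add: C_def power_mult_distrib power_mult)
    qed
    have "norm (\<Sum>n. w n * (of_real (- X n) ^ m / C ^ m * (C / (C + of_real (X n))))) \<le> (\<Sum>n. 1 / R ^ (s * m) * (norm (w n) * \<bar>X n\<bar> ^ m))"
    proof (rule norm_suminf_le)
      fix n
      have "norm (w n * (of_real (- X n) ^ m / C ^ m * (C / (C + of_real (X n))))) =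
          (norm (w n) * \<bar>X n\<bar> ^ m) / (R ^ s) ^ m * norm (C / (C + of_real (X n)))"
        by (simp add: norm_mult norm_divide norm_power nC)
      also have "\<dots> \<le> (norm (w n) * \<bar>X n\<bar> ^ m) / (R ^ s) ^ m * 1"
        using CX(2)[of n] R by (intro mult_left_mono) auto
      finally show "norm (w n * (of_real (- X n) ^ m / C ^ m * (C / (C + of_real (X n))))) \<le> 1 / R ^ (s * m) * (norm (w n) * \<bar>X n\<bar> ^ m)"
        by (simp add: power_mult)
    qed (intro summable_mult w)
    also have "\<dots> = K / R ^ (s * m)" unfolding K_def by (subst suminf_mult[OF w]) simp
    finally show ?thesis unfolding coeff using eq by (simp add: C_def)
  qed
  then have "\<forall>\<^sub>F R in at_top. norm ((\<Sum>n. w n * (\<i> * of_real R ^ s / (\<i> * of_real R ^ s + of_real (X n)))) -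
      (\<Sum>i<s * m. (if s dvd i then M (i div s) / \<i> ^ (i div s) else 0) / of_real R ^ i)) \<le> K / R ^ (s * m)"
    using eventually_gt_at_top[of 0] by (rule eventually_mono[rotated])
  moreover have "s * m \<ge> m" using s by simp
  ultimately show "\<exists>m'\<ge>m. \<exists>K. \<forall>\<^sub>F R in at_top. norm ((\<Sum>n. w n * (\<i> * of_real R ^ s / (\<i> * of_real R ^ s + of_real (X n)))) -
      (\<Sum>i<m'. (if s dvd i then (\<Sum>n. w n * of_real (- X n) ^ (i div s)) / \<i> ^ (i div s) else 0) / of_real R ^ i)) \<le> K / R ^ m'"
    unfolding M_def by blast
qed

text \<open>With \<rho> = \<sigma> i w and \<rho>^2 = -w^2, the fraction n / (n^2 + w^2) is 1 / (n +
  \<rho>) + \<rho> / (n^2 + w^2). The first part sums to \<open>J\<close>, the second to an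
  exponential term. The sign \<sigma> is left free so that \<rho> falls into the half plane where
  \<open>J\<close> has an expansion.\<close>

lemma harmonic_shift_sum:
  assumes w: "Re w > 0" and \<sigma>: "\<sigma> = 1 \<or> \<sigma> = -1" and \<rho>: "Re (\<sigma> * \<i> * w) > 0"
  shows "(\<lambda>n. 1 / of_nat (Suc n) - of_nat (Suc n) / ((of_nat (Suc n))\<^sup>2 + w\<^sup>2)) sums
     (trivial_exp.J (\<sigma> * \<i> * w) - \<sigma> * \<i> * of_real pi / 2 - \<sigma> * \<i> * of_real pi * (1 / (exp (2 * of_real pi * w) - 1)) + \<sigma> * \<i> / 2 / w)"
proof -
  define \<rho> where "\<rho> = \<sigma> * \<i> * w"
  have \<rho>2: "\<rho>\<^sup>2 = - (w\<^sup>2)" using \<sigma> by (auto simp: \<rho>_def power_mult_distrib)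
  have w0: "w \<noteq> 0" using w by auto
  have e: "exp (2 * of_real pi * w) \<noteq> 1" using w by (intro norm_inverse_exp_minus_1_le(1)[of _ 1]) auto
  have W: "(\<lambda>n. \<rho> / ((of_nat (Suc n))\<^sup>2 + w\<^sup>2)) sums
      (\<sigma> * \<i> * of_real pi * (1 / (exp (2 * of_real pi * w) - 1) + 1 / 2 - 1 / (2 * of_real pi * w)))"
  proof -
    have *: "\<sigma> * \<i> * of_real pi * (2 * (2 * of_real pi * w) /
        ((2 * of_real pi * w)\<^sup>2 + 4 * of_real (pi\<^sup>2) * (of_nat (Suc n))\<^sup>2))
      = \<rho> / ((of_nat (Suc n))\<^sup>2 + w\<^sup>2)" for n
    proof -
      have "(2 * of_real pi * w)\<^sup>2 + 4 * of_real (pi\<^sup>2) * (of_nat (Suc n))\<^sup>2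
          = 4 * of_real (pi\<^sup>2) * ((of_nat (Suc n))\<^sup>2 + w\<^sup>2)"
        by (simp add: algebra_simps power2_eq_square)
      moreover have "\<sigma> * \<i> * of_real pi * (2 * (2 * of_real pi * w) / (4 * of_real (pi\<^sup>2) * D)) = \<sigma> * \<i> * w / D" for D
        by (cases "D = 0") (simp_all add: field_simps power2_eq_square)
      ultimately show ?thesis unfolding \<rho>_def by (simp only:)
    qed
    show ?thesis
      using sums_mult[OF exp_minus_1_partial_fractions[OF e], of "\<sigma> * \<i> * of_real pi"] unfolding * .
  qed
  have J: "(\<lambda>n. 1 / of_nat (Suc n) - 1 / (of_nat (Suc n) + \<rho>)) sums trivial_exp.J \<rho>"
    using summable_sums[OF trivial_exp.summable_J[of \<rho>]] \<rho> unfolding trivial_exp.J_def \<rho>_def by simp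
  have "1 / of_nat (Suc n) - 1 / (of_nat (Suc n) + \<rho>) - \<rho> / ((of_nat (Suc n))\<^sup>2 + w\<^sup>2)
      = 1 / of_nat (Suc n) - of_nat (Suc n) / ((of_nat (Suc n))\<^sup>2 + w\<^sup>2)" for n
  proof -
    define K where "K = (of_nat (Suc n) :: complex)"
    have "Re (K + \<rho>) > 0" using \<rho> by (simp add: K_def \<rho>_def add_pos_pos)
    then have K1: "K + \<rho> \<noteq> 0" by (metis less_irrefl zero_complex.sel(1))
    have "Im (K - \<rho>) \<noteq> 0" using \<sigma> w by (auto simp: K_def \<rho>_def)
    then have K2: "K - \<rho> \<noteq> 0" by (metis zero_complex.sel(2))
    have D: "K\<^sup>2 + w\<^sup>2 = (K + \<rho>) * (K - \<rho>)" using \<rho>2 by (simp add: algebra_simps power2_eq_square)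
    have "1 / (K + \<rho>) + \<rho> / ((K + \<rho>) * (K - \<rho>)) = K / ((K + \<rho>) * (K - \<rho>))"
      using K1 K2 by (simp add: divide_simps)
    then show ?thesis unfolding K_def[symmetric] D by (simp add: algebra_simps)
  qed
  with sums_diff[OF J W]
  have "(\<lambda>n. 1 / of_nat (Suc n) - of_nat (Suc n) / ((of_nat (Suc n))\<^sup>2 + w\<^sup>2)) sums
     (trivial_exp.J \<rho> - \<sigma> * \<i> * of_real pi * (1 / (exp (2 * of_real pi * w) - 1) + 1 / 2 - 1 / (2 * of_real pi * w)))"
    by (simp only:)
  also have "trivial_exp.J \<rho> - \<sigma> * \<i> * of_real pi * (1 / (exp (2 * of_real pi * w) - 1) + 1 / 2 - 1 / (2 * of_real pi * w))
     = trivial_exp.J \<rho> - \<sigma> * \<i> * of_real pi / 2 - \<sigma> * \<i> * of_real pi * (1 / (exp (2 * of_real pi * w) - 1)) + \<sigma> * \<i> / 2 / w"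
    using w0 by (simp add: ring_distribs)
  finally show ?thesis unfolding \<rho>_def .
qed

text \<open>What the weights make of the terms \<open>pole_coeff / (2 n)\<close> in
  \<open>kernel_expansion\<close>.\<close>

definition weighted_harmonic :: "nat \<Rightarrow> real \<Rightarrow> complex" where
  "weighted_harmonic p R = (\<Sum>n. 1 / of_nat (Suc n) *
     (\<i> * of_real R ^ (2 * (2 * p + 1)) / (\<i> * of_real R ^ (2 * (2 * p + 1)) + of_real (real (Suc n) ^ (2 * (2 * p + 1))))))"

text \<open>Multiplication by i sends the imaginary part to minus the real part, so the sign
  opposite to that imaginary part gives a positive real part.\<close>

definition root_sign :: "nat \<Rightarrow> int \<Rightarrow> complex" where
  "root_sign p j = (if Im (generic_dir p * root_dir (2 * p + 1) j) > 0 then -1 else 1)"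

lemma Re_signed_root:
  assumes "j \<in> {- int p..int p}"
  shows "Re (root_sign p j * \<i> * (generic_dir p * root_dir (2 * p + 1) j)) > 0"
  using generic_dir_root_dir(2)[OF assms] by (auto simp: root_sign_def)

text \<open>By \<open>partial_fractions_roots_of_unity\<close> with i = 0, the weighted term is the
  average over j of 1/n - n / (n^2 + (c w)^2), where w runs through the directions.\<close>

lemma weighted_harmonic_sums:
  fixes p :: nat
  assumes R: "R > 0"
  defines "N \<equiv> 2 * p + 1"
  shows "(\<lambda>n. 1 / of_nat (Suc n) *
     (\<i> * of_real R ^ (2 * N) / (\<i> * of_real R ^ (2 * N) + of_real (real (Suc n) ^ (2 * N))))) sums
     (1 / of_nat N * (\<Sum>j\<in>{- int p..int p}.
        trivial_exp.J (root_sign p j * \<i> * (generic_dir p * root_dir N j) * of_real R)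
        - root_sign p j * \<i> * of_real pi / 2
        - root_sign p j * \<i> * of_real pi * (1 / (exp (2 * of_real pi * (generic_dir p * of_real R) * root_dir N j) - 1))
        + (root_sign p j * \<i> / 2 / (generic_dir p * root_dir N j)) / of_real R ^ 1))"
proof -
  have N0: "N > 0" by (simp add: N_def)
  define c where "c = generic_dir p * of_real R"
  have c2N: "c ^ (2 * N) = \<i> * of_real R ^ (2 * N)"
    unfolding c_def power_mult_distrib N_def generic_dir_power ..
  have "(\<lambda>n. 1 / of_nat N * (\<Sum>j\<in>{- int p..int p}. 1 / of_nat (Suc n) - of_nat (Suc n) / ((of_nat (Suc n))\<^sup>2 + (c * root_dir N j)\<^sup>2))) sums
     (1 / of_nat N * (\<Sum>j\<in>{- int p..int p}.
        trivial_exp.J (root_sign p j * \<i> * (c * root_dir N j))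
        - root_sign p j * \<i> * of_real pi / 2
        - root_sign p j * \<i> * of_real pi * (1 / (exp (2 * of_real pi * (c * root_dir N j)) - 1))
        + root_sign p j * \<i> / 2 / (c * root_dir N j)))"
  proof (intro sums_mult sums_sum harmonic_shift_sum)
    fix j assume j: "j \<in> {- int p..int p}"
    have e: "c * root_dir N j = generic_dir p * root_dir (2 * p + 1) j * of_real R" by (simp add: c_def N_def mult_ac)
    show "Re (c * root_dir N j) > 0" unfolding e using generic_dir_root_dir(1)[OF j] R by simp
    show "root_sign p j = 1 \<or> root_sign p j = -1" by (simp add: root_sign_def)
    have "Re (root_sign p j * \<i> * (c * root_dir N j)) = Re (root_sign p j * \<i> * (generic_dir p * root_dir (2 * p + 1) j) * of_real R)"
      unfolding e by (simp only: mult.assoc)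
    also have "\<dots> = Re (root_sign p j * \<i> * (generic_dir p * root_dir (2 * p + 1) j)) * R" by simp
    finally show "Re (root_sign p j * \<i> * (c * root_dir N j)) > 0" using Re_signed_root[OF j] R by simp
  qed
  also have "(\<lambda>n. 1 / of_nat N * (\<Sum>j\<in>{- int p..int p}. 1 / of_nat (Suc n) - of_nat (Suc n) / ((of_nat (Suc n))\<^sup>2 + (c * root_dir N j)\<^sup>2)))
     = (\<lambda>n. 1 / of_nat (Suc n) *
     (\<i> * of_real R ^ (2 * N) / (\<i> * of_real R ^ (2 * N) + of_real (real (Suc n) ^ (2 * N)))))"
  proof
    fix n
    define X where "X = (of_nat (Suc n) :: complex)"
    have X0: "X \<noteq> 0" by (simp add: X_def del: of_nat_Suc)
    have XC: "X ^ (2 * N) + c ^ (2 * N) \<noteq> 0"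
    proof -
      have "R ^ (2 * N) > 0" using R by simp
      moreover have "\<bar>R ^ (2 * N)\<bar> \<le> norm (\<i> * of_real (R ^ (2 * N)) + of_real (real (Suc n) ^ (2 * N)))"
        by (rule norm_imaginary_add_real)
      moreover have "\<i> * of_real (R ^ (2 * N)) + of_real (real (Suc n) ^ (2 * N)) = X ^ (2 * N) + c ^ (2 * N)"
        unfolding c2N X_def by (simp add: add.commute)
      ultimately show ?thesis by auto
    qed
    have "(\<Sum>j\<in>{- int p..int p}. X / (X\<^sup>2 + (c * root_dir N j)\<^sup>2))
        = X * (\<Sum>j\<in>{- int p..int p}. exp (2 * of_real pi * \<i> * of_int (j * int 0) / of_nat (2 * p + 1)) /
            (X\<^sup>2 + c\<^sup>2 * exp (- (2 * of_real pi * \<i> * of_int j / of_nat (2 * p + 1)))))"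
      unfolding sum_distrib_left power_mult_distrib root_dir_square[OF N0] by (simp add: N_def)
    also have "\<dots> = X * (of_nat N * (X\<^sup>2) ^ (N - 1) / ((X\<^sup>2) ^ N + (c\<^sup>2) ^ N))"
      unfolding N_def using partial_fractions_roots_of_unity[of "X\<^sup>2" p "c\<^sup>2" 0] XC[unfolded N_def power_mult] by simp
    also have "\<dots> = of_nat N * (X ^ (2 * N) / X) / (X ^ (2 * N) + c ^ (2 * N))"
    proof -
      have "X ^ (2 * N) = X * (X\<^sup>2) ^ (N - 1) * X"
        unfolding N_def by (simp add: power_mult[symmetric])
      then have "X ^ (2 * N) / X = X * (X\<^sup>2) ^ (N - 1)" using X0 by (metis nonzero_mult_div_cancel_right)
      then show ?thesis by (simp add: power_mult[symmetric])
    qed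
    finally have s: "(\<Sum>j\<in>{- int p..int p}. X / (X\<^sup>2 + (c * root_dir N j)\<^sup>2)) = of_nat N * (X ^ (2 * N) / X) / (X ^ (2 * N) + c ^ (2 * N))" .
    have "card {- int p..int p} = N" by (simp add: N_def)
    then have "1 / of_nat N * (\<Sum>j\<in>{- int p..int p}. 1 / X - X / (X\<^sup>2 + (c * root_dir N j)\<^sup>2))
        = 1 / of_nat N * (of_nat N * (1 / X) - of_nat N * (X ^ (2 * N) / X) / (X ^ (2 * N) + c ^ (2 * N)))"
      unfolding sum_subtractf s by simp
    also have "\<dots> = 1 / X - X ^ (2 * N) / X / (X ^ (2 * N) + c ^ (2 * N))"
      using N0 by (simp add: right_diff_distrib)
    also have "\<dots> = 1 / X * (c ^ (2 * N) / (c ^ (2 * N) + X ^ (2 * N)))"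
      using X0 XC by (simp add: divide_simps add.commute)
    finally show "1 / of_nat N * (\<Sum>j\<in>{- int p..int p}. 1 / of_nat (Suc n) - of_nat (Suc n) / ((of_nat (Suc n))\<^sup>2 + (c * root_dir N j)\<^sup>2))
      = 1 / of_nat (Suc n) * (\<i> * of_real R ^ (2 * N) / (\<i> * of_real R ^ (2 * N) + of_real (real (Suc n) ^ (2 * N))))"
      unfolding X_def c2N by simp
  qed
  finally show ?thesis using R by (simp add: c_def mult_ac)
qed

lemma dir_exp_negligible:
  assumes j: "j \<in> {- int p..int p}"
  shows "asym_expansion (\<lambda>R. 1 / (exp (2 * of_real pi * (generic_dir p * of_real R) * root_dir (2 * p + 1) j) - 1)) (\<lambda>_. 0)"
proof (rule asym_negligible)
  fix n
  obtain C where "\<forall>R>0. \<forall>j\<in>{- int p..int p}.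
        norm (1 / (exp (2 * of_real pi * (generic_dir p * of_real R) * root_dir (2 * p + 1) j) - 1)) \<le> C / R ^ Suc n"
    using dir_sum_bound[of p "generic_dir p" "Suc n", OF generic_dir_root_dir(1)] by blast
  then have C: "norm (1 / (exp (2 * of_real pi * (generic_dir p * of_real R) * root_dir (2 * p + 1) j) - 1)) \<le> C / R ^ Suc n" if "R > 0" for R
    using that j by blast
  have "\<forall>\<^sub>F R in at_top. norm (1 / (exp (2 * of_real pi * (generic_dir p * of_real R) * root_dir (2 * p + 1) j) - 1)) \<le> \<bar>C\<bar> / R ^ n"
    using eventually_ge_at_top[of 1]
  proof eventually_elim
    case (elim R)
    have "C / R ^ Suc n \<le> \<bar>C\<bar> / R ^ Suc n" using elim by (intro divide_right_mono) auto
    also have "\<dots> \<le> \<bar>C\<bar> / R ^ n" using elim by (intro divide_left_mono power_increasing mult_pos_pos) auto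
    finally show ?case using C[of R] elim by simp
  qed
  then show "\<exists>K. \<forall>\<^sub>F R in at_top. norm (1 / (exp (2 * of_real pi * (generic_dir p * of_real R) * root_dir (2 * p + 1) j) - 1)) \<le> K / R ^ n"
    by blast
qed

lemma signed_root_power:
  assumes j: "j \<in> {- int p..int p}"
  shows "(root_sign p j * \<i> * (generic_dir p * root_dir (2 * p + 1) j)) ^ (2 * (2 * p + 1)) = - \<i>"
proof -
  define N where "N = 2 * p + 1"
  have "(root_dir N j) ^ (2 * N) = ((-1) powi j)\<^sup>2"
    using root_dir_power_N[of N j] power_mult[of "root_dir N j" N 2] by (simp add: N_def mult.commute)
  also have "\<dots> = 1" by (simp add: power2_eq_square power_int_mult_distrib[symmetric])
  finally have 1: "(root_dir N j) ^ (2 * N) = 1" .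
  have 2: "(root_sign p j) ^ (2 * N) = 1" by (simp add: root_sign_def power_mult)
  have 3: "\<i> ^ (2 * N) = -1" by (simp add: N_def power_mult)
  show ?thesis
    using 1 2 3 generic_dir_power[of p] unfolding N_def[symmetric] power_mult_distrib by simp
qed

text \<open>At index 2NM all directions contribute alike, because the 2N-th power of each signed
  root is -i; the average is then a single zeta value. The explicit 1/R terms have index 1 and do
  not interfere.\<close>

lemma log_asym_weighted_harmonic:
  fixes p :: nat
  defines "N \<equiv> 2 * p + 1"
  obtains u where "log_asym (weighted_harmonic p) u"
    and "\<And>M. M > 0 \<Longrightarrow> u (2 * N * M) = riemann_zeta (1 - 2 * of_nat (N * M)) / (- \<i>) ^ M"
proof
  define v where "v = (\<lambda>j i. (if i > 0 \<and> 1 dvd i then - fact (i div 1 - 1) * trivial.exp_coeff (i div 1 - 1) /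
       (root_sign p j * \<i> * (generic_dir p * root_dir N j)) ^ (i div 1) else 0)
     - 0 - root_sign p j * \<i> * of_real pi * 0
     + (if i = 1 then root_sign p j * \<i> / 2 / (generic_dir p * root_dir N j) else 0))"
  have "log_asym (\<lambda>R. 1 / of_nat N * (\<Sum>j\<in>{- int p..int p}.
        trivial_exp.J (root_sign p j * \<i> * (generic_dir p * root_dir N j) * of_real R ^ 1)
        - root_sign p j * \<i> * of_real pi / 2
        - root_sign p j * \<i> * of_real pi * (1 / (exp (2 * of_real pi * (generic_dir p * of_real R) * root_dir N j) - 1))
        + (root_sign p j * \<i> / 2 / (generic_dir p * root_dir N j)) / of_real R ^ 1))
      (\<lambda>i. 1 / of_nat N * (\<Sum>j\<in>{- int p..int p}. v j i))"
    unfolding v_def N_def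
    by (intro log_asym_cmult log_asym_sum log_asym_add log_asym_diff trivial_exp.log_asym_J log_asym_const
        asym_imp_log_asym[OF asym_monomial] asym_imp_log_asym[OF dir_exp_negligible] Re_signed_root) auto
  moreover have "\<forall>\<^sub>F R in at_top. 1 / of_nat N * (\<Sum>j\<in>{- int p..int p}.
        trivial_exp.J (root_sign p j * \<i> * (generic_dir p * root_dir N j) * of_real R ^ 1)
        - root_sign p j * \<i> * of_real pi / 2
        - root_sign p j * \<i> * of_real pi * (1 / (exp (2 * of_real pi * (generic_dir p * of_real R) * root_dir N j) - 1))
        + (root_sign p j * \<i> / 2 / (generic_dir p * root_dir N j)) / of_real R ^ 1) = weighted_harmonic p R"
    using eventually_gt_at_top[of 0]
  proof eventually_elim
    case (elim R)
    show ?case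
      using sums_unique[OF weighted_harmonic_sums[OF elim, of p]]
      unfolding weighted_harmonic_def N_def by simp
  qed
  ultimately show "log_asym (weighted_harmonic p) (\<lambda>i. 1 / of_nat N * (\<Sum>j\<in>{- int p..int p}. v j i))"
    by (rule log_asym_cong_ev[rotated])
  show "1 / of_nat N * (\<Sum>j\<in>{- int p..int p}. v j (2 * N * M)) = riemann_zeta (1 - 2 * of_nat (N * M)) / (- \<i>) ^ M"
    if "M > 0" for M
  proof -
    define e where "e = 2 * N * M"
    have e: "e > 0" "e \<noteq> 1" using that by (auto simp: e_def N_def)
    have "v j e = riemann_zeta (1 - 2 * of_nat (N * M)) / (- \<i>) ^ M" if j: "j \<in> {- int p..int p}" for j
    proof -
      have "(root_sign p j * \<i> * (generic_dir p * root_dir N j)) ^ e = (- \<i>) ^ M"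
        unfolding e_def power_mult[of _ "2 * N" M] using signed_root_power[OF j] by (simp add: N_def)
      moreover have "riemann_zeta (1 - 2 * of_nat (N * M)) = - fact (e - 1) * trivial.exp_coeff (e - 1)"
      proof -
        have "- of_nat (e - 1) = (1 - 2 * of_nat (N * M) :: complex)"
          using e by (simp add: e_def of_nat_diff)
        moreover have "odd (e - 1)" using e by (simp add: e_def)
        ultimately show ?thesis using riemann_zeta_nonpos[of "e - 1"] by simp
      qed
      ultimately show ?thesis using e by (simp add: v_def)
    qed
    then have "(\<Sum>j\<in>{- int p..int p}. v j e) = of_nat N * (riemann_zeta (1 - 2 * of_nat (N * M)) / (- \<i>) ^ M)"
      by (simp add: N_def)
    moreover have "of_nat N \<noteq> (0 :: complex)" unfolding N_def by (simp only: of_nat_eq_0_iff)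
    ultimately show ?thesis unfolding e_def[symmetric] by simp
  qed
qed

section \<open>The identity for negative m\<close>

lemma dir_sum_mult_negligible:
  assumes g: "\<And>R. R \<ge> 1 \<Longrightarrow> norm (g R) \<le> K * R ^ e"
  shows "asym_expansion (\<lambda>R. dir_sum p (generic_dir p * of_real R) * g R) (\<lambda>_. 0)"
proof (rule asym_negligible)
  fix n
  obtain C where C: "C \<ge> 0" "\<And>R. R > 0 \<Longrightarrow> norm (dir_sum p (generic_dir p * of_real R)) \<le> C / R ^ Suc (n + e)"
    using dir_sum_bound[of p "generic_dir p" "Suc (n + e)", OF generic_dir_root_dir(1)] by auto
  have "\<forall>\<^sub>F R in at_top. norm (dir_sum p (generic_dir p * of_real R) * g R) \<le> (C * K) / R ^ n"
    using eventually_ge_at_top[of 1]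
  proof eventually_elim
    case (elim R)
    have K: "K * R ^ e \<ge> 0" using g[OF elim] norm_ge_zero order_trans by blast
    have "norm (dir_sum p (generic_dir p * of_real R) * g R) \<le> C / R ^ Suc (n + e) * (K * R ^ e)"
      unfolding norm_mult using C(1) C(2)[of R] g[OF elim] elim by (intro mult_mono) auto
    also have "\<dots> \<le> C / R ^ (n + e) * (K * R ^ e)"
      using C(1) K elim by (intro mult_right_mono divide_left_mono power_increasing mult_pos_pos) auto
    also have "\<dots> = (C * K) / R ^ n" using elim by (simp add: power_add)
    finally show ?case .
  qed
  then show "\<exists>K. \<forall>\<^sub>F R in at_top. norm (dir_sum p (generic_dir p * of_real R) * g R) \<le> K / R ^ n" by blast
qed

context kernel_setup
begin

interpretation cnj_char: even_primitive_character q "\<lambda>n. cnj (chi n)"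
  by (rule even_primitive_cnj)

interpretation cnj_exp: exp_expansion "\<lambda>k. cnj (chi (int (Suc k)))" cnj_char.exp_coeff pole_coeff "pi / real q"
  by (rule cnj_char.exp_expansion_chi)

text \<open>The counterpart of \<open>psi\<close> with the node replaced by a point of the oblique
  ray, so that (b k)^2 becomes C.\<close>

definition Psi :: "real \<Rightarrow> complex" where
  "Psi R = of_real pi / (2 * of_nat N * (generic_dir p * of_real R) ^ N)
     + of_real pi / (of_nat N * (generic_dir p * of_real R) ^ N) * (-1) ^ p * dir_sum p (generic_dir p * of_real R)
     - (if p = 0 then 1 / (2 * (generic_dir p * of_real R)\<^sup>2) else 0)"

lemma generic_point:
  assumes "R > 0"
  shows "(generic_dir p * of_real R) ^ (2 * N) = \<i> * of_real (R ^ (2 * N))"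
    and "generic_dir p * of_real R \<noteq> 0"
    and "\<i> * of_real (R ^ (2 * N)) + of_real x \<noteq> 0"
proof -
  show "(generic_dir p * of_real R) ^ (2 * N) = \<i> * of_real (R ^ (2 * N))"
    unfolding power_mult_distrib N_def generic_dir_power by simp
  show "generic_dir p * of_real R \<noteq> 0" using assms by (simp add: generic_dir_def)
  have "R ^ (2 * N) > 0" using assms by simp
  moreover have "\<bar>R ^ (2 * N)\<bar> \<le> norm (\<i> * of_real (R ^ (2 * N)) + of_real x)" by (rule norm_imaginary_add_real)
  ultimately show "\<i> * of_real (R ^ (2 * N)) + of_real x \<noteq> 0" by auto
qed

lemma Psi_sums:
  assumes R: "R > 0"
  shows "(\<lambda>n. of_nat (Suc n) ^ (2 * p) / (of_nat (Suc n) ^ (2 * N) + \<i> * of_real (R ^ (2 * N)))) sums Psi R"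
proof -
  have ne: "of_nat (Suc n) ^ (2 * N) + (generic_dir p * of_real R) ^ (2 * N) \<noteq> 0" for n
    unfolding generic_point(1)[OF R] using generic_point(3)[OF R, of "real (Suc n) ^ (2 * N)"]
    by (simp add: add.commute)
  have ne1: "exp (2 * of_real pi * (generic_dir p * of_real R) * root_dir N j) \<noteq> 1" if j: "j \<in> {- int p..int p}" for j
  proof (rule norm_inverse_exp_minus_1_le(1)[of _ 1])
    have "2 * of_real pi * (generic_dir p * of_real R) * root_dir N j = of_real (2 * pi * R) * (generic_dir p * root_dir (2 * p + 1) j)"
      by (simp add: N_def mult_ac)
    then have "Re (2 * of_real pi * (generic_dir p * of_real R) * root_dir N j) = 2 * pi * R * Re (generic_dir p * root_dir (2 * p + 1) j)"
      by (simp only: Re_complex_of_real Im_complex_of_real times_complex.sel)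
    then show "Re (2 * of_real pi * (generic_dir p * of_real R) * root_dir N j) > 0"
      using generic_dir_root_dir(1)[OF j] R by simp
  qed simp
  show ?thesis
    using sum_power_over_binomial[of "generic_dir p * of_real R" p, folded N_def, OF generic_point(2)[OF R] ne ne1]
    unfolding generic_point(1)[OF R] Psi_def dir_sum_def N_def[symmetric] by simp
qed

text \<open>Weights whose moments against powers of (b k)^2 are values of \<open>dir_series\<close>
  at negative odd arguments.\<close>

definition node_weight :: "nat \<Rightarrow> complex" where
  "node_weight k = cnj (chi (int (Suc k))) / of_real (b * real (Suc k)) * dir_sum p (of_real (node k))"

lemma node_weight_eq:
  "node_weight k * of_real ((b * real (Suc k))\<^sup>2) ^ Suc j
     = of_real b ^ (2 * j + 1) * (cnj (chi (int (Suc k))) / of_nat (Suc k) powi (- 2 * int j - 1) * dir_sum p (of_real (node k)))"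
proof -
  define X where "X = (of_nat (Suc k) :: complex)"
  have nz: "X \<noteq> 0" "complex_of_real b \<noteq> 0" using b_pos by (simp_all add: X_def del: of_nat_Suc)
  have "X powi (- 2 * int j - 1) = inverse (X powi int (2 * j + 1))"
    unfolding power_int_minus[symmetric] by (rule arg_cong[of _ _ "\<lambda>e. X powi e"]) simp
  then have pw: "1 / X powi (- 2 * int j - 1) = X ^ (2 * j + 1)"
    unfolding power_int_of_nat by (simp add: divide_inverse)
  have bk: "complex_of_real (b * real (Suc k)) = of_real b * X" by (simp add: X_def)
  have "1 / (of_real b * X) * ((of_real b * X)\<^sup>2) ^ Suc j = (of_real b * X) ^ (2 * j + 1)"
  proof -
    have "1 / Z * (Z\<^sup>2) ^ Suc j = Z ^ (2 * j + 1)" if "Z \<noteq> 0" for Z :: complex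
    proof -
      have "(Z\<^sup>2) ^ Suc j = Z ^ (2 * j + 1) * Z" by (simp only: power_mult[symmetric]) simp
      then show ?thesis using that by simp
    qed
    then show ?thesis using nz by simp
  qed
  note pw' = this
  have "Z / (of_real b * X) * D * ((of_real b * X)\<^sup>2) ^ Suc j = (of_real b * X) ^ (2 * j + 1) * (Z * D)" for Z D
    unfolding pw'[symmetric] by simp
  then have "node_weight k * of_real ((b * real (Suc k))\<^sup>2) ^ Suc j
      = (of_real b * X) ^ (2 * j + 1) * (cnj (chi (int (Suc k))) * dir_sum p (of_real (node k)))"
    unfolding node_weight_def of_real_power bk by (simp only:)
  also have "\<dots> = of_real b ^ (2 * j + 1) * (cnj (chi (int (Suc k))) * X ^ (2 * j + 1) * dir_sum p (of_real (node k)))"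
    by (simp only: power_mult_distrib mult_ac)
  also have "cnj (chi (int (Suc k))) * X ^ (2 * j + 1) = cnj (chi (int (Suc k))) / X powi (- 2 * int j - 1)"
    unfolding pw[symmetric] by simp
  finally show ?thesis unfolding X_def .
qed

lemma summable_node_weight: "summable (\<lambda>k. norm (node_weight k) * \<bar>- ((b * real (Suc k))\<^sup>2)\<bar> ^ j)"
proof -
  obtain C where C: "C \<ge> 0" "\<And>k. norm (dir_sum p (of_real (node k))) \<le> C / real (Suc k) ^ (2 * j + 2)"
    using dir_sum_node_bound[of "2 * j + 2"] by auto
  show ?thesis
  proof (rule summable_comparison_test'[OF summable_mult[OF summable_inverse_power_Suc[of 2]]])
    fix k
    define x where "x = real (Suc k)"
    have x: "x \<ge> 1" by (simp add: x_def)
    have "norm (node_weight k) = norm (chi (int (Suc k))) / (b * x) * norm (dir_sum p (of_real (node k)))"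
      using b_pos by (simp add: node_weight_def norm_mult norm_divide x_def del: of_nat_Suc of_real_mult)
    also have "\<dots> \<le> 1 / (b * 1) * (C / x ^ (2 * j + 2))"
      using norm_chi_le_1[of "int (Suc k)"] C x b_pos unfolding x_def[symmetric]
      by (intro mult_mono frac_le) (auto simp: x_def)
    finally have "norm (node_weight k) * \<bar>- ((b * x)\<^sup>2)\<bar> ^ j \<le> 1 / (b * 1) * (C / x ^ (2 * j + 2)) * \<bar>- ((b * x)\<^sup>2)\<bar> ^ j"
      by (intro mult_right_mono) auto
    also have "\<dots> = (C * b ^ (2 * j) / b) * (1 / x ^ 2)"
    proof -
      have "\<bar>- ((b * x)\<^sup>2)\<bar> ^ j = b ^ (2 * j) * x ^ (2 * j)" by (simp add: power_mult power_mult_distrib)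
      then show ?thesis using x by (simp add: power_add power2_eq_square)
    qed
    finally show "norm (norm (node_weight k) * \<bar>- ((b * real (Suc k))\<^sup>2)\<bar> ^ j) \<le> (C * b ^ (2 * j) / b) * (1 / real (Suc k) ^ 2)"
      unfolding x_def[symmetric] by simp
  qed simp
qed

definition kernel_weight :: "nat \<Rightarrow> complex" where
  "kernel_weight n = char_kernel (of_real (a * real (Suc n) ^ N)) / of_nat (Suc n)"

lemma summable_kernel_weight: "summable (\<lambda>n. norm (kernel_weight n) * \<bar>real (Suc n) ^ (2 * N)\<bar> ^ j)"
proof (rule summable_comparison_test'[OF summable_mult[OF summable_inverse_power_Suc[of 2]]])
  fix n
  define x where "x = real (Suc n)"
  have x: "x \<ge> 1" by (simp add: x_def)
  have "norm (kernel_weight n) = norm (char_kernel (of_real (a * x ^ N))) / x"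
    unfolding kernel_weight_def x_def norm_divide by (simp del: of_nat_Suc of_real_mult of_real_power)
  also have "\<dots> \<le> fact (2 * j + 2) * real q ^ (2 * j + 2) / (a * x ^ N) ^ (2 * j + 2) / 1"
    using norm_char_kernel_le[of "a * x ^ N" "2 * j + 2"] a x by (intro frac_le) auto
  finally have "norm (kernel_weight n) * \<bar>x ^ (2 * N)\<bar> ^ j \<le> fact (2 * j + 2) * real q ^ (2 * j + 2) / (a * x ^ N) ^ (2 * j + 2) * \<bar>x ^ (2 * N)\<bar> ^ j"
    using x by (intro mult_right_mono) auto
  also have "\<dots> = (fact (2 * j + 2) * real q ^ (2 * j + 2) / a ^ (2 * j + 2)) * (1 / x ^ (2 * N))"
  proof -
    have "(x ^ N) ^ (2 * j + 2) = (x ^ (2 * N)) ^ j * x ^ (2 * N)"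
      by (simp add: power_mult[symmetric] power_add[symmetric] algebra_simps)
    moreover have "\<bar>x ^ (2 * N)\<bar> = x ^ (2 * N)" using x by simp
    moreover have "F * Q / (A * (P * V)) * P = F * Q / A * (1 / V)" if "P \<noteq> 0" for F Q A P V :: real
      using that by simp
    moreover have "(x ^ (2 * N)) ^ j \<noteq> 0" using x by simp
    ultimately show ?thesis unfolding power_mult_distrib by (simp only:)
  qed
  also have "\<dots> \<le> (fact (2 * j + 2) * real q ^ (2 * j + 2) / a ^ (2 * j + 2)) * (1 / x ^ 2)"
    using x a N_pos by (intro mult_left_mono divide_left_mono power_increasing mult_pos_pos) auto
  finally show "norm (norm (kernel_weight n) * \<bar>real (Suc n) ^ (2 * N)\<bar> ^ j)
      \<le> (fact (2 * j + 2) * real q ^ (2 * j + 2) / a ^ (2 * j + 2)) * (1 / real (Suc n) ^ 2)"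
    unfolding x_def[symmetric] by simp
qed simp

text \<open>With C = Y^2 the factor C / (C - B^2) turns 1/B - 1/Y into 1/B - 1/(Y + B), the summand
  of \<open>J\<close>, and turns 1/B^2 - 1/C back into 1/B^2. The exponential parts do not simplify:
  the one at the node becomes a weighted sum, the one on the ray is negligible.\<close>

lemma column_identity:
  fixes k :: nat
  assumes R: "R > 0"
  defines "C \<equiv> \<i> * of_real (R ^ (2 * N))" and "Y \<equiv> (generic_dir p * of_real R) ^ N"
    and "B \<equiv> complex_of_real (b * real (Suc k))"
  shows "C / (C + of_real (- ((b * real (Suc k))\<^sup>2))) * (psi k - Psi R)
     = of_real pi / (2 * of_nat N * of_real b) * (1 / of_nat (Suc k) - 1 / (of_nat (Suc k) + Y / of_real b))
       - (if p = 0 then 1 / (2 * (of_real b)\<^sup>2) else 0) * (1 / of_nat (Suc k) ^ 2)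
       + of_real pi / of_nat N * (-1) ^ p * (dir_sum p (of_real (node k)) / B * (C / (C + of_real (- ((b * real (Suc k))\<^sup>2)))))
       - of_real pi / (of_nat N * Y) * (-1) ^ p * dir_sum p (generic_dir p * of_real R) * (C / (C + of_real (- ((b * real (Suc k))\<^sup>2))))"
proof -
  define X where "X = (of_nat (Suc k) :: complex)"
  define \<beta> where "\<beta> = complex_of_real b"
  define n where "n = (of_nat N :: complex)"
  define s where "s = (-1 :: complex) ^ p"
  have BX: "B = \<beta> * X" by (simp add: B_def \<beta>_def X_def)
  have CY: "C = Y\<^sup>2" unfolding C_def Y_def using generic_point(1)[OF R] by (simp add: power_mult[symmetric] mult.commute)
  have nz: "X \<noteq> 0" "\<beta> \<noteq> 0" "n \<noteq> 0" "Y \<noteq> 0" "B \<noteq> 0"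
    using b_pos N_pos generic_point(2)[OF R]
    by (simp_all add: X_def \<beta>_def n_def Y_def B_def del: of_nat_Suc)
  have CB: "C + of_real (- ((b * real (Suc k))\<^sup>2)) = C - B\<^sup>2" by (simp add: B_def del: of_nat_Suc)
  have "C + of_real (- ((b * real (Suc k))\<^sup>2)) \<noteq> 0" unfolding C_def by (rule generic_point(3)[OF R])
  then have "C - B\<^sup>2 \<noteq> 0" unfolding CB .
  moreover have fac: "C - B\<^sup>2 = (Y - B) * (Y + B)" unfolding CY by (simp add: power2_eq_square algebra_simps)
  ultimately have YB: "Y - B \<noteq> 0" "Y + B \<noteq> 0" "C - B\<^sup>2 \<noteq> 0" by auto
  define F where "F = C / (C - B\<^sup>2)"
  have F1: "F * (1 / B - 1 / Y) = 1 / \<beta> * (1 / X - 1 / (X + Y / \<beta>))"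
  proof -
    have "F * (1 / B - 1 / Y) = 1 / B - 1 / (Y + B)"
      unfolding F_def fac unfolding CY using YB nz by (simp add: divide_simps power2_eq_square)
    moreover have "1 / \<beta> * (1 / X - 1 / (X + Y / \<beta>)) = 1 / B - 1 / (Y + B)"
    proof -
      have "X + Y / \<beta> = (Y + B) / \<beta>" using nz by (simp add: BX field_simps)
      then show ?thesis using nz by (simp add: BX right_diff_distrib)
    qed
    ultimately show ?thesis by simp
  qed
  have F2: "F * (1 / B\<^sup>2 - 1 / C) = 1 / B\<^sup>2"
    unfolding F_def using YB nz CY by (simp add: divide_simps)
  have C2: "(generic_dir p * of_real R)\<^sup>2 = C" if "p = 0"
  proof -
    have "N = 1" unfolding N_def using that by simp
    then show ?thesis unfolding C_def using generic_point(1)[OF R] by simp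
  qed
  define \<epsilon> where "\<epsilon> = (if p = 0 then 1 else 0 :: complex)"
  have psi': "psi k = of_real pi / (2 * n) * (1 / B) + of_real pi / n * s * (dir_sum p (of_real (node k)) / B) - \<epsilon> / 2 * (1 / B\<^sup>2)"
    unfolding psi_def B_def[symmetric] n_def s_def \<epsilon>_def by simp
  have Psi': "Psi R = of_real pi / (2 * n) * (1 / Y) + of_real pi / n * s * (dir_sum p (generic_dir p * of_real R) / Y) - \<epsilon> / 2 * (1 / C)"
    unfolding Psi_def Y_def[symmetric] n_def s_def \<epsilon>_def using C2 by (cases "p = 0") auto
  have alg: "F * ((P * u + Q * d - e * v) - (P * u' + Q * d' - e * v'))
      = P * (F * (u - u')) + Q * (d * F) - Q * (d' * F) - e * (F * (v - v'))" for P u u' Q d d' e v v'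
    by (simp add: algebra_simps)
  have "F * (psi k - Psi R) = of_real pi / (2 * n) * (1 / \<beta> * (1 / X - 1 / (X + Y / \<beta>)))
      + of_real pi / n * s * (dir_sum p (of_real (node k)) / B * F)
      - of_real pi / n * s * (dir_sum p (generic_dir p * of_real R) / Y * F) - \<epsilon> / 2 * (1 / B\<^sup>2)"
    unfolding psi' Psi' alg F1 F2 ..
  also have "\<dots> = of_real pi / (2 * n * \<beta>) * (1 / X - 1 / (X + Y / \<beta>)) - (if p = 0 then 1 / (2 * \<beta>\<^sup>2) else 0) * (1 / X ^ 2)
      + of_real pi / n * s * (dir_sum p (of_real (node k)) / B * F)
      - of_real pi / (n * Y) * s * dir_sum p (generic_dir p * of_real R) * F"
    unfolding BX \<epsilon>_def by (simp add: power_mult_distrib mult.assoc)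
  finally show ?thesis
    unfolding CB F_def[symmetric] unfolding X_def \<beta>_def n_def s_def .
qed

text \<open>The columns are accessible because C / (C + V) times 1 / (V + B^2), with V = n^(2N), is
  C / (C - B^2) times the difference of 1 / (V + B^2) and 1 / (V + C). Each weighted column is thus
  a multiple of \<open>psi k - Psi R\<close>.\<close>

theorem weighted_kernel_identity:
  assumes R: "R > 0"
  defines "C \<equiv> \<i> * of_real (R ^ (2 * N))"
  shows "(\<Sum>n. kernel_weight n * (C / (C + of_real (real (Suc n) ^ (2 * N)))))
     = - pole_coeff / 2 * weighted_harmonic p R + pole_coeff / of_real a * (zeta_sum (N + 1) - Psi R)
       + 2 * gauss_sum q chi / of_real a *
         (of_real pi / (2 * of_nat N * of_real b) * cnj_exp.J ((generic_dir p * of_real R) ^ N / of_real b)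
          - (if p = 0 then 1 / (2 * (of_real b)\<^sup>2) else 0) * cnj_L_series 2
          + of_real pi / of_nat N * (-1) ^ p * (\<Sum>k. node_weight k * (C / (C + of_real (- ((b * real (Suc k))\<^sup>2)))))
          - of_real pi / (of_nat N * (generic_dir p * of_real R) ^ N) * (-1) ^ p * dir_sum p (generic_dir p * of_real R) *
              (\<Sum>k. cnj (chi (int (Suc k))) * (C / (C + of_real (- ((b * real (Suc k))\<^sup>2))))))"
proof -
  define K where "K = 2 * gauss_sum q chi / of_real a"
  define Y where "Y = (generic_dir p * of_real R) ^ N"
  define g where "g = (\<lambda>n. C / (C + of_real (real (Suc n) ^ (2 * N))))"
  define f where "f = (\<lambda>n k. cnj (chi (int (Suc k))) *
      (of_nat (Suc n) ^ (2 * p) / (of_nat (Suc n) ^ (2 * N) + (complex_of_real (b * real (Suc k)))\<^sup>2)) * g n)"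
  have nC: "norm C = R ^ (2 * N)" using R by (simp add: C_def norm_mult norm_power)
  have Cx: "C + of_real x \<noteq> 0" "\<bar>x\<bar> \<le> norm (C + of_real x)" "R ^ (2 * N) \<le> norm (C + of_real x)" for x
    using generic_point(3)[OF R, of x] norm_imaginary_add_real(2)[of x "R ^ (2 * N)"]
      order_trans[OF abs_ge_self norm_imaginary_add_real(1)[of "R ^ (2 * N)" x]] unfolding C_def by blast+
  have bound: "norm (f n k) \<le> (1 / real (Suc n) ^ 2) * ((R ^ (2 * N) / b\<^sup>2) * (1 / real (Suc k) ^ 2))" for n k
  proof -
    define x where "x = real (Suc n)"
    have x: "x \<ge> 1" by (simp add: x_def)
    have bk: "(b * real (Suc k))\<^sup>2 > 0" using b_pos by simp
    have "of_nat (Suc n) ^ (2 * p) / (of_nat (Suc n) ^ (2 * N) + (complex_of_real (b * real (Suc k)))\<^sup>2)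
        = complex_of_real (x ^ (2 * p) / (x ^ (2 * N) + (b * real (Suc k))\<^sup>2))"
      by (simp add: x_def)
    then have "norm (of_nat (Suc n) ^ (2 * p) / (of_nat (Suc n) ^ (2 * N) + (complex_of_real (b * real (Suc k)))\<^sup>2))
        = \<bar>x ^ (2 * p) / (x ^ (2 * N) + (b * real (Suc k))\<^sup>2)\<bar>" by (simp only: norm_of_real)
    also have "\<dots> = x ^ (2 * p) / (x ^ (2 * N) + (b * real (Suc k))\<^sup>2)"
      using x by (intro abs_of_nonneg divide_nonneg_nonneg add_nonneg_nonneg) auto
    also have "\<dots> \<le> x ^ (2 * p) / (b * real (Suc k))\<^sup>2"
      using x bk by (intro divide_left_mono mult_pos_pos add_nonneg_pos) auto
    finally have 1: "norm (of_nat (Suc n) ^ (2 * p) / (of_nat (Suc n) ^ (2 * N) + (complex_of_real (b * real (Suc k)))\<^sup>2))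
       \<le> x ^ (2 * p) / (b * real (Suc k))\<^sup>2" .
    have xp: "x ^ (2 * N) > 0" using x by simp
    have xC: "x ^ (2 * N) \<le> norm (C + of_real (x ^ (2 * N)))" using Cx(2)[of "x ^ (2 * N)"] xp by linarith
    \<comment> \<open>The weight supplies the missing decay in n: against the numerator n^(2p) it
      leaves n^(-2p-2), at the cost of a constant depending on the fixed R.\<close>
    have 2: "norm (g n) \<le> R ^ (2 * N) / x ^ (2 * N)"
      unfolding g_def norm_divide nC x_def[symmetric] using R
      by (intro divide_left_mono mult_pos_pos xC xp less_le_trans[OF xp xC]) auto
    have "norm (f n k) \<le> 1 * (x ^ (2 * p) / (b * real (Suc k))\<^sup>2) * (R ^ (2 * N) / x ^ (2 * N))"
      unfolding f_def norm_mult using norm_chi_le_1[of "int (Suc k)"] 1 2 x by (intro mult_mono) auto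
    also have "\<dots> = (1 / x ^ (2 * p + 2)) * ((R ^ (2 * N) / b\<^sup>2) * (1 / real (Suc k) ^ 2))"
    proof -
      have "x ^ (2 * N) = x ^ (2 * p) * x ^ (2 * p + 2)" unfolding N_def power_add[symmetric] by simp
      moreover have "1 * (P / D) * (V / (P * Q)) = 1 / Q * (V / D)" if "P \<noteq> 0" for P D V Q :: real
        using that by simp
      moreover have "x ^ (2 * p) \<noteq> 0" using x by simp
      ultimately have "1 * (x ^ (2 * p) / (b * real (Suc k))\<^sup>2) * (R ^ (2 * N) / x ^ (2 * N))
          = 1 / x ^ (2 * p + 2) * (R ^ (2 * N) / (b * real (Suc k))\<^sup>2)" by (simp only:)
      then show ?thesis by (simp only: power_mult_distrib) simp
    qed
    also have "\<dots> \<le> (1 / x ^ 2) * ((R ^ (2 * N) / b\<^sup>2) * (1 / real (Suc k) ^ 2))"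
      using x R by (intro mult_right_mono divide_left_mono power_increasing mult_pos_pos) auto
    finally show ?thesis unfolding x_def .
  qed
  note swap = sums_swap_product_bound[OF bound summable_inverse_power_Suc[OF order_refl] _
     summable_mult[OF summable_inverse_power_Suc[OF order_refl]]]
  have sw: "(\<lambda>k. \<Sum>n. f n k) sums (\<Sum>n. \<Sum>k. f n k)" and sm: "summable (\<lambda>n. \<Sum>k. f n k)"
    by (rule swap; simp)+
  have row: "K * (\<Sum>k. f n k) = kernel_weight n * g n + pole_coeff / 2 * (1 / of_nat (Suc n) * g n)
      - pole_coeff / of_real a * (1 / of_nat (Suc n) ^ (N + 1) * g n)" for n
  proof -
    have "(\<lambda>k. 2 * gauss_sum q chi / of_real a * (cnj (chi (int (Suc k))) *
        (of_nat (Suc n) ^ (2 * p) / (of_nat (Suc n) ^ (2 * N) + (complex_of_real (b * real (Suc k)))\<^sup>2))) * g n) sums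
     ((char_kernel (of_real (a * real (Suc n) ^ N)) / of_nat (Suc n) + pole_coeff / (2 * of_nat (Suc n))
        - pole_coeff / (of_real a * of_nat (Suc n) ^ (N + 1))) * g n)"
      by (intro sums_mult2 kernel_expansion)
    then have "(\<lambda>k. K * f n k) sums
     ((char_kernel (of_real (a * real (Suc n) ^ N)) / of_nat (Suc n) + pole_coeff / (2 * of_nat (Suc n))
        - pole_coeff / (of_real a * of_nat (Suc n) ^ (N + 1))) * g n)"
      unfolding K_def f_def by (simp only: mult.assoc)
    moreover have "(\<lambda>k. K * f n k) sums (K * (\<Sum>k. f n k))"
      by (intro sums_mult summable_sums, rule summable_norm_cancel, rule swap(2)) simp_all
    ultimately have "K * (\<Sum>k. f n k) = (char_kernel (of_real (a * real (Suc n) ^ N)) / of_nat (Suc n) + pole_coeff / (2 * of_nat (Suc n))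
        - pole_coeff / (of_real a * of_nat (Suc n) ^ (N + 1))) * g n" by (rule sums_unique2[symmetric])
    then show ?thesis unfolding kernel_weight_def by (simp add: left_diff_distrib distrib_right del: of_nat_Suc)
  qed
  have gX: "1 / of_nat (Suc n) ^ (N + 1) * g n
      = 1 / of_nat (Suc n) ^ (N + 1) - of_nat (Suc n) ^ (2 * p) / (of_nat (Suc n) ^ (2 * N) + C)" for n
  proof -
    define X where "X = (of_nat (Suc n) :: complex)"
    have X0: "X \<noteq> 0" by (simp add: X_def del: of_nat_Suc)
    have D: "C + X ^ (2 * N) \<noteq> 0" using Cx(1)[of "real (Suc n) ^ (2 * N)"] by (simp add: X_def)
    have "X ^ (2 * N) = X ^ (2 * p) * X ^ (N + 1)" unfolding N_def by (simp add: power_add[symmetric])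
    then have "X ^ (2 * p) / (X ^ (2 * N) + C) = 1 / X ^ (N + 1) * (X ^ (2 * N) / (C + X ^ (2 * N)))"
      using X0 by (simp add: add.commute)
    moreover have "1 - X ^ (2 * N) / (C + X ^ (2 * N)) = C / (C + X ^ (2 * N))"
      using D by (simp add: divide_simps)
    ultimately have "1 / X ^ (N + 1) - X ^ (2 * p) / (X ^ (2 * N) + C) = 1 / X ^ (N + 1) * (C / (C + X ^ (2 * N)))"
      by (metis (no_types, lifting) mult.right_neutral right_diff_distrib)
    then show ?thesis unfolding g_def X_def by simp
  qed
  have zsum: "(\<lambda>n. 1 / of_nat (Suc n) ^ (N + 1) * g n) sums (zeta_sum (N + 1) - Psi R)"
    unfolding gX using N_pos by (intro sums_diff zeta_sum_sums) (use Psi_sums[OF R] in \<open>auto simp: C_def\<close>)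
  have hsum: "(\<lambda>n. 1 / of_nat (Suc n) * g n) sums weighted_harmonic p R"
    using weighted_harmonic_sums[OF R, of p] unfolding weighted_harmonic_def g_def C_def N_def of_real_power
    by (simp add: sums_iff)
  have col: "(\<Sum>n. f n k) = cnj (chi (int (Suc k))) * (C / (C + of_real (- ((b * real (Suc k))\<^sup>2))) * (psi k - Psi R))" for k
  proof -
    define B where "B = complex_of_real (b * real (Suc k))"
    have CB: "C + of_real (- ((b * real (Suc k))\<^sup>2)) = C - B\<^sup>2" by (simp add: B_def del: of_nat_Suc)
    have CB0: "C - B\<^sup>2 \<noteq> 0" unfolding CB[symmetric] by (rule Cx)
    have "(\<lambda>n. cnj (chi (int (Suc k))) * (C / (C - B\<^sup>2) * (of_nat (Suc n) ^ (2 * p) / (of_nat (Suc n) ^ (2 * N) + B\<^sup>2)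
        - of_nat (Suc n) ^ (2 * p) / (of_nat (Suc n) ^ (2 * N) + C)))) sums
      (cnj (chi (int (Suc k))) * (C / (C - B\<^sup>2) * (psi k - Psi R)))"
      unfolding B_def C_def by (intro sums_mult sums_diff psi_sums Psi_sums R)
    moreover have "cnj (chi (int (Suc k))) * (C / (C - B\<^sup>2) * (of_nat (Suc n) ^ (2 * p) / (of_nat (Suc n) ^ (2 * N) + B\<^sup>2)
        - of_nat (Suc n) ^ (2 * p) / (of_nat (Suc n) ^ (2 * N) + C))) = f n k" for n
    proof -
      define X where "X = (of_nat (Suc n) :: complex)"
      have D: "C + X ^ (2 * N) \<noteq> 0" using Cx(1)[of "real (Suc n) ^ (2 * N)"] by (simp add: X_def)
      have "real (Suc n) ^ (2 * N) + (b * real (Suc k))\<^sup>2 > 0" by (intro add_pos_nonneg) auto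
      then have "complex_of_real (real (Suc n) ^ (2 * N) + (b * real (Suc k))\<^sup>2) \<noteq> 0"
        by (simp only: of_real_eq_0_iff)
      then have D2: "X ^ (2 * N) + B\<^sup>2 \<noteq> 0" unfolding X_def B_def by simp
      have "C / (C - B\<^sup>2) * (P / (Q + B\<^sup>2) - P / (Q + C)) = P / (Q + B\<^sup>2) * (C / (C + Q))"
        if "C + Q \<noteq> 0" "Q + B\<^sup>2 \<noteq> 0" for P Q
        using that CB0 by (simp add: divide_simps add.commute) (simp add: algebra_simps)
      from this[OF D D2, of "X ^ (2 * p)"] show ?thesis
        unfolding f_def g_def B_def[symmetric] X_def by (simp add: mult.assoc)
    qed
    ultimately show ?thesis unfolding CB by (simp add: sums_iff)
  qed
  \<comment> \<open>The N-th power of the generic direction has argument pi/4, so Y stays in the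
    right half plane.\<close>
  have y0: "Re (Y / of_real b) \<ge> 0"
  proof -
    have "generic_dir p ^ N = exp (of_nat N * (\<i> * of_real (pi / (4 * real N))))"
      unfolding generic_dir_def exp_of_nat_mult N_def ..
    also have "of_nat N * (\<i> * of_real (pi / (4 * real N))) = \<i> * of_real (pi / 4)" using N_pos by simp
    finally have "generic_dir p ^ N = cis (pi / 4)" by (simp add: cis_conv_exp)
    then have "Y = of_real (R ^ N) * cis (pi / 4)" unfolding Y_def power_mult_distrib by simp
    then have "Re (Y / of_real b) = R ^ N * cos (pi / 4) / b" by simp
    then show ?thesis using R b_pos by (simp add: cos_45)
  qed
  have sJ: "(\<lambda>k. cnj (chi (int (Suc k))) * (1 / of_nat (Suc k) - 1 / (of_nat (Suc k) + Y / of_real b))) sums cnj_exp.J (Y / of_real b)"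
    unfolding cnj_exp.J_def by (rule summable_sums[OF cnj_exp.summable_J[OF y0]])
  define F where "F = (\<lambda>k. C / (C + of_real (- ((b * real (Suc k))\<^sup>2))))"
  have nF: "norm (F k) \<le> 1" "norm (F k) \<le> (R ^ (2 * N) / b\<^sup>2) * (1 / real (Suc k) ^ 2)" for k
  proof -
    have "R ^ (2 * N) > 0" using R by simp
    then show "norm (F k) \<le> 1" unfolding F_def norm_divide nC using Cx(3)[of "- ((b * real (Suc k))\<^sup>2)"]
      by (simp add: divide_le_eq del: of_nat_Suc)
    have xp: "(b * real (Suc k))\<^sup>2 > 0" using b_pos by simp
    have xC: "(b * real (Suc k))\<^sup>2 \<le> norm (C + of_real (- ((b * real (Suc k))\<^sup>2)))"
      using Cx(2)[of "- ((b * real (Suc k))\<^sup>2)"] xp by linarith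
    have "norm (F k) \<le> R ^ (2 * N) / (b * real (Suc k))\<^sup>2"
      unfolding F_def norm_divide nC using R
      by (intro divide_left_mono mult_pos_pos xC xp less_le_trans[OF xp xC]) auto
    then show "norm (F k) \<le> (R ^ (2 * N) / b\<^sup>2) * (1 / real (Suc k) ^ 2)"
      by (simp add: power_mult_distrib del: of_nat_Suc)
  qed
  have sH: "(\<lambda>k. node_weight k * F k) sums (\<Sum>k. node_weight k * F k)"
  proof (intro summable_sums summable_comparison_test'[OF summable_node_weight[of 0]])
    show "norm (node_weight k * F k) \<le> norm (node_weight k) * \<bar>- ((b * real (Suc k))\<^sup>2)\<bar> ^ 0" for k
      using nF(1)[of k] by (simp add: norm_mult mult_left_le)
  qed
  have sB: "(\<lambda>k. cnj (chi (int (Suc k))) * F k) sums (\<Sum>k. cnj (chi (int (Suc k))) * F k)"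
  proof (intro summable_sums summable_comparison_test'[OF summable_mult[OF summable_inverse_power_Suc[of 2]]])
    show "norm (cnj (chi (int (Suc k))) * F k) \<le> (R ^ (2 * N) / b\<^sup>2) * (1 / real (Suc k) ^ 2)" for k
      using mult_mono[OF norm_chi_le_1[of "int (Suc k)"] nF(2)[of k]] by (simp add: norm_mult)
  qed simp
  have dsum: "(\<lambda>k. \<Sum>n. f n k) sums
         (of_real pi / (2 * of_nat N * of_real b) * cnj_exp.J (Y / of_real b)
          - (if p = 0 then 1 / (2 * (of_real b)\<^sup>2) else 0) * cnj_L_series 2
          + of_real pi / of_nat N * (-1) ^ p * (\<Sum>k. node_weight k * F k)
          - of_real pi / (of_nat N * Y) * (-1) ^ p * dir_sum p (generic_dir p * of_real R) *
              (\<Sum>k. cnj (chi (int (Suc k))) * F k))"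
  proof -
    have "(\<lambda>k. of_real pi / (2 * of_nat N * of_real b) * (cnj (chi (int (Suc k))) * (1 / of_nat (Suc k) - 1 / (of_nat (Suc k) + Y / of_real b)))
          - (if p = 0 then 1 / (2 * (of_real b)\<^sup>2) else 0) * (cnj (chi (int (Suc k))) / of_nat (Suc k) ^ 2)
          + of_real pi / of_nat N * (-1) ^ p * (node_weight k * F k)
          - of_real pi / (of_nat N * Y) * (-1) ^ p * dir_sum p (generic_dir p * of_real R) * (cnj (chi (int (Suc k))) * F k)) sums
         (of_real pi / (2 * of_nat N * of_real b) * cnj_exp.J (Y / of_real b)
          - (if p = 0 then 1 / (2 * (of_real b)\<^sup>2) else 0) * cnj_L_series 2
          + of_real pi / of_nat N * (-1) ^ p * (\<Sum>k. node_weight k * F k)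
          - of_real pi / (of_nat N * Y) * (-1) ^ p * dir_sum p (generic_dir p * of_real R) *
              (\<Sum>k. cnj (chi (int (Suc k))) * F k))"
      by (intro sums_add sums_diff sums_mult sJ sH sB cnj_L_series_sums) simp
    moreover have "(\<Sum>n. f n k) = of_real pi / (2 * of_nat N * of_real b) * (cnj (chi (int (Suc k))) * (1 / of_nat (Suc k) - 1 / (of_nat (Suc k) + Y / of_real b)))
          - (if p = 0 then 1 / (2 * (of_real b)\<^sup>2) else 0) * (cnj (chi (int (Suc k))) / of_nat (Suc k) ^ 2)
          + of_real pi / of_nat N * (-1) ^ p * (node_weight k * F k)
          - of_real pi / (of_nat N * Y) * (-1) ^ p * dir_sum p (generic_dir p * of_real R) * (cnj (chi (int (Suc k))) * F k)" for k
    proof -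
      have alg: "x * (P * u - e * (1 / v) + Q * (d / B * F') - W * F') = P * (x * u) - e * (x / v) + Q * (x / B * d * F') - W * (x * F')"
        for x P u e v Q d B F' W :: complex by (simp add: algebra_simps)
      have ci: "F k * (psi k - Psi R)
        = of_real pi / (2 * of_nat N * of_real b) * (1 / of_nat (Suc k) - 1 / (of_nat (Suc k) + Y / of_real b))
          - (if p = 0 then 1 / (2 * (of_real b)\<^sup>2) else 0) * (1 / of_nat (Suc k) ^ 2)
          + of_real pi / of_nat N * (-1) ^ p * (dir_sum p (of_real (node k)) / of_real (b * real (Suc k)) * F k)
          - of_real pi / (of_nat N * Y) * (-1) ^ p * dir_sum p (generic_dir p * of_real R) * F k"
        unfolding F_def C_def Y_def by (rule column_identity[OF R])
      have "(\<Sum>n. f n k) = cnj (chi (int (Suc k))) * (F k * (psi k - Psi R))" unfolding col F_def ..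
      then show ?thesis unfolding ci alg node_weight_def .
    qed
    ultimately show ?thesis by (simp only:)
  qed
  have "(\<lambda>n. K * (\<Sum>k. f n k) - pole_coeff / 2 * (1 / of_nat (Suc n) * g n)
      + pole_coeff / of_real a * (1 / of_nat (Suc n) ^ (N + 1) * g n)) sums
      (K * (\<Sum>n. \<Sum>k. f n k) - pole_coeff / 2 * weighted_harmonic p R + pole_coeff / of_real a * (zeta_sum (N + 1) - Psi R))"
    by (intro sums_add sums_diff sums_mult zsum hsum summable_sums sm)
  also have "(\<lambda>n. K * (\<Sum>k. f n k) - pole_coeff / 2 * (1 / of_nat (Suc n) * g n)
      + pole_coeff / of_real a * (1 / of_nat (Suc n) ^ (N + 1) * g n)) = (\<lambda>n. kernel_weight n * g n)"
    unfolding row by simp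
  finally have "(\<Sum>n. kernel_weight n * g n) = K * (\<Sum>n. \<Sum>k. f n k) - pole_coeff / 2 * weighted_harmonic p R + pole_coeff / of_real a * (zeta_sum (N + 1) - Psi R)"
    by (simp add: sums_iff)
  then show ?thesis
    unfolding sums_unique2[OF sw dsum] g_def F_def K_def Y_def by simp
qed

lemma generic_dir_power_N: "generic_dir p ^ N = cis (pi / 4)"
proof -
  have "generic_dir p ^ N = exp (of_nat N * (\<i> * of_real (pi / (4 * real N))))"
    unfolding generic_dir_def exp_of_nat_mult N_def ..
  also have "of_nat N * (\<i> * of_real (pi / (4 * real N))) = \<i> * of_real (pi / 4)" using N_pos by simp
  finally show ?thesis by (simp add: cis_conv_exp)
qed

text \<open>Only the indices N and 2 occur. The second one, present for N = 1, will meet the index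
  2NM exactly when N = M = 1.\<close>

lemma log_asym_Psi:
  "log_asym Psi (\<lambda>i. (if i = N then of_real pi / (2 * of_nat N * generic_dir p ^ N) else 0) + 0
      - (if i = 2 then if p = 0 then 1 / (2 * (generic_dir p)\<^sup>2) else 0 else 0))"
proof -
  define g where "g = (\<lambda>R. of_real pi / (of_nat N * (generic_dir p * complex_of_real R) ^ N) * (-1) ^ p)"
  have g: "norm (g R) \<le> pi * R ^ 0" if "R \<ge> 1" for R
  proof -
    have "norm (g R) = pi / (real N * R ^ N)"
      using that by (simp add: g_def norm_mult norm_divide norm_power norm_generic_dir)
    also have "\<dots> \<le> pi / 1"
    proof (rule divide_left_mono)
      have "1 * 1 \<le> real N * R ^ N" using that N_pos by (intro mult_mono one_le_power) auto
      then show "1 \<le> real N * R ^ N" by simp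
    qed (use that N_pos in auto)
    finally show ?thesis by simp
  qed
  have eq: "Psi = (\<lambda>R. (of_real pi / (2 * of_nat N * generic_dir p ^ N)) / of_real R ^ N
      + dir_sum p (generic_dir p * of_real R) * g R - (if p = 0 then 1 / (2 * (generic_dir p)\<^sup>2) else 0) / of_real R ^ 2)"
  proof
    fix R :: real
    have 1: "of_real pi / (2 * of_nat N * (generic_dir p * of_real R) ^ N)
        = (of_real pi / (2 * of_nat N * generic_dir p ^ N)) / of_real R ^ N"
      by (simp add: power_mult_distrib)
    have 2: "x * dir_sum p (generic_dir p * of_real R) = dir_sum p (generic_dir p * of_real R) * x" for x
      by (rule mult.commute)
    have 3: "(if p = 0 then 1 / (2 * (generic_dir p * of_real R)\<^sup>2) else 0)
        = (if p = 0 then 1 / (2 * (generic_dir p)\<^sup>2) else 0) / of_real R ^ 2"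
      by (simp add: power_mult_distrib)
    show "Psi R = (of_real pi / (2 * of_nat N * generic_dir p ^ N)) / of_real R ^ N
      + dir_sum p (generic_dir p * of_real R) * g R - (if p = 0 then 1 / (2 * (generic_dir p)\<^sup>2) else 0) / of_real R ^ 2"
      unfolding Psi_def g_def 1 3 by (simp only: 2)
  qed
  show ?thesis
    unfolding eq
    by (intro log_asym_add log_asym_diff asym_imp_log_asym[OF asym_monomial]
        asym_imp_log_asym[OF dir_sum_mult_negligible[OF g]])
qed

text \<open>The sum over k grows at most like R^(2N), whereas \<open>dir_sum\<close> on the oblique
  ray decays faster than every power.\<close>

lemma boundary_term_negligible:
  "asym_expansion (\<lambda>R. dir_sum p (generic_dir p * of_real R) *
     (of_real pi / (of_nat N * (generic_dir p * of_real R) ^ N) * (-1) ^ p *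
       (\<Sum>k. cnj (chi (int (Suc k))) * (\<i> * of_real R ^ (2 * N) / (\<i> * of_real R ^ (2 * N) + of_real (- ((b * real (Suc k))\<^sup>2))))))) (\<lambda>_. 0)"
proof (rule dir_sum_mult_negligible)
  fix R :: real assume R: "R \<ge> 1"
  define S where "S = (\<Sum>k. 1 / real (Suc k) ^ 2)"
  have b1: "norm (\<Sum>k. cnj (chi (int (Suc k))) * (\<i> * of_real R ^ (2 * N) / (\<i> * of_real R ^ (2 * N) + of_real (- ((b * real (Suc k))\<^sup>2)))))
      \<le> (\<Sum>k. R ^ (2 * N) / b\<^sup>2 * (1 / real (Suc k) ^ 2))"
  proof (rule norm_suminf_le)
    show "summable (\<lambda>k. R ^ (2 * N) / b\<^sup>2 * (1 / real (Suc k) ^ 2))" by (intro summable_mult summable_inverse_power_Suc) simp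
    fix k
    have xp: "(b * real (Suc k))\<^sup>2 > 0" using b_pos by simp
    have xC: "(b * real (Suc k))\<^sup>2 \<le> norm (\<i> * of_real (R ^ (2 * N)) + of_real (- ((b * real (Suc k))\<^sup>2)))"
      using norm_imaginary_add_real(2)[of "- ((b * real (Suc k))\<^sup>2)" "R ^ (2 * N)"] xp by linarith
    have "norm (cnj (chi (int (Suc k))) * (\<i> * of_real (R ^ (2 * N)) / (\<i> * of_real (R ^ (2 * N)) + of_real (- ((b * real (Suc k))\<^sup>2)))))
       = norm (chi (int (Suc k))) * (R ^ (2 * N) / norm (\<i> * of_real (R ^ (2 * N)) + complex_of_real (- ((b * real (Suc k))\<^sup>2))))"
      using R unfolding norm_mult norm_divide by (simp add: norm_power del: of_nat_Suc)
    also have "\<dots> \<le> 1 * (R ^ (2 * N) / (b * real (Suc k))\<^sup>2)"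
      using R by (intro mult_mono norm_chi_le_1 divide_left_mono mult_pos_pos xC xp less_le_trans[OF xp xC]) auto
    finally show "norm (cnj (chi (int (Suc k))) * (\<i> * of_real R ^ (2 * N) / (\<i> * of_real R ^ (2 * N) + of_real (- ((b * real (Suc k))\<^sup>2)))))
       \<le> R ^ (2 * N) / b\<^sup>2 * (1 / real (Suc k) ^ 2)"
      by (simp add: power_mult_distrib del: of_nat_Suc)
  qed
  also have "\<dots> = R ^ (2 * N) / b\<^sup>2 * S"
    unfolding S_def by (rule suminf_mult[OF summable_inverse_power_Suc]) simp
  finally have b1: "norm (\<Sum>k. cnj (chi (int (Suc k))) * (\<i> * of_real R ^ (2 * N) / (\<i> * of_real R ^ (2 * N) + of_real (- ((b * real (Suc k))\<^sup>2)))))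
      \<le> R ^ (2 * N) / b\<^sup>2 * S" .
  have b2: "norm (of_real pi / (of_nat N * (generic_dir p * complex_of_real R) ^ N) * (-1) ^ p) \<le> pi"
  proof -
    have "norm (of_real pi / (of_nat N * (generic_dir p * complex_of_real R) ^ N) * (-1) ^ p) = pi / (real N * R ^ N)"
      using R by (simp add: norm_mult norm_divide norm_power norm_generic_dir)
    also have "\<dots> \<le> pi / 1"
    proof (rule divide_left_mono)
      have "1 * 1 \<le> real N * R ^ N" using R N_pos by (intro mult_mono one_le_power) auto
      then show "1 \<le> real N * R ^ N" by simp
    qed (use R N_pos in auto)
    finally show ?thesis by simp
  qed
  show "norm (of_real pi / (of_nat N * (generic_dir p * of_real R) ^ N) * (-1) ^ p *
       (\<Sum>k. cnj (chi (int (Suc k))) * (\<i> * of_real R ^ (2 * N) / (\<i> * of_real R ^ (2 * N) + of_real (- ((b * real (Suc k))\<^sup>2))))))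
     \<le> (pi * (\<Sum>k. 1 / real (Suc k) ^ 2) / b\<^sup>2) * R ^ (2 * N)"
    unfolding norm_mult[of "of_real pi / (of_nat N * (generic_dir p * of_real R) ^ N) * (-1) ^ p"]
    using mult_mono[OF b2 b1] by (simp add: S_def mult_ac)
qed

text \<open>The M-th moment of \<open>kernel_weight\<close> is, up to (-1)^M, the series on the
  left, and the expansions carry it with the factor 1 / C^M. Hence the coefficients of index 2NM in
  \<open>weighted_kernel_identity\<close> are compared after multiplication by i^M.\<close>

theorem core_identity_neg:
  assumes M: "M > 0"
  shows "(\<lambda>n. char_kernel (of_real (a * real (Suc n) ^ N)) * of_nat (Suc n) ^ (2 * N * M - 1)) sums
    (- pole_coeff / 2 * riemann_zeta (1 - 2 * of_nat (N * M)) - (if p = 0 \<and> M = 1 then pole_coeff / (2 * of_real a) else 0)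
      + 2 * gauss_sum q chi / of_real a *
       ((-1) ^ M * of_real b ^ (2 * M - 1) * (of_real pi / of_nat N) *
          (dirichlet_L (\<lambda>n. cnj (chi n)) (1 - 2 * of_nat M) / 2 + (-1) ^ p * dir_series (1 - 2 * int M))))"
proof -
  define K where "K = 2 * gauss_sum q chi / of_real a"
  define P where "P = of_real pi / (of_nat N :: complex)"
  define \<kappa> where "\<kappa> = generic_dir p"
  obtain u1 where u1: "log_asym (weighted_harmonic p) u1"
      "\<And>M. M > 0 \<Longrightarrow> u1 (2 * N * M) = riemann_zeta (1 - 2 * of_nat (N * M)) / (- \<i>) ^ M"
    using log_asym_weighted_harmonic[of p] unfolding N_def by blast
  define uP where "uP = (\<lambda>i. (if i = N then of_real pi / (2 * of_nat N * \<kappa> ^ N) else 0) + 0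
      - (if i = 2 then if p = 0 then 1 / (2 * \<kappa>\<^sup>2) else 0 else 0))"
  have uP: "log_asym Psi uP" unfolding uP_def \<kappa>_def by (rule log_asym_Psi)
  define y where "y = \<kappa> ^ N / of_real b"
  have y: "Re y > 0" unfolding y_def \<kappa>_def generic_dir_power_N using b_pos by (simp add: cos_45)
  define uJ where "uJ = (\<lambda>i. if i > 0 \<and> N dvd i then - fact (i div N - 1) * cnj_char.exp_coeff (i div N - 1) / y ^ (i div N) else 0)"
  have uJ: "log_asym (\<lambda>R. cnj_exp.J (y * of_real R ^ N)) uJ"
    unfolding uJ_def by (rule cnj_exp.log_asym_J[OF y N_pos])
  define uE where "uE = (\<lambda>i. if 2 * N dvd i then (\<Sum>n. kernel_weight n * of_real (- (real (Suc n) ^ (2 * N))) ^ (i div (2 * N))) / \<i> ^ (i div (2 * N)) else 0)"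
  have uE: "log_asym (\<lambda>R. \<Sum>n. kernel_weight n * (\<i> * of_real R ^ (2 * N) / (\<i> * of_real R ^ (2 * N) + of_real (real (Suc n) ^ (2 * N))))) uE"
    unfolding uE_def using N_pos by (intro asym_imp_log_asym weighted_sum_expansion summable_kernel_weight) auto
  define uH where "uH = (\<lambda>i. if 2 * N dvd i then (\<Sum>k. node_weight k * of_real (- (- ((b * real (Suc k))\<^sup>2))) ^ (i div (2 * N))) / \<i> ^ (i div (2 * N)) else 0)"
  have uH: "log_asym (\<lambda>R. \<Sum>k. node_weight k * (\<i> * of_real R ^ (2 * N) / (\<i> * of_real R ^ (2 * N) + of_real (- ((b * real (Suc k))\<^sup>2))))) uH"
    unfolding uH_def using N_pos by (intro asym_imp_log_asym weighted_sum_expansion summable_node_weight) auto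
  define u where "u = (\<lambda>i. - pole_coeff / 2 * u1 i + pole_coeff / of_real a * (0 - uP i)
      + K * (P / (2 * of_real b) * uJ i - 0 + P * (-1) ^ p * uH i - 0))"
  have "log_asym (\<lambda>R. - pole_coeff / 2 * weighted_harmonic p R + pole_coeff / of_real a * (zeta_sum (N + 1) - Psi R)
       + K * (P / (2 * of_real b) * cnj_exp.J (y * of_real R ^ N)
          - (if p = 0 then 1 / (2 * (of_real b)\<^sup>2) else 0) * cnj_L_series 2
          + P * (-1) ^ p * (\<Sum>k. node_weight k * (\<i> * of_real R ^ (2 * N) / (\<i> * of_real R ^ (2 * N) + of_real (- ((b * real (Suc k))\<^sup>2)))))
          - dir_sum p (generic_dir p * of_real R) * (of_real pi / (of_nat N * (generic_dir p * of_real R) ^ N) * (-1) ^ p *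
            (\<Sum>k. cnj (chi (int (Suc k))) * (\<i> * of_real R ^ (2 * N) / (\<i> * of_real R ^ (2 * N) + of_real (- ((b * real (Suc k))\<^sup>2)))))))) u"
    unfolding u_def
    by (intro log_asym_add log_asym_diff log_asym_cmult u1(1) uP uJ uH log_asym_const
        asym_imp_log_asym[OF boundary_term_negligible])
  moreover have "\<forall>\<^sub>F R in at_top. - pole_coeff / 2 * weighted_harmonic p R + pole_coeff / of_real a * (zeta_sum (N + 1) - Psi R)
       + K * (P / (2 * of_real b) * cnj_exp.J (y * of_real R ^ N)
          - (if p = 0 then 1 / (2 * (of_real b)\<^sup>2) else 0) * cnj_L_series 2
          + P * (-1) ^ p * (\<Sum>k. node_weight k * (\<i> * of_real R ^ (2 * N) / (\<i> * of_real R ^ (2 * N) + of_real (- ((b * real (Suc k))\<^sup>2)))))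
          - dir_sum p (generic_dir p * of_real R) * (of_real pi / (of_nat N * (generic_dir p * of_real R) ^ N) * (-1) ^ p *
            (\<Sum>k. cnj (chi (int (Suc k))) * (\<i> * of_real R ^ (2 * N) / (\<i> * of_real R ^ (2 * N) + of_real (- ((b * real (Suc k))\<^sup>2)))))))
     = (\<Sum>n. kernel_weight n * (\<i> * of_real R ^ (2 * N) / (\<i> * of_real R ^ (2 * N) + of_real (real (Suc n) ^ (2 * N)))))"
    using eventually_gt_at_top[of 0]
  proof eventually_elim
    case (elim R)
    have 1: "(generic_dir p * of_real R) ^ N / of_real b = y * of_real R ^ N"
      unfolding y_def \<kappa>_def by (simp add: power_mult_distrib)
    have 2: "of_real pi / (2 * of_nat N * complex_of_real b) = P / (2 * of_real b)" by (simp add: P_def)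
    have 3: "X * D * B = D * (X * B)" for X D B :: complex by simp
    show ?case
      unfolding weighted_kernel_identity[OF elim, unfolded of_real_power[where x = R], folded K_def, unfolded 1 2 P_def[symmetric]]
      by (simp only: 3[of _ "dir_sum p (generic_dir p * of_real R)"])
  qed
  ultimately have u: "log_asym (\<lambda>R. \<Sum>n. kernel_weight n * (\<i> * of_real R ^ (2 * N) / (\<i> * of_real R ^ (2 * N) + of_real (real (Suc n) ^ (2 * N))))) u"
    by (rule log_asym_cong_ev[rotated])
  \<comment> \<open>Positive, so \<open>log_asym_unique\<close> applies. It is an even multiple of N
    and therefore avoids the index N from the expansion of \<open>Psi\<close>; for \<open>J\<close>
    it selects the coefficient with the L-value at 1 - 2M.\<close>
  define i0 where "i0 = 2 * N * M"
  have i0: "i0 > 0" "2 * N dvd i0" "i0 div (2 * N) = M" "N dvd i0" "i0 div N = 2 * M"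
    using M N_pos by (simp_all add: i0_def)
  have i0N: "i0 \<noteq> N" using M N_pos by (simp add: i0_def)
  have i02: "i0 = 2 \<longleftrightarrow> p = 0 \<and> M = 1"
  proof
    assume "i0 = 2"
    then have "(2 * p + 1) * M = 1" unfolding i0_def N_def by simp
    then have "2 * p + 1 = 1 \<and> M = 1" by (simp only: nat_mult_eq_1_iff)
    then show "p = 0 \<and> M = 1" by simp
  next
    assume "p = 0 \<and> M = 1"
    then show "i0 = 2" unfolding i0_def N_def by simp
  qed
  have \<kappa>2N: "\<kappa> ^ (2 * N) = \<i>" unfolding \<kappa>_def N_def by (rule generic_dir_power)
  have I: "\<i> ^ M \<noteq> 0" by simp
  have mI: "1 / (- \<i>) ^ M = (-1) ^ M / \<i> ^ M" by (subst power_minus) (simp add: field_simps flip: power_mult_distrib)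
  define S where "S = (\<Sum>n. kernel_weight n * of_real (- (real (Suc n) ^ (2 * N))) ^ M)"
  have "uE i0 = u i0" using log_asym_unique[OF uE u i0(1)] .
  moreover have "uE i0 = S / \<i> ^ M" unfolding uE_def S_def using i0 by simp
  ultimately have S1: "S = \<i> ^ M * u i0" using I by (metis nonzero_mult_div_cancel_left times_divide_eq_right)
  have e1: "\<i> ^ M * u1 i0 = (-1) ^ M * riemann_zeta (1 - 2 * of_nat (N * M))"
  proof -
    have "u1 i0 = riemann_zeta (1 - 2 * of_nat (N * M)) * (1 / (- \<i>) ^ M)" unfolding i0_def u1(2)[OF M] by simp
    then show ?thesis unfolding mI by simp
  qed
  \<comment> \<open>The elementary term of \<open>Psi\<close> for N = 1 is seen only when i0 = 2; it
    accounts for the residual term with B_0 at N = 1, m = -1.\<close>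
  have e2: "\<i> ^ M * uP i0 = - (if p = 0 \<and> M = 1 then 1 / 2 else 0)"
  proof (cases "p = 0 \<and> M = 1")
    case True
    then have "N = 1" unfolding N_def by simp
    then have "\<kappa>\<^sup>2 = \<i>" using \<kappa>2N by simp
    moreover have "i0 = 2" using True i02 by simp
    ultimately show ?thesis using True i0N by (simp add: uP_def)
  next
    case False
    then show ?thesis using i02 i0N by (auto simp: uP_def)
  qed
  have e3: "\<i> ^ M * uJ i0 = of_real b ^ (2 * M) * dirichlet_L (\<lambda>n. cnj (chi n)) (1 - 2 * of_nat M)"
  proof -
    have "y ^ (2 * M) = \<i> ^ M / of_real b ^ (2 * M)"
      unfolding y_def power_divide using \<kappa>2N by (simp add: power_mult[symmetric] mult_ac) (metis mult.commute mult.left_commute power_mult)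
    moreover have "dirichlet_L (\<lambda>n. cnj (chi n)) (1 - 2 * of_nat M) = - fact (2 * M - 1) * cnj_char.exp_coeff (2 * M - 1)"
    proof -
      have "- of_nat (2 * M - 1) = (1 - 2 * of_nat M :: complex)" using M by (simp add: of_nat_diff)
      moreover have "odd (2 * M - 1)" using M by simp
      ultimately show ?thesis using cnj_char.dirichlet_L_values(2)[of "2 * M - 1"] by simp
    qed
    ultimately show ?thesis using i0 I by (simp add: uJ_def)
  qed
  have e4: "\<i> ^ M * uH i0 = of_real b ^ (2 * M - 1) * dir_series (1 - 2 * int M)"
  proof -
    obtain j where j: "M = Suc j" using M by (cases M) auto
    have 1: "(\<Sum>k. node_weight k * of_real ((b * real (Suc k))\<^sup>2) ^ Suc j) = of_real b ^ (2 * j + 1) * dir_series (- 2 * int j - 1)"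
      unfolding node_weight_eq using sums_unique[OF sums_mult[OF dir_series_sums[of "- 2 * int j - 1"], of "of_real b ^ (2 * j + 1)"]] by simp
    have 2: "2 * M - 1 = 2 * j + 1" "1 - 2 * int M = - 2 * int j - 1" by (simp_all add: j)
    have "uH i0 = (\<Sum>k. node_weight k * of_real ((b * real (Suc k))\<^sup>2) ^ M) / \<i> ^ M"
      unfolding uH_def using i0 by simp
    then have "\<i> ^ M * uH i0 = (\<Sum>k. node_weight k * of_real ((b * real (Suc k))\<^sup>2) ^ M)" using I by simp
    then show ?thesis unfolding 2 1[folded j] .
  qed
  have b0: "complex_of_real b \<noteq> 0" using b_pos by simp
  have bM: "complex_of_real b ^ (2 * M) = of_real b ^ (2 * M - 1) * of_real b"
    using power_Suc2[of "complex_of_real b" "2 * M - 1"] M by simp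
  have "S = - pole_coeff / 2 * (\<i> ^ M * u1 i0) - pole_coeff / of_real a * (\<i> ^ M * uP i0)
      + K * (P / (2 * of_real b) * (\<i> ^ M * uJ i0) + P * (-1) ^ p * (\<i> ^ M * uH i0))"
  proof -
    have "I * (c1 * x1 + c2 * (0 - x2) + K' * (c3 * x3 - 0 + c4 * x4 - 0)) = c1 * (I * x1) - c2 * (I * x2) + K' * (c3 * (I * x3) + c4 * (I * x4))"
      for I c1 c2 c3 c4 x1 x2 x3 x4 K' :: complex by (simp add: algebra_simps)
    then show ?thesis unfolding S1 u_def .
  qed
  also have "\<dots> = - pole_coeff / 2 * ((-1) ^ M * riemann_zeta (1 - 2 * of_nat (N * M))) + pole_coeff / of_real a * (if p = 0 \<and> M = 1 then 1 / 2 else 0)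
      + K * (of_real b ^ (2 * M - 1) * P * (dirichlet_L (\<lambda>n. cnj (chi n)) (1 - 2 * of_nat M) / 2 + (-1) ^ p * dir_series (1 - 2 * int M)))"
  proof -
    have "c1 - c2 * (- e) + K' * (P' / (2 * b') * (B * b' * L) + P' * s * (B * D)) = c1 + c2 * e + K' * (B * P' * (L / 2 + s * D))"
      if "b' \<noteq> 0" for c1 c2 e K' P' b' B L s D :: complex using that by (simp add: algebra_simps)
    from this[OF b0] show ?thesis unfolding e1 e2 e3 e4 bM .
  qed
  finally have S2: "(-1) ^ M * S = - pole_coeff / 2 * riemann_zeta (1 - 2 * of_nat (N * M)) - (if p = 0 \<and> M = 1 then pole_coeff / (2 * of_real a) else 0)
      + K * ((-1) ^ M * of_real b ^ (2 * M - 1) * P *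
          (dirichlet_L (\<lambda>n. cnj (chi n)) (1 - 2 * of_nat M) / 2 + (-1) ^ p * dir_series (1 - 2 * int M)))"
  proof -
    have m1: "(-1 :: complex) ^ M * (-1) ^ M = 1" by (simp flip: power_mult_distrib)
    have "s * (x * (s * z)) = (s * s) * (x * z)" for s x z :: complex by simp
    then have m2: "(-1 :: complex) ^ M * (x * ((-1) ^ M * z)) = x * z" for x z
      unfolding m1 by simp
    have m3: "(-1 :: complex) ^ M * (pole_coeff / of_real a * (if p = 0 \<and> M = 1 then 1 / 2 else 0)) = - (if p = 0 \<and> M = 1 then pole_coeff / (2 * of_real a) else 0)"
      by auto
    assume "S = - pole_coeff / 2 * ((-1) ^ M * riemann_zeta (1 - 2 * of_nat (N * M))) + pole_coeff / of_real a * (if p = 0 \<and> M = 1 then 1 / 2 else 0)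
      + K * (of_real b ^ (2 * M - 1) * P * (dirichlet_L (\<lambda>n. cnj (chi n)) (1 - 2 * of_nat M) / 2 + (-1) ^ p * dir_series (1 - 2 * int M)))"
    then show ?thesis by (simp only: distrib_left m2 m3) (simp add: mult_ac)
  qed
  have "(\<lambda>n. (-1) ^ M * (kernel_weight n * of_real (- (real (Suc n) ^ (2 * N))) ^ M)) sums ((-1) ^ M * S)"
    unfolding S_def
    by (intro sums_mult summable_sums, rule summable_norm_cancel)
      (use summable_kernel_weight[of M] in \<open>simp add: norm_mult norm_power del: of_nat_Suc\<close>)
  also have "(\<lambda>n. (-1) ^ M * (kernel_weight n * of_real (- (real (Suc n) ^ (2 * N))) ^ M))
     = (\<lambda>n. char_kernel (of_real (a * real (Suc n) ^ N)) * of_nat (Suc n) ^ (2 * N * M - 1))"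
  proof
    fix n
    define X where "X = (of_nat (Suc n) :: complex)"
    have X0: "X \<noteq> 0" by (simp add: X_def del: of_nat_Suc)
    have "complex_of_real (- (real (Suc n) ^ (2 * N))) ^ M = (- (X ^ (2 * N))) ^ M" by (simp add: X_def)
    also have "\<dots> = (-1) ^ M * X ^ (2 * N * M)" by (subst power_minus) (simp add: power_mult)
    also have "X ^ (2 * N * M) = X ^ (2 * N * M - 1) * X"
      using power_Suc2[of X "2 * N * M - 1"] M N_pos by simp
    finally have e: "complex_of_real (- (real (Suc n) ^ (2 * N))) ^ M = (-1) ^ M * (X ^ (2 * N * M - 1) * X)" .
    have m1: "(-1 :: complex) ^ M * (-1) ^ M = 1" by (simp flip: power_mult_distrib)
    have "(-1) ^ M * (c / X * ((-1) ^ M * (V * X))) = ((-1) ^ M * (-1) ^ M) * (c * V)" for c V :: complex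
      using X0 by simp
    then show "(-1) ^ M * (kernel_weight n * of_real (- (real (Suc n) ^ (2 * N))) ^ M)
      = char_kernel (of_real (a * real (Suc n) ^ N)) * of_nat (Suc n) ^ (2 * N * M - 1)"
      unfolding e kernel_weight_def X_def[symmetric] m1 by (simp only: mult_1)
  qed
  finally show ?thesis unfolding S2 K_def P_def .
qed

end

section \<open>The transformation formula\<close>

lemma powi_eq_exp_ln: "x > 0 \<Longrightarrow> x powi k = exp (of_int k * ln (x :: real))"
  by (simp add: powr_def flip: powr_real_of_int')

lemma minus_one_powi_square: "(-1 :: 'a :: field) powi k * (-1) powi k = 1"
  by (simp flip: power_int_mult_distrib)

lemma minus_one_powi_add: "(-1 :: 'a :: field) powi (k + l) = (-1) powi k * (-1) powi l"
  by (simp add: power_int_add)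

lemma sum_int_eq_sum_nat: "(\<Sum>j\<in>{1..int m}. f j) = (\<Sum>j=1..m. f (int j))"
  by (rule sum.reindex_cong[of int]) (auto simp: image_int_atLeastAtMost)

text \<open>The fraction (N + 1) / (2N) is 1 for N = 1 and lies strictly between 0 and 1
  otherwise.\<close>

lemma floor_upper_index:
  assumes "N = 2 * p + 1"
  shows "\<lfloor>of_int m + (real N + 1) / (2 * real N)\<rfloor> = m + (if p = 0 then 1 else 0)"
proof (cases "p = 0")
  case False
  then have "\<lfloor>(real N + 1) / (2 * real N)\<rfloor> = 0"
    using assms by (simp add: floor_eq_iff field_simps)
  then show ?thesis using False by simp
qed (simp add: assms)

lemma exp_over_one_minus_exp_le:
  assumes x: "x > 0" and r: "r \<in> {1..q}" and m: "m > 0"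
  shows "exp (- (real r / real q * x)) / (1 - exp (- x)) \<le> fact m * real q ^ m / x ^ m"
proof -
  define t where "t = x / real q"
  have q: "real q \<ge> 1" "real r \<ge> 1" using r by auto
  have t: "t > 0" "t \<le> x" "t \<le> real r / real q * x" using x q by (auto simp: t_def field_simps)
  have "exp (- (real r / real q * x)) / (1 - exp (- x)) \<le> exp (- t) / (1 - exp (- t))"
    using t by (intro frac_le) auto
  also have "\<dots> = 1 / (exp t - 1)"
    using t(1) by (simp add: exp_minus divide_simps)
  also have "\<dots> \<le> 1 / (t ^ m / fact m)"
    using power_over_fact_le_exp_minus_1[of t m] t m by (intro divide_left_mono) auto
  also have "\<dots> = fact m * real q ^ m / x ^ m" by (simp add: t_def power_divide)
  finally show ?thesis .
qed

context kernel_setup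
begin

text \<open>The value at \<open>0\<close> and the vanishing at negative arguments are those of \<open>B\<^sub>e / e!\<close>, up to the factor relating it to \<open>\<zeta>(e)\<close>.\<close>

definition zeta_ext :: "int \<Rightarrow> complex" where
  "zeta_ext e = (if e < 0 then 0 else if e = 0 then - 1 / 2 else zeta_sum (nat e))"

lemma bern_over_fact_zeta_ext:
  "bern_over_fact (2 * i) = 2 * (-1) powi (i - 1) * zeta_ext (2 * i) / (2 * of_real pi) powi (2 * i)"
proof -
  consider "i < 0" | "i = 0" | n where "i = int n" "n > 0"
    by (metis linorder_less_linear zero_less_imp_eq_int)
  then show ?thesis
  proof cases
    case 3
    have 1: "nat (2 * i) = 2 * n" "i - 1 = int (n - 1)" "2 * i = int (2 * n)" "\<not> 2 * i < 0" "2 * i \<noteq> 0"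
      using 3 by auto
    show ?thesis
      unfolding bern_over_fact_def zeta_ext_def using 1(4,5)
      by (simp only: if_False 1(1)) (simp only: 1(2,3) power_int_of_nat bernoulli_num_even[OF 3(2)] zeta_sum_def)
  qed (auto simp: bern_over_fact_def zeta_ext_def bernoulli_num_0)
qed

text \<open>The value -1/2 of \<open>zeta_ext\<close> at 0 absorbs the exceptions of both cases. For
  m > 0 and N = 1 the correction with the L-series at 2m + 2 is the summand j = m + 1. For m < 0 the
  sum is empty, and 2Nm + N + 1 is negative unless N = 1 and m = -1, where it is 0.\<close>

theorem core_identity:
  assumes m: "m \<noteq> 0"
  shows "(\<lambda>n. char_kernel (of_real (a * real (Suc n) ^ N)) / of_nat (Suc n) powi (2 * int N * m + 1)) sums
    (- pole_coeff / 2 * riemann_zeta (of_int (2 * int N * m + 1))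
      + pole_coeff / of_real a * zeta_ext (2 * int N * m + int N + 1)
      + 2 * gauss_sum q chi / of_real a *
       ((-1) powi m / of_real b powi (2 * m + 1) * (of_real pi / of_nat N) *
          (dirichlet_L (\<lambda>n. cnj (chi n)) (of_int (2 * m + 1)) / 2 + (-1) ^ p * dir_series (2 * m + 1))
        + (\<Sum>j\<in>{1..m + (if p = 0 then 1 else 0)}. (-1) powi (j - 1) / of_real b powi (2 * j) * cnj_L_series (nat (2 * j))
             * zeta_ext (2 * int N * (m - j) + int N + 1))))"
proof (cases "m > 0")
  case True
  then obtain k where k: "m = int k" "k > 0" using zero_less_imp_eq_int by blast
  interpret cnj_char: even_primitive_character q "\<lambda>n. cnj (chi n)" by (rule even_primitive_cnj)
  have L: "dirichlet_L (\<lambda>n. cnj (chi n)) (of_int (2 * m + 1)) = cnj_L_series (2 * k + 1)"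
    using cnj_char.dirichlet_L_nat[of "2 * k + 1"] k by (simp add: cnj_L_series_def add.commute)
  have Z: "riemann_zeta (of_int (2 * int N * m + 1)) = zeta_sum (2 * N * k + 1)"
    using riemann_zeta_nat[of "2 * N * k + 1"] k N_pos by (simp add: zeta_sum_def add.commute)
  have E: "zeta_ext (2 * int N * int i + int N + 1) = zeta_sum (2 * N * i + N + 1)" for i
  proof -
    have "zeta_ext (int n) = zeta_sum n" if "n > 0" for n using that by (simp add: zeta_ext_def)
    from this[of "2 * N * i + N + 1"] show ?thesis by (simp add: ac_simps)
  qed
  have pw: "x powi (2 * int N * m + 1) = x ^ (2 * N * k + 1)" "x powi (2 * m + 1) = x ^ (2 * k + 1)" for x :: complex
    using power_int_of_nat[of x "2 * N * k + 1"] power_int_of_nat[of x "2 * k + 1"] k by (simp_all add: ac_simps)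
  have pm: "(-1 :: complex) powi m = (-1) ^ k" by (simp add: k)
  define T where "T = (\<lambda>j. (-1) powi (j - 1) / of_real b powi (2 * j) * cnj_L_series (nat (2 * j))
             * zeta_ext (2 * int N * (m - j) + int N + 1))"
  have Tj: "T (int j) = (-1) ^ (j - 1) / of_real b ^ (2 * j) * cnj_L_series (2 * j) * zeta_sum (2 * N * (k - j) + N + 1)"
    if "j \<in> {1..k}" for j
  proof -
    have 1: "m - int j = int (k - j)" "int j - 1 = int (j - 1)" "2 * int j = int (2 * j)" using that k by auto
    show ?thesis unfolding T_def 1 E power_int_of_nat nat_int ..
  qed
  have S1: "(\<Sum>j\<in>{1..m}. T j) = (\<Sum>j=1..k. (-1) ^ (j - 1) / of_real b ^ (2 * j) * cnj_L_series (2 * j) * zeta_sum (2 * N * (k - j) + N + 1))"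
    unfolding k(1) sum_int_eq_sum_nat by (rule sum.cong[OF refl Tj])
  have S2: "T (m + 1) = - ((-1) ^ k / (2 * of_real b ^ (2 * k + 2)) * cnj_L_series (2 * k + 2))" if "p = 0"
  proof -
    have n1: "N = 1" using that unfolding N_def by simp
    have 1: "2 * (m + 1) = int (2 * k + 2)" "2 * int N * (m - (m + 1)) + int N + 1 = 0" "m + 1 - 1 = int k"
      using k n1 by auto
    show ?thesis unfolding T_def 1 power_int_of_nat nat_int zeta_ext_def by simp
  qed
  have S: "(\<Sum>j\<in>{1..m + (if p = 0 then 1 else 0)}. T j)
     = - (if p = 0 then (-1) ^ k / (2 * of_real b ^ (2 * k + 2)) * cnj_L_series (2 * k + 2) else 0) + (\<Sum>j\<in>{1..m}. T j)"
  proof (cases "p = 0")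
    case True
    have "{1..m + 1} = insert (m + 1) {1..m}" using k by auto
    then have "(\<Sum>j\<in>{1..m + 1}. T j) = T (m + 1) + (\<Sum>j\<in>{1..m}. T j)" by simp
    then show ?thesis unfolding S2[OF True] by (simp only: True refl if_True)
  qed simp
  have A: "x + (- e + s) = x - e + s" for x e s :: complex by simp
  show ?thesis
    unfolding T_def[symmetric] S S1 L Z E[of k, folded k(1)] pw pm A
    using core_identity_pos[OF k(2)] unfolding k(1) of_nat_mult by (simp only: of_nat_mult of_nat_numeral)
next
  case False
  then obtain M where k: "m = - int M" "M > 0"
    using m by (metis int_cases2 neg_0_equal_iff_equal of_nat_0 of_nat_0_less_iff gr0I)
  have L: "complex_of_int (1 - 2 * int M) = 1 - 2 * of_nat M" "complex_of_int (2 * int N * m + 1) = 1 - 2 * of_nat (N * M)"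
     "2 * m + 1 = 1 - 2 * int M"
    using k by simp_all
  have NM: "2 * N * M > 0" using k N_pos by simp
  have e: "2 * int N * m + 1 = - int (2 * N * M - 1)" "1 - 2 * int M = - int (2 * M - 1)"
    using k NM by (simp_all add: of_nat_diff)
  have pw: "x / y powi (2 * int N * m + 1) = x * y ^ (2 * N * M - 1)"  "x / y powi (1 - 2 * int M) = x * y ^ (2 * M - 1)" for x y :: complex
    unfolding e by (simp_all add: power_int_minus divide_inverse)
  have pm: "(-1 :: complex) powi m = (-1) ^ M" by (simp add: k power_int_minus flip: power_inverse)
  have S: "(\<Sum>j\<in>{1..m + (if p = 0 then 1 else 0)}. T j) = 0" for T :: "int \<Rightarrow> complex"
    using k by simp
  have E: "pole_coeff / of_real a * zeta_ext (2 * int N * m + int N + 1) = - (if p = 0 \<and> M = 1 then pole_coeff / (2 * of_real a) else 0)"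
  proof (cases "p = 0 \<and> M = 1")
    case True
    then have "N = 1" unfolding N_def by simp
    then have "2 * int N * m + int N + 1 = 0" using k True by simp
    then have "zeta_ext (2 * int N * m + int N + 1) = - 1 / 2" unfolding zeta_ext_def by simp
    then show ?thesis using True by simp
  next
    case False
    have "2 * int N * m + int N + 1 < 0"
    proof (cases "M = 1")
      case True
      then have "N > 1" using False unfolding N_def by simp
      then show ?thesis using k True by simp
    next
      case M: False
      have "2 * int N * 2 \<le> 2 * int N * int M" using M k(2) by (intro mult_left_mono) auto
      then have "2 * int N * int M \<ge> 4 * int N" by simp
      moreover have "2 * int N * m = - (2 * int N * int M)" using k by simp
      ultimately show ?thesis using N_pos by linarith
    qed
    then show ?thesis using False unfolding zeta_ext_def by auto
  qed
  have A: "x + - e = x - e" "x + 0 = x" for x e :: complex by simp_all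
  show ?thesis
    unfolding S E L pw pm A using core_identity_neg[OF k(2)] .
qed

section \<open>Identification with the sums of the theorem\<close>

lemma kernel_double_sum:
  "(\<Sum>r=1..q. \<Sum>n. chi (int r) * of_real (exp (- (real r / real q * (a * real (Suc n) ^ N))) /
           (real (Suc n) powi e * (1 - exp (- (a * real (Suc n) ^ N))))))
      = (\<Sum>n. char_kernel (of_real (a * real (Suc n) ^ N)) / of_nat (Suc n) powi e)"
proof -
  define f where "f = (\<lambda>r n. chi (int r) * complex_of_real (exp (- (real r / real q * (a * real (Suc n) ^ N))) / (1 - exp (- (a * real (Suc n) ^ N)))))"
  define M where "M = nat \<bar>e\<bar> + 2"
  have sm: "summable (\<lambda>n. f r n / of_nat (Suc n) powi e)" if r: "r \<in> {1..q}" for r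
  proof (rule summable_norm_cancel, rule summable_over_powi)
    fix n
    define x where "x = real (Suc n)"
    have x: "x \<ge> 1" by (simp add: x_def)
    have "x ^ 1 \<le> x ^ N" using x N_pos by (intro power_increasing) auto
    then have ax: "a * x \<le> a * x ^ N" "a * x > 0" "a * x ^ N > 0" using a x by auto
    have "norm (f r n) \<le> 1 * (exp (- (real r / real q * (a * x ^ N))) / (1 - exp (- (a * x ^ N))))"
      unfolding f_def x_def[symmetric] norm_mult norm_of_real using norm_chi_le_1[of "int r"] ax(3)
      by (intro mult_mono) (auto intro!: divide_nonneg_nonneg)
    also have "\<dots> \<le> fact M * real q ^ M / (a * x ^ N) ^ M"
      using exp_over_one_minus_exp_le[OF ax(3) r, of M] by (simp add: M_def)
    also have "\<dots> \<le> fact M * real q ^ M / (a * x) ^ M"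
      using ax by (intro divide_left_mono power_mono mult_pos_pos) auto
    finally show "norm (f r n) \<le> (fact M * real q ^ M / a ^ M) / real (Suc n) ^ (nat \<bar>e\<bar> + 2)"
      unfolding x_def[symmetric] M_def[symmetric] by (simp add: power_mult_distrib)
  qed
  have "(\<Sum>r=1..q. \<Sum>n. f r n / of_nat (Suc n) powi e) = (\<Sum>n. \<Sum>r=1..q. f r n / of_nat (Suc n) powi e)"
    by (rule suminf_sum[symmetric, OF sm])
  also have "\<dots> = (\<Sum>n. char_kernel (of_real (a * real (Suc n) ^ N)) / of_nat (Suc n) powi e)"
  proof (rule suminf_cong)
    fix n
    have "(\<Sum>r=1..q. f r n) = char_kernel (of_real (a * real (Suc n) ^ N))"
      unfolding char_kernel_def sum_divide_distrib f_def
      by (simp add: exp_of_real[symmetric] del: of_nat_Suc)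
    then show "(\<Sum>r=1..q. f r n / of_nat (Suc n) powi e) = char_kernel (of_real (a * real (Suc n) ^ N)) / of_nat (Suc n) powi e"
      by (simp only: sum_divide_distrib[symmetric])
  qed
  finally show ?thesis unfolding f_def by (simp add: mult_ac del: of_nat_Suc)
qed

lemma dir_double_sum:
  "(\<Sum>j\<in>{- int p..int p}. (-1) powi j * (\<Sum>n. 1 / of_real (real (Suc n) powi e) * cnj (chi (int (Suc n))) /
        (exp (of_real (2 * pi * node n) * root_dir N j) - 1))) = dir_series e"
proof -
  define f where "f = (\<lambda>j n. cnj (chi (int (Suc n))) / (exp (2 * of_real pi * of_real (node n) * root_dir N j) - 1))"
  have sm: "summable (\<lambda>n. f j n / of_nat (Suc n) powi e)" if j: "j \<in> {- int p..int p}" for j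
  proof -
    obtain C where C: "\<And>n. norm (1 / (exp (2 * of_real pi * of_real (node n) * root_dir N j) - 1)) \<le> C / real (Suc n) ^ (nat \<bar>e\<bar> + 2)"
      using dir_sum_node_bound[of "nat \<bar>e\<bar> + 2"] j by blast
    show ?thesis
    proof (rule summable_norm_cancel, rule summable_over_powi)
      fix n
      have "norm (f j n) = norm (chi (int (Suc n))) * norm (1 / (exp (2 * of_real pi * of_real (node n) * root_dir N j) - 1))"
        unfolding f_def norm_divide by simp
      also have "\<dots> \<le> 1 * (C / real (Suc n) ^ (nat \<bar>e\<bar> + 2))"
        by (intro mult_mono norm_chi_le_1 C) auto
      finally show "norm (f j n) \<le> C / real (Suc n) ^ (nat \<bar>e\<bar> + 2)" by simp
    qed
  qed
  have "(\<Sum>j\<in>{- int p..int p}. (-1) powi j * (\<Sum>n. f j n / of_nat (Suc n) powi e))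
      = (\<Sum>j\<in>{- int p..int p}. \<Sum>n. (-1) powi j * (f j n / of_nat (Suc n) powi e))"
    by (rule sum.cong[OF refl suminf_mult[symmetric, OF sm]])
  also have "\<dots> = (\<Sum>n. \<Sum>j\<in>{- int p..int p}. (-1) powi j * (f j n / of_nat (Suc n) powi e))"
    by (rule suminf_sum[symmetric, OF summable_mult[OF sm]])
  also have "\<dots> = dir_series e"
    unfolding dir_series_def dir_sum_def sum_distrib_left f_def N_def by (simp add: mult_ac del: of_nat_Suc)
  finally show ?thesis unfolding f_def by (simp add: mult_ac del: of_nat_Suc)
qed

end

text \<open>All quantities are exponentials; eliminating ln \<alpha> through the relation between
  \<alpha> and \<beta> reduces both claims to identities between exponents that are linear in ln 2,
  ln pi and ln \<beta>. The first relation serves the L-value and the exponential sums, the second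
  the Bernoulli terms, with j = 0 for the residual term.\<close>

lemma magnitude_relations:
  fixes \<alpha> \<beta> a b :: real and N :: nat and m j :: int
  assumes pos: "\<alpha> > 0" "\<beta> > 0" and rel: "\<alpha> * \<beta> ^ N = pi ^ (N + 1)"
    and a: "a = 2 ^ N * \<alpha>" and b: "b = 2 * pi / a"
  shows "\<alpha> powr (- (2 * real N * of_int m) / (real N + 1)) * (2 / a) * (pi / b powi (2 * m + 1))
      = \<beta> powr (- (2 * real N * of_int m) / (real N + 1)) * 2 powi (2 * m * (int N - 1))" (is ?T1)
    and "2 powi (2 * int N * m) * (4 / (2 * pi) powi (2 * j + (2 * int N * (m - j) + int N + 1)) *
        (\<alpha> powr (2 * of_int j / (real N + 1)) * \<beta> powr (real N + 2 * (real N)\<^sup>2 * of_int (m - j) / (real N + 1))))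
      = \<alpha> powr (- (2 * real N * of_int m) / (real N + 1)) * (2 / a) * (1 / b powi (2 * j))" (is ?T2)
proof -
  define x where "x = ln (2 :: real)"
  define n where "n = real N"
  define y where "y = ln \<beta>"
  define z where "z = ln pi"
  define k where "k = n + 1"
  have k: "k \<noteq> 0" "n = k - 1" "real N = k - 1" unfolding n_def k_def by (linarith, simp_all)
  have "ln (\<alpha> * \<beta> ^ N) = ln (pi ^ (N + 1))" using rel by simp
  then have la: "ln \<alpha> = (n + 1) * z - n * y"
    using pos by (simp add: ln_mult ln_realpow n_def y_def z_def algebra_simps)
  have a0: "a > 0" and b0: "b > 0" using pos a b by auto
  have lna: "ln a = n * x + ln \<alpha>" unfolding a using pos by (simp add: ln_mult ln_realpow n_def x_def)
  have lnb: "ln b = x + z - ln a" unfolding b using a0 by (simp add: ln_mult ln_div x_def z_def)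
  have ln2pi: "ln (2 * pi) = x + z" by (simp add: ln_mult x_def z_def)
  have e: "a = exp (ln a)" "pi = exp z" "(2 :: real) = exp x" "(4 :: real) = exp (2 * x)"
    using a0 exp_double[of "ln (2 :: real)"] by (simp_all add: z_def x_def)
  have P: "\<alpha> powr t = exp (t * ln \<alpha>)" "\<beta> powr t = exp (t * y)" for t using pos by (simp_all add: powr_def y_def)
  have Q: "2 powi k = exp (of_int k * x)" "(2 * pi) powi k = exp (of_int k * (x + z))" "b powi k = exp (of_int k * ln b)" for k
    using b0 by (simp_all only: powi_eq_exp_ln[of 2] powi_eq_exp_ln[of "2 * pi"] powi_eq_exp_ln[of b] pi_gt_zero zero_less_numeral mult_pos_pos x_def ln2pi[unfolded x_def])
  have "(- (2 * n * of_int m) / (n + 1)) * ln \<alpha> + (x - ln a) + (z - of_int (2 * m + 1) * ln b)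
      = (- (2 * n * of_int m) / (n + 1)) * y + of_int (2 * m * (int N - 1)) * x"
    unfolding lnb lna la using k(1) by (simp add: k(2,3) field_simps)
  then have "exp ((- (2 * n * of_int m) / (n + 1)) * ln \<alpha> + (x - ln a) + (z - of_int (2 * m + 1) * ln b))
      = exp ((- (2 * n * of_int m) / (n + 1)) * y + of_int (2 * m * (int N - 1)) * x)" by (rule arg_cong)
  then show ?T1 unfolding exp_add exp_diff P Q n_def e(1,2,3)[symmetric] .
  have "of_int (2 * int N * m) * x + (2 * x - of_int (2 * j + (2 * int N * (m - j) + int N + 1)) * (x + z)
         + (2 * of_int j / (n + 1) * ln \<alpha> + (n + 2 * n\<^sup>2 * of_int (m - j) / (n + 1)) * y))
      = (- (2 * n * of_int m) / (n + 1)) * ln \<alpha> + (x - ln a) + (0 - of_int (2 * j) * ln b)"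
    unfolding lnb lna la using k(1) by (simp add: k(2,3) field_simps power2_eq_square)
  then have "exp (of_int (2 * int N * m) * x + (2 * x - of_int (2 * j + (2 * int N * (m - j) + int N + 1)) * (x + z)
         + (2 * of_int j / (n + 1) * ln \<alpha> + (n + 2 * n\<^sup>2 * of_int (m - j) / (n + 1)) * y)))
      = exp ((- (2 * n * of_int m) / (n + 1)) * ln \<alpha> + (x - ln a) + (0 - of_int (2 * j) * ln b))" by (rule arg_cong)
  then show ?T2 unfolding exp_add exp_diff P Q n_def e(1)[symmetric] e(3,4)[symmetric] exp_zero .
qed

text \<open>This is \<open>core_identity\<close> at a = 2^N \<alpha>, multiplied by the power of
  \<alpha>. Its remaining terms fall into three groups, matched separately in \<open>R1\<close>,
  \<open>R2\<close> and \<open>R3\<close>.\<close>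

theorem theorem2p2:
  fixes N q :: nat and chi :: "int \<Rightarrow> complex" and \<alpha> \<beta> :: real and m :: int
  assumes "N \<ge> 1" and "odd N"
    and "primitive_dirichlet_char q chi" and "even_char chi"
    and "\<alpha> > 0" and "\<beta> > 0" and "\<alpha> * \<beta> ^ N = pi ^ (N + 1)"
    and "m \<noteq> 0"
  shows
   "complex_of_real (\<alpha> powr (- (2 * real N * of_int m) / (real N + 1))) *
      ((\<Sum>r=1..q. \<Sum>n. chi (int r) *
          complex_of_real (exp (- ((real r / real q) * ((2 * real (Suc n)) ^ N) * \<alpha>)) /
            (real (Suc n) powi (2 * int N * m + 1) * (1 - exp (- (((2 * real (Suc n)) ^ N) * \<alpha>))))))
       - riemann_zeta (of_int (2 * int N * m + 1)) * dirichlet_L chi 0)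
    = complex_of_real ((-1) powi m * \<beta> powr (- (2 * real N * of_int m) / (real N + 1))
          * 2 powi (2 * m * (int N - 1)) / real N) *
       (of_nat q / (2 * gauss_sum q (\<lambda>n. cnj (chi n)))
            * dirichlet_L (\<lambda>n. cnj (chi n)) (of_int (2 * m + 1))
        + (-1) ^ ((N + 3) div 2) * gauss_sum q chi *
          (\<Sum>j\<in>{- ((int N - 1) div 2) .. (int N - 1) div 2}. (-1) powi j *
             (\<Sum>n. 1 / of_real (real (Suc n) powi (2 * m + 1)) * cnj (chi (int (Suc n))) /
               (exp (of_real ((2 * real (Suc n)) powr (1 / real N) * \<beta>)
                     * exp (- \<i> * of_real (pi * of_int j / real N))) - 1))))
     + complex_of_real ((-1) powi (m + int ((N + 3) div 2)) * 2 powi (2 * int N * m)) *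
       (\<Sum>j\<in>{1 .. \<lfloor>of_int m + (real N + 1) / (2 * real N)\<rfloor>}.
          of_real ((-1) powi j / real q powi (2 * j - 1)) *
          (gen_bernoulli q chi (nat (2 * j)) / fact (nat (2 * j))) *
          bern_over_fact (2 * int N * (m - j) + int N + 1) *
          of_real (\<alpha> powr (2 * of_int j / (real N + 1)) *
                   \<beta> powr (real N + 2 * (real N)\<^sup>2 * of_int (m - j) / (real N + 1))))
     + (if q = 1 then complex_of_real ((-1) powi (m + int ((N + 3) div 2)) * 2 powi (2 * int N * m)) *
            bern_over_fact (2 * int N * m + int N + 1) *
            of_real (\<beta> powr (real N + 2 * (real N)\<^sup>2 * of_int m / (real N + 1)))
        else 0)"
proof -
  obtain p where N: "N = 2 * p + 1" using assms(2) by (elim oddE)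
  define a where "a = 2 ^ N * \<alpha>"
  interpret K: kernel_setup q chi p a
    using assms(3-5) by unfold_locales (auto simp: primitive_dirichlet_char_def a_def)
  have KN: "K.N = N" unfolding K.N_def N ..
  have N0: "N > 0" using assms(1) by simp
  define A where "A = \<alpha> powr (- (2 * real N * of_int m) / (real N + 1))"
  define G where "G = gauss_sum q chi"
  define L where "L = dirichlet_L (\<lambda>n. cnj (chi n)) (of_int (2 * m + 1))"
  define D where "D = K.dir_series (2 * m + 1)"
  define Z where "Z = (\<lambda>j. K.zeta_ext (2 * int N * (m - j) + int N + 1))"
  define T where "T = (\<lambda>j. (-1) powi (j - 1) / of_real K.b powi (2 * j) * K.cnj_L_series (nat (2 * j)) * Z j)"
  define s where "s = (-1 :: complex) powi (m + int (p + 2))"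
  note mag = magnitude_relations[OF assms(5,6,7) a_def K.b_def, of m, folded A_def]
  have q0: "complex_of_nat q \<noteq> 0" using K.modulus_pos by simp

  \<comment> \<open>Because L(0, chi) is \<open>- pole_coeff / 2\<close>, the zeta term of
    \<open>core_identity\<close> is precisely the product that the theorem subtracts.\<close>
  have kernel: "(\<Sum>r=1..q. \<Sum>n. chi (int r) *
          complex_of_real (exp (- ((real r / real q) * ((2 * real (Suc n)) ^ N) * \<alpha>)) /
            (real (Suc n) powi (2 * int N * m + 1) * (1 - exp (- (((2 * real (Suc n)) ^ N) * \<alpha>))))))
     = K.pole_coeff / of_real a * Z 0
      + 2 * G / of_real a * ((-1) powi m / of_real K.b powi (2 * m + 1) * (of_real pi / of_nat N) * (L / 2 + (-1) ^ p * D)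
        + (\<Sum>j\<in>{1..m + (if p = 0 then 1 else 0)}. T j))
      + riemann_zeta (of_int (2 * int N * m + 1)) * dirichlet_L chi 0"
  proof -
    have x: "(2 * real (Suc n)) ^ N * \<alpha> = a * real (Suc n) ^ N"
      "real r / real q * (2 * real (Suc n)) ^ N * \<alpha> = real r / real q * (a * real (Suc n) ^ N)" for r n
      by (simp_all add: a_def power_mult_distrib del: of_nat_Suc)
    have alg: "- c / 2 * z + u + v = u + v + z * (- c / 2)" for c z u v :: complex by simp
    show ?thesis
      unfolding x K.kernel_double_sum[unfolded KN] sums_unique[OF K.core_identity[OF assms(8)], unfolded KN, symmetric]
        K.dirichlet_L_0 G_def L_def D_def T_def Z_def diff_zero by (rule alg)
  qed

  \<comment> \<open>Both sides are nonnegative, so N-th powers are compared, where the relation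
    between \<alpha> and \<beta> can be used.\<close>
  have nd: "(2 * real (Suc n)) powr (1 / real N) * \<beta> = 2 * pi * K.node n" for n
  proof (rule power_eq_imp_eq_base[where n = N])
    have "((2 * real (Suc n)) powr (1 / real N)) ^ N = 2 * real (Suc n)"
      using N0 by (simp add: powr_power del: of_nat_Suc)
    then have "((2 * real (Suc n)) powr (1 / real N) * \<beta>) ^ N = 2 * real (Suc n) * \<beta> ^ N"
      unfolding power_mult_distrib by simp
    also have "\<beta> ^ N = pi ^ (N + 1) / \<alpha>" using assms(5,7) by (simp add: field_simps)
    also have "2 * real (Suc n) * (pi ^ (N + 1) / \<alpha>) = (2 * pi) ^ N * (K.b * real (Suc n))"
      using assms(5) unfolding K.b_def unfolding a_def by (simp add: power_mult_distrib field_simps del: of_nat_Suc)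
    also have "\<dots> = (2 * pi * K.node n) ^ N"
      unfolding power_mult_distrib[of "2 * pi" "K.node n"] K.node_power[unfolded KN] ..
    finally show "((2 * real (Suc n)) powr (1 / real N) * \<beta>) ^ N = (2 * pi * K.node n) ^ N" .
  qed (use assms(6) N0 K.node_pos[of n] in auto)
  have h: "(int N - 1) div 2 = int p" "(N + 3) div 2 = p + 2" unfolding N by auto
  have dir: "(\<Sum>j\<in>{- ((int N - 1) div 2) .. (int N - 1) div 2}. (-1) powi j *
             (\<Sum>n. 1 / of_real (real (Suc n) powi (2 * m + 1)) * cnj (chi (int (Suc n))) /
               (exp (of_real ((2 * real (Suc n)) powr (1 / real N) * \<beta>)
                     * exp (- \<i> * of_real (pi * of_int j / real N))) - 1))) = D"
    unfolding h nd root_dir_def[symmetric] D_def by (rule K.dir_double_sum[unfolded KN])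
  have R1: "complex_of_real ((-1) powi m * \<beta> powr (- (2 * real N * of_int m) / (real N + 1))
          * 2 powi (2 * m * (int N - 1)) / real N) *
       (of_nat q / (2 * gauss_sum q (\<lambda>n. cnj (chi n))) * L + (-1) ^ ((N + 3) div 2) * gauss_sum q chi * D)
     = of_real A * (2 * G / of_real a * ((-1) powi m / of_real K.b powi (2 * m + 1) * (of_real pi / of_nat N) * (L / 2 + (-1) ^ p * D)))"
  proof -
    have "gauss_sum q (\<lambda>n. cnj (chi n)) \<noteq> 0" using K.gauss_sum_mult q0 by auto
    then have g: "of_nat q / (2 * gauss_sum q (\<lambda>n. cnj (chi n))) = G / 2"
      using K.gauss_sum_mult by (simp add: G_def field_simps)
    have e: "(-1) powi m * \<beta> powr (- (2 * real N * of_int m) / (real N + 1)) * 2 powi (2 * m * (int N - 1)) / real N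
        = (-1) powi m * (A * (2 / a) * (pi / K.b powi (2 * m + 1))) / real N"
      unfolding mag(1) by simp
    show ?thesis unfolding g e h(2) G_def[symmetric] by (simp add: field_simps)
  qed

  \<comment> \<open>Only parity matters: as N = 2p + 1, the total exponent differs from j by an even
    number.\<close>
  have sg: "s * (-1) powi (int N * (m - j) + int p) = (-1) powi j" for j
  proof -
    have "s * (-1) powi (int N * (m - j) + int p) = (-1) powi (m + int (p + 2) + (int N * (m - j) + int p))"
      unfolding s_def by (rule minus_one_powi_add[symmetric])
    also have "m + int (p + 2) + (int N * (m - j) + int p) = j + 2 * ((int p + 1) * (m - j) + int p + 1)"
      unfolding N by (simp add: algebra_simps)
    finally show ?thesis unfolding minus_one_powi_add by simp
  qed
  have bern: "bern_over_fact (2 * int N * (m - j) + int N + 1) = 2 * (-1) powi (int N * (m - j) + int p) * Z j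
      / (2 * of_real pi) powi (2 * int N * (m - j) + int N + 1)" for j
  proof -
    have e: "2 * int N * (m - j) + int N + 1 = 2 * (int N * (m - j) + int p + 1)"
      unfolding N by (simp add: algebra_simps)
    show ?thesis unfolding Z_def e K.bern_over_fact_zeta_ext add_diff_cancel_right' ..
  qed
  have mag2: "complex_of_real (2 powi (2 * int N * m)) * (4 / ((2 * of_real pi) powi (2 * j) * (2 * of_real pi) powi (2 * int N * (m - j) + int N + 1))
        * of_real (\<alpha> powr (2 * of_int j / (real N + 1)) * \<beta> powr (real N + 2 * (real N)\<^sup>2 * of_int (m - j) / (real N + 1))))
      = of_real A * (2 / of_real a) * (1 / of_real K.b powi (2 * j))" for j
    using arg_cong[OF mag(2)[of j], of complex_of_real] by (simp add: power_int_add)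
  \<comment> \<open>Equality holds index by index. The powers of q cancel against those in
    \<open>gen_bernoulli_even\<close>, the factors 2 of the two Bernoulli formulas make up the 4 in
    \<open>mag2\<close>, and of the signs only (-1)^(j-1) remains.\<close>
  have R2: "complex_of_real ((-1) powi (m + int ((N + 3) div 2)) * 2 powi (2 * int N * m)) *
       (\<Sum>j\<in>{1 .. \<lfloor>of_int m + (real N + 1) / (2 * real N)\<rfloor>}.
          of_real ((-1) powi j / real q powi (2 * j - 1)) *
          (gen_bernoulli q chi (nat (2 * j)) / fact (nat (2 * j))) *
          bern_over_fact (2 * int N * (m - j) + int N + 1) *
          of_real (\<alpha> powr (2 * of_int j / (real N + 1)) *
                   \<beta> powr (real N + 2 * (real N)\<^sup>2 * of_int (m - j) / (real N + 1))))
     = of_real A * (2 * G / of_real a * (\<Sum>j\<in>{1..m + (if p = 0 then 1 else 0)}. T j))"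
    unfolding floor_upper_index[OF N] h sum_distrib_left
  proof (rule sum.cong[OF refl])
    fix j assume "j \<in> {1..m + (if p = 0 then 1 else 0)}"
    then obtain i where i: "j = int i" "i > 0"
      using zero_less_imp_eq_int[of j] by auto
    have i': "nat (2 * j) = 2 * i" "2 * j = int (2 * i)" "2 * j - 1 = int (2 * i - 1)" "j - 1 = int (i - 1)"
      using i by auto
    have gb: "gen_bernoulli q chi (nat (2 * j)) / fact (nat (2 * j)) = of_nat q powi (2 * j - 1) * 2 * G * (-1) powi (j - 1)
        * K.cnj_L_series (nat (2 * j)) / (2 * of_real pi) powi (2 * j)"
      unfolding G_def i'(3) unfolding i' power_int_of_nat nat_int by (rule K.gen_bernoulli_even[OF i(2)])
    have alg: "(s * t) * (sj / Q * (Q * 2 * G * s1 * L / P1) * (2 * se * Z / P2) * ab)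
        = ((s * se) * sj) * s1 * G * L * Z * (t * (4 / (P1 * P2) * ab))"
      if "Q \<noteq> 0" for s t sj Q G s1 L P1 se Z P2 ab :: complex
      using that by (simp add: field_simps)
    have sj: "(-1 :: complex) powi j * (-1) powi j = 1" by (rule minus_one_powi_square)
    have Q: "complex_of_nat q powi (2 * j - 1) \<noteq> 0" using q0 by simp
    have c: "complex_of_real ((-1) powi (m + int (p + 2)) * 2 powi (2 * int N * m)) = s * of_real (2 powi (2 * int N * m))"
      "complex_of_real ((-1) powi j / real q powi (2 * j - 1)) = (-1) powi j / of_nat q powi (2 * j - 1)"
      unfolding s_def by simp_all
    show "complex_of_real ((-1) powi (m + int (p + 2)) * 2 powi (2 * int N * m)) *
          (of_real ((-1) powi j / real q powi (2 * j - 1)) *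
          (gen_bernoulli q chi (nat (2 * j)) / fact (nat (2 * j))) *
          bern_over_fact (2 * int N * (m - j) + int N + 1) *
          of_real (\<alpha> powr (2 * of_int j / (real N + 1)) *
                   \<beta> powr (real N + 2 * (real N)\<^sup>2 * of_int (m - j) / (real N + 1))))
        = of_real A * (2 * G / of_real a * T j)"
      unfolding c gb bern alg[OF Q] sg sj mag2 T_def by simp
  qed

  \<comment> \<open>The residual term has the sign and the magnitude of a summand with j = 0, where
    \<open>pole_coeff\<close> takes the place of the character data.\<close>
  have R3: "(if q = 1 then complex_of_real ((-1) powi (m + int ((N + 3) div 2)) * 2 powi (2 * int N * m)) *
            bern_over_fact (2 * int N * m + int N + 1) *
            of_real (\<beta> powr (real N + 2 * (real N)\<^sup>2 * of_int m / (real N + 1)))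
        else 0) = of_real A * (K.pole_coeff / of_real a * Z 0)"
  proof (cases "q = 1")
    case True
    have alg: "(s * t) * (2 * se * Z / P2) * ab = (s * se) * Z / 2 * (t * (4 / P2 * ab))" for s t se Z P2 ab :: complex
      by simp
    have c: "complex_of_real ((-1) powi (m + int (p + 2)) * 2 powi (2 * int N * m)) = s * of_real (2 powi (2 * int N * m))"
      unfolding s_def by simp
    have mag0: "complex_of_real (2 powi (2 * int N * m)) * (4 / (2 * of_real pi) powi (2 * int N * m + int N + 1)
        * of_real (\<beta> powr (real N + 2 * (real N)\<^sup>2 * of_int m / (real N + 1)))) = of_real A * (2 / of_real a)"
      using mag2[of 0] assms(5) by simp
    have "complex_of_real ((-1) powi (m + int (p + 2)) * 2 powi (2 * int N * m)) *
            bern_over_fact (2 * int N * m + int N + 1) *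
            of_real (\<beta> powr (real N + 2 * (real N)\<^sup>2 * of_int m / (real N + 1))) = of_real A * (1 / of_real a * Z 0)"
      unfolding c bern[of 0, unfolded diff_zero] alg mag0 sg[of 0, unfolded diff_zero] by simp
    then show ?thesis using True unfolding h K.pole_coeff_def by simp
  qed (simp add: K.pole_coeff_def)

  have alg: "A * (u + g * (w + t) + z - z) = A * (g * w) + A * (g * t) + A * u" for A u g w t z :: complex
    by (simp add: algebra_simps)
  show ?thesis
    unfolding A_def[symmetric] L_def[symmetric] kernel dir R1 R2 R3 by (rule alg)
qed

end
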